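(* Let $q>d$ and let $(m,u,\mu,p,\lambda)$, with $m\in W^{1,q}(\Omega)$, $u\in W^{1,s}_\diamond(\Omega)$ for all $s\in\,]1,d/(d-1)[$, $\mu,p\in\mathfrak{M}_+(\overline\Omega)$ and $\lambda\in\mathbb{R}$, be a solution of the system $$\begin{cases}-\Delta u+\frac{1}{q'}|\nabla u|^{q'}+\mu-p-\lambda=f(x,m) & \text{in }\Omega,\\ \nabla u\cdot n=0 & \text{on }\partial\Omega,\\ -\Delta m-\operatorname{div}\big(m|\nabla u|^{\frac{2-q}{q-1}}\nabla u\big)=0 & \text{in }\Omega,\\ \nabla m\cdot n=0 & \text{on }\partial\Omega,\\ \int_\Omega m\,dx=1,\quad 0\le m\le1 & \text{in }\Omega,\\ \operatorname{spt}(\mu)\subseteq\{m=0\},\quad \operatorname{spt}(p)\subseteq\{m=1\},\end{cases}$$ where the coupled system for $(u,m)$ is satisfied in the sense that for all $\varphi\in C^1(\overline\Omega)$ $$\int_\Omega\nabla u\cdot\nabla\varphi\,dx+\int_\Omega\tfrac1{q'}|\nabla u|^{q'}\varphi\,dx-\lambda\int_\Omega\varphi\,dx+\int_{\overline\Omega}\varphi\,d(\mu-p)=\int_\Omega f(x,m(x))\varphi(x)\,dx,$$ $$\int_\Omega\Big(\nabla m+m|\nabla u|^{\frac{2-q}{q-1}}\nabla u\Big)\cdot\nabla\varphi\,dx=0.$$ Let $E_2^m:=\{x\in\Omega:0<m(x)<1\}$, which is open. Then there exists $\gamma_0\in\,]0,1[$ such that $$u\in C^{1,\gamma_0}_{\rm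 loc}(E_2^m)\quad\text{and}\quad m\in C^{1,\gamma_0}_{\rm loc}(E_2^m).$$ If in addition $f\in C^{j,\gamma_1}_{\rm loc}(\overline\Omega\times\mathbb{R})$ for $j\in\{0,1\}$ and some $\gamma_1\in\,]0,1[$, then for some $\gamma_2\in\,]0,1[$ $$u\in C^{2+j,\gamma_2}_{\rm loc}(E_2^m).$$
   Context: $\Omega\subset\mathbb{R}^d$ ($d\ge2$) is a non-empty, bounded open set with smooth boundary satisfying a uniform interior ball condition, with Lebesgue measure $|\Omega|>1$; $n$ is the outward unit normal to $\partial\Omega$. $q':=q/(q-1)$. $f:\overline\Omega\times\mathbb{R}\to\mathbb{R}$ is continuous and non-decreasing in its second variable. $\mathfrak{M}_+(\overline\Omega)$ is the set of non-negative Radon measures on $\overline\Omega$, and $\operatorname{spt}$ denotes the support of a measure. $W^{1,s}_\diamond(\Omega):=\{u\in W^{1,s}(\Omega):\int_\Omega u\,dx=0\}$. Since $q>d$, $m$ is identified with its representative in $C(\overline\Omega)$; $\{m=0\},\{m=1\}$ are subsets of $\overline\Omega$. The expression $|\nabla u|^{\frac{2-q}{q-1}}\nabla u=|\nabla u|^{q'-2}\nabla u$ is understood to be $0$ where $\nabla u=0$. $C^{k,\gamma}_{\rm loc}$ denotes functions of class $C^k$ whose $k$-th derivatives are $\gamma$-Hölder continuous on compact subsets. *)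

theory Defs
  imports "HOL-Analysis.Analysis"
begin

text \<open>
  \<open>Ck_on k S g\<close> renders \<open>g \<in> C\<^sup>k(S)\<close>, for \<open>S\<close> with \<open>S \<subseteq> closure (interior S)\<close>: \<open>g\<close> is \<open>C\<^sup>k\<close> in the
  interior and all its partial derivatives of order at most \<open>k\<close> extend continuously to \<open>S\<close>.
  The witness \<open>h\<close> is that extension; it is determined by \<open>g\<close> on \<open>S\<close>. For open \<open>S\<close> this is
  the classical space. For \<open>S = closure \<Omega>\<close> the interior is again \<open>\<Omega>\<close> if \<open>\<Omega>\<close> has a smooth
  boundary, see the lemma \<open>interior_closure_smooth_boundary\<close> below.
\<close>

primrec Ck_on :: "nat \<Rightarrow> 'a::euclidean_space set \<Rightarrow> ('a \<Rightarrow> real) \<Rightarrow> bool" where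
  "Ck_on 0 S g \<longleftrightarrow> continuous_on S g"
| "Ck_on (Suc k) S g \<longleftrightarrow>
     continuous_on S g \<and> (\<forall>x\<in>interior S. g differentiable (at x)) \<and>
     (\<forall>i\<in>Basis. \<exists>h. (\<forall>x\<in>interior S. h x = frechet_derivative g (at x) i) \<and> Ck_on k S h)"

definition holder_on_compacts :: "real \<Rightarrow> 'a::euclidean_space set \<Rightarrow> ('a \<Rightarrow> real) \<Rightarrow> bool" where
  "holder_on_compacts \<gamma> S g \<longleftrightarrow>
     (\<forall>K. compact K \<and> K \<subseteq> S \<longrightarrow>
        (\<exists>C. \<forall>x\<in>K. \<forall>y\<in>K. \<bar>g x - g y\<bar> \<le> C * dist x y powr \<gamma>))"

text \<open>\<open>C\<^sup>k\<^sup>,\<^sup>\<gamma>\<close> locally on \<open>S\<close>, with the same convention for derivatives on sets that are not open.\<close>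

primrec Ck_holder_loc :: "nat \<Rightarrow> real \<Rightarrow> 'a::euclidean_space set \<Rightarrow> ('a \<Rightarrow> real) \<Rightarrow> bool" where
  "Ck_holder_loc 0 \<gamma> S g \<longleftrightarrow> continuous_on S g \<and> holder_on_compacts \<gamma> S g"
| "Ck_holder_loc (Suc k) \<gamma> S g \<longleftrightarrow>
     continuous_on S g \<and> (\<forall>x\<in>interior S. g differentiable (at x)) \<and>
     (\<forall>i\<in>Basis. \<exists>h. (\<forall>x\<in>interior S. h x = frechet_derivative g (at x) i) \<and>
        Ck_holder_loc k \<gamma> S h)"

text \<open>Membership of an almost-everywhere equivalence class in the space.\<close>

definition ae_Ck_holder_loc :: "nat \<Rightarrow> real \<Rightarrow> 'a::euclidean_space set \<Rightarrow> ('a \<Rightarrow> real) \<Rightarrow> bool" where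
  "ae_Ck_holder_loc k \<gamma> S g \<longleftrightarrow>
     (\<exists>v. (AE x in lebesgue. x \<in> S \<longrightarrow> v x = g x) \<and> Ck_holder_loc k \<gamma> S v)"

definition gradient :: "('a::euclidean_space \<Rightarrow> real) \<Rightarrow> 'a \<Rightarrow> 'a" where
  "gradient \<phi> x = (\<Sum>i\<in>Basis. frechet_derivative \<phi> (at x) i *\<^sub>R i)"

text \<open>
  Near each boundary point, \<open>\<Omega>\<close> is the strict epigraph, in some unit direction \<open>e\<close>, of a smooth
  function \<open>\<psi>\<close> of the component orthogonal to \<open>e\<close>.
\<close>

definition smooth_boundary :: "'a::euclidean_space set \<Rightarrow> bool" where
  "smooth_boundary \<Omega> \<longleftrightarrow>
     (\<forall>x0\<in>frontier \<Omega>. \<exists>r>0. \<exists>e \<psi>. norm e = 1 \<and> (\<forall>k. Ck_on k UNIV \<psi>) \<and>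
        \<Omega> \<inter> ball x0 r = {x \<in> ball x0 r. x \<bullet> e > \<psi> (x - (x \<bullet> e) *\<^sub>R e)})"

lemma interior_closure_smooth_boundary:
  fixes \<Omega> :: "'a::euclidean_space set"
  assumes "open \<Omega>" and "smooth_boundary \<Omega>"
  shows "interior (closure \<Omega>) = \<Omega>"
proof
  show "\<Omega> \<subseteq> interior (closure \<Omega>)"
    using assms(1) closure_subset interior_maximal by blast
  show "interior (closure \<Omega>) \<subseteq> \<Omega>"
  proof (rule ccontr)
    assume "\<not> interior (closure \<Omega>) \<subseteq> \<Omega>"
    then obtain x where x: "x \<in> interior (closure \<Omega>)" "x \<notin> \<Omega>" by blast
    then have "x \<in> frontier \<Omega>"
      using assms(1) interior_subset by (auto simp: frontier_def interior_open)
    from bspec[OF assms(2)[unfolded smooth_boundary_def] this] obtain r e \<psi> where r: "r > 0" and e: "norm e = 1" and k: "\<forall>k. Ck_on k UNIV \<psi>"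
      and eq: "\<Omega> \<inter> ball x r = {z \<in> ball x r. z \<bullet> e > \<psi> (z - (z \<bullet> e) *\<^sub>R e)}"
      by blast
    have c\<psi>: "continuous_on UNIV \<psi>" using k[rule_format, of 0] by simp
    have xe: "x \<bullet> e \<le> \<psi> (x - (x \<bullet> e) *\<^sub>R e)"
      using x(2) eq r by force
    obtain s where s: "s > 0" "ball x s \<subseteq> closure \<Omega>"
      using x(1) by (auto simp: mem_interior)
    define t where "t = min r s / 2"
    have t: "t > 0" "t < r" "t < s" using r s by (auto simp: t_def)
    define y where "y = x - t *\<^sub>R e"
    have dxy: "dist x y = t" using e t by (simp add: y_def dist_norm)
    have ee: "e \<bullet> e = 1" using e by (simp add: norm_eq_1)
    have proj: "y - (y \<bullet> e) *\<^sub>R e = x - (x \<bullet> e) *\<^sub>R e"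
      by (simp add: y_def inner_diff_left ee algebra_simps)
    define V where "V = ball x r \<inter> {z. z \<bullet> e < \<psi> (z - (z \<bullet> e) *\<^sub>R e)}"
    have cont: "continuous_on UNIV (\<lambda>z. \<psi> (z - (z \<bullet> e) *\<^sub>R e))"
      by (rule continuous_on_compose2[OF c\<psi>]) (auto intro!: continuous_intros)
    have "open V" unfolding V_def
      by (intro open_Int open_ball open_Collect_less cont continuous_intros)
    moreover have "y \<bullet> e < \<psi> (y - (y \<bullet> e) *\<^sub>R e)"
      unfolding proj using t xe by (simp add: y_def inner_diff_left ee)
    then have "y \<in> V"
      unfolding V_def using dxy t by simp
    moreover have "V \<inter> \<Omega> = {}" unfolding V_def using eq by force
    ultimately have "y \<notin> closure \<Omega>"
      by (meson disjoint_iff closure_iff_nhds_not_empty subset_refl)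
    moreover have "y \<in> ball x s" using dxy t by simp
    ultimately show False using s(2) by blast
  qed
qed

definition uniform_interior_ball :: "'a::euclidean_space set \<Rightarrow> bool" where
  "uniform_interior_ball \<Omega> \<longleftrightarrow>
     (\<exists>r>0. \<forall>x\<in>frontier \<Omega>. \<exists>y. ball y r \<subseteq> \<Omega> \<and> dist x y = r)"

definition test_function :: "'a::euclidean_space set \<Rightarrow> ('a \<Rightarrow> real) \<Rightarrow> bool" where
  "test_function \<Omega> \<phi> \<longleftrightarrow>
     (\<forall>k. Ck_on k UNIV \<phi>) \<and> compact (closure {x. \<phi> x \<noteq> 0}) \<and> closure {x. \<phi> x \<noteq> 0} \<subseteq> \<Omega>"

definition locally_integrable ::
  "'a::euclidean_space set \<Rightarrow> ('a \<Rightarrow> 'b::{banach, second_countable_topology}) \<Rightarrow> bool" where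
  "locally_integrable \<Omega> g \<longleftrightarrow> (\<forall>K. compact K \<and> K \<subseteq> \<Omega> \<longrightarrow> set_integrable lebesgue K g)"

definition has_weak_gradient ::
  "'a::euclidean_space set \<Rightarrow> ('a \<Rightarrow> real) \<Rightarrow> ('a \<Rightarrow> 'a) \<Rightarrow> bool" where
  "has_weak_gradient \<Omega> u g \<longleftrightarrow>
     locally_integrable \<Omega> u \<and> locally_integrable \<Omega> g \<and>
     (\<forall>\<phi>. test_function \<Omega> \<phi> \<longrightarrow> (\<forall>i\<in>Basis.
        (LINT x:\<Omega>|lebesgue. u x * frechet_derivative \<phi> (at x) i) =
        - (LINT x:\<Omega>|lebesgue. (g x \<bullet> i) * \<phi> x)))"

text \<open>
  A chosen representative of the weak gradient, which is unique up to null sets; meaningful only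
  if \<open>u\<close> has a weak gradient on \<open>\<Omega>\<close>.
\<close>

definition weak_grad :: "'a::euclidean_space set \<Rightarrow> ('a \<Rightarrow> real) \<Rightarrow> 'a \<Rightarrow> 'a" where
  "weak_grad \<Omega> u = (SOME g. has_weak_gradient \<Omega> u g)"

definition in_Lp ::
  "real \<Rightarrow> 'a::euclidean_space set \<Rightarrow> ('a \<Rightarrow> 'b::{banach, second_countable_topology}) \<Rightarrow> bool" where
  "in_Lp s \<Omega> g \<longleftrightarrow>
     g \<in> borel_measurable (lebesgue_on \<Omega>) \<and> integrable (lebesgue_on \<Omega>) (\<lambda>x. norm (g x) powr s)"

definition in_W1 :: "real \<Rightarrow> 'a::euclidean_space set \<Rightarrow> ('a \<Rightarrow> real) \<Rightarrow> bool" where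
  "in_W1 s \<Omega> u \<longleftrightarrow> in_Lp s \<Omega> u \<and> (\<exists>g. has_weak_gradient \<Omega> u g \<and> in_Lp s \<Omega> g)"

definition in_W1_mean_zero :: "real \<Rightarrow> 'a::euclidean_space set \<Rightarrow> ('a \<Rightarrow> real) \<Rightarrow> bool" where
  "in_W1_mean_zero s \<Omega> u \<longleftrightarrow> in_W1 s \<Omega> u \<and> (LINT x:\<Omega>|lebesgue. u x) = 0"

text \<open>
  Non-negative Radon measures on a closed subset \<open>S\<close> of Euclidean space: Borel measures that are
  finite on compact sets (regularity is then automatic). The underlying space of \<open>\<mu>\<close> is \<open>S\<close>.
\<close>

definition nonneg_radon :: "'a::euclidean_space set \<Rightarrow> 'a measure \<Rightarrow> bool" where
  "nonneg_radon S \<mu> \<longleftrightarrow>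
     sets \<mu> = sets (restrict_space borel S) \<and>
     (\<forall>K. compact K \<and> K \<subseteq> S \<longrightarrow> emeasure \<mu> K < \<infinity>)"

definition spt :: "'a::topological_space measure \<Rightarrow> 'a set" where
  "spt \<mu> = {x \<in> space \<mu>. \<forall>U. open U \<and> x \<in> U \<longrightarrow> emeasure \<mu> (U \<inter> space \<mu>) > 0}"

end

theory Submission
  imports Defs
begin

text \<open>
  On the open set where \<open>0 < m < 1\<close> neither of the two measures has mass, so there the system reads
  \<open>\<Delta>u = |\<nabla>u|^q'/q' - f(x,m) - \<lambda>\<close> and \<open>\<Delta>m = - div (m |\<nabla>u|^(q'-2) \<nabla>u)\<close> in the sense of distributions,
  and the claim is interior regularity for two Poisson equations. As \<open>q > d\<close>, the exponent
  \<open>q'\<close> is below \<open>d/(d-1)\<close>; hence \<open>|\<nabla>u|^q'\<close> is integrable, which is all that is known at the start.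

  The theory of Poisson's equation that is needed rests on one identity. There are smooth functions
  \<open>\<eta> \<ge> 0\<close> of integral one and \<open>\<Psi>\<close>, both supported in the unit ball, with
  \<open>\<Delta>\<Psi>(z) = \<eta>(z) - 2^d \<eta>(2z)\<close> (lemma \<open>mollifier_exists\<close>). Write \<open>\<kappa>_n(z) = 2^(nd) \<kappa>(2^n z)\<close>. Testing
  \<open>\<Delta>w = h\<close> with a reflected \<open>\<Psi>_n\<close> gives \<open>w * \<eta>_n - w * \<eta>_(n+1) = 4^(-n) h * \<Psi>_n\<close>, so that the difference
  of consecutive mollifications of \<open>w\<close> at \<open>x\<close> only involves \<open>h\<close> within distance \<open>2^(-n)\<close> of \<open>x\<close>. Every
  derivative costs a factor \<open>2^n\<close>, and against a kernel of integral zero a \<open>\<beta>\<close>-Hoelder \<open>h\<close> gains \<open>2^(-\<beta>n)\<close>.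
  A sequence whose consecutive differences decay in this way converges to a function in \<open>C^(k,\<sigma>)\<close>
  (lemma \<open>dyadic_limit\<close>), and the limit is a representative of \<open>w\<close> (lemma \<open>regularity_of_dyadic\<close>).
  Summing the geometric series costs an arbitrarily small part of the Hoelder exponent; this replaces the
  sharp Schauder estimates and suffices here.

  The step that uses \<open>q' < d/(d-1)\<close> is the local boundedness of \<open>\<nabla>u\<close>. Summing the gradients of the same identity
  yields \<open>|\<nabla>u(x)| \<le> A + A \<integral> (1 + |\<nabla>u(y)|^q') |x-y|^(1-d) dy\<close> near each point (lemma \<open>riesz_gradient\<close>).
  From this inequality, the potentials \<open>\<integral> (1 + |\<nabla>u(y)|^q') |y-z|^(-\<theta>) dy\<close> are shown to be bounded in \<open>z\<close>, first for
  \<open>\<theta> = 0\<close> and then, in finitely many steps of a fixed length, up to \<open>\<theta> = d-1\<close> (lemma \<open>riesz_bootstrap\<close>).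

  The regularity of the system follows in this order (lemma \<open>system_regularity\<close>). The right-hand side of the
  equation for \<open>u\<close> is locally bounded, so \<open>u\<close> is in \<open>C^(1,\<sigma>)\<close> for all \<open>\<sigma> < 1\<close>. The flux \<open>m |\<nabla>u|^(q'-2) \<nabla>u\<close> is bounded, so
  \<open>m\<close> is Hoelder continuous; then the flux is Hoelder continuous, because \<open>z \<mapsto> |z|^(q'-2) z\<close> is
  \<open>(q'-1)\<close>-Hoelder, and \<open>m\<close> is in \<open>C^(1,\<gamma>)\<close>. If \<open>f\<close> is Hoelder continuous, so is the right-hand side of the
  equation for \<open>u\<close>, and \<open>u\<close> gains two derivatives. If \<open>f\<close> is in \<open>C^(1,\<gamma>)\<close>, that right-hand side is in
  \<open>C^(1,\<beta>)\<close> since \<open>z \<mapsto> |z|^q'\<close> is in \<open>C^(1,q'-1)\<close>, and \<open>u\<close> gains three derivatives.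
\<close>

section \<open>Partial derivatives\<close>

definition pd :: "'a::euclidean_space \<Rightarrow> ('a \<Rightarrow> real) \<Rightarrow> 'a \<Rightarrow> real" where
  "pd i g x = frechet_derivative g (at x) i"

lemma pd_eqI: "(g has_derivative g') (at x) \<Longrightarrow> pd i g x = g' i"
  unfolding pd_def using frechet_derivative_at by metis

lemma pd_cong_open:
  assumes "open S" "\<And>x. x \<in> S \<Longrightarrow> f x = g x" "x \<in> S"
  shows "pd i f x = pd i g x"
proof -
  have "(f has_derivative D) (at x) \<longleftrightarrow> (g has_derivative D) (at x)" for D
    using assms has_derivative_transform_within_open[of f D x UNIV S g]
      has_derivative_transform_within_open[of g D x UNIV S f] by auto
  then show ?thesis unfolding pd_def frechet_derivative_def by simp
qed

lemma differentiable_cong_open: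
  assumes "open S" "\<And>x. x \<in> S \<Longrightarrow> f x = g x" "x \<in> S" "f differentiable (at x)"
  shows "g differentiable (at x)"
  using assms has_derivative_transform_within_open[of f _ x UNIV S g] unfolding differentiable_def by fast

lemma has_derivative_pd:
  fixes g :: "'a::euclidean_space \<Rightarrow> real"
  assumes "g differentiable (at x)"
  shows "(g has_derivative (\<lambda>h. \<Sum>i\<in>Basis. (h \<bullet> i) * pd i g x)) (at x)"
proof -
  have d: "(g has_derivative frechet_derivative g (at x)) (at x)"
    using assms frechet_derivative_works by blast
  have l: "linear (frechet_derivative g (at x))" using assms linear_frechet_derivative by blast
  have "frechet_derivative g (at x) h = (\<Sum>i\<in>Basis. (h \<bullet> i) * pd i g x)" for h
  proof -
    have "frechet_derivative g (at x) h = frechet_derivative g (at x) (\<Sum>i\<in>Basis. (h \<bullet> i) *\<^sub>R i)"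
      by (simp add: euclidean_representation)
    also have "\<dots> = (\<Sum>i\<in>Basis. (h \<bullet> i) * pd i g x)"
      by (simp add: linear_sum[OF l] linear_cmul[OF l] pd_def)
    finally show ?thesis .
  qed
  then have "frechet_derivative g (at x) = (\<lambda>h. \<Sum>i\<in>Basis. (h \<bullet> i) * pd i g x)" by blast
  with d show ?thesis by simp
qed

lemma gradient_inner: "i \<in> Basis \<Longrightarrow> gradient \<phi> x \<bullet> i = pd i \<phi> x"
  unfolding gradient_def pd_def by simp

section \<open>Calculus of the classes C^k on open sets\<close>

lemma Ck_on_imp_continuous: "Ck_on k S g \<Longrightarrow> continuous_on S g"
  by (cases k) auto

lemma Ck_on_cong:
  assumes "open S" "\<And>x. x \<in> S \<Longrightarrow> f x = g x"
  shows "Ck_on k S f \<longleftrightarrow> Ck_on k S g"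
proof -
  have *: "Ck_on k S g" if "Ck_on k S f" "\<And>x. x \<in> S \<Longrightarrow> f x = g x" for f g
  proof (cases k)
    case 0 then show ?thesis using that by (auto cong: continuous_on_cong)
  next
    case (Suc n)
    have "continuous_on S g" using that Suc by (auto cong: continuous_on_cong)
    moreover have "\<forall>x\<in>interior S. g differentiable (at x)"
      using that Suc differentiable_cong_open[OF assms(1)] assms(1)
      by (auto simp: interior_open) (blast)
    moreover have "\<forall>i\<in>Basis. \<exists>h. (\<forall>x\<in>interior S. h x = frechet_derivative g (at x) i) \<and> Ck_on n S h"
      using that(1) Suc pd_cong_open[OF assms(1) that(2), unfolded pd_def] assms(1)
      by (simp add: interior_open)
    ultimately show ?thesis using Suc by simp
  qed
  show ?thesis using *[of f g] *[of g f] assms by auto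
qed

text \<open>
  On an open set the continuous extension of a derivative, which the definition asks for, is the derivative
  itself. This turns the definition into a recursion over \<open>pd\<close>.
\<close>

lemma Ck_on_Suc_open:
  assumes "open S"
  shows "Ck_on (Suc k) S g \<longleftrightarrow> (\<forall>x\<in>S. g differentiable (at x)) \<and> (\<forall>i\<in>Basis. Ck_on k S (pd i g))"
proof -
  have 1: "(\<exists>h. (\<forall>x\<in>S. h x = frechet_derivative g (at x) i) \<and> Ck_on k S h) \<longleftrightarrow> Ck_on k S (pd i g)" for i
  proof
    assume "\<exists>h. (\<forall>x\<in>S. h x = frechet_derivative g (at x) i) \<and> Ck_on k S h"
    then obtain h where h: "\<And>x. x \<in> S \<Longrightarrow> h x = pd i g x" "Ck_on k S h" unfolding pd_def by metis
    show "Ck_on k S (pd i g)" using Ck_on_cong[OF assms h(1)] h(2) by simp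
  next
    assume "Ck_on k S (pd i g)"
    then show "\<exists>h. (\<forall>x\<in>S. h x = frechet_derivative g (at x) i) \<and> Ck_on k S h"
      by (intro exI[of _ "pd i g"]) (simp add: pd_def)
  qed
  have 2: "(\<forall>x\<in>S. g differentiable (at x)) \<Longrightarrow> continuous_on S g"
    by (intro continuous_at_imp_continuous_on ballI differentiable_imp_continuous_within) (rule bspec)
  have 3: "interior S = S" using assms by (simp add: interior_open)
  have 4: "Ck_on (Suc k) S g \<longleftrightarrow> continuous_on S g \<and> (\<forall>x\<in>S. g differentiable (at x)) \<and> (\<forall>i\<in>Basis. Ck_on k S (pd i g))"
    unfolding Ck_on.simps(2) 3 1 ..
  show ?thesis unfolding 4 using 2 by blast
qed

declare Ck_on.simps(2) [simp del]

lemma Ck_on_1_subset: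
  fixes \<phi> :: "'a::euclidean_space \<Rightarrow> real"
  assumes "Ck_on 1 UNIV \<phi>"
  shows "Ck_on 1 S \<phi>"
proof -
  have d: "\<phi> differentiable (at x)" and c: "i \<in> Basis \<Longrightarrow> continuous_on UNIV (pd i \<phi>)" for x i
    using assms by (auto simp: Ck_on_Suc_open)
  show ?thesis unfolding One_nat_def Ck_on.simps
  proof (intro conjI ballI)
    show "continuous_on S \<phi>" using Ck_on_imp_continuous[OF assms] continuous_on_subset by blast
    fix i :: 'a assume "i \<in> Basis"
    then have "continuous_on S (pd i \<phi>)" using c continuous_on_subset by blast
    then show "\<exists>h. (\<forall>x\<in>interior S. h x = frechet_derivative \<phi> (at x) i) \<and> continuous_on S h"
      by (intro exI[of _ "pd i \<phi>"]) (simp add: pd_def)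
  qed (rule d)
qed

lemma Ck_on_SucD:
  assumes "open S" "Ck_on (Suc k) S g"
  shows "Ck_on k S g"
  using assms(2)
proof (induction k arbitrary: g)
  case 0 then show ?case using Ck_on_imp_continuous by auto
next
  case (Suc k) then show ?case using Ck_on_Suc_open[OF assms(1)] by blast
qed

lemma Ck_on_Un:
  assumes "open S" "open T" "Ck_on k S f" "Ck_on k T f"
  shows "Ck_on k (S \<union> T) f"
  using assms(3,4)
proof (induction k arbitrary: f)
  case 0 then show ?case using assms by (auto intro: continuous_on_open_Un)
next
  case (Suc k) then show ?case using assms by (auto simp: Ck_on_Suc_open open_Un)
qed

lemma Ck_on_subset:
  assumes "open S" "open T" "T \<subseteq> S" "Ck_on k S f"
  shows "Ck_on k T f"
  using assms(4)
proof (induction k arbitrary: f)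
  case 0 then show ?case using assms by (auto intro: continuous_on_subset)
next
  case (Suc k) then show ?case using assms by (auto simp: Ck_on_Suc_open)
qed

lemma Ck_on_const: "open S \<Longrightarrow> Ck_on k S (\<lambda>x. c)"
proof (induction k arbitrary: c)
  case (Suc k)
  have "pd i (\<lambda>x. c) = (\<lambda>x. 0)" for i :: 'a
    by (intro ext pd_eqI[THEN trans]) (rule has_derivative_const, simp)
  then show ?case using Suc by (auto simp: Ck_on_Suc_open)
qed simp

lemma pd_add:
  assumes "f differentiable (at x)" "g differentiable (at x)"
  shows "pd i (\<lambda>x. f x + g x) x = pd i f x + pd i g x"
  using has_derivative_add[OF frechet_derivative_works[THEN iffD1, OF assms(1)] frechet_derivative_works[THEN iffD1, OF assms(2)]]
  by (subst pd_eqI, assumption) (simp add: pd_def)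

lemma pd_mult:
  fixes f g :: "'a::euclidean_space \<Rightarrow> real"
  assumes "f differentiable (at x)" "g differentiable (at x)"
  shows "pd i (\<lambda>x. f x * g x) x = f x * pd i g x + pd i f x * g x"
  using has_derivative_mult[OF frechet_derivative_works[THEN iffD1, OF assms(1)] frechet_derivative_works[THEN iffD1, OF assms(2)]]
  by (subst pd_eqI, assumption) (simp add: pd_def)

lemma pd_sum:
  assumes "finite J" "\<And>j. j \<in> J \<Longrightarrow> f j differentiable (at x)"
  shows "pd i (\<lambda>x. \<Sum>j\<in>J. f j x) x = (\<Sum>j\<in>J. pd i (f j) x)"
proof -
  have "((\<lambda>x. \<Sum>j\<in>J. f j x) has_derivative (\<lambda>h. \<Sum>j\<in>J. frechet_derivative (f j) (at x) h)) (at x)"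
    by (rule has_derivative_sum) (use assms frechet_derivative_works in blast)
  from pd_eqI[OF this] show ?thesis by (simp add: pd_def)
qed

lemma Ck_on_add:
  assumes "open S"
  shows "Ck_on k S f \<Longrightarrow> Ck_on k S g \<Longrightarrow> Ck_on k S (\<lambda>x. f x + g x)"
proof (induction k arbitrary: f g)
  case 0 then show ?case by (auto intro: continuous_on_add)
next
  case (Suc k)
  then have d: "\<And>x. x \<in> S \<Longrightarrow> f differentiable (at x)" "\<And>x. x \<in> S \<Longrightarrow> g differentiable (at x)"
    by (auto simp: Ck_on_Suc_open assms)
  have "Ck_on k S (pd i (\<lambda>x. f x + g x))" if "i \<in> Basis" for i
    using Suc that by (subst Ck_on_cong[OF assms pd_add]) (auto simp: d Ck_on_Suc_open assms)
  then show ?case using d by (auto simp: Ck_on_Suc_open assms intro!: differentiable_add)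
qed

lemma Ck_on_mult:
  assumes "open S"
  shows "Ck_on k S f \<Longrightarrow> Ck_on k S g \<Longrightarrow> Ck_on k S (\<lambda>x. f x * g x)"
proof (induction k arbitrary: f g)
  case 0 then show ?case by (auto intro: continuous_on_mult)
next
  case (Suc k)
  then have d: "\<And>x. x \<in> S \<Longrightarrow> f differentiable (at x)" "\<And>x. x \<in> S \<Longrightarrow> g differentiable (at x)"
    by (auto simp: Ck_on_Suc_open assms)
  have "Ck_on k S (pd i (\<lambda>x. f x * g x))" if "i \<in> Basis" for i
    using Suc that Ck_on_SucD[OF assms Suc.prems(1)] Ck_on_SucD[OF assms Suc.prems(2)]
    by (subst Ck_on_cong[OF assms pd_mult]) (auto simp: d Ck_on_Suc_open assms intro!: Ck_on_add[OF assms] Suc.IH)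
  then show ?case using d by (auto simp: Ck_on_Suc_open assms intro!: differentiable_mult)
qed

lemma Ck_on_sum:
  assumes "open S" "finite J" "\<And>j. j \<in> J \<Longrightarrow> Ck_on k S (f j)"
  shows "Ck_on k S (\<lambda>x. \<Sum>j\<in>J. f j x)"
  using assms(2,3) by (induction J) (auto intro: Ck_on_const Ck_on_add assms)

lemma Ck_on_cmult: "open S \<Longrightarrow> Ck_on k S f \<Longrightarrow> Ck_on k S (\<lambda>x. c * f x)"
  by (intro Ck_on_mult Ck_on_const)

lemma Ck_on_inner: "Ck_on k UNIV (\<lambda>z. z \<bullet> i)"
proof (cases k)
  case 0 then show ?thesis by (auto intro: continuous_intros)
next
  case (Suc n)
  have h: "((\<lambda>z. z \<bullet> i) has_derivative (\<lambda>h. h \<bullet> i)) (at x)" for x by (auto intro!: derivative_eq_intros)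
  have "pd j (\<lambda>z. z \<bullet> i) = (\<lambda>x. j \<bullet> i)" for j
    by (rule ext) (rule pd_eqI[OF h])
  then show ?thesis using Suc h by (auto simp: Ck_on_Suc_open differentiable_def intro!: Ck_on_const)
qed

lemma pd_affine:
  fixes g :: "'a::euclidean_space \<Rightarrow> real"
  assumes "g differentiable (at (a + c *\<^sub>R x))"
  shows "((\<lambda>y. g (a + c *\<^sub>R y)) has_derivative (\<lambda>h. c * frechet_derivative g (at (a + c *\<^sub>R x)) h)) (at x)"
    and "pd i (\<lambda>y. g (a + c *\<^sub>R y)) x = c * pd i g (a + c *\<^sub>R x)"
proof -
  have 1: "(g has_derivative frechet_derivative g (at (a + c *\<^sub>R x))) (at (a + c *\<^sub>R x))"
    using assms frechet_derivative_works by blast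
  have 2: "((\<lambda>y. a + c *\<^sub>R y) has_derivative (\<lambda>h. c *\<^sub>R h)) (at x)"
    by (auto intro!: derivative_eq_intros)
  have 3: "linear (frechet_derivative g (at (a + c *\<^sub>R x)))" using assms linear_frechet_derivative by blast
  show *: "((\<lambda>y. g (a + c *\<^sub>R y)) has_derivative (\<lambda>h. c * frechet_derivative g (at (a + c *\<^sub>R x)) h)) (at x)"
    using has_derivative_compose[OF 2 1] by (simp add: linear_cmul[OF 3])
  show "pd i (\<lambda>y. g (a + c *\<^sub>R y)) x = c * pd i g (a + c *\<^sub>R x)"
    using pd_eqI[OF *] by (simp add: pd_def)
qed

lemma Ck_on_affine:
  fixes g :: "'a::euclidean_space \<Rightarrow> real"
  shows "Ck_on k UNIV g \<Longrightarrow> Ck_on k UNIV (\<lambda>y. g (a + c *\<^sub>R y))"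
proof (induction k arbitrary: g)
  case 0 then show ?case
    by (auto intro!: continuous_on_compose2[where f="\<lambda>y. a + c *\<^sub>R y" and s=UNIV and g=g and t=UNIV] continuous_intros)
next
  case (Suc k)
  then have d: "\<And>x. g differentiable (at x)" by (auto simp: Ck_on_Suc_open)
  have "pd i (\<lambda>y. g (a + c *\<^sub>R y)) = (\<lambda>x. c * pd i g (a + c *\<^sub>R x))" for i
    using pd_affine(2)[OF d] by blast
  moreover have "(\<lambda>y. g (a + c *\<^sub>R y)) differentiable (at x)" for x
    using pd_affine(1)[OF d] unfolding differentiable_def by blast
  ultimately show ?case using Suc by (auto simp: Ck_on_Suc_open intro!: Ck_on_cmult)
qed

lemma DERIV_pd_1:
  fixes \<phi> :: "real \<Rightarrow> real"
  shows "\<phi> differentiable (at x) \<Longrightarrow> (\<phi> has_real_derivative pd 1 \<phi> x) (at x)"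
proof -
  assume "\<phi> differentiable (at x)"
  moreover have "(\<lambda>h. h * pd 1 \<phi> x) = (*) (pd 1 \<phi> x)" by (auto simp: mult.commute)
  ultimately show ?thesis using has_derivative_pd[of \<phi> x] by (simp add: has_field_derivative_def)
qed

lemma pd_1_eqI:
  fixes \<phi> :: "real \<Rightarrow> real"
  shows "(\<phi> has_real_derivative D) (at x) \<Longrightarrow> pd 1 \<phi> x = D"
  by (auto simp: has_field_derivative_def dest: pd_eqI[where i=1])

lemma Ck_on_SucI_DERIV:
  fixes \<phi> :: "real \<Rightarrow> real"
  assumes "open S" "\<And>x. x \<in> S \<Longrightarrow> (\<phi> has_real_derivative \<phi>' x) (at x)" "Ck_on k S \<phi>'"
  shows "Ck_on (Suc k) S \<phi>"
proof -
  have "Ck_on k S (pd 1 \<phi>)" 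
    using assms(3) Ck_on_cong[OF assms(1), of "pd 1 \<phi>" \<phi>'] pd_1_eqI assms(2) by blast
  then show ?thesis using assms
    by (auto simp: Ck_on_Suc_open real_differentiable_def)
qed

lemma pd_compose:
  fixes \<phi> :: "real \<Rightarrow> real"
  assumes "\<phi> differentiable (at (g x))" "g differentiable (at x)"
  shows "((\<lambda>x. \<phi> (g x)) has_derivative (\<lambda>h. pd 1 \<phi> (g x) * frechet_derivative g (at x) h)) (at x)"
    and "pd i (\<lambda>x. \<phi> (g x)) x = pd 1 \<phi> (g x) * pd i g x"
proof -
  show *: "((\<lambda>x. \<phi> (g x)) has_derivative (\<lambda>h. pd 1 \<phi> (g x) * frechet_derivative g (at x) h)) (at x)"
    using has_derivative_compose[OF frechet_derivative_works[THEN iffD1, OF assms(2)], of \<phi> "\<lambda>h. pd 1 \<phi> (g x) * h"] DERIV_pd_1[OF assms(1)]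
    by (simp add: has_field_derivative_def)
  show "pd i (\<lambda>x. \<phi> (g x)) x = pd 1 \<phi> (g x) * pd i g x"
    using pd_eqI[OF *] by (simp add: pd_def)
qed

lemma Ck_on_compose:
  fixes \<phi> :: "real \<Rightarrow> real"
  assumes "open S" "open T" "g ` S \<subseteq> T"
  shows "Ck_on k T \<phi> \<Longrightarrow> Ck_on k S g \<Longrightarrow> Ck_on k S (\<lambda>x. \<phi> (g x))"
proof (induction k arbitrary: \<phi>)
  case 0 then show ?case using assms by (auto intro: continuous_on_compose2)
next
  case (Suc k)
  then have d: "\<And>x. x \<in> S \<Longrightarrow> g differentiable (at x)" "\<And>x. x \<in> S \<Longrightarrow> \<phi> differentiable (at (g x))"
    using assms by (auto simp: Ck_on_Suc_open)
  have "Ck_on k S (pd i (\<lambda>x. \<phi> (g x)))" if "i \<in> Basis" for i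
    using Suc that Ck_on_SucD[OF assms(1) Suc.prems(2)]
    by (subst Ck_on_cong[OF assms(1) pd_compose(2)])
       (auto simp: d Ck_on_Suc_open assms intro!: Ck_on_mult[OF assms(1)] Suc.IH)
  then show ?case using pd_compose(1)[OF d(2) d(1)]
    by (auto simp: Ck_on_Suc_open assms differentiable_def)
qed

section \<open>A compactly supported mollifier with explicit Laplacian potential\<close>

text \<open>
  The powers of \<open>1/t\<close> are built in because the span of this family is closed under differentiation.
\<close>

definition flat_exp :: "nat \<Rightarrow> real \<Rightarrow> real" where
  "flat_exp k t = (if t > 0 then (1 / t) ^ k * exp (- 1 / t) else 0)"

text \<open>
  One term of the exponential series of \<open>1/t\<close> beats the power of \<open>1/t\<close> with two powers of \<open>t\<close> to spare; the
  square gives the derivative zero at the origin.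
\<close>

lemma flat_exp_bound: "\<bar>flat_exp k t\<bar> \<le> fact (k + 2) * t\<^sup>2"
proof (cases "t > 0")
  case True
  have "(1/t) ^ (k+2) / fact (k+2) \<le> exp (1/t)"
  proof -
    have "(\<Sum>n\<in>{k+2}. inverse (fact n) * (1/t) ^ n) \<le> (\<Sum>n. inverse (fact n) * (1/t) ^ n)"
      using True summable_exp[of "1/t"] by (intro sum_le_suminf) auto
    then show ?thesis
      by (simp add: exp_def divide_inverse mult.commute)
  qed
  then have "(1/t) ^ (k+2) \<le> exp (1/t) * fact (k+2)"
    by (subst (asm) pos_divide_le_eq) (simp, assumption)
  then have "(1/t)^(k+2) * exp (-1/t) \<le> exp (1/t) * fact (k+2) * exp(-1/t)"
    by (intro mult_right_mono) auto
  also have "\<dots> = fact (k+2)" by (simp add: exp_minus)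
  finally have "(1/t)^k * (1/t)^2 * exp (-1/t) \<le> fact (k+2)"
    by (subst power_add[symmetric])
  then have "(1/t)^k * (1/t)^2 * exp (-1/t) * t\<^sup>2 \<le> fact (k+2) * t\<^sup>2"
    by (rule mult_right_mono) simp
  moreover have "(1/t)^k * (1/t)^2 * exp (-1/t) * t\<^sup>2 = (1/t)^k * exp (-1/t) * ((1/t)^2 * t\<^sup>2)"
    by (simp only: mult_ac)
  moreover have "(1/t)^2 * t\<^sup>2 = 1" using True by (simp add: power_divide)
  ultimately have "(1/t)^k * exp (-1/t) \<le> fact (k+2) * t\<^sup>2" by (metis mult_1_right)
  then show ?thesis using True by (simp add: flat_exp_def del: fact_Suc)
qed (simp add: flat_exp_def)

lemma flat_exp_DERIV: "(flat_exp k has_real_derivative (flat_exp (k + 2) t - real k * flat_exp (k + 1) t)) (at t)"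
proof -
  consider "t > 0" | "t < 0" | "t = 0" by linarith
  then show ?thesis
  proof cases
    case 1
    have e: "((\<lambda>t. exp (- 1 / t)) has_real_derivative (exp (- 1 / t) * (1/t)^2)) (at t)"
      using 1 by (auto intro!: derivative_eq_intros simp: power2_eq_square)
    have p: "((\<lambda>t. (1 / t) ^ k) has_real_derivative (- real k * (1/t)^(k+1))) (at t)"
    proof (cases k)
      case (Suc j)
      have d: "((\<lambda>t. 1 / t) has_real_derivative - ((1/t)^2)) (at t)"
        using 1 by (auto intro!: derivative_eq_intros simp: power2_eq_square)
      have e: "real (Suc j) * (- (x^2) * x ^ (Suc j - Suc 0)) = - real (Suc j) * x ^ (Suc j + 1)" for x :: real
        by (simp add: power2_eq_square algebra_simps)
      show ?thesis unfolding Suc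
        by (rule DERIV_cong[OF DERIV_power[OF d, of "Suc j"] e])
    qed simp
    have "((\<lambda>t. (1 / t) ^ k * exp (- 1 / t)) has_real_derivative (flat_exp (k + 2) t - real k * flat_exp (k + 1) t)) (at t)"
      by (rule DERIV_cong[OF DERIV_mult[OF p e]]) (use 1 in \<open>simp add: flat_exp_def power2_eq_square algebra_simps\<close>)
    then show ?thesis
      by (rule has_field_derivative_transform_within_open[where S="{0<..}"]) (use 1 in \<open>auto simp: flat_exp_def\<close>)
  next
    case 2
    have "((\<lambda>t. 0) has_real_derivative 0) (at t)" by simp
    then have "(flat_exp k has_real_derivative 0) (at t)"
      by (rule has_field_derivative_transform_within_open[where S="{..<0}"]) (use 2 in \<open>auto simp: flat_exp_def\<close>)
    then show ?thesis using 2 by (simp add: flat_exp_def)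
  next
    case 3
    have "((\<lambda>h. (flat_exp k (0 + h) - flat_exp k 0) / h) \<longlongrightarrow> 0) (at 0)"
    proof (rule Lim_null_comparison)
      show "\<forall>\<^sub>F h in at 0. norm ((flat_exp k (0 + h) - flat_exp k 0) / h) \<le> fact (k + 2) * \<bar>h\<bar>"
      proof (rule always_eventually, rule allI)
        fix h :: real
        have "\<bar>flat_exp k h\<bar> \<le> fact (k + 2) * \<bar>h\<bar> * \<bar>h\<bar>"
          using flat_exp_bound[of k h] by (simp add: power2_eq_square mult.assoc)
        then show "norm ((flat_exp k (0 + h) - flat_exp k 0) / h) \<le> fact (k + 2) * \<bar>h\<bar>"
          by (cases "h = 0") (auto simp: flat_exp_def divide_simps simp del: fact_Suc)
      qed
      show "((\<lambda>h. fact (k + 2) * \<bar>h\<bar>) \<longlongrightarrow> (0::real)) (at 0)"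
        by (auto intro!: tendsto_eq_intros)
    qed
    then show ?thesis unfolding 3 by (simp add: DERIV_def flat_exp_def)
  qed
qed

lemma Ck_on_flat_exp: "Ck_on n UNIV (flat_exp k)"
proof (induction n arbitrary: k)
  case 0
  show ?case using flat_exp_DERIV by (auto intro!: continuous_at_imp_continuous_on DERIV_isCont)
next
  case (Suc n)
  have "Ck_on n UNIV (\<lambda>t. flat_exp (k + 2) t + (- real k) * flat_exp (k + 1) t)"
    by (intro Ck_on_add Ck_on_cmult Suc) auto
  then show ?case
    by (intro Ck_on_SucI_DERIV[OF _ flat_exp_DERIV]) auto
qed

lemma Ck_on_powr: "Ck_on k {0<..} (\<lambda>s::real. s powr a)"
proof (induction k arbitrary: a)
  case 0 show ?case by (auto intro!: continuous_intros)
next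
  case (Suc k)
  show ?case
    by (rule Ck_on_SucI_DERIV[OF _ has_real_derivative_powr]) (auto intro!: Ck_on_cmult Suc)
qed

definition bump :: "real \<Rightarrow> real" where
  "bump s = flat_exp 0 (s - 1/4) * flat_exp 0 (1 - s)"

lemma bump_nonneg: "bump s \<ge> 0" by (simp add: bump_def flat_exp_def)
lemma bump_pos: "1/4 < s \<Longrightarrow> s < 1 \<Longrightarrow> bump s > 0" by (simp add: bump_def flat_exp_def)
lemma bump_zero: "s \<le> 1/4 \<or> s \<ge> 1 \<Longrightarrow> bump s = 0" by (auto simp: bump_def flat_exp_def)

lemma Ck_on_bump: "Ck_on k UNIV bump"
proof -
  have "Ck_on k UNIV (\<lambda>s. flat_exp 0 (-1/4 + 1 *\<^sub>R s) * flat_exp 0 (1 + (-1) *\<^sub>R s))"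
    by (intro Ck_on_mult Ck_on_affine Ck_on_flat_exp) auto
  moreover have "(\<lambda>s. flat_exp 0 (-1/4 + 1 *\<^sub>R s) * flat_exp 0 (1 + (-1) *\<^sub>R s)) = bump"
    by (auto simp: bump_def)
  ultimately show ?thesis by simp
qed

lemma antiderivative_ex:
  fixes b :: "real \<Rightarrow> real"
  assumes "continuous_on UNIV b"
  obtains B where "\<And>x. (B has_real_derivative b x) (at x)"
proof -
  have "\<exists>F. \<forall>x::real. (-\<infinity>::ereal) < x \<longrightarrow> x < \<infinity> \<longrightarrow> (F has_vector_derivative b x) (at x)"
    using assms by (intro einterval_antiderivative) (auto simp: continuous_on_eq_continuous_at)
  then show ?thesis using that by (auto simp: has_real_derivative_iff_has_vector_derivative)
qed

lemma DERIV_0_const_on: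
  fixes f :: "real \<Rightarrow> real"
  assumes "convex S" "\<And>x. x \<in> S \<Longrightarrow> (f has_real_derivative 0) (at x)" "x \<in> S" "y \<in> S"
  shows "f x = f y"
proof -
  have "\<exists>c. \<forall>x\<in>S. f x = c"
    using assms by (intro has_field_derivative_zero_constant) (auto intro: has_field_derivative_at_within)
  then show ?thesis using assms by auto
qed

text \<open>
  The unit ball is chosen so that the \<open>n\<close>-th dyadic dilation of a kernel is supported in the ball of
  radius \<open>2^(-n)\<close>.
\<close>

definition kernel :: "('a::euclidean_space \<Rightarrow> real) \<Rightarrow> bool" where
  "kernel \<kappa> \<longleftrightarrow> (\<forall>k. Ck_on k UNIV \<kappa>) \<and> (\<forall>z. 1 < norm z \<longrightarrow> \<kappa> z = 0)"

definition lap :: "('a::euclidean_space \<Rightarrow> real) \<Rightarrow> 'a \<Rightarrow> real" where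
  "lap \<phi> x = (\<Sum>i\<in>Basis. pd i (pd i \<phi>) x)"

lemma Ck_on_inner_self: "Ck_on k UNIV (\<lambda>z::'a::euclidean_space. z \<bullet> z)"
proof -
  have "Ck_on k UNIV (\<lambda>z::'a. \<Sum>i\<in>Basis. (z \<bullet> i) * (z \<bullet> i))"
    by (intro Ck_on_sum Ck_on_mult Ck_on_inner) auto
  then show ?thesis by (simp add: euclidean_inner[symmetric])
qed

lemma pd_inner_self: "pd i (\<lambda>z. z \<bullet> z) x = 2 * (x \<bullet> i)"
proof -
  have "((\<lambda>z. z \<bullet> z) has_derivative (\<lambda>h. 2 * (x \<bullet> h))) (at x)"
    by (auto intro!: derivative_eq_intros simp: inner_commute)
  from pd_eqI[OF this] show ?thesis .
qed

lemma inner_self_differentiable: "(\<lambda>z::'a::euclidean_space. z \<bullet> z) differentiable (at x)"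
  using Ck_on_inner_self[of 1] Ck_on_Suc_open[of UNIV 0] by auto

text \<open>
  A radial function is written as a function of \<open>z \<bullet> z\<close> rather than of \<open>norm z\<close>, which keeps it
  smooth at the origin.
\<close>

lemma lap_radial:
  fixes z :: "'a::euclidean_space"
  assumes Q: "\<And>s. (Q has_real_derivative N s) (at s)" and N: "Ck_on 1 UNIV N"
  shows "lap (\<lambda>z. Q (z \<bullet> z)) z = 2 * real DIM('a) * N (z \<bullet> z) + 4 * (z \<bullet> z) * pd 1 N (z \<bullet> z)"
proof -
  have Qd: "Q differentiable (at s)" for s using Q real_differentiable_def by blast
  have Nd: "N differentiable (at s)" for s using N Ck_on_Suc_open[of UNIV 0 N] by auto
  have 1: "pd i (\<lambda>z. Q (z \<bullet> z)) = (\<lambda>z. N (z \<bullet> z) * (2 * (z \<bullet> i)))" for i :: 'a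
  proof
    fix z show "pd i (\<lambda>z. Q (z \<bullet> z)) z = N (z \<bullet> z) * (2 * (z \<bullet> i))"
      using pd_compose(2)[where g="\<lambda>z. z \<bullet> z", OF Qd inner_self_differentiable] pd_1_eqI[OF Q]
      by (simp add: pd_inner_self)
  qed
  have 2: "pd i (pd i (\<lambda>z. Q (z \<bullet> z))) z = 2 * N (z \<bullet> z) * (i \<bullet> i) + 4 * (z \<bullet> i)^2 * pd 1 N (z \<bullet> z)" for i :: 'a
  proof -
    have h: "((\<lambda>z. 2 * (z \<bullet> i)) has_derivative (\<lambda>h. 2 * (h \<bullet> i))) (at z)"
      by (auto intro!: derivative_eq_intros)
    have dN: "(\<lambda>z. N (z \<bullet> z)) differentiable (at z)"
      using pd_compose(1)[where g="\<lambda>z. z \<bullet> z", OF Nd inner_self_differentiable] unfolding differentiable_def by blast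
    have "pd i (pd i (\<lambda>z. Q (z \<bullet> z))) z
      = N (z \<bullet> z) * pd i (\<lambda>z. 2 * (z \<bullet> i)) z + pd i (\<lambda>z. N (z \<bullet> z)) z * (2 * (z \<bullet> i))"
      unfolding 1 by (rule pd_mult[OF dN]) (use h differentiable_def in blast)
    also have "pd i (\<lambda>z. 2 * (z \<bullet> i)) z = 2 * (i \<bullet> i)" by (rule pd_eqI[OF h])
    also have "pd i (\<lambda>z. N (z \<bullet> z)) z = pd 1 N (z \<bullet> z) * (2 * (z \<bullet> i))"
      using pd_compose(2)[where g="\<lambda>z. z \<bullet> z", OF Nd inner_self_differentiable] by (simp add: pd_inner_self)
    finally show ?thesis by (simp add: power2_eq_square algebra_simps)
  qed
  have "lap (\<lambda>z. Q (z \<bullet> z)) z = (\<Sum>i\<in>Basis. 2 * N (z \<bullet> z) + 4 * pd 1 N (z \<bullet> z) * ((z \<bullet> i) * (z \<bullet> i)))"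
    unfolding lap_def by (intro sum.cong refl) (simp add: 2 power2_eq_square)
  also have "\<dots> = 2 * real DIM('a) * N (z \<bullet> z) + 4 * pd 1 N (z \<bullet> z) * (\<Sum>i\<in>Basis. (z \<bullet> i) * (z \<bullet> i))"
    by (simp add: sum.distrib sum_distrib_left)
  also have "(\<Sum>i\<in>Basis. (z \<bullet> i) * (z \<bullet> i)) = z \<bullet> z" by (simp add: euclidean_inner[symmetric])
  finally show ?thesis by simp
qed

lemma Ck_on_radial: "Ck_on k UNIV Q \<Longrightarrow> Ck_on k UNIV (\<lambda>z::'a::euclidean_space. Q (z \<bullet> z))"
  by (rule Ck_on_compose[OF _ _ _ _ Ck_on_inner_self]) auto

text \<open>
  The radial form of \<open>\<Delta>\<Psi>(z) = \<eta>(z) - 2^n \<eta>(2z)\<close> in the variable \<open>s = z \<bullet> z\<close>, solved explicitly. The equation for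
  \<open>N = Q'\<close> is linear of first order and reads \<open>4 s^(1-n/2) (s^(n/2) N)' = \<rho>(s) - 2^n \<rho>(4s)\<close>. The two terms on the
  right have the same total mass with respect to the weight, which is why \<open>N\<close>, and with it \<open>Q\<close>, has compact support.
\<close>

lemma mollifier_potential_radial:
  fixes n :: real
  obtains \<rho> Q N :: "real \<Rightarrow> real" where "\<And>k. Ck_on k UNIV \<rho>" "\<And>k. Ck_on k UNIV Q" "\<And>k. Ck_on k UNIV N"
    "\<And>s. (Q has_real_derivative N s) (at s)" "\<And>s. s \<ge> 1 \<Longrightarrow> \<rho> s = 0" "\<And>s. s \<ge> 1 \<Longrightarrow> Q s = 0"
    "\<And>s. \<rho> s \<ge> 0" "\<And>s. 1/4 < s \<Longrightarrow> s < 1 \<Longrightarrow> \<rho> s > 0"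
    "\<And>s. s \<ge> 0 \<Longrightarrow> 2 * n * N s + 4 * s * pd 1 N s = \<rho> s - 2 powr n * \<rho> (4 * s)"
proof -
  \<comment> \<open>With this weight the right-hand side is \<open>s^(1-n/2) (bump s - 4 bump (4s))\<close>, so \<open>s^(n/2) N\<close> is
    a quarter of \<open>\<Theta> s - \<Theta> (4s)\<close> for an antiderivative \<open>\<Theta>\<close> of the bump.\<close>
  define \<rho> where "\<rho> = (\<lambda>s. s powr (1 - n/2) * bump s)"
  obtain \<Theta>0 where T0: "\<And>s. (\<Theta>0 has_real_derivative bump s) (at s)"
    using antiderivative_ex[of bump] Ck_on_bump[of 0] by auto
  define \<Theta> where "\<Theta> s = \<Theta>0 s - \<Theta>0 0" for s
  have T: "(\<Theta> has_real_derivative bump s) (at s)" for s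
    unfolding \<Theta>_def by (auto intro!: derivative_eq_intros T0)
  have Tz: "\<Theta> s = 0" if "s \<le> 1/4" for s
    using DERIV_0_const_on[of "{..1/4}" \<Theta> s 0] T bump_zero that by (auto simp: \<Theta>_def) metis
  have Tc: "\<Theta> s = \<Theta> 1" if "s \<ge> 1" for s
    using DERIV_0_const_on[of "{1..}" \<Theta> s 1] T bump_zero that by auto metis
  have CT: "Ck_on k UNIV \<Theta>" for k
    using Ck_on_SucI_DERIV[OF open_UNIV T Ck_on_bump] Ck_on_SucD[OF open_UNIV] by blast
  have CT4: "Ck_on k UNIV (\<lambda>s. \<Theta> (4 * s))" for k
    using Ck_on_affine[OF CT, of k 0 4] by simp
  define N where "N s = s powr (-n/2) * ((1/4) * (\<Theta> s + (-1) * \<Theta> (4 * s)))" for s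
  \<comment> \<open>The singular power of \<open>s\<close> does no harm, because \<open>\<Theta>\<close> vanishes near the origin.\<close>
  have CN: "Ck_on k UNIV N" for k
  proof -
    have "Ck_on k ({0<..} \<union> {..<1/16}) N"
    proof (rule Ck_on_Un)
      show "Ck_on k {0<..} N" unfolding N_def
        by (intro Ck_on_mult Ck_on_powr Ck_on_cmult Ck_on_add Ck_on_subset[OF open_UNIV _ _ CT] Ck_on_subset[OF open_UNIV _ _ CT4]) auto
      have "Ck_on k {..<1/16} (\<lambda>s::real. 0)" by (rule Ck_on_const) auto
      then show "Ck_on k {..<1/16} N"
        by (subst Ck_on_cong[where g="\<lambda>s. 0"]) (auto simp: N_def Tz)
    qed auto
    moreover have "({0<..} \<union> {..<1/16}) = (UNIV::real set)" by auto
    ultimately show ?thesis by simp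
  qed
  have C\<rho>: "Ck_on k UNIV \<rho>" for k
  proof -
    have "Ck_on k ({0<..} \<union> {..<1/4}) \<rho>"
    proof (rule Ck_on_Un)
      show "Ck_on k {0<..} \<rho>" unfolding \<rho>_def
        by (intro Ck_on_mult Ck_on_powr Ck_on_subset[OF open_UNIV _ _ Ck_on_bump]) auto
      have "Ck_on k {..<1/4} (\<lambda>s::real. 0)" by (rule Ck_on_const) auto
      then show "Ck_on k {..<1/4} \<rho>"
        by (subst Ck_on_cong[where g="\<lambda>s. 0"]) (auto simp: \<rho>_def bump_zero)
    qed auto
    moreover have "({0<..} \<union> {..<1/4}) = (UNIV::real set)" by auto
    ultimately show ?thesis by simp
  qed
  obtain Q0 where Q0: "\<And>s. (Q0 has_real_derivative N s) (at s)"
    using antiderivative_ex[of N] CN[of 0] by auto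
  define Q where "Q s = Q0 s - Q0 1" for s
  have Q: "(Q has_real_derivative N s) (at s)" for s
    unfolding Q_def by (auto intro!: derivative_eq_intros Q0)
  \<comment> \<open>Beyond 1 the antiderivative is constant, so the two terms cancel.\<close>
  have Nz: "N s = 0" if "s \<ge> 1" for s using Tc[of s] Tc[of "4 * s"] that by (simp add: N_def)
  have Qz: "Q s = 0" if "s \<ge> 1" for s
    using DERIV_0_const_on[of "{1..}" Q s 1] Q Nz that by (auto simp: Q_def) metis
  have CQ: "Ck_on k UNIV Q" for k
    using Ck_on_SucI_DERIV[OF open_UNIV Q CN] Ck_on_SucD[OF open_UNIV] by blast
  have eq: "2 * n * N s + 4 * s * pd 1 N s = \<rho> s - 2 powr n * \<rho> (4 * s)" if "s \<ge> 0" for s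
  proof (cases "s = 0")
    case True then show ?thesis by (simp add: N_def Tz \<rho>_def bump_zero)
  next
    case False
    with that have s: "s > 0" by simp
    have T4: "((\<lambda>s. \<Theta> (4 * s)) has_real_derivative bump (4 * s) * 4) (at s)"
      using DERIV_chain2[OF T, where g="\<lambda>s. 4 * s" and x=s and Db=4] by (auto intro!: derivative_eq_intros)
    have "(N has_real_derivative (-n/2 * s powr (-n/2 - 1)) * ((1/4) * (\<Theta> s + (-1) * \<Theta> (4 * s)))
        + ((1/4) * (bump s + (-1) * (bump (4 * s) * 4))) * s powr (-n/2)) (at s)"
      unfolding N_def
      by (intro DERIV_mult has_real_derivative_powr DERIV_cmult DERIV_add T T4 s)
    from pd_1_eqI[OF this]
    have p: "pd 1 N s = (-n/2 * s powr (-n/2 - 1)) * ((1/4) * (\<Theta> s + (-1) * \<Theta> (4 * s)))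
        + ((1/4) * (bump s + (-1) * (bump (4 * s) * 4))) * s powr (-n/2)" .
    have a1: "s powr (-n/2) = s * s powr (-n/2 - 1)" and a2: "s powr (1 - n/2) = s * s powr (-n/2)"
      using powr_add[of s 1 "-n/2 - 1"] powr_add[of s 1 "-n/2"] s by simp_all
    have a3: "2 powr n * (4 * s) powr (1 - n/2) = 4 * s powr (1 - n/2)"
    proof -
      have "(4::real) powr (1 - n/2) = (2 powr 2) powr (1 - n/2)" by simp
      also have "\<dots> = 2 powr (2 - n)" unfolding powr_powr by (simp add: algebra_simps)
      finally have "2 powr n * (4::real) powr (1 - n/2) = 4" by (simp add: powr_add[symmetric])
      then show ?thesis using s by (simp add: powr_mult)
    qed
    have "2 powr n * \<rho> (4 * s) = 4 * (s * s powr (-n/2)) * bump (4 * s)"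
      using a3 a2 by (simp add: \<rho>_def)
    moreover have "\<rho> s = s * s powr (-n/2) * bump s" by (simp only: \<rho>_def a2)
    moreover have "4 * s * pd 1 N s = - 2 * n * (s * s powr (-n/2 - 1)) * ((1/4) * (\<Theta> s + (-1) * \<Theta> (4 * s)))
        + (bump s + (-1) * (bump (4 * s) * 4)) * (s * s powr (-n/2))"
      unfolding p by (simp add: algebra_simps)
    ultimately show ?thesis unfolding a1[symmetric] by (simp add: N_def algebra_simps)
  qed
  show ?thesis
    by (rule that[of \<rho> Q N]) (auto simp: C\<rho> CQ CN Q Qz eq, auto simp: \<rho>_def bump_zero bump_nonneg bump_pos)
qed

lemma integrable_compact_support:
  fixes f :: "'a::euclidean_space \<Rightarrow> real"
  assumes "continuous_on UNIV f" "compact K" "\<And>x. x \<notin> K \<Longrightarrow> f x = 0"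
  shows "integrable lborel f"
proof -
  have "integrable lborel (\<lambda>x. indicator K x *\<^sub>R f x)"
    using assms by (intro borel_integrable_compact) (auto intro: continuous_on_subset)
  moreover have "(\<lambda>x. indicator K x *\<^sub>R f x) = f"
  proof
    fix x show "indicator K x *\<^sub>R f x = f x" using assms(3) by (cases "x \<in> K") auto
  qed
  ultimately show ?thesis by simp
qed

lemma kernel_continuous: "kernel \<kappa> \<Longrightarrow> continuous_on UNIV \<kappa>"
  using Ck_on_imp_continuous unfolding kernel_def by blast

lemma kernel_integrable: "kernel \<kappa> \<Longrightarrow> integrable lborel \<kappa>"
  by (rule integrable_compact_support[OF kernel_continuous compact_cball[of 0 1]])
     (auto simp: kernel_def)

lemma pd_cmult:
  fixes f :: "'a::euclidean_space \<Rightarrow> real"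
  assumes "f differentiable (at x)"
  shows "pd i (\<lambda>x. c * f x) x = c * pd i f x"
proof -
  have "((\<lambda>x. c * f x) has_derivative (\<lambda>h. c * frechet_derivative f (at x) h)) (at x)"
    using frechet_derivative_works[THEN iffD1, OF assms] by (rule has_derivative_mult_right)
  from pd_eqI[OF this] show ?thesis by (simp add: pd_def)
qed

lemma Ck_on_differentiable: "Ck_on (Suc k) UNIV f \<Longrightarrow> f differentiable (at x)"
  by (simp add: Ck_on_Suc_open)

lemma lap_cmult:
  assumes "\<And>k. Ck_on k UNIV f"
  shows "lap (\<lambda>x. c * f x) x = c * lap f x"
proof -
  have 1: "pd i (\<lambda>x. c * f x) = (\<lambda>x. c * pd i f x)" for i
    using pd_cmult Ck_on_differentiable[OF assms] by blast
  have "pd i (pd i (\<lambda>x. c * f x)) x = c * pd i (pd i f) x" if "i \<in> Basis" for i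
    unfolding 1 using assms[of "Suc (Suc 0)"] that by (intro pd_cmult) (simp add: Ck_on_Suc_open)
  then show ?thesis by (simp add: lap_def sum_distrib_left)
qed

text \<open>
  The function \<open>\<Psi>\<close> is the difference of the Newtonian potentials of \<open>\<eta>\<close> and of its dilation by 2. Both sources have the
  same mass, so by Newton's theorem for radial sources the potentials agree outside the unit ball. It plays the role of a
  fundamental solution in everything that follows, without a singularity.
\<close>

lemma mollifier_exists:
  obtains \<eta> \<Psi> :: "'a::euclidean_space \<Rightarrow> real" where
    "kernel \<eta>" "kernel \<Psi>" "\<And>z. 0 \<le> \<eta> z" "integral\<^sup>L lborel \<eta> = 1"
    "\<And>z. lap \<Psi> z = \<eta> z - 2 ^ DIM('a) * \<eta> (2 *\<^sub>R z)"
proof -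
  obtain \<rho> Q N :: "real \<Rightarrow> real" where C: "\<And>k. Ck_on k UNIV \<rho>" "\<And>k. Ck_on k UNIV Q" "\<And>k. Ck_on k UNIV N"
    and Q: "\<And>s. (Q has_real_derivative N s) (at s)" and z: "\<And>s. s \<ge> 1 \<Longrightarrow> \<rho> s = 0" "\<And>s. s \<ge> 1 \<Longrightarrow> Q s = 0"
    and nn: "\<And>s. \<rho> s \<ge> 0" and pos: "\<And>s. 1/4 < s \<Longrightarrow> s < 1 \<Longrightarrow> \<rho> s > 0"
    and eq: "\<And>s. s \<ge> 0 \<Longrightarrow> 2 * real DIM('a) * N s + 4 * s * pd 1 N s = \<rho> s - 2 powr real DIM('a) * \<rho> (4 * s)"
    using mollifier_potential_radial[of "real DIM('a)"] by metis
  define \<eta>0 where "\<eta>0 = (\<lambda>z::'a. \<rho> (z \<bullet> z))"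
  define \<Psi>0 where "\<Psi>0 = (\<lambda>z::'a. Q (z \<bullet> z))"
  have big: "z \<bullet> z \<ge> 1" if "1 < norm z" for z :: 'a
    using that by (simp add: dot_square_norm one_le_power)
  have k\<eta>: "kernel \<eta>0" unfolding kernel_def \<eta>0_def using C Ck_on_radial z big by blast
  have k\<Psi>: "kernel \<Psi>0" unfolding kernel_def \<Psi>0_def using C Ck_on_radial z big by blast
  have L: "lap \<Psi>0 z = \<eta>0 z - 2 ^ DIM('a) * \<eta>0 (2 *\<^sub>R z)" for z
    unfolding \<Psi>0_def \<eta>0_def using lap_radial[of Q N z, OF Q C(3)] eq[of "z \<bullet> z"]
    by (simp add: powr_realpow)
  define c where "c = integral\<^sup>L lborel \<eta>0"
  have c: "c > 0"
  proof -
    have int: "integrable lborel \<eta>0" using kernel_integrable k\<eta> .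
    have "c \<ge> 0" unfolding c_def using nn by (intro integral_nonneg_AE) (auto simp: \<eta>0_def)
    moreover have "c \<noteq> 0"
    proof
      assume "c = 0"
      then have "AE z in lborel. \<eta>0 z = 0"
        using integral_nonneg_eq_0_iff_AE[OF int] nn by (auto simp: c_def \<eta>0_def)
      then have ae: "AE z in lborel. z \<notin> {z::'a. 1/4 < z \<bullet> z \<and> z \<bullet> z < 1}"
        by eventually_elim (use pos in \<open>force simp: \<eta>0_def\<close>)
      have op: "open {z::'a. 1/4 < z \<bullet> z \<and> z \<bullet> z < 1}"
        by (intro open_Collect_conj open_Collect_less continuous_intros)
      then have "{z::'a. 1/4 < z \<bullet> z \<and> z \<bullet> z < 1} \<in> null_sets lborel"
        using ae by (subst AE_iff_null_sets) auto
      then have "negligible {z::'a. 1/4 < z \<bullet> z \<and> z \<bullet> z < 1}"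
        using null_sets_completionI negligible_iff_null_sets by blast
      then have "{z::'a. 1/4 < z \<bullet> z \<and> z \<bullet> z < 1} = {}"
        using open_not_negligible op by blast
      moreover obtain b :: 'a where b: "b \<in> Basis" using nonempty_Basis by blast
      have "sqrt (1/2) *\<^sub>R b \<in> {z::'a. 1/4 < z \<bullet> z \<and> z \<bullet> z < 1}"
        using b by (simp add: inner_Basis)
      ultimately show False by blast
    qed
    ultimately show ?thesis by simp
  qed
  have sc: "kernel (\<lambda>z. (1/c) * \<kappa> z)" if "kernel \<kappa>" for \<kappa> :: "'a \<Rightarrow> real"
    using that Ck_on_cmult[OF open_UNIV, of _ \<kappa> "1/c"] unfolding kernel_def by simp
  show ?thesis
  proof (rule that[of "\<lambda>z. (1/c) * \<eta>0 z" "\<lambda>z. (1/c) * \<Psi>0 z"])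
    show "lap (\<lambda>z. (1/c) * \<Psi>0 z) z = (1/c) * \<eta>0 z - 2 ^ DIM('a) * ((1/c) * \<eta>0 (2 *\<^sub>R z))" for z
      using k\<Psi> unfolding kernel_def by (subst lap_cmult) (auto simp: L right_diff_distrib)
    show "integral\<^sup>L lborel (\<lambda>z. (1/c) * \<eta>0 z) = 1" using c by (simp add: c_def[symmetric])
  qed (use sc k\<eta> k\<Psi> c nn in \<open>auto simp: \<eta>0_def\<close>)
qed

section \<open>Convolution with smooth compactly supported functions\<close>

definition C1c :: "('a::euclidean_space \<Rightarrow> real) \<Rightarrow> bool" where
  "C1c \<kappa> \<longleftrightarrow> Ck_on 1 UNIV \<kappa> \<and> (\<exists>R. \<forall>z. R < norm z \<longrightarrow> \<kappa> z = 0)"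

definition Cinfc :: "('a::euclidean_space \<Rightarrow> real) \<Rightarrow> bool" where
  "Cinfc \<kappa> \<longleftrightarrow> (\<forall>k. Ck_on k UNIV \<kappa>) \<and> (\<exists>R. \<forall>z. R < norm z \<longrightarrow> \<kappa> z = 0)"

lemma Cinfc_C1c: "Cinfc \<kappa> \<Longrightarrow> C1c \<kappa>" by (auto simp: Cinfc_def C1c_def)

lemma kernel_Cinfc: "kernel \<kappa> \<Longrightarrow> Cinfc \<kappa>" by (auto simp: Cinfc_def kernel_def)

lemma C1c_differentiable: "C1c \<kappa> \<Longrightarrow> \<kappa> differentiable (at x)"
  using Ck_on_differentiable unfolding C1c_def One_nat_def by blast

lemma C1c_continuous: "C1c \<kappa> \<Longrightarrow> continuous_on UNIV \<kappa>"
  using Ck_on_imp_continuous unfolding C1c_def by blast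

lemma C1c_pd_continuous: "C1c \<kappa> \<Longrightarrow> i \<in> Basis \<Longrightarrow> continuous_on UNIV (pd i \<kappa>)"
  unfolding C1c_def One_nat_def Ck_on_Suc_open[OF open_UNIV] by (auto dest: Ck_on_imp_continuous)

lemma pd_zero_outside:
  fixes \<kappa> :: "'a::euclidean_space \<Rightarrow> real"
  assumes "\<And>z. R < norm z \<Longrightarrow> \<kappa> z = 0" "R < norm z"
  shows "pd i \<kappa> z = 0"
proof -
  have "open {z::'a. R < norm z}" by (intro open_Collect_less continuous_intros)
  then have "pd i \<kappa> z = pd i (\<lambda>z. 0) z"
    using assms by (intro pd_cong_open) auto
  also have "\<dots> = 0" by (rule pd_eqI[OF has_derivative_const])
  finally show ?thesis .
qed

lemma Ck_on_pd: "Ck_on (Suc k) UNIV \<kappa> \<Longrightarrow> i \<in> Basis \<Longrightarrow> Ck_on k UNIV (pd i \<kappa>)"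
  by (simp add: Ck_on_Suc_open)

lemma Cinfc_pd: "Cinfc \<kappa> \<Longrightarrow> i \<in> Basis \<Longrightarrow> Cinfc (pd i \<kappa>)"
  unfolding Cinfc_def using Ck_on_pd pd_zero_outside by blast

lemma kernel_pd: "kernel \<kappa> \<Longrightarrow> i \<in> Basis \<Longrightarrow> kernel (pd i \<kappa>)"
  unfolding kernel_def using Ck_on_pd pd_zero_outside by blast

lemma cont_compact_bounded:
  fixes \<kappa> :: "'a::euclidean_space \<Rightarrow> real"
  assumes "continuous_on UNIV \<kappa>" "\<exists>R. \<forall>z. R < norm z \<longrightarrow> \<kappa> z = 0"
  shows "\<exists>M\<ge>0. \<forall>z. \<bar>\<kappa> z\<bar> \<le> M"
proof -
  obtain R where R: "\<And>z. R < norm z \<Longrightarrow> \<kappa> z = 0" using assms(2) by blast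
  have "bounded (\<kappa> ` cball 0 R)"
    using assms(1) by (intro compact_imp_bounded compact_continuous_image) (auto intro: continuous_on_subset)
  then obtain M where M: "\<forall>z\<in>cball 0 R. \<bar>\<kappa> z\<bar> \<le> M" unfolding bounded_iff by auto
  have "\<bar>\<kappa> z\<bar> \<le> max M 0" for z
    using M R[of z] by (cases "norm z \<le> R") force+
  then show ?thesis by (intro exI[of _ "max M 0"]) auto
qed

lemma C1c_bounded: "C1c \<kappa> \<Longrightarrow> \<exists>M\<ge>0. \<forall>z. \<bar>\<kappa> z\<bar> \<le> M"
  by (rule cont_compact_bounded) (auto simp: C1c_continuous, auto simp: C1c_def)

lemma C1c_pd_bounded: "C1c \<kappa> \<Longrightarrow> i \<in> Basis \<Longrightarrow> \<exists>M\<ge>0. \<forall>z. \<bar>pd i \<kappa> z\<bar> \<le> M"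
proof (rule cont_compact_bounded[OF C1c_pd_continuous])
  assume "C1c \<kappa>"
  then obtain R where "\<And>z. R < norm z \<Longrightarrow> \<kappa> z = 0" unfolding C1c_def by blast
  then show "\<exists>R. \<forall>z. R < norm z \<longrightarrow> pd i \<kappa> z = 0"
    by (intro exI[of _ R] allI impI pd_zero_outside)
qed

lemma C1c_derivative_bound:
  fixes \<kappa> :: "'a::euclidean_space \<Rightarrow> real"
  assumes "C1c \<kappa>"
  obtains L where "L \<ge> 0" "\<And>z h. \<bar>\<Sum>i\<in>Basis. (h \<bullet> i) * pd i \<kappa> z\<bar> \<le> L * norm h"
    "\<And>y z. \<bar>\<kappa> y - \<kappa> z\<bar> \<le> L * norm (y - z)"
proof -
  obtain M where M: "\<And>i. i \<in> Basis \<Longrightarrow> M i \<ge> 0" "\<And>i z. i \<in> Basis \<Longrightarrow> \<bar>pd i \<kappa> z\<bar> \<le> M i"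
    using C1c_pd_bounded[OF assms] by metis
  define L where "L = (\<Sum>i\<in>Basis. M i)"
  have L0: "L \<ge> 0" unfolding L_def using M(1) by (rule sum_nonneg)
  have 1: "\<bar>\<Sum>i\<in>Basis. (h \<bullet> i) * pd i \<kappa> z\<bar> \<le> L * norm h" for z h
  proof -
    have "\<bar>\<Sum>i\<in>Basis. (h \<bullet> i) * pd i \<kappa> z\<bar> \<le> (\<Sum>i\<in>Basis. \<bar>(h \<bullet> i) * pd i \<kappa> z\<bar>)" by (rule sum_abs)
    also have "\<dots> \<le> (\<Sum>i\<in>Basis. norm h * M i)"
      unfolding abs_mult by (intro sum_mono mult_mono) (auto simp: Basis_le_norm M)
    finally show ?thesis by (simp add: L_def sum_distrib_left mult.commute)
  qed
  have on: "onorm (\<lambda>h. \<Sum>i\<in>Basis. (h \<bullet> i) * pd i \<kappa> z) \<le> L" for z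
    using 1 L0 by (intro onorm_bound) (auto simp: mult.commute)
  have 2: "\<bar>\<kappa> y - \<kappa> z\<bar> \<le> L * norm (y - z)" for y z
    using differentiable_bound[of UNIV \<kappa> "\<lambda>z h. \<Sum>i\<in>Basis. (h \<bullet> i) * pd i \<kappa> z" L y z]
      has_derivative_pd[OF C1c_differentiable[OF assms]] on
    by simp
  show ?thesis using that[OF L0 1 2] .
qed

lemma integrable_mult_bounded:
  fixes g f :: "'a::euclidean_space \<Rightarrow> real"
  assumes "integrable lborel g" "f \<in> borel_measurable borel" "\<And>x. \<bar>f x\<bar> \<le> M"
  shows "integrable lborel (\<lambda>x. g x * f x)"
proof (rule Bochner_Integration.integrable_bound)
  show "integrable lborel (\<lambda>x. g x * M)" using assms by simp
  show "(\<lambda>x. g x * f x) \<in> borel_measurable lborel"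
    using borel_measurable_integrable[OF assms(1)] assms(2) by measurable
  have "\<bar>f x\<bar> \<le> \<bar>M\<bar>" for x using assms(3)[of x] by linarith
  then show "AE x in lborel. norm (g x * f x) \<le> norm (g x * M)"
    by (intro AE_I2) (auto simp: abs_mult intro!: mult_left_mono)
qed

definition conv :: "('a::euclidean_space \<Rightarrow> real) \<Rightarrow> ('a \<Rightarrow> real) \<Rightarrow> 'a \<Rightarrow> real" where
  "conv g \<kappa> x = (LINT y|lborel. g y * \<kappa> (x - y))"

lemma cont_diff_measurable:
  fixes \<kappa> :: "'a::euclidean_space \<Rightarrow> real"
  assumes "continuous_on UNIV \<kappa>"
  shows "(\<lambda>y. \<kappa> (x - y)) \<in> borel_measurable borel"
  by (rule borel_measurable_continuous_onI, rule continuous_on_compose2[OF assms])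
     (auto intro!: continuous_intros)

lemma conv_integrable:
  assumes "integrable lborel g" "C1c \<kappa>"
  shows "integrable lborel (\<lambda>y. g y * \<kappa> (x - y))"
proof -
  obtain M where M: "\<And>z. \<bar>\<kappa> z\<bar> \<le> M" using C1c_bounded[OF assms(2)] by blast
  show ?thesis
    by (rule integrable_mult_bounded[OF assms(1) cont_diff_measurable[OF C1c_continuous[OF assms(2)]] M])
qed

text \<open>
  The difference quotients of \<open>\<kappa>\<close> are bounded by its Lipschitz constant, so dominated convergence allows differentiation
  under the integral for merely integrable \<open>g\<close>.
\<close>

lemma conv_has_derivative:
  fixes g \<kappa> :: "'a::euclidean_space \<Rightarrow> real"
  assumes g: "integrable lborel g" and k: "C1c \<kappa>"
  shows "(conv g \<kappa> has_derivative (\<lambda>h. \<Sum>i\<in>Basis. (h \<bullet> i) * conv g (pd i \<kappa>) x)) (at x)"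
proof -
  obtain L where L: "L \<ge> 0" "\<And>z h. \<bar>\<Sum>i\<in>Basis. (h \<bullet> i) * pd i \<kappa> z\<bar> \<le> L * norm h"
    "\<And>y z. \<bar>\<kappa> y - \<kappa> z\<bar> \<le> L * norm (y - z)"
    using C1c_derivative_bound[OF k] by metis
  define D where "D z h = (\<Sum>i\<in>Basis. (h \<bullet> i) * pd i \<kappa> z)" for z h
  have kc: "continuous_on UNIV \<kappa>" using C1c_continuous k .
  have ipd: "integrable lborel (\<lambda>y. g y * pd i \<kappa> (x - y))" if i: "i \<in> Basis" for i
  proof -
    obtain M where "\<And>z. \<bar>pd i \<kappa> z\<bar> \<le> M"
      using C1c_pd_bounded[OF k i] by blast
    then show ?thesis by (rule integrable_mult_bounded[OF g cont_diff_measurable[OF C1c_pd_continuous[OF k i]]])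
  qed
  have Dint: "integrable lborel (\<lambda>y. g y * D (x - y) h)"
    "(LINT y|lborel. g y * D (x - y) h) = (\<Sum>i\<in>Basis. (h \<bullet> i) * conv g (pd i \<kappa>) x)" for h
  proof -
    have eq: "(\<lambda>y. g y * D (x - y) h) = (\<lambda>y. \<Sum>i\<in>Basis. (h \<bullet> i) * (g y * pd i \<kappa> (x - y)))"
      by (simp add: D_def sum_distrib_left mult_ac)
    show "integrable lborel (\<lambda>y. g y * D (x - y) h)" unfolding eq
      by (intro Bochner_Integration.integrable_sum integrable_mult_right ipd)
    show "(LINT y|lborel. g y * D (x - y) h) = (\<Sum>i\<in>Basis. (h \<bullet> i) * conv g (pd i \<kappa>) x)"
      unfolding eq conv_def
      by (subst Bochner_Integration.integral_sum) (auto intro!: integrable_mult_right ipd)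
  qed
  show ?thesis unfolding has_derivative_at
  proof (intro conjI)
    show "bounded_linear (\<lambda>h. \<Sum>i\<in>Basis. (h \<bullet> i) * conv g (pd i \<kappa>) x)"
      by (intro bounded_linear_sum bounded_linear_mult_left bounded_linear_compose[OF bounded_linear_mult_left bounded_linear_inner_left])
    show "(\<lambda>h. norm (conv g \<kappa> (x + h) - conv g \<kappa> x - (\<Sum>i\<in>Basis. (h \<bullet> i) * conv g (pd i \<kappa>) x)) / norm h) \<midarrow>0\<rightarrow> 0"
      unfolding tendsto_at_iff_sequentially comp_def
    proof (intro allI impI)
      fix X :: "nat \<Rightarrow> 'a" assume X: "\<forall>n. X n \<in> UNIV - {0}" "X \<longlonglongrightarrow> 0"
      define P where "P n y = (\<kappa> (x + X n - y) - \<kappa> (x - y) - D (x - y) (X n)) / norm (X n)" for n y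
      have Pb: "\<bar>P n y\<bar> \<le> 2 * L" for n y
      proof -
        have "\<bar>\<kappa> (x + X n - y) - \<kappa> (x - y)\<bar> \<le> L * norm (X n)"
          using L(3)[of "x + X n - y" "x - y"] by simp
        with L(2)[where z="x-y" and h="X n"] have "\<bar>\<kappa> (x + X n - y) - \<kappa> (x - y) - D (x - y) (X n)\<bar> \<le> 2 * L * norm (X n)"
          unfolding D_def by linarith
        then show ?thesis using X(1) by (simp add: P_def divide_simps)
      qed
      have eq: "(conv g \<kappa> (x + X n) - conv g \<kappa> x - (\<Sum>i\<in>Basis. (X n \<bullet> i) * conv g (pd i \<kappa>) x)) / norm (X n)
         = (LINT y|lborel. g y * P n y)" for n
      proof -
        have "(LINT y|lborel. g y * P n y)
          = (LINT y|lborel. (g y * \<kappa> (x + X n - y) - g y * \<kappa> (x - y) - g y * D (x - y) (X n)) / norm (X n))"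
          by (simp add: P_def algebra_simps diff_divide_distrib)
        also have "\<dots> = (LINT y|lborel. (g y * \<kappa> (x + X n - y) - g y * \<kappa> (x - y) - g y * D (x - y) (X n))) / norm (X n)"
          by simp
        also have "(LINT y|lborel. (g y * \<kappa> (x + X n - y) - g y * \<kappa> (x - y) - g y * D (x - y) (X n)))
           = conv g \<kappa> (x + X n) - conv g \<kappa> x - (\<Sum>i\<in>Basis. (X n \<bullet> i) * conv g (pd i \<kappa>) x)"
          by (simp add: Dint conv_def conv_integrable[OF g k])
        finally show ?thesis by simp
      qed
      have lim0: "(\<lambda>n. P n y) \<longlonglongrightarrow> 0" for y
      proof -
        have "(\<kappa> has_derivative D (x - y)) (at (x - y))"
          using has_derivative_pd[OF C1c_differentiable[OF k]] unfolding D_def .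
        then have "(\<lambda>h. norm (\<kappa> (x - y + h) - \<kappa> (x - y) - D (x - y) h) / norm h) \<midarrow>0\<rightarrow> 0"
          unfolding has_derivative_at by blast
        then have "(\<lambda>n. norm (\<kappa> (x - y + X n) - \<kappa> (x - y) - D (x - y) (X n)) / norm (X n)) \<longlonglongrightarrow> 0"
          unfolding tendsto_at_iff_sequentially comp_def using X by blast
        then have "(\<lambda>n. norm (P n y)) \<longlonglongrightarrow> 0"
          by (simp add: P_def abs_divide algebra_simps)
        then show ?thesis by (rule tendsto_norm_zero_cancel)
      qed
      have "(\<lambda>n. LINT y|lborel. g y * P n y) \<longlonglongrightarrow> (LINT (y::'a)|lborel. 0::real)"
      proof (rule integral_dominated_convergence[where s="\<lambda>n y. g y * P n y" and f="\<lambda>y. 0" and w="\<lambda>y. \<bar>g y\<bar> * (2 * L)"])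
        show "integrable lborel (\<lambda>y. \<bar>g y\<bar> * (2 * L))" using g by simp
        show "AE y in lborel. (\<lambda>n. g y * P n y) \<longlonglongrightarrow> 0"
          using lim0 by (auto intro!: tendsto_mult_right_zero AE_I2)
        show "AE y in lborel. norm (g y * P n y) \<le> \<bar>g y\<bar> * (2 * L)" for n
          using Pb by (auto simp: abs_mult intro!: AE_I2 mult_left_mono)
        have [measurable]: "(\<lambda>y. D (x - y) (X n)) \<in> borel_measurable borel" for n unfolding D_def
          by (intro borel_measurable_sum borel_measurable_times borel_measurable_const cont_diff_measurable C1c_pd_continuous k)
        have [measurable]: "(\<lambda>y. \<kappa> (a - y)) \<in> borel_measurable borel" for a
          by (rule cont_diff_measurable[OF kc])
        have [measurable]: "g \<in> borel_measurable borel" using borel_measurable_integrable[OF g] by simp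
        show "(\<lambda>y. g y * P n y) \<in> borel_measurable lborel" for n
          unfolding P_def by measurable
      qed simp
      then have "(\<lambda>n. norm (LINT y|lborel. g y * P n y)) \<longlonglongrightarrow> 0"
        using tendsto_norm_zero by fastforce
      then show "(\<lambda>n. norm (conv g \<kappa> (x + X n) - conv g \<kappa> x - (\<Sum>i\<in>Basis. (X n \<bullet> i) * conv g (pd i \<kappa>) x)) / norm (X n)) \<longlonglongrightarrow> 0"
        unfolding eq[symmetric] by (simp add: abs_divide)
    qed
  qed
qed

lemma conv_differentiable: "integrable lborel g \<Longrightarrow> C1c \<kappa> \<Longrightarrow> conv g \<kappa> differentiable (at x)"
  using conv_has_derivative unfolding differentiable_def by blast

lemma pd_conv:
  assumes "integrable lborel g" "C1c \<kappa>" "i \<in> Basis"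
  shows "pd i (conv g \<kappa>) x = conv g (pd i \<kappa>) x"
  using pd_eqI[OF conv_has_derivative[OF assms(1,2)], of i] assms(3)
  by (simp add: inner_Basis if_distrib[of "\<lambda>c. c * _"] cong: if_cong)

lemma Ck_on_conv:
  assumes "integrable lborel g" "Cinfc \<kappa>"
  shows "Ck_on k UNIV (conv g \<kappa>)"
  using assms(2)
proof (induction k arbitrary: \<kappa>)
  case 0
  show ?case using conv_differentiable[OF assms(1) Cinfc_C1c[OF 0]]
    by (auto intro!: continuous_at_imp_continuous_on differentiable_imp_continuous_within)
next
  case (Suc k)
  have "pd i (conv g \<kappa>) = conv g (pd i \<kappa>)" if "i \<in> Basis" for i
    using pd_conv[OF assms(1) Cinfc_C1c[OF Suc.prems] that] by blast
  then show ?case using Suc conv_differentiable[OF assms(1) Cinfc_C1c[OF Suc.prems]]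
    by (auto simp: Ck_on_Suc_open Cinfc_pd)
qed

section \<open>Dyadic dilations\<close>

text \<open>
  The factor keeps the integral fixed.
\<close>

definition dil :: "nat \<Rightarrow> ('a::euclidean_space \<Rightarrow> real) \<Rightarrow> 'a \<Rightarrow> real" where
  "dil n \<kappa> z = 2 ^ (n * DIM('a)) * \<kappa> (2 ^ n *\<^sub>R z)"

lemma dil_zero:
  fixes z :: "'a::euclidean_space"
  assumes "kernel \<kappa>" "1 / 2 ^ n < norm z" shows "dil n \<kappa> z = 0"
  using assms unfolding dil_def kernel_def by (auto simp: field_simps)

lemma Ck_on_dil: "Ck_on k UNIV \<kappa> \<Longrightarrow> Ck_on k UNIV (dil n \<kappa>)"
  using Ck_on_cmult[OF open_UNIV Ck_on_affine[of k \<kappa> 0 "2^n"]] by (simp add: dil_def[abs_def])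

lemma Cinfc_dil: "kernel \<kappa> \<Longrightarrow> Cinfc (dil n \<kappa>)"
  unfolding Cinfc_def using dil_zero[of \<kappa> n] Ck_on_dil kernel_def by blast

lemma pd_dil: 
  assumes "kernel \<kappa>"
  shows "pd i (dil n \<kappa>) z = 2 ^ n * dil n (pd i \<kappa>) z"
proof -
  have d: "\<kappa> differentiable (at y)" for y using C1c_differentiable Cinfc_C1c kernel_Cinfc assms by blast
  have d2: "(\<lambda>z. \<kappa> (2 ^ n *\<^sub>R z)) differentiable (at z)"
    using pd_affine(1)[OF d, of 0 "2^n"] unfolding differentiable_def by auto
  show ?thesis unfolding dil_def[abs_def]
    using pd_cmult[OF d2] pd_affine(2)[OF d, of i 0 "2^n"] by simp
qed

lemma pd_conv_dil:
  assumes "integrable lborel g" "kernel \<kappa>" "i \<in> Basis"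
  shows "pd i (conv g (dil n \<kappa>)) x = 2 ^ n * conv g (dil n (pd i \<kappa>)) x"
proof -
  have "pd i (conv g (dil n \<kappa>)) x = conv g (pd i (dil n \<kappa>)) x"
    by (rule pd_conv[OF assms(1) Cinfc_C1c[OF Cinfc_dil[OF assms(2)]] assms(3)])
  also have "pd i (dil n \<kappa>) = (\<lambda>z. 2 ^ n * dil n (pd i \<kappa>) z)"
    by (rule ext) (rule pd_dil[OF assms(2)])
  also have "conv g (\<lambda>z. 2 ^ n * dil n (pd i \<kappa>) z) x = (LINT y|lborel. 2 ^ n * (g y * dil n (pd i \<kappa>) (x - y)))"
    unfolding conv_def by (simp add: mult_ac)
  finally show ?thesis unfolding conv_def[of g "dil n (pd i \<kappa>)"] by simp
qed

text \<open>
  Covers both translations and reflections, for \<open>c = 1\<close> and \<open>c = -1\<close>.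
\<close>

lemma integral_affine:
  fixes f :: "'a::euclidean_space \<Rightarrow> real"
  assumes "f \<in> borel_measurable borel" "c \<noteq> 0"
  shows "(LINT y|lborel. f y) = \<bar>c\<bar> ^ DIM('a) * (LINT y|lborel. f (t + c *\<^sub>R y))"
proof -
  have "(LINT y|lborel. f y) = (LINT y|density (distr lborel borel (\<lambda>x. t + c *\<^sub>R x)) (\<lambda>_. \<bar>c\<bar>^DIM('a)). f y)"
    using lborel_affine[OF assms(2), of t] by simp
  also have "\<dots> = \<bar>c\<bar> ^ DIM('a) * (LINT y|lborel. f (t + c *\<^sub>R y))"
    using assms by (simp add: integral_density integral_distr)
  finally show ?thesis .
qed

lemma integral_dil:
  fixes \<kappa> :: "'a::euclidean_space \<Rightarrow> real"
  assumes "continuous_on UNIV \<kappa>"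
  shows "(LINT y|lborel. dil n \<kappa> (x - y)) = integral\<^sup>L lborel \<kappa>"
    and "(LINT y|lborel. dil n \<kappa> (y - x)) = integral\<^sup>L lborel \<kappa>"
proof -
  have m: "\<kappa> \<in> borel_measurable borel" using assms by (rule borel_measurable_continuous_onI)
  have "integral\<^sup>L lborel \<kappa> = \<bar>- (2^n)\<bar> ^ DIM('a) * (LINT y|lborel. \<kappa> (2^n *\<^sub>R x + (- (2^n)) *\<^sub>R y))"
    by (rule integral_affine[OF m]) simp
  then show "(LINT y|lborel. dil n \<kappa> (x - y)) = integral\<^sup>L lborel \<kappa>"
    by (simp add: dil_def power_mult scaleR_diff_right)
  have "integral\<^sup>L lborel \<kappa> = \<bar>2^n\<bar> ^ DIM('a) * (LINT y|lborel. \<kappa> (- (2^n *\<^sub>R x) + 2^n *\<^sub>R y))"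
    by (rule integral_affine[OF m]) simp
  then show "(LINT y|lborel. dil n \<kappa> (y - x)) = integral\<^sup>L lborel \<kappa>"
    by (simp add: dil_def power_mult scaleR_diff_right)
qed

section \<open>Reflected dilations as test functions\<close>

lemma pd_reflect:
  fixes \<kappa> :: "'a::euclidean_space \<Rightarrow> real"
  assumes "\<And>z. \<kappa> differentiable (at z)"
  shows "pd i (\<lambda>y. \<kappa> (x - y)) y = - pd i \<kappa> (x - y)"
  using pd_affine(2)[OF assms, of i x "-1" y] by simp

lemma Cinfc_differentiable: "Cinfc \<kappa> \<Longrightarrow> \<kappa> differentiable (at z)"
  by (rule C1c_differentiable[OF Cinfc_C1c])

lemma lap_reflect:
  assumes "Cinfc \<kappa>"
  shows "lap (\<lambda>y. \<kappa> (x - y)) y = lap \<kappa> (x - y)"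
  unfolding lap_def
proof (rule sum.cong[OF refl])
  fix i :: 'a assume i: "i \<in> Basis"
  have 1: "pd i (\<lambda>y. \<kappa> (x - y)) = (\<lambda>y. (-1) * pd i \<kappa> (x - y))"
    using pd_reflect[OF Cinfc_differentiable[OF assms]] by auto
  have d: "pd i \<kappa> differentiable (at z)" for z using Cinfc_differentiable Cinfc_pd assms i by blast
  have d2: "(\<lambda>y. pd i \<kappa> (x - y)) differentiable (at y)"
    using pd_affine(1)[OF d, of x "-1"] unfolding differentiable_def by auto
  show "pd i (pd i (\<lambda>y. \<kappa> (x - y))) y = pd i (pd i \<kappa>) (x - y)"
    unfolding 1 pd_cmult[OF d2] pd_reflect[OF d] by simp
qed

lemma test_function_reflect:
  fixes \<kappa> :: "'a::euclidean_space \<Rightarrow> real"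
  assumes "\<And>k. Ck_on k UNIV \<kappa>" "\<And>z. R < norm z \<Longrightarrow> \<kappa> z = 0" "cball x R \<subseteq> U"
  shows "test_function U (\<lambda>y. \<kappa> (x - y))"
proof -
  have "Ck_on k UNIV (\<lambda>y. \<kappa> (x - y))" for k
    using Ck_on_affine[OF assms(1), of k x "-1"] by simp
  moreover have "{y. \<kappa> (x - y) \<noteq> 0} \<subseteq> cball x R"
    using assms(2) by (auto simp: dist_norm) (meson not_le)
  then have "closure {y. \<kappa> (x - y) \<noteq> 0} \<subseteq> cball x R" by (rule closure_minimal) auto
  ultimately show ?thesis unfolding test_function_def using assms(3)
    by (meson bounded_cball bounded_subset closed_closure compact_eq_bounded_closed subset_trans)
qed

lemma test_function_dil:
  fixes \<kappa> :: "'a::euclidean_space \<Rightarrow> real"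
  assumes "kernel \<kappa>" "cball x (1 / 2 ^ n) \<subseteq> U"
  shows "test_function U (\<lambda>y. dil n \<kappa> (x - y))"
  using assms Cinfc_dil[OF assms(1)] dil_zero[OF assms(1)]
  by (intro test_function_reflect[where R="1 / 2^n"]) (auto simp: Cinfc_def)

lemma lap_dil:
  assumes "kernel \<kappa>"
  shows "lap (dil n \<kappa>) z = 4 ^ n * dil n (lap \<kappa>) z"
proof -
  have "pd i (pd i (dil n \<kappa>)) z = 4 ^ n * dil n (pd i (pd i \<kappa>)) z" if i: "i \<in> Basis" for i
  proof -
    have 1: "pd i (dil n \<kappa>) = (\<lambda>z. 2 ^ n * dil n (pd i \<kappa>) z)"
      by (rule ext) (rule pd_dil[OF assms])
    have k: "kernel (pd i \<kappa>)" using kernel_pd assms i .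
    show ?thesis unfolding 1 pd_cmult[OF Cinfc_differentiable[OF Cinfc_dil[OF k]]] pd_dil[OF k]
      by (simp add: power_mult_distrib[symmetric] mult.assoc[symmetric])
  qed
  then show ?thesis by (simp add: lap_def dil_def sum_distrib_left mult_ac)
qed

text \<open>
  The mollifier identity at scale \<open>2^(-n)\<close>: summing over \<open>n\<close> telescopes.
\<close>

lemma dil_telescope:
  fixes \<Psi> \<eta> :: "'a::euclidean_space \<Rightarrow> real"
  assumes "\<And>z. lap \<Psi> z = \<eta> z - 2 ^ DIM('a) * \<eta> (2 *\<^sub>R z)"
  shows "dil n (lap \<Psi>) z = dil n \<eta> z - dil (Suc n) \<eta> z"
  unfolding dil_def assms by (simp add: algebra_simps power_add)

lemma test_function_Cinfc:
  fixes \<phi> :: "'a::euclidean_space \<Rightarrow> real"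
  assumes "test_function U \<phi>" shows "Cinfc \<phi>"
proof -
  have "bounded (closure {x. \<phi> x \<noteq> 0})" using assms compact_imp_bounded unfolding test_function_def by blast
  then obtain R where R: "\<forall>x\<in>closure {x. \<phi> x \<noteq> 0}. norm x \<le> R" unfolding bounded_iff by blast
  have "\<phi> z = 0" if "R < norm z" for z
    using R closure_subset[of "{x. \<phi> x \<noteq> 0}"] that by force
  then show ?thesis using assms unfolding Cinfc_def test_function_def by blast
qed

lemma test_function_support:
  assumes "test_function U \<phi>"
  obtains K where "compact K" "K \<subseteq> U" "\<And>x. x \<notin> K \<Longrightarrow> \<phi> x = 0"
proof (rule that[of "closure {x. \<phi> x \<noteq> 0}"])
  show "compact (closure {x. \<phi> x \<noteq> 0})" "closure {x. \<phi> x \<noteq> 0} \<subseteq> U"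
    using assms unfolding test_function_def by auto
  show "\<And>x. x \<notin> closure {x. \<phi> x \<noteq> 0} \<Longrightarrow> \<phi> x = 0"
    using closure_subset[of "{x. \<phi> x \<noteq> 0}"] by blast
qed

lemma test_function_zero_outside: "test_function U \<phi> \<Longrightarrow> x \<notin> U \<Longrightarrow> \<phi> x = 0"
  using test_function_support by (metis in_mono)

lemma pd_zero_off_closed:
  fixes \<phi> :: "'a::euclidean_space \<Rightarrow> real"
  assumes "closed K" "\<And>x. x \<notin> K \<Longrightarrow> \<phi> x = 0" "x \<notin> K"
  shows "pd i \<phi> x = 0"
proof -
  have "pd i \<phi> x = pd i (\<lambda>z. 0) x"
    using assms by (intro pd_cong_open[of "-K"]) auto
  also have "\<dots> = 0" by (rule pd_eqI[OF has_derivative_const])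
  finally show ?thesis .
qed

lemma test_function_pd:
  fixes \<phi> :: "'a::euclidean_space \<Rightarrow> real"
  assumes "test_function U \<phi>" "i \<in> Basis"
  shows "test_function U (pd i \<phi>)"
proof -
  obtain K where K: "compact K" "K \<subseteq> U" "\<And>x. x \<notin> K \<Longrightarrow> \<phi> x = 0"
    using test_function_support[OF assms(1)] by blast
  have cl: "closed K" using K(1) compact_imp_closed by blast
  have "{x. pd i \<phi> x \<noteq> 0} \<subseteq> K" using pd_zero_off_closed[OF cl, of \<phi>] K(3) by blast
  then have "closure {x. pd i \<phi> x \<noteq> 0} \<subseteq> K" using cl by (rule closure_minimal)
  then show ?thesis using assms Ck_on_pd K(1,2) unfolding test_function_def
    by (meson bounded_subset closed_closure compact_eq_bounded_closed subset_trans)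
qed

section \<open>Mollification and the fundamental lemma of the calculus of variations\<close>

lemma dil_nonneg: "(\<And>z. 0 \<le> \<eta> z) \<Longrightarrow> 0 \<le> dil n \<eta> z"
  by (simp add: dil_def)

lemma C1c_integrable:
  fixes \<kappa> :: "'a::euclidean_space \<Rightarrow> real"
  assumes "C1c \<kappa>"
  shows "integrable lborel \<kappa>"
proof -
  obtain R where R: "\<And>z. R < norm z \<Longrightarrow> \<kappa> z = 0" using assms unfolding C1c_def by blast
  show ?thesis
    by (rule integrable_compact_support[OF C1c_continuous[OF assms] compact_cball[of 0 R]]) (simp add: R)
qed

lemma dil_integrable:
  fixes \<kappa> :: "'a::euclidean_space \<Rightarrow> real"
  assumes "kernel \<kappa>"
  shows "integrable lborel (\<lambda>y. dil n \<kappa> (x - y))" "integrable lborel (\<lambda>y. dil n \<kappa> (y - x))"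
proof -
  have c: "continuous_on UNIV (dil n \<kappa>)" using C1c_continuous Cinfc_C1c Cinfc_dil assms by blast
  have "continuous_on UNIV (\<lambda>y. dil n \<kappa> (x - y))" "continuous_on UNIV (\<lambda>y. dil n \<kappa> (y - x))"
    by (rule continuous_on_compose2[OF c], auto intro!: continuous_intros)+
  then show "integrable lborel (\<lambda>y. dil n \<kappa> (x - y))" "integrable lborel (\<lambda>y. dil n \<kappa> (y - x))"
    by (auto intro!: integrable_compact_support[OF _ compact_cball[of x "1/2^n"]] dil_zero[OF assms]
        simp: dist_norm norm_minus_commute)
qed

lemma mollify_pointwise:
  fixes \<phi> :: "'a::euclidean_space \<Rightarrow> real"
  assumes \<eta>: "kernel \<eta>" "\<And>z. 0 \<le> \<eta> z" "integral\<^sup>L lborel \<eta> = 1"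
    and \<phi>: "continuous_on UNIV \<phi>" "\<And>x. \<bar>\<phi> x\<bar> \<le> M"
  shows "\<bar>LINT x|lborel. dil n \<eta> (x - y) * \<phi> x\<bar> \<le> M"
    and "(\<lambda>n. LINT x|lborel. dil n \<eta> (x - y) * \<phi> x) \<longlonglongrightarrow> \<phi> y"
proof -
  have m: "\<phi> \<in> borel_measurable borel" using \<phi>(1) by (rule borel_measurable_continuous_onI)
  note I = dil_integrable(2)[OF \<eta>(1)]
  have one: "(LINT x|lborel. dil n \<eta> (x - y)) = 1" for n
    using integral_dil(2)[OF kernel_continuous[OF \<eta>(1)]] \<eta>(3) by metis
  have dn: "0 \<le> dil n \<eta> z" for n z using dil_nonneg \<eta>(2) by blast
  have I2: "integrable lborel (\<lambda>x. dil n \<eta> (x - y) * \<phi> x)" for n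
    by (rule integrable_mult_bounded[OF I m \<phi>(2)])
  show "\<bar>LINT x|lborel. dil n \<eta> (x - y) * \<phi> x\<bar> \<le> M"
  proof -
    have "\<bar>LINT x|lborel. dil n \<eta> (x - y) * \<phi> x\<bar> \<le> (LINT x|lborel. \<bar>dil n \<eta> (x - y) * \<phi> x\<bar>)"
      by (rule integral_abs_bound)
    also have "\<dots> \<le> (LINT x|lborel. dil n \<eta> (x - y) * M)"
      using dn \<phi>(2) by (intro integral_mono integrable_abs I2 integrable_mult_left I)
        (auto simp: abs_mult intro!: mult_left_mono)
    also have "\<dots> = M" using one by simp
    finally show ?thesis .
  qed
  show "(\<lambda>n. LINT x|lborel. dil n \<eta> (x - y) * \<phi> x) \<longlonglongrightarrow> \<phi> y"
  proof (rule LIMSEQ_I)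
    fix r :: real assume r: "0 < r"
    have "isCont \<phi> y" using \<phi>(1) by (simp add: continuous_on_eq_continuous_at)
    then obtain d where d: "d > 0" "\<And>x. dist x y < d \<Longrightarrow> dist (\<phi> x) (\<phi> y) < r / 2"
      using r unfolding continuous_at_eps_delta by (metis half_gt_zero)
    obtain N where N: "1 / 2 ^ N < d" using real_arch_pow_inv[of d "1/2"] d(1) by (auto simp: power_one_over)
    show "\<exists>N. \<forall>n\<ge>N. norm ((LINT x|lborel. dil n \<eta> (x - y) * \<phi> x) - \<phi> y) < r"
    proof (intro exI[of _ N] allI impI)
      fix n assume n: "n \<ge> N"
      have nd: "1 / 2 ^ n < d" using N n by (smt (verit) frac_le power_increasing zero_less_power)
      have "(LINT x|lborel. dil n \<eta> (x - y) * \<phi> x) - \<phi> y = (LINT x|lborel. dil n \<eta> (x - y) * \<phi> x - dil n \<eta> (x - y) * \<phi> y)"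
        using I2 I one by simp
      also have "\<bar>\<dots>\<bar> \<le> (LINT x|lborel. \<bar>dil n \<eta> (x - y) * \<phi> x - dil n \<eta> (x - y) * \<phi> y\<bar>)"
        by (rule integral_abs_bound)
      also have "\<dots> \<le> (LINT x|lborel. dil n \<eta> (x - y) * (r / 2))"
      proof (intro integral_mono)
        fix x
        show "\<bar>dil n \<eta> (x - y) * \<phi> x - dil n \<eta> (x - y) * \<phi> y\<bar> \<le> dil n \<eta> (x - y) * (r / 2)"
        proof (cases "1 / 2 ^ n < norm (x - y)")
          case True then show ?thesis using dil_zero[OF \<eta>(1)] by simp
        next
          case False
          then have "\<bar>\<phi> x - \<phi> y\<bar> \<le> r / 2" using d(2)[of x] nd by (simp add: dist_norm)
          then have "dil n \<eta> (x - y) * \<bar>\<phi> x - \<phi> y\<bar> \<le> dil n \<eta> (x - y) * (r / 2)"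
            using dn by (intro mult_left_mono) auto
          then show ?thesis using dn by (simp add: right_diff_distrib[symmetric] abs_mult)
        qed
      qed (use I I2 in auto)
      also have "\<dots> = r / 2" using one by simp
      finally show "norm ((LINT x|lborel. dil n \<eta> (x - y) * \<phi> x) - \<phi> y) < r" using r by simp
    qed
  qed
qed

lemma conv_fubini:
  fixes g \<phi> :: "'a::euclidean_space \<Rightarrow> real"
  assumes g: "integrable lborel g" and k: "kernel \<kappa>"
    and \<phi>: "continuous_on UNIV \<phi>" "\<And>x. \<bar>\<phi> x\<bar> \<le> M"
  shows "(LINT x|lborel. conv g (dil n \<kappa>) x * \<phi> x) = (LINT y|lborel. g y * (LINT x|lborel. dil n \<kappa> (x - y) * \<phi> x))"
proof -
  have c: "continuous_on UNIV (dil n \<kappa>)" using C1c_continuous Cinfc_C1c Cinfc_dil k by blast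
  have [measurable]: "g \<in> borel_measurable borel" using borel_measurable_integrable[OF g] by simp
  have [measurable]: "\<phi> \<in> borel_measurable borel" using \<phi>(1) by (rule borel_measurable_continuous_onI)
  have [measurable]: "dil n \<kappa> \<in> borel_measurable borel" using c by (rule borel_measurable_continuous_onI)
  have I: "integrable lborel (\<lambda>x. dil n \<kappa> (x - y) * \<phi> x)" for y
    by (rule integrable_mult_bounded[OF dil_integrable(2)[OF k] _ \<phi>(2)]) measurable
  have Ia: "integrable lborel (\<lambda>x. \<bar>dil n \<kappa> (x - y)\<bar>)" for y
    using dil_integrable(2)[OF k] by (rule integrable_abs)
  have abs_int: "(LINT x|lborel. \<bar>dil n \<kappa> (x - y)\<bar>) = (LINT x|lborel. \<bar>\<kappa> x\<bar>)" for y
    using integral_dil(2)[of "\<lambda>z. \<bar>\<kappa> z\<bar>" n y] kernel_continuous[OF k]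
    by (simp add: dil_def abs_mult continuous_on_rabs)
  have int: "integrable (lborel \<Otimes>\<^sub>M lborel) (\<lambda>(y, x). g y * (dil n \<kappa> (x - y) * \<phi> x))"
  proof (rule lborel_pair.Fubini_integrable)
    show "(\<lambda>(y, x). g y * (dil n \<kappa> (x - y) * \<phi> x)) \<in> borel_measurable (lborel \<Otimes>\<^sub>M lborel)"
      by measurable
    show "AE y in lborel. integrable lborel (\<lambda>x. case (y, x) of (y, x) \<Rightarrow> g y * (dil n \<kappa> (x - y) * \<phi> x))"
      using I by simp
    show "integrable lborel (\<lambda>y. LINT x|lborel. norm (case (y, x) of (y, x) \<Rightarrow> g y * (dil n \<kappa> (x - y) * \<phi> x)))"
    proof (rule Bochner_Integration.integrable_bound)
      show "integrable lborel (\<lambda>y. \<bar>g y\<bar> * ((LINT x|lborel. \<bar>\<kappa> x\<bar>) * M))" using g by simp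
      show "(\<lambda>y. LINT x|lborel. norm (case (y, x) of (y, x) \<Rightarrow> g y * (dil n \<kappa> (x - y) * \<phi> x))) \<in> borel_measurable lborel"
        by measurable
      have "(LINT x|lborel. \<bar>g y * (dil n \<kappa> (x - y) * \<phi> x)\<bar>) \<le> \<bar>g y\<bar> * ((LINT x|lborel. \<bar>\<kappa> x\<bar>) * M)" for y
      proof -
        have "(LINT x|lborel. \<bar>g y * (dil n \<kappa> (x - y) * \<phi> x)\<bar>) \<le> (LINT x|lborel. \<bar>g y\<bar> * (\<bar>dil n \<kappa> (x - y)\<bar> * M))"
          using \<phi>(2) by (intro integral_mono integrable_abs integrable_mult_right integrable_mult_left I Ia)
            (auto simp: abs_mult intro!: mult_left_mono)
        also have "\<dots> = \<bar>g y\<bar> * ((LINT x|lborel. \<bar>\<kappa> x\<bar>) * M)" using abs_int by simp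
        finally show ?thesis .
      qed
      moreover have "0 \<le> M" using \<phi>(2)[of 0] by linarith
      ultimately show "AE y in lborel. norm (LINT x|lborel. norm (case (y, x) of (y, x) \<Rightarrow> g y * (dil n \<kappa> (x - y) * \<phi> x)))
           \<le> norm (\<bar>g y\<bar> * ((LINT x|lborel. \<bar>\<kappa> x\<bar>) * M))"
        by (intro AE_I2) (auto simp: abs_mult)
    qed
  qed
  have "(LINT x|lborel. conv g (dil n \<kappa>) x * \<phi> x) = (LINT x|lborel. LINT y|lborel. g y * (dil n \<kappa> (x - y) * \<phi> x))"
    by (simp add: conv_def mult.assoc[symmetric])
  also have "\<dots> = (LINT y|lborel. LINT x|lborel. g y * (dil n \<kappa> (x - y) * \<phi> x))"
    by (rule lborel_pair.Fubini_integral[OF int])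
  also have "\<dots> = (LINT y|lborel. g y * (LINT x|lborel. dil n \<kappa> (x - y) * \<phi> x))"
    by simp
  finally show ?thesis .
qed

text \<open>
  The mollification is moved to the test function by Fubini, where it converges pointwise and boundedly.
\<close>

lemma mollify_limit:
  fixes g \<phi> :: "'a::euclidean_space \<Rightarrow> real"
  assumes \<eta>: "kernel \<eta>" "\<And>z. 0 \<le> \<eta> z" "integral\<^sup>L lborel \<eta> = 1"
    and g: "integrable lborel g" and \<phi>: "C1c \<phi>"
  shows "(\<lambda>n. LINT x|lborel. conv g (dil n \<eta>) x * \<phi> x) \<longlonglongrightarrow> (LINT x|lborel. g x * \<phi> x)"
proof -
  obtain M where M: "\<And>z. \<bar>\<phi> z\<bar> \<le> M" using C1c_bounded[OF \<phi>] by blast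
  note c = C1c_continuous[OF \<phi>]
  note P = mollify_pointwise[OF \<eta> c M]
  have [measurable]: "g \<in> borel_measurable borel" using borel_measurable_integrable[OF g] by simp
  have [measurable]: "\<phi> \<in> borel_measurable borel" using c by (rule borel_measurable_continuous_onI)
  have c2: "continuous_on UNIV (dil n \<eta>)" for n using C1c_continuous Cinfc_C1c Cinfc_dil \<eta>(1) by blast
  have [measurable]: "dil n \<eta> \<in> borel_measurable borel" for n using c2 by (rule borel_measurable_continuous_onI)
  show ?thesis unfolding conv_fubini[OF g \<eta>(1) c M]
  proof (rule integral_dominated_convergence[where w="\<lambda>y. \<bar>g y\<bar> * M"])
    show "integrable lborel (\<lambda>y. \<bar>g y\<bar> * M)" using g by simp
    show "AE y in lborel. (\<lambda>n. g y * (LINT x|lborel. dil n \<eta> (x - y) * \<phi> x)) \<longlonglongrightarrow> g y * \<phi> y"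
      using P(2) by (intro AE_I2 tendsto_mult_left)
    show "AE y in lborel. norm (g y * (LINT x|lborel. dil n \<eta> (x - y) * \<phi> x)) \<le> \<bar>g y\<bar> * M" for n
      using P(1) by (intro AE_I2) (auto simp: abs_mult intro!: mult_left_mono)
  qed measurable
qed

lemma borel_measurable_lebesgue_of_continuous:
  fixes f :: "'a::euclidean_space \<Rightarrow> real"
  shows "continuous_on UNIV f \<Longrightarrow> f \<in> borel_measurable lebesgue"
  by (intro measurable_completion) (simp add: borel_measurable_continuous_onI)

lemma compact_neighbourhood:
  fixes K :: "'a::euclidean_space set"
  assumes "compact K" "K \<noteq> {}" "open U" "K \<subseteq> U"
  obtains e where "e > 0" "compact {x. infdist x K \<le> e}" "{x. infdist x K \<le> e} \<subseteq> U"
proof -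
  have "\<exists>d>0. \<forall>x\<in>K. \<forall>y\<in>-U. d \<le> dist x y"
    by (rule separate_compact_closed) (use assms in auto)
  then obtain d where d: "d > 0" "\<And>x y. x \<in> K \<Longrightarrow> y \<in> - U \<Longrightarrow> d \<le> dist x y"
    by blast
  have "x \<in> U" if "infdist x K \<le> d / 2" for x
  proof (rule ccontr)
    assume "x \<notin> U"
    then have "d \<le> infdist x K"
      unfolding infdist_notempty[OF assms(2)] using d(2) assms(2)
      by (intro cINF_greatest) (auto simp: dist_commute)
    then show False using that d(1) by linarith
  qed
  then show ?thesis using that[of "d/2"] d(1) compact_infdist_le[OF assms(2,1), of "d/2"] by auto
qed

text \<open>
  Mollifications of indicators of shrinking neighbourhoods of \<open>K\<close>. The exact pointwise limit, also
  on the boundary of \<open>K\<close>, and the common support are what dominated convergence needs.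
\<close>

lemma cutoff_sequence:
  fixes K :: "'a::euclidean_space set"
  assumes K: "compact K" "K \<noteq> {}" "open U" "K \<subseteq> U"
  obtains K' and \<phi> :: "nat \<Rightarrow> 'a \<Rightarrow> real" where "compact K'" "K' \<subseteq> U" "\<And>n. test_function U (\<phi> n)"
    "\<And>n x. 0 \<le> \<phi> n x" "\<And>n x. \<phi> n x \<le> 1" "\<And>n x. x \<notin> K' \<Longrightarrow> \<phi> n x = 0"
    "\<And>x. (\<lambda>n. \<phi> n x) \<longlonglongrightarrow> indicator K x"
proof -
  obtain \<eta> \<Psi> :: "'a \<Rightarrow> real" where \<eta>: "kernel \<eta>" "\<And>z. 0 \<le> \<eta> z" "integral\<^sup>L lborel \<eta> = 1"
    using mollifier_exists by metis
  obtain e where e: "e > 0" "compact {x. infdist x K \<le> e}" "{x. infdist x K \<le> e} \<subseteq> U"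
    using compact_neighbourhood[OF K] .
  obtain N where N: "1 / 2 ^ N < e / 2" using real_arch_pow_inv[of "e/2" "1/2"] e(1) by (auto simp: power_one_over)
  have Nn: "1 / 2 ^ (n + N) \<le> e / 2" for n
  proof -
    have "(1::real) / 2 ^ (n + N) \<le> 1 / 2 ^ N" by (simp add: frac_le power_increasing)
    then show ?thesis using N by linarith
  qed
  define K' where "K' = {x. infdist x K \<le> e}"
  define C where "C n = {x. infdist x K \<le> 1 / 2 ^ (n + N)}" for n
  define \<phi> where "\<phi> n = conv (indicator (C n)) (dil (n + N) \<eta>)" for n
  have Cc: "compact (C n)" for n unfolding C_def using compact_infdist_le[OF K(2,1)] by simp
  then have Cm: "C n \<in> sets borel" for n by (simp add: borel_compact)
  have CI: "integrable lborel (indicator (C n) :: 'a \<Rightarrow> real)" for n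
    using Cm emeasure_bounded_finite[OF compact_imp_bounded[OF Cc]] by simp
  note dI = dil_integrable(1)[OF \<eta>(1)]
  have one: "(LINT y|lborel. dil n \<eta> (x - y)) = 1" for n x
    using integral_dil(1)[OF kernel_continuous[OF \<eta>(1)]] \<eta>(3) by metis
  have dn: "0 \<le> dil n \<eta> z" for n z using dil_nonneg \<eta>(2) by blast
  have prodI: "integrable lborel (\<lambda>y. indicator (C n) y * dil (n + N) \<eta> (x - y))" for n x
    by (rule conv_integrable[OF CI Cinfc_C1c[OF Cinfc_dil[OF \<eta>(1)]]])
  have far: "\<phi> n x = 0" if "infdist x K > 2 * (1 / 2 ^ (n + N))" for n x
  proof -
    have "indicator (C n) y * dil (n + N) \<eta> (x - y) = 0" for y
    proof (cases "1 / 2 ^ (n + N) < norm (x - y)")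
      case True then show ?thesis using dil_zero[OF \<eta>(1)] by simp
    next
      case False
      then have "infdist x K \<le> infdist y K + 1 / 2 ^ (n + N)"
        using infdist_triangle[of x K y] by (simp add: dist_norm)
      then have "y \<notin> C n" using that unfolding C_def by simp
      then show ?thesis by simp
    qed
    then have "(\<lambda>y. indicator (C n) y * dil (n + N) \<eta> (x - y)) = (\<lambda>y. 0)" by blast
    then show ?thesis unfolding \<phi>_def conv_def by (simp only: integral_zero)
  qed
  have near: "\<phi> n x = 1" if "x \<in> K" for n x
  proof -
    have "indicator (C n) y * dil (n + N) \<eta> (x - y) = dil (n + N) \<eta> (x - y)" for y
    proof (cases "1 / 2 ^ (n + N) < norm (x - y)")
      case True then show ?thesis using dil_zero[OF \<eta>(1)] by simp
    next
      case False
      then have "infdist y K \<le> 1 / 2 ^ (n + N)"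
        using infdist_le[OF that, of y] by (simp add: dist_norm norm_minus_commute)
      then show ?thesis unfolding C_def by simp
    qed
    then have "(\<lambda>y. indicator (C n) y * dil (n + N) \<eta> (x - y)) = (\<lambda>y. dil (n + N) \<eta> (x - y))" by blast
    then show ?thesis unfolding \<phi>_def conv_def by (simp only: one)
  qed
  have out: "\<phi> n x = 0" if "x \<notin> K'" for n x
    using far[of n x] that Nn[of n] unfolding K'_def by auto
  have tf: "test_function U (\<phi> n)" for n
  proof -
    have "{x. \<phi> n x \<noteq> 0} \<subseteq> K'" using out by blast
    then have "closure {x. \<phi> n x \<noteq> 0} \<subseteq> K'" using e(2) unfolding K'_def
      by (intro closure_minimal compact_imp_closed)
    moreover have "Ck_on k UNIV (\<phi> n)" for k unfolding \<phi>_def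
      by (rule Ck_on_conv[OF CI Cinfc_dil[OF \<eta>(1)]])
    ultimately show ?thesis using e(2,3) unfolding test_function_def K'_def
      by (meson bounded_subset closed_closure compact_eq_bounded_closed subset_trans)
  qed
  show ?thesis
  proof (rule that[of K' \<phi>])
    show "compact K'" "K' \<subseteq> U" using e unfolding K'_def by auto
    show "0 \<le> \<phi> n x" for n x unfolding \<phi>_def conv_def
      by (intro integral_nonneg_AE AE_I2 mult_nonneg_nonneg dn) simp
    show "\<phi> n x \<le> 1" for n x
    proof -
      have "\<phi> n x \<le> (LINT y|lborel. dil (n + N) \<eta> (x - y))"
        unfolding \<phi>_def conv_def by (intro integral_mono prodI dI) (auto simp: indicator_def dn)
      then show ?thesis using one by simp
    qed
    show "(\<lambda>n. \<phi> n x) \<longlonglongrightarrow> indicator K x" for x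
    proof (cases "x \<in> K")
      case True then show ?thesis using near by simp
    next
      case False
      have "infdist x K > 0"
        using False K in_closed_iff_infdist_zero[OF compact_imp_closed[OF K(1)] K(2), of x] infdist_nonneg[of x K]
        by linarith
      then obtain M where M: "1 / 2 ^ M < infdist x K / 2"
        using real_arch_pow_inv[of "infdist x K/2" "1/2"] by (auto simp: power_one_over)
      have "\<phi> n x = 0" if "n \<ge> M" for n
      proof (rule far)
        have "(1::real) / 2 ^ (n + N) \<le> 1 / 2 ^ M" using that by (intro frac_le power_increasing) auto
        then show "infdist x K > 2 * (1 / 2 ^ (n + N))" using M by linarith
      qed
      then have "\<forall>\<^sub>F n in sequentially. \<phi> n x = indicator K x"
        using False unfolding eventually_sequentially by auto
      then show ?thesis by (rule tendsto_eventually)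
    qed
  qed (use tf out in auto)
qed

text \<open>
  Cutoff functions give \<open>\<integral>_K g \<le> 0\<close> for every compact \<open>K\<close>. If \<open>{g > 0}\<close> had positive measure, a compact
  subset of positive measure would contradict this.
\<close>

lemma fundamental_nonpos:
  fixes g :: "'a::euclidean_space \<Rightarrow> real"
  assumes U: "open U" and loc: "\<And>K. compact K \<Longrightarrow> K \<subseteq> U \<Longrightarrow> set_integrable lebesgue K g"
    and test: "\<And>\<phi>. test_function U \<phi> \<Longrightarrow> (\<And>x. 0 \<le> \<phi> x) \<Longrightarrow> (LINT x:U|lebesgue. g x * \<phi> x) \<le> 0"
  shows "AE x in lebesgue. x \<in> U \<longrightarrow> g x \<le> 0"
proof -
  have compact_le: "(LINT x:K|lebesgue. g x) \<le> 0" if K: "compact K" "K \<subseteq> U" for K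
  proof (cases "K = {}")
    case True then show ?thesis by (simp add: set_lebesgue_integral_def)
  next
    case False
    obtain K' and \<phi> :: "nat \<Rightarrow> 'a \<Rightarrow> real" where K': "compact K'" "K' \<subseteq> U" and tf: "\<And>n. test_function U (\<phi> n)"
      and \<phi>: "\<And>n x. 0 \<le> \<phi> n x" "\<And>n x. \<phi> n x \<le> 1" "\<And>n x. x \<notin> K' \<Longrightarrow> \<phi> n x = 0"
      and lim: "\<And>x. (\<lambda>n. \<phi> n x) \<longlonglongrightarrow> indicator K x"
      by (rule cutoff_sequence[OF K(1) False U K(2)]) (rule that; assumption)
    have I: "integrable lebesgue (\<lambda>x. indicator K' x * g x)" "integrable lebesgue (\<lambda>x. indicator K x * g x)"
      using loc[OF K'] loc[OF K] by (auto simp: set_integrable_def)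
    have [measurable]: "\<phi> n \<in> borel_measurable lebesgue" for n
      using tf[of n] Ck_on_imp_continuous unfolding test_function_def
      by (intro borel_measurable_lebesgue_of_continuous) blast
    have KK': "K \<subseteq> K'"
    proof
      fix x assume "x \<in> K"
      with lim[of x] have "(\<lambda>n. \<phi> n x) \<longlonglongrightarrow> 1" by simp
      then show "x \<in> K'" using \<phi>(3)[of x] LIMSEQ_unique[of "\<lambda>n. 0::real" 0 1] by fastforce
    qed
    have L: "(\<lambda>n. LINT x|lebesgue. (indicator K' x * g x) * \<phi> n x) \<longlonglongrightarrow> (LINT x|lebesgue. (indicator K' x * g x) * indicator K x)"
    proof (rule integral_dominated_convergence[where w="\<lambda>x. \<bar>indicator K' x * g x\<bar>"])
      show "integrable lebesgue (\<lambda>x. \<bar>indicator K' x * g x\<bar>)" using I(1) by (rule integrable_abs)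
      have [measurable]: "(\<lambda>x. indicator K' x * g x) \<in> borel_measurable lebesgue" using I(1) by (rule borel_measurable_integrable)
      show "(\<lambda>x. (indicator K' x * g x) * \<phi> n x) \<in> borel_measurable lebesgue" for n by measurable
      have [measurable]: "K \<in> sets lebesgue" using borel_compact[OF K(1)] by simp
      show "(\<lambda>x. (indicator K' x * g x) * indicator K x) \<in> borel_measurable lebesgue" by measurable
      show "AE x in lebesgue. (\<lambda>n. (indicator K' x * g x) * \<phi> n x) \<longlonglongrightarrow> (indicator K' x * g x) * indicator K x"
        by (intro AE_I2 tendsto_mult_left lim)
      show "AE x in lebesgue. norm ((indicator K' x * g x) * \<phi> n x) \<le> \<bar>indicator K' x * g x\<bar>" for n
        using \<phi>(1,2)[of n] by (intro AE_I2) (auto simp: abs_mult mult_left_le)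
    qed
    have le: "(LINT x|lebesgue. (indicator K' x * g x) * \<phi> n x) \<le> 0" for n
    proof -
      have "(\<lambda>x. (indicator K' x * g x) * \<phi> n x) = (\<lambda>x. indicator U x *\<^sub>R (g x * \<phi> n x))"
        using \<phi>(3)[of _ n] K'(2) by (auto simp: indicator_def fun_eq_iff)
      then show ?thesis using test[OF tf[of n] \<phi>(1)] by (simp add: set_lebesgue_integral_def)
    qed
    have "(LINT x|lebesgue. (indicator K' x * g x) * indicator K x) \<le> 0"
      by (rule LIMSEQ_le_const2[OF L]) (use le in blast)
    moreover have "(\<lambda>x. (indicator K' x * g x) * indicator K x) = (\<lambda>x. indicator K x *\<^sub>R g x)"
      using KK' by (auto simp: indicator_def fun_eq_iff)
    ultimately show ?thesis by (simp add: set_lebesgue_integral_def)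
  qed
  obtain C :: "nat \<Rightarrow> 'a set" where C: "\<And>n. compact (C n)" "\<And>n. C n \<subseteq> U" "\<Union>(range C) = U"
    using open_Union_compact_subsets[OF U] by metis
  define A where "A = (\<Union>n. {x. indicator (C n) x * g x > 0})"
  have Aeq: "A = {x \<in> U. g x > 0}" unfolding A_def using C(2,3) by (auto simp: indicator_def split: if_splits)
  have Am: "A \<in> sets lebesgue"
  proof -
    have [measurable]: "(\<lambda>x. indicator (C n) x * g x) \<in> borel_measurable lebesgue" for n
      using borel_measurable_integrable[OF loc[OF C(1,2)[of n], unfolded set_integrable_def]] by simp
    have "{x\<in>space lebesgue. indicator (C n) x * g x > 0} \<in> sets lebesgue" for n by measurable
    then show ?thesis unfolding A_def by simp
  qed
  \<comment> \<open>Inner regularity: up to a null set, \<open>{g > 0}\<close> is a countable union of compact sets.\<close>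
  obtain F T where F: "fsigma F" "T \<in> null_sets lebesgue" "F \<union> T = A"
    using lebesgue_set_almost_fsigma[OF Am] by metis
  obtain D :: "nat \<Rightarrow> 'a set" where D: "range D \<subseteq> Collect compact" "F = \<Union>(range D)"
    using F(1) fsigma_Union_compact by metis
  have Dn: "D n \<in> null_sets lebesgue" for n
  proof -
    have Dc: "compact (D n)" using D(1) by auto
    have DA: "D n \<subseteq> A" using D(2) F(3) by auto
    then have DU: "D n \<subseteq> U" using Aeq by auto
    have I: "integrable lebesgue (\<lambda>x. indicator (D n) x *\<^sub>R g x)" using loc[OF Dc DU] by (simp add: set_integrable_def)
    have nn: "0 \<le> indicator (D n) x *\<^sub>R g x" for x using DA Aeq by (auto simp: indicator_def)
    have "(LINT x|lebesgue. indicator (D n) x *\<^sub>R g x) \<ge> 0" using nn by (intro integral_nonneg_AE AE_I2)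
    then have "(LINT x|lebesgue. indicator (D n) x *\<^sub>R g x) = 0"
      using compact_le[OF Dc DU] by (simp add: set_lebesgue_integral_def)
    then have "AE x in lebesgue. indicator (D n) x *\<^sub>R g x = 0"
      using integral_nonneg_eq_0_iff_AE[OF I] nn by auto
    then have "AE x in lebesgue. x \<notin> D n"
      by eventually_elim (use DA Aeq in \<open>auto simp: indicator_def split: if_splits\<close>)
    then show ?thesis using borel_compact[OF Dc] by (subst AE_iff_null_sets) auto
  qed
  then have "F \<in> null_sets lebesgue" unfolding D(2) by blast
  then have "A \<in> null_sets lebesgue" using F(2,3) null_sets.Un by metis
  then have "AE x in lebesgue. x \<notin> A" by (rule AE_not_in)
  then show ?thesis by eventually_elim (auto simp: Aeq not_less)
qed

lemma fundamental_zero: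
  fixes g :: "'a::euclidean_space \<Rightarrow> real"
  assumes U: "open U" and loc: "\<And>K. compact K \<Longrightarrow> K \<subseteq> U \<Longrightarrow> set_integrable lebesgue K g"
    and test: "\<And>\<phi>. test_function U \<phi> \<Longrightarrow> (LINT x:U|lebesgue. g x * \<phi> x) = 0"
  shows "AE x in lebesgue. x \<in> U \<longrightarrow> g x = 0"
proof -
  have 1: "AE x in lebesgue. x \<in> U \<longrightarrow> g x \<le> 0"
    by (rule fundamental_nonpos[OF U loc]) (auto simp: test)
  have 2: "AE x in lebesgue. x \<in> U \<longrightarrow> - g x \<le> 0"
  proof (rule fundamental_nonpos[OF U])
    show "set_integrable lebesgue K (\<lambda>x. - g x)" if "compact K" "K \<subseteq> U" for K
      using loc[OF that] unfolding set_integrable_def by simp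
    show "(LINT x:U|lebesgue. - g x * \<phi> x) \<le> 0" if "test_function U \<phi>" for \<phi>
      using test[OF that] unfolding set_lebesgue_integral_def by simp
  qed
  show ?thesis using 1 2 by eventually_elim auto
qed

section \<open>Integration by parts\<close>

lemma pd_directional:
  fixes \<psi> :: "'a::euclidean_space \<Rightarrow> real"
  assumes "\<psi> differentiable (at x)" "i \<in> Basis"
  shows "((\<lambda>t. (\<psi> (x + t *\<^sub>R i) - \<psi> x) / t) \<longlongrightarrow> pd i \<psi> x) (at 0)"
proof -
  have 1: "((\<lambda>t. x + t *\<^sub>R i) has_derivative (\<lambda>t. t *\<^sub>R i)) (at 0)" by (auto intro!: derivative_eq_intros)
  have 2: "(\<psi> has_derivative frechet_derivative \<psi> (at x)) (at x)"
    using assms frechet_derivative_works by blast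
  have l: "linear (frechet_derivative \<psi> (at x))" using assms linear_frechet_derivative by blast
  have "((\<lambda>t. \<psi> (x + t *\<^sub>R i)) has_derivative (\<lambda>t. frechet_derivative \<psi> (at x) (t *\<^sub>R i))) (at 0)"
    using has_derivative_compose[OF 1, of \<psi> "frechet_derivative \<psi> (at x)"] 2 by simp
  moreover have "(\<lambda>t. frechet_derivative \<psi> (at x) (t *\<^sub>R i)) = (*) (pd i \<psi> x)"
    by (auto simp: linear_cmul[OF l] pd_def mult.commute)
  ultimately have "((\<lambda>t. \<psi> (x + t *\<^sub>R i)) has_real_derivative pd i \<psi> x) (at 0)"
    by (simp add: has_field_derivative_def)
  then show ?thesis by (simp add: DERIV_def)
qed

text \<open>
  The integral of a difference quotient vanishes by translation invariance.
\<close>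

lemma integral_pd_C1c:
  fixes \<psi> :: "'a::euclidean_space \<Rightarrow> real"
  assumes "C1c \<psi>" and i: "i \<in> Basis"
  shows "integral\<^sup>L lborel (pd i \<psi>) = 0"
proof -
  obtain L where L: "L \<ge> 0" "\<And>y z. \<bar>\<psi> y - \<psi> z\<bar> \<le> L * norm (y - z)"
    using C1c_derivative_bound[OF assms(1)] by metis
  obtain R where R: "\<And>z. R < norm z \<Longrightarrow> \<psi> z = 0" using assms unfolding C1c_def by blast
  have [measurable]: "\<psi> \<in> borel_measurable borel" using C1c_continuous[OF assms(1)] by (rule borel_measurable_continuous_onI)
  have [measurable]: "pd i \<psi> \<in> borel_measurable borel" using C1c_pd_continuous[OF assms] by (rule borel_measurable_continuous_onI)
  define t where "t n = inverse (real (Suc n))" for n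
  have t: "t n \<noteq> 0" "0 < t n" "t n \<le> 1" for n by (auto simp: t_def divide_simps)
  have tl: "t \<longlonglongrightarrow> 0" unfolding t_def by (rule LIMSEQ_inverse_real_of_nat)
  have I: "integrable lborel \<psi>" by (rule C1c_integrable[OF assms(1)])
  have Is: "integrable lborel (\<lambda>x. \<psi> (x + a))" for a
  proof (rule integrable_compact_support[OF _ compact_cball[of "-a" R]])
    show "continuous_on UNIV (\<lambda>x. \<psi> (x + a))"
      by (rule continuous_on_compose2[OF C1c_continuous[OF assms(1)]]) (auto intro!: continuous_intros)
    show "\<psi> (x + a) = 0" if "x \<notin> cball (- a) R" for x
      using that by (intro R) (simp add: dist_norm norm_minus_commute add.commute)
  qed
  have sh: "(LINT x|lborel. \<psi> (x + a)) = integral\<^sup>L lborel \<psi>" for a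
    using integral_affine[of \<psi> 1 a] by (simp add: add.commute)
  have lim: "(\<lambda>n. LINT x|lborel. (\<psi> (x + t n *\<^sub>R i) - \<psi> x) / t n) \<longlonglongrightarrow> integral\<^sup>L lborel (pd i \<psi>)"
  proof (rule integral_dominated_convergence[where w="\<lambda>x. L * indicator (cball 0 (R + 1)) x"])
    show "integrable lborel (\<lambda>x. L * indicator (cball 0 (R + 1)) x)"
      using emeasure_bounded_finite[OF bounded_cball] by (intro integrable_mult_right) (simp add: integrable_indicator_iff)
    show "AE x in lborel. (\<lambda>n. (\<psi> (x + t n *\<^sub>R i) - \<psi> x) / t n) \<longlonglongrightarrow> pd i \<psi> x"
      using pd_directional[OF C1c_differentiable[OF assms(1)] i] tl t(1)
      unfolding tendsto_at_iff_sequentially comp_def by (intro AE_I2) auto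
    show "AE x in lborel. norm ((\<psi> (x + t n *\<^sub>R i) - \<psi> x) / t n) \<le> L * indicator (cball 0 (R + 1)) x" for n
    proof (intro AE_I2)
      fix x
      show "norm ((\<psi> (x + t n *\<^sub>R i) - \<psi> x) / t n) \<le> L * indicator (cball 0 (R + 1)) x"
      proof (cases "x \<in> cball 0 (R + 1)")
        case True
        have "\<bar>\<psi> (x + t n *\<^sub>R i) - \<psi> x\<bar> \<le> L * t n"
          using L(2)[of "x + t n *\<^sub>R i" x] t[of n] i by simp
        then show ?thesis using t[of n] True by (simp add: divide_simps)
      next
        case False
        have "norm x \<le> norm (x + t n *\<^sub>R i) + norm (t n *\<^sub>R i)"
          using norm_triangle_ineq4[of "x + t n *\<^sub>R i" "t n *\<^sub>R i"] by simp
        then have "R < norm x" "R < norm (x + t n *\<^sub>R i)" using False t[of n] i by auto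
        then show ?thesis using R L(1) by simp
      qed
    qed
  qed measurable
  have z: "(LINT x|lborel. (\<psi> (x + t n *\<^sub>R i) - \<psi> x) / t n) = 0" for n
    using Is I sh by simp
  have "(\<lambda>n::nat. 0) \<longlonglongrightarrow> integral\<^sup>L lborel (pd i \<psi>)" using lim unfolding z .
  then show ?thesis using LIMSEQ_unique tendsto_const by blast
qed

lemma Ck_on_mult_test:
  fixes f \<phi> :: "'a::euclidean_space \<Rightarrow> real"
  assumes U: "open U" and f: "Ck_on k U f" and \<phi>: "test_function U \<phi>"
  shows "Ck_on k UNIV (\<lambda>x. f x * \<phi> x)" "\<exists>R. \<forall>z. R < norm z \<longrightarrow> f z * \<phi> z = 0"
proof -
  obtain K where K: "compact K" "K \<subseteq> U" "\<And>x. x \<notin> K \<Longrightarrow> \<phi> x = 0" using test_function_support[OF \<phi>] by blast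
  have "Ck_on k (U \<union> - K) (\<lambda>x. f x * \<phi> x)"
  proof (rule Ck_on_Un)
    show o: "open (- K)" using K(1) compact_imp_closed by blast
    show "Ck_on k U (\<lambda>x. f x * \<phi> x)"
      using \<phi> by (intro Ck_on_mult U f Ck_on_subset[of UNIV U k \<phi>]) (auto simp: test_function_def)
    show "Ck_on k (- K) (\<lambda>x. f x * \<phi> x)"
      using Ck_on_cong[OF o, of "\<lambda>x. f x * \<phi> x" "\<lambda>x. 0"] K(3) Ck_on_const[OF o] by simp
  qed (rule U)
  moreover have "U \<union> - K = UNIV" using K(2) by auto
  ultimately show "Ck_on k UNIV (\<lambda>x. f x * \<phi> x)" by simp
  show "\<exists>R. \<forall>z. R < norm z \<longrightarrow> f z * \<phi> z = 0"
    using test_function_Cinfc[OF \<phi>] unfolding Cinfc_def by fastforce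
qed

text \<open>
  \<open>f\<close> has to be regular on \<open>U\<close> only, because the product with a test function extends by zero.
\<close>

lemma integral_by_parts:
  fixes f \<phi> :: "'a::euclidean_space \<Rightarrow> real"
  assumes U: "open U" and f: "Ck_on 1 U f" and \<phi>: "test_function U \<phi>" and i: "i \<in> Basis"
  shows "integrable lborel (\<lambda>x. f x * pd i \<phi> x)" "integrable lborel (\<lambda>x. pd i f x * \<phi> x)"
    "(LINT x|lborel. f x * pd i \<phi> x) = - (LINT x|lborel. pd i f x * \<phi> x)"
proof -
  have f': "Ck_on 0 U f" "Ck_on 0 U (pd i f)" "\<And>x. x \<in> U \<Longrightarrow> f differentiable (at x)"
    using f i Ck_on_SucD[OF U, of 0 f] by (auto simp: Ck_on_Suc_open[OF U])
  have int: "integrable lborel (\<lambda>x. h x * \<psi> x)" if "Ck_on 0 U h" "test_function U \<psi>" for h \<psi> :: "'a \<Rightarrow> real"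
  proof -
    have "\<exists>R. \<forall>z. R < norm z \<longrightarrow> h z * \<psi> z = 0" by (rule Ck_on_mult_test(2)[OF U that])
    then obtain R where R: "\<And>z. R < norm z \<Longrightarrow> h z * \<psi> z = 0" by blast
    show ?thesis
      using Ck_on_mult_test(1)[OF U that]
      by (intro integrable_compact_support[OF _ compact_cball[of 0 R]] R) auto
  qed
  show 1: "integrable lborel (\<lambda>x. f x * pd i \<phi> x)"
    by (rule int[OF f'(1) test_function_pd[OF \<phi> i]])
  show 2: "integrable lborel (\<lambda>x. pd i f x * \<phi> x)" by (rule int[OF f'(2) \<phi>])
  have "C1c (\<lambda>x. f x * \<phi> x)" using Ck_on_mult_test[OF U f \<phi>] unfolding C1c_def by blast
  then have "integral\<^sup>L lborel (pd i (\<lambda>x. f x * \<phi> x)) = 0" using i by (rule integral_pd_C1c)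
  moreover have "pd i (\<lambda>x. f x * \<phi> x) = (\<lambda>x. f x * pd i \<phi> x + pd i f x * \<phi> x)"
  proof
    fix x
    show "pd i (\<lambda>x. f x * \<phi> x) x = f x * pd i \<phi> x + pd i f x * \<phi> x"
    proof (cases "x \<in> U")
      case True
      show ?thesis using f'(3)[OF True] Cinfc_differentiable[OF test_function_Cinfc[OF \<phi>]] by (rule pd_mult)
    next
      case False
      obtain K where K: "compact K" "K \<subseteq> U" "\<And>x. x \<notin> K \<Longrightarrow> \<phi> x = 0" using test_function_support[OF \<phi>] by blast
      have "pd i (\<lambda>x. f x * \<phi> x) x = 0"
        using K False by (intro pd_zero_off_closed[of K]) (auto simp: compact_imp_closed)
      then show ?thesis using False test_function_zero_outside[OF \<phi>] test_function_zero_outside[OF test_function_pd[OF \<phi> i]]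
        by simp
    qed
  qed
  ultimately have "(LINT x|lborel. f x * pd i \<phi> x + pd i f x * \<phi> x) = 0" by simp
  then show "(LINT x|lborel. f x * pd i \<phi> x) = - (LINT x|lborel. pd i f x * \<phi> x)"
    using 1 2 by simp
qed

section \<open>Local Hoelder spaces\<close>

definition holder_on :: "real \<Rightarrow> 'a::euclidean_space set \<Rightarrow> ('a \<Rightarrow> real) \<Rightarrow> bool" where
  "holder_on \<gamma> S g \<longleftrightarrow> (\<exists>C. \<forall>x\<in>S. \<forall>y\<in>S. \<bar>g x - g y\<bar> \<le> C * dist x y powr \<gamma>)"

lemma holder_onE:
  assumes "holder_on \<gamma> S g"
  obtains C where "C \<ge> 0" "\<And>x y. x \<in> S \<Longrightarrow> y \<in> S \<Longrightarrow> \<bar>g x - g y\<bar> \<le> C * dist x y powr \<gamma>"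
proof -
  obtain C where C: "\<And>x y. x \<in> S \<Longrightarrow> y \<in> S \<Longrightarrow> \<bar>g x - g y\<bar> \<le> C * dist x y powr \<gamma>"
    using assms unfolding holder_on_def by blast
  show ?thesis
  proof (rule that[of "\<bar>C\<bar>"])
    fix x y assume xy: "x \<in> S" "y \<in> S"
    have "\<bar>g x - g y\<bar> \<le> C * dist x y powr \<gamma>" using C[OF xy] .
    also have "\<dots> \<le> \<bar>C\<bar> * dist x y powr \<gamma>" by (intro mult_right_mono) auto
    finally show "\<bar>g x - g y\<bar> \<le> \<bar>C\<bar> * dist x y powr \<gamma>" .
  qed simp
qed

lemma holder_onD: "holder_on \<gamma> S g \<Longrightarrow> \<exists>C\<ge>0. \<forall>x\<in>S. \<forall>y\<in>S. \<bar>g x - g y\<bar> \<le> C * dist x y powr \<gamma>"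
  by (erule holder_onE) blast

lemma powr_mult_nat: "0 < b \<Longrightarrow> b powr (a * real n) = (b powr a) ^ n" for b :: real
  unfolding powr_powr[symmetric] by (simp add: powr_realpow)

lemma holder_on_subset: "holder_on \<gamma> S g \<Longrightarrow> T \<subseteq> S \<Longrightarrow> holder_on \<gamma> T g"
  unfolding holder_on_def by blast

lemma holder_on_compacts_iff: "holder_on_compacts \<gamma> S g \<longleftrightarrow> (\<forall>K. compact K \<and> K \<subseteq> S \<longrightarrow> holder_on \<gamma> K g)"
  by (simp add: holder_on_compacts_def holder_on_def)

text \<open>
  Pairs closer than a Lebesgue number of the cover lie in a common ball; for the others the boundedness of \<open>g\<close> suffices.
\<close>

lemma holder_on_compact_of_local:
  fixes g :: "'a::euclidean_space \<Rightarrow> real"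
  assumes K: "compact K" and cont: "continuous_on K g" and \<gamma>: "\<gamma> > 0"
    and loc: "\<And>x. x \<in> K \<Longrightarrow> \<exists>r>0. holder_on \<gamma> (ball x r) g"
  shows "holder_on \<gamma> K g"
proof -
  obtain r where r: "\<And>x. x \<in> K \<Longrightarrow> r x > 0" "\<And>x. x \<in> K \<Longrightarrow> holder_on \<gamma> (ball x (r x)) g"
    using loc by metis
  obtain D where D: "D \<subseteq> K" "finite D" "K \<subseteq> (\<Union>c\<in>D. ball c (r c))"
    using compactE_image[OF K, of K "\<lambda>c. ball c (r c)"] r(1) by force
  have "\<exists>C. \<forall>c\<in>D. C c \<ge> 0 \<and> (\<forall>x\<in>ball c (r c). \<forall>y\<in>ball c (r c). \<bar>g x - g y\<bar> \<le> C c * dist x y powr \<gamma>)"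
  proof (rule bchoice, rule ballI)
    fix c assume "c \<in> D"
    then have "holder_on \<gamma> (ball c (r c)) g" using r(2) D(1) by blast
    then show "\<exists>C\<ge>0. \<forall>x\<in>ball c (r c). \<forall>y\<in>ball c (r c). \<bar>g x - g y\<bar> \<le> C * dist x y powr \<gamma>"
      by (rule holder_onD)
  qed
  then obtain C where C: "\<And>c. c \<in> D \<Longrightarrow> C c \<ge> 0"
    "\<And>c x y. c \<in> D \<Longrightarrow> x \<in> ball c (r c) \<Longrightarrow> y \<in> ball c (r c) \<Longrightarrow> \<bar>g x - g y\<bar> \<le> C c * dist x y powr \<gamma>"
    by blast
  \<comment> \<open>A Lebesgue number of the cover.\<close>
  obtain e where e: "e > 0" "\<And>x. x \<in> K \<Longrightarrow> \<exists>c\<in>D. ball x e \<subseteq> ball c (r c)"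
    using Heine_Borel_lemma[OF K, of "(\<lambda>c. ball c (r c)) ` D"] D(3) by auto
  have "bounded (g ` K)" using K cont compact_continuous_image compact_imp_bounded by blast
  then obtain M where M: "\<And>x. x \<in> K \<Longrightarrow> \<bar>g x\<bar> \<le> M" unfolding bounded_iff by auto
  define A where "A = (\<Sum>c\<in>D. C c) + 2 * \<bar>M\<bar> / e powr \<gamma>"
  have sC: "(\<Sum>c\<in>D. C c) \<ge> 0" using C(1) by (rule sum_nonneg)
  have "\<bar>g x - g y\<bar> \<le> A * dist x y powr \<gamma>" if "x \<in> K" "y \<in> K" for x y
  proof (cases "dist x y < e")
    case True
    obtain c where c: "c \<in> D" "ball x e \<subseteq> ball c (r c)" using e(2)[OF \<open>x \<in> K\<close>] by blast
    then have "\<bar>g x - g y\<bar> \<le> C c * dist x y powr \<gamma>"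
      using C(2)[OF c(1)] True e(1) by (auto simp: subset_iff)
    also have "\<dots> \<le> A * dist x y powr \<gamma>"
    proof (rule mult_right_mono)
      have "C c \<le> (\<Sum>c\<in>D. C c)" using C(1) c(1) D(2) by (intro member_le_sum) auto
      moreover have "0 \<le> 2 * \<bar>M\<bar> / e powr \<gamma>" by simp
      ultimately show "C c \<le> A" unfolding A_def by linarith
    qed simp
    finally show ?thesis .
  next
    case False
    have "\<bar>g x - g y\<bar> \<le> 2 * \<bar>M\<bar>" using M[OF that(1)] M[OF that(2)] by linarith
    also have "\<dots> = 2 * \<bar>M\<bar> / e powr \<gamma> * e powr \<gamma>" using e(1) by simp
    also have "\<dots> \<le> A * dist x y powr \<gamma>"
      using False e(1) \<gamma> sC by (intro mult_mono powr_mono2) (auto simp: A_def)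
    finally show ?thesis .
  qed
  then show ?thesis unfolding holder_on_def by blast
qed

lemma Ck_holder_loc_cong:
  assumes "open S" "\<And>x. x \<in> S \<Longrightarrow> f x = g x" "Ck_holder_loc k \<gamma> S f"
  shows "Ck_holder_loc k \<gamma> S g"
proof (cases k)
  case 0
  then have c: "continuous_on S g" using assms by (auto cong: continuous_on_cong)
  have "holder_on \<gamma> K g" if "compact K" "K \<subseteq> S" for K
  proof -
    have "holder_on \<gamma> K f" using assms(3) 0 that by (auto simp: holder_on_compacts_iff)
    moreover have "f x = g x" if "x \<in> K" for x using assms(2) that \<open>K \<subseteq> S\<close> by blast
    ultimately show ?thesis unfolding holder_on_def by simp
  qed
  then show ?thesis using 0 c by (simp add: holder_on_compacts_iff)
next
  case (Suc n)
  have "continuous_on S g" using assms Suc by (auto cong: continuous_on_cong)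
  moreover have "\<forall>x\<in>interior S. g differentiable (at x)"
    using assms Suc differentiable_cong_open[OF assms(1,2)] by (simp add: interior_open)
  moreover have "\<forall>i\<in>Basis. \<exists>h. (\<forall>x\<in>interior S. h x = frechet_derivative g (at x) i) \<and> Ck_holder_loc n \<gamma> S h"
    using assms(3) Suc pd_cong_open[OF assms(1,2), unfolded pd_def] assms(1)
    by (simp add: interior_open)
  ultimately show ?thesis using Suc by simp
qed

lemma Ck_holder_loc_Suc_open:
  assumes "open S"
  shows "Ck_holder_loc (Suc k) \<gamma> S g \<longleftrightarrow> (\<forall>x\<in>S. g differentiable (at x)) \<and> (\<forall>i\<in>Basis. Ck_holder_loc k \<gamma> S (pd i g))"
proof -
  have 1: "(\<exists>h. (\<forall>x\<in>S. h x = frechet_derivative g (at x) i) \<and> Ck_holder_loc k \<gamma> S h) \<longleftrightarrow> Ck_holder_loc k \<gamma> S (pd i g)" for i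
  proof
    assume "\<exists>h. (\<forall>x\<in>S. h x = frechet_derivative g (at x) i) \<and> Ck_holder_loc k \<gamma> S h"
    then obtain h where h: "\<And>x. x \<in> S \<Longrightarrow> h x = pd i g x" "Ck_holder_loc k \<gamma> S h" unfolding pd_def by metis
    show "Ck_holder_loc k \<gamma> S (pd i g)" using Ck_holder_loc_cong[OF assms h(1)] h(2) by simp
  next
    assume "Ck_holder_loc k \<gamma> S (pd i g)"
    then show "\<exists>h. (\<forall>x\<in>S. h x = frechet_derivative g (at x) i) \<and> Ck_holder_loc k \<gamma> S h"
      by (intro exI[of _ "pd i g"]) (simp add: pd_def)
  qed
  have 2: "(\<forall>x\<in>S. g differentiable (at x)) \<Longrightarrow> continuous_on S g"
    by (intro continuous_at_imp_continuous_on ballI differentiable_imp_continuous_within) (rule bspec)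
  have 3: "interior S = S" using assms by (simp add: interior_open)
  have 4: "Ck_holder_loc (Suc k) \<gamma> S g \<longleftrightarrow> continuous_on S g \<and> (\<forall>x\<in>S. g differentiable (at x)) \<and> (\<forall>i\<in>Basis. Ck_holder_loc k \<gamma> S (pd i g))"
    unfolding Ck_holder_loc.simps(2) 3 1 ..
  show ?thesis unfolding 4 using 2 by blast
qed

declare Ck_holder_loc.simps(2) [simp del]

lemma Ck_holder_loc_local:
  fixes g :: "'a::euclidean_space \<Rightarrow> real"
  assumes U: "open U" and \<gamma>: "\<gamma> > 0"
  shows "(\<And>x. x \<in> U \<Longrightarrow> \<exists>r>0. Ck_holder_loc k \<gamma> (ball x r) g) \<Longrightarrow> Ck_holder_loc k \<gamma> U g"
proof (induction k arbitrary: g)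
  case 0
  have cont: "continuous_on U g"
  proof (rule continuous_at_imp_continuous_on, rule ballI)
    fix x assume "x \<in> U"
    then obtain r where "r > 0" "continuous_on (ball x r) g" using 0 by auto
    then show "isCont g x" by (simp add: continuous_on_eq_continuous_at)
  qed
  have "holder_on \<gamma> K g" if K: "compact K" "K \<subseteq> U" for K
  proof (rule holder_on_compact_of_local[OF K(1) _ \<gamma>])
    show "continuous_on K g" using cont K(2) continuous_on_subset by blast
    fix x assume "x \<in> K"
    then obtain r where r: "r > 0" "holder_on_compacts \<gamma> (ball x r) g" using 0 K(2) by auto
    then have "holder_on \<gamma> (cball x (r/2)) g"
      unfolding holder_on_compacts_iff by (auto simp: subset_iff)
    then have "holder_on \<gamma> (ball x (r/2)) g" by (rule holder_on_subset) auto
    then show "\<exists>r>0. holder_on \<gamma> (ball x r) g" using r(1) by (intro exI[of _ "r/2"]) auto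
  qed
  then show ?case using cont by (simp add: holder_on_compacts_iff)
next
  case (Suc k)
  have "g differentiable (at x)" if x: "x \<in> U" for x
  proof -
    obtain r where "r > 0" "Ck_holder_loc (Suc k) \<gamma> (ball x r) g" using Suc.prems[OF x] by blast
    then show ?thesis using Ck_holder_loc_Suc_open[OF open_ball] centre_in_ball by blast
  qed
  moreover have "Ck_holder_loc k \<gamma> U (pd i g)" if i: "i \<in> Basis" for i
  proof (rule Suc.IH)
    fix x assume "x \<in> U"
    then obtain r where "r > 0" "Ck_holder_loc (Suc k) \<gamma> (ball x r) g" using Suc.prems by blast
    then show "\<exists>r>0. Ck_holder_loc k \<gamma> (ball x r) (pd i g)"
      using Ck_holder_loc_Suc_open[OF open_ball] i by blast
  qed
  ultimately show ?case unfolding Ck_holder_loc_Suc_open[OF U] by blast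
qed

section \<open>Dyadic sequences and their limits\<close>

text \<open>
  The decay, uniform on \<open>B\<close> and from index \<open>N\<close> on, that a sequence of mollifications of a \<open>C^(k,\<gamma>)\<close> function
  shows: the differences of the derivatives of order \<open>k\<close> are of size \<open>2^(-\<gamma>n)\<close>, and one more derivative
  costs a factor \<open>2^n\<close>. For the lower derivatives the same rate is enough.
\<close>

primrec dyadic :: "nat \<Rightarrow> real \<Rightarrow> 'a::euclidean_space set \<Rightarrow> nat \<Rightarrow> (nat \<Rightarrow> 'a \<Rightarrow> real) \<Rightarrow> bool" where
  "dyadic 0 \<gamma> B N g \<longleftrightarrow>
     (\<forall>n k. Ck_on k UNIV (g n)) \<and>
     (\<exists>C. \<forall>n\<ge>N. \<forall>x\<in>B. \<bar>g n x - g (Suc n) x\<bar> \<le> C * 2 powr (- \<gamma> * n)) \<and>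
     (\<forall>i\<in>Basis. \<exists>C. \<forall>n\<ge>N. \<forall>x\<in>B. \<bar>pd i (g n) x - pd i (g (Suc n)) x\<bar> \<le> C * 2 powr ((1 - \<gamma>) * n))"
| "dyadic (Suc k) \<gamma> B N g \<longleftrightarrow>
     (\<forall>n k. Ck_on k UNIV (g n)) \<and>
     (\<exists>C. \<forall>n\<ge>N. \<forall>x\<in>B. \<bar>g n x - g (Suc n) x\<bar> \<le> C * 2 powr (- \<gamma> * n)) \<and>
     (\<forall>i\<in>Basis. dyadic k \<gamma> B N (\<lambda>n. pd i (g n)))"

lemma dyadicD:
  assumes "dyadic k \<gamma> B N g"
  shows "Ck_on l UNIV (g n)"
    "\<exists>C. \<forall>n\<ge>N. \<forall>x\<in>B. \<bar>g n x - g (Suc n) x\<bar> \<le> C * 2 powr (- \<gamma> * n)"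
  using assms by (cases k; auto)+

lemma dyadic_uniform_limit:
  fixes g :: "nat \<Rightarrow> 'a::euclidean_space \<Rightarrow> real"
  assumes \<gamma>: "\<gamma> > 0" and C: "\<forall>n\<ge>N. \<forall>x\<in>B. \<bar>g n x - g (Suc n) x\<bar> \<le> C * 2 powr (- \<gamma> * n)"
  shows "\<exists>v. uniform_limit B g v sequentially"
proof -
  define q where "q = (2::real) powr (- \<gamma>)"
  have q: "0 < q" "q < 1" using \<gamma> by (auto simp: q_def powr_less_one)
  have qn: "2 powr (- \<gamma> * real n) = q ^ n" for n
    unfolding q_def by (rule powr_mult_nat) simp
  define f where "f n x = g (N + Suc n) x - g (N + n) x" for n x
  have "uniform_limit B (\<lambda>n x. \<Sum>i<n. f i x) (\<lambda>x. suminf (\<lambda>i. f i x)) sequentially"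
  proof (rule Weierstrass_m_test)
    show "norm (f n x) \<le> \<bar>C\<bar> * q ^ N * q ^ n" if "x \<in> B" for n x
    proof -
      have "\<bar>g (N + n) x - g (Suc (N + n)) x\<bar> \<le> C * q ^ (N + n)"
        using C[rule_format, of "N + n" x] that unfolding qn by simp
      also have "\<dots> \<le> \<bar>C\<bar> * q ^ (N + n)" using q by (intro mult_right_mono) auto
      finally show ?thesis by (simp add: f_def power_add mult.assoc abs_minus_commute)
    qed
    show "summable (\<lambda>n. \<bar>C\<bar> * q ^ N * q ^ n)" using q by (intro summable_mult summable_geometric) simp
  qed
  then have "uniform_limit B (\<lambda>n x. (\<Sum>i<n. f i x) + g N x) (\<lambda>x. suminf (\<lambda>i. f i x) + g N x) sequentially"
    by (intro uniform_limit_add uniform_limit_const)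
  moreover have "(\<Sum>i<n. f i x) + g N x = g (n + N) x" for n x
    by (induction n) (auto simp: f_def add.commute)
  ultimately have "uniform_limit B (\<lambda>n. g (n + N)) (\<lambda>x. suminf (\<lambda>i. f i x) + g N x) sequentially"
    by simp
  then have "uniform_limit B g (\<lambda>x. suminf (\<lambda>i. f i x) + g N x) sequentially"
    unfolding uniform_limit_iff by (subst (asm) eventually_sequentially_seg) 
  then show ?thesis by blast
qed

text \<open>
  The mean value inequality, in terms of the partial derivatives.
\<close>

lemma lipschitz_of_pd_bound:
  fixes g :: "'a::euclidean_space \<Rightarrow> real"
  assumes S: "convex S" and d: "\<And>x. x \<in> S \<Longrightarrow> g differentiable (at x)"
    and M: "\<And>i x. i \<in> Basis \<Longrightarrow> x \<in> S \<Longrightarrow> \<bar>pd i g x\<bar> \<le> M i" "\<And>i. i \<in> Basis \<Longrightarrow> 0 \<le> M i"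
    and xy: "x \<in> S" "y \<in> S"
  shows "\<bar>g x - g y\<bar> \<le> (\<Sum>i\<in>Basis. M i) * norm (x - y)"
proof -
  have 1: "\<bar>\<Sum>i\<in>Basis. (h \<bullet> i) * pd i g z\<bar> \<le> norm h * (\<Sum>i\<in>Basis. M i)" if "z \<in> S" for z h
  proof -
    have "\<bar>\<Sum>i\<in>Basis. (h \<bullet> i) * pd i g z\<bar> \<le> (\<Sum>i\<in>Basis. \<bar>(h \<bullet> i) * pd i g z\<bar>)" by (rule sum_abs)
    also have "\<dots> \<le> (\<Sum>i\<in>Basis. norm h * M i)"
      unfolding abs_mult using that by (intro sum_mono mult_mono) (auto simp: Basis_le_norm M)
    finally show ?thesis by (simp add: sum_distrib_left)
  qed
  have on: "onorm (\<lambda>h. \<Sum>i\<in>Basis. (h \<bullet> i) * pd i g z) \<le> (\<Sum>i\<in>Basis. M i)" if "z \<in> S" for z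
    using 1[OF that] M(2) by (intro onorm_bound sum_nonneg) (auto simp: mult.commute)
  show ?thesis
    using differentiable_bound[OF S has_derivative_at_withinI[OF has_derivative_pd[OF d]] on xy] by simp
qed

lemma smooth_lipschitz_ball:
  fixes g :: "'a::euclidean_space \<Rightarrow> real"
  assumes "Ck_on 1 UNIV g"
  obtains L where "L \<ge> 0" "\<And>x y. x \<in> ball x0 r \<Longrightarrow> y \<in> ball x0 r \<Longrightarrow> \<bar>g x - g y\<bar> \<le> L * norm (x - y)"
proof -
  have d: "g differentiable (at x)" for x using assms by (simp add: Ck_on_Suc_open)
  have "\<exists>M. \<forall>i\<in>Basis. 0 \<le> M i \<and> (\<forall>x\<in>cball x0 r. \<bar>pd i g x\<bar> \<le> M i)"
  proof (rule bchoice, rule ballI)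
    fix i :: 'a assume i: "i \<in> Basis"
    have "continuous_on (cball x0 r) (pd i g)"
      using assms i by (auto simp: Ck_on_Suc_open intro: continuous_on_subset)
    then have "bounded (pd i g ` cball x0 r)" by (intro compact_imp_bounded compact_continuous_image) auto
    then obtain b where "\<forall>x\<in>cball x0 r. \<bar>pd i g x\<bar> \<le> b" unfolding bounded_iff by auto
    then show "\<exists>M\<ge>0. \<forall>x\<in>cball x0 r. \<bar>pd i g x\<bar> \<le> M"
      by (intro exI[of _ "\<bar>b\<bar>"]) force
  qed
  then obtain M where M: "\<And>i. i \<in> Basis \<Longrightarrow> 0 \<le> M i" "\<And>i x. i \<in> Basis \<Longrightarrow> x \<in> cball x0 r \<Longrightarrow> \<bar>pd i g x\<bar> \<le> M i"
    by blast
  show ?thesis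
  proof (rule that[of "\<Sum>i\<in>Basis. M i"])
    show "(\<Sum>i\<in>Basis. M i) \<ge> 0" using M(1) by (rule sum_nonneg)
    show "\<bar>g x - g y\<bar> \<le> (\<Sum>i\<in>Basis. M i) * norm (x - y)" if "x \<in> ball x0 r" "y \<in> ball x0 r" for x y
      using lipschitz_of_pd_bound[of "ball x0 r" g M x y] d M that by auto
  qed
qed

lemma interpolate_powr:
  fixes d a b \<sigma> :: real
  assumes "0 \<le> d" "d \<le> a" "d \<le> b" "0 < \<sigma>" "\<sigma> < 1"
  shows "d \<le> a powr (1 - \<sigma>) * b powr \<sigma>"
proof -
  have "d = d powr (1 - \<sigma>) * d powr \<sigma>" using assms by (cases "d = 0") (auto simp: powr_add[symmetric])
  also have "\<dots> \<le> a powr (1 - \<sigma>) * b powr \<sigma>"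
    using assms by (intro mult_mono powr_mono2) auto
  finally show ?thesis .
qed

text \<open>
  The difference \<open>d\<close> of consecutive members oscillates by at most \<open>2^(-\<gamma>n)\<close> and is Lipschitz with constant \<open>2^((1-\<gamma>)n)\<close>.
  Interpolating with weight \<open>\<sigma>\<close> bounds the oscillation by \<open>2^(-(\<gamma>-\<sigma>)n) |x-y|^\<sigma>\<close>, which is summable as \<open>\<sigma> < \<gamma>\<close>.
\<close>

lemma dyadic_holder_on:
  fixes g :: "nat \<Rightarrow> 'a::euclidean_space \<Rightarrow> real"
  assumes dy: "dyadic 0 \<gamma> (ball x0 r) N g" and \<sigma>: "0 < \<sigma>" "\<sigma> < \<gamma>" "\<gamma> \<le> 1"
    and lim: "\<And>x. x \<in> ball x0 r \<Longrightarrow> (\<lambda>n. g n x) \<longlonglongrightarrow> v x"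
  shows "holder_on \<sigma> (ball x0 r) v"
proof -
  let ?B = "ball x0 r"
  obtain C where C: "\<forall>n\<ge>N. \<forall>x\<in>?B. \<bar>g n x - g (Suc n) x\<bar> \<le> C * 2 powr (- \<gamma> * n)"
    using dyadicD(2)[OF dy] by blast
  have "\<exists>C. \<forall>i\<in>Basis. \<forall>n\<ge>N. \<forall>x\<in>?B. \<bar>pd i (g n) x - pd i (g (Suc n)) x\<bar> \<le> C i * 2 powr ((1 - \<gamma>) * n)"
    using dy by (intro bchoice) simp
  then obtain C' where C': "\<And>i n x. i \<in> Basis \<Longrightarrow> n \<ge> N \<Longrightarrow> x \<in> ?B \<Longrightarrow> \<bar>pd i (g n) x - pd i (g (Suc n)) x\<bar> \<le> C' i * 2 powr ((1 - \<gamma>) * n)"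
    by blast
  define A where "A = (\<Sum>i\<in>(Basis::'a set). \<bar>C' i\<bar>)"
  have A0: "A \<ge> 0" unfolding A_def by (rule sum_nonneg) auto
  have sm: "Ck_on 1 UNIV (g n)" for n using dyadicD(1)[OF dy] .
  have df: "g n differentiable (at x)" for n x using sm[of n] by (simp add: Ck_on_Suc_open)
  define d where "d n x = g n x + (-1) * g (Suc n) x" for n x
  have dd: "(\<lambda>x. (-1) * g (Suc n) x) differentiable (at x)" for n x
    using df by (intro differentiable_mult) auto
  have pdd: "pd i (d n) x = pd i (g n) x - pd i (g (Suc n)) x" for i n x
    unfolding d_def by (simp only: pd_add[OF df dd] pd_cmult[OF df])
  have ddf: "d n differentiable (at x)" for n x
    unfolding d_def using df dd by (intro differentiable_add)
  have lip: "\<bar>d n x - d n y\<bar> \<le> A * 2 powr ((1 - \<gamma>) * n) * norm (x - y)" if "n \<ge> N" "x \<in> ?B" "y \<in> ?B" for n x y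
  proof -
    have "\<bar>d n x - d n y\<bar> \<le> (\<Sum>i\<in>Basis. \<bar>C' i\<bar> * 2 powr ((1 - \<gamma>) * n)) * norm (x - y)"
    proof (rule lipschitz_of_pd_bound[OF convex_ball ddf _ _ that(2,3)])
      fix i x assume i: "i \<in> (Basis::'a set)" and x: "x \<in> ?B"
      have "\<bar>pd i (d n) x\<bar> \<le> C' i * 2 powr ((1 - \<gamma>) * n)" unfolding pdd using C'[OF i \<open>n \<ge> N\<close> x] .
      also have "\<dots> \<le> \<bar>C' i\<bar> * 2 powr ((1 - \<gamma>) * n)" by (intro mult_right_mono) auto
      finally show "\<bar>pd i (d n) x\<bar> \<le> \<bar>C' i\<bar> * 2 powr ((1 - \<gamma>) * n)" .
    qed auto
    then show ?thesis by (simp add: A_def sum_distrib_right)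
  qed
  have db: "\<bar>d n x - d n y\<bar> \<le> 2 * \<bar>C\<bar> * 2 powr (- \<gamma> * n)" if "n \<ge> N" "x \<in> ?B" "y \<in> ?B" for n x y
  proof -
    have "\<bar>d n z\<bar> \<le> \<bar>C\<bar> * 2 powr (- \<gamma> * n)" if "z \<in> ?B" for z
    proof -
      have "\<bar>d n z\<bar> \<le> C * 2 powr (- \<gamma> * n)" using C \<open>n \<ge> N\<close> that by (simp add: d_def)
      also have "\<dots> \<le> \<bar>C\<bar> * 2 powr (- \<gamma> * n)" by (intro mult_right_mono) auto
      finally show ?thesis .
    qed
    from this[OF that(2)] this[OF that(3)] show ?thesis by linarith
  qed
  define q where "q = (2::real) powr (- (\<gamma> - \<sigma>))"
  have q: "0 < q" "q < 1" using \<sigma> by (auto simp: q_def powr_less_one)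
  define E where "E = (2 * \<bar>C\<bar>) powr (1 - \<sigma>) * A powr \<sigma>"
  have E0: "E \<ge> 0" by (simp add: E_def)
  have comb: "\<bar>d n x - d n y\<bar> \<le> E * q ^ n * dist x y powr \<sigma>" if "n \<ge> N" "x \<in> ?B" "y \<in> ?B" for n x y
  proof -
    have "\<bar>d n x - d n y\<bar> \<le> (2 * \<bar>C\<bar> * 2 powr (- \<gamma> * n)) powr (1 - \<sigma>) * (A * 2 powr ((1 - \<gamma>) * n) * norm (x - y)) powr \<sigma>"
      using \<sigma> by (intro interpolate_powr db lip that) auto
    also have "\<dots> = E * (2 powr (- \<gamma> * n * (1 - \<sigma>)) * 2 powr ((1 - \<gamma>) * n * \<sigma>)) * dist x y powr \<sigma>"
      using A0 by (simp add: E_def powr_mult powr_powr dist_norm)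
    also have "2 powr (- \<gamma> * n * (1 - \<sigma>)) * 2 powr ((1 - \<gamma>) * n * \<sigma>) = (2::real) powr (- (\<gamma> - \<sigma>) * n)"
      unfolding powr_add[symmetric] by (simp add: algebra_simps)
    also have "\<dots> = q ^ n" unfolding q_def by (rule powr_mult_nat) simp
    finally show ?thesis .
  qed
  obtain L where L: "L \<ge> 0" "\<And>x y. x \<in> ?B \<Longrightarrow> y \<in> ?B \<Longrightarrow> \<bar>g N x - g N y\<bar> \<le> L * norm (x - y)"
    using smooth_lipschitz_ball[OF sm] by metis
  define R where "R = (2 * \<bar>r\<bar>) powr (1 - \<sigma>)"
  have LR: "\<bar>g N x - g N y\<bar> \<le> L * R * dist x y powr \<sigma>" if "x \<in> ?B" "y \<in> ?B" for x y
  proof -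
    have "dist x y \<le> 2 * \<bar>r\<bar>" using that dist_triangle2[of x y x0] by (simp add: dist_commute)
    then have "dist x y \<le> R * dist x y powr \<sigma>"
      unfolding R_def using \<sigma> by (intro interpolate_powr) auto
    then show ?thesis using L(2)[OF that] L(1) mult_left_mono by (fastforce simp: dist_norm mult.assoc)
  qed
  have step: "\<bar>g (N + n) x - g (N + n) y\<bar> \<le> L * R * dist x y powr \<sigma> + (\<Sum>m<n. E * q ^ (N + m) * dist x y powr \<sigma>)"
    if "x \<in> ?B" "y \<in> ?B" for n x y
  proof (induction n)
    case 0 show ?case using LR[OF that] by simp
  next
    case (Suc n)
    have "g (N + Suc n) x - g (N + Suc n) y = (g (N + n) x - g (N + n) y) - (d (N + n) x - d (N + n) y)"
      by (simp add: d_def)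
    then show ?case using Suc comb[of "N + n" x y] that by (simp add: algebra_simps)
  qed
  have step2: "\<bar>g (N + n) x - g (N + n) y\<bar> \<le> (L * R + E / (1 - q)) * dist x y powr \<sigma>" if "x \<in> ?B" "y \<in> ?B" for n x y
  proof -
    have "(\<Sum>m<n. E * q ^ (N + m) * dist x y powr \<sigma>) = E * dist x y powr \<sigma> * q ^ N * (\<Sum>m<n. q ^ m)"
      unfolding sum_distrib_left by (intro sum.cong refl) (simp add: power_add mult_ac)
    also have "\<dots> \<le> E * dist x y powr \<sigma> * 1 * (1 / (1 - q))"
    proof (intro mult_mono mult_nonneg_nonneg sum_nonneg)
      show "q ^ N \<le> 1" using q by (simp add: power_le_one)
      have "(\<Sum>m<n. q ^ m) = (1 - q ^ n) / (1 - q)" using q sum_gp_strict[of q n] by simp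
      also have "\<dots> \<le> 1 / (1 - q)" using q by (intro divide_right_mono) auto
      finally show "(\<Sum>m<n. q ^ m) \<le> 1 / (1 - q)" .
    qed (use E0 q in auto)
    finally show ?thesis using step[OF that, of n] by (simp add: algebra_simps)
  qed
  have "\<bar>v x - v y\<bar> \<le> (L * R + E / (1 - q)) * dist x y powr \<sigma>" if "x \<in> ?B" "y \<in> ?B" for x y
  proof (rule LIMSEQ_le_const2)
    show "(\<lambda>n. \<bar>g (N + n) x - g (N + n) y\<bar>) \<longlonglongrightarrow> \<bar>v x - v y\<bar>"
      using lim[OF that(1)] lim[OF that(2)]
      by (intro tendsto_rabs tendsto_diff) (auto simp: add.commute[of N] intro: LIMSEQ_ignore_initial_segment)
  qed (use step2[OF that] in blast)
  then show ?thesis unfolding holder_on_def by blast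
qed

text \<open>
  By induction the first derivatives converge uniformly to functions in \<open>C^(k,\<sigma>)\<close>, and these are then the
  derivatives of the limit.
\<close>

lemma dyadic_limit:
  fixes g :: "nat \<Rightarrow> 'a::euclidean_space \<Rightarrow> real"
  assumes \<sigma>: "0 < \<sigma>" "\<sigma> < \<gamma>" "\<gamma> \<le> 1"
  shows "dyadic k \<gamma> (ball x0 r) N g \<Longrightarrow> \<exists>v. uniform_limit (ball x0 r) g v sequentially \<and> Ck_holder_loc k \<sigma> (ball x0 r) v"
proof (induction k arbitrary: g)
  case 0
  have \<gamma>: "\<gamma> > 0" using \<sigma> by simp
  obtain v where v: "uniform_limit (ball x0 r) g v sequentially"
    using dyadic_uniform_limit[OF \<gamma>] dyadicD(2)[OF 0] by blast
  have lim: "(\<lambda>n. g n x) \<longlonglongrightarrow> v x" if "x \<in> ball x0 r" for x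
    using tendsto_uniform_limitI[OF v that] .
  have h: "holder_on \<sigma> (ball x0 r) v" using dyadic_holder_on[OF 0 \<sigma> lim] .
  have "continuous_on (ball x0 r) (g n)" for n
    using Ck_on_imp_continuous[OF dyadicD(1)[OF 0]] continuous_on_subset by blast
  then have "continuous_on (ball x0 r) v"
    by (intro uniform_limit_theorem[OF _ v]) auto
  then show ?case using v h
    by (intro exI[of _ v]) (auto simp: holder_on_compacts_iff intro: holder_on_subset)
next
  case (Suc k)
  have \<gamma>: "\<gamma> > 0" using \<sigma> by simp
  obtain v where v: "uniform_limit (ball x0 r) g v sequentially"
    using dyadic_uniform_limit[OF \<gamma>] dyadicD(2)[OF Suc.prems] by blast
  have lim: "(\<lambda>n. g n x) \<longlonglongrightarrow> v x" if "x \<in> ball x0 r" for x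
    using tendsto_uniform_limitI[OF v that] .
  have "\<exists>w. \<forall>i\<in>Basis. uniform_limit (ball x0 r) (\<lambda>n. pd i (g n)) (w i) sequentially \<and> Ck_holder_loc k \<sigma> (ball x0 r) (w i)"
    using Suc.IH Suc.prems by (intro bchoice) simp
  then obtain w where w: "\<And>i. i \<in> Basis \<Longrightarrow> uniform_limit (ball x0 r) (\<lambda>n. pd i (g n)) (w i) sequentially"
    "\<And>i. i \<in> Basis \<Longrightarrow> Ck_holder_loc k \<sigma> (ball x0 r) (w i)" by blast
  have df: "g n differentiable (at x)" for n x using dyadicD(1)[OF Suc.prems, of 1] by (simp add: Ck_on_Suc_open)
  have der: "(v has_derivative (\<lambda>h. \<Sum>i\<in>Basis. (h \<bullet> i) * w i x)) (at x)" if x: "x \<in> ball x0 r" for x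
  proof -
    have "\<exists>G. \<forall>x\<in>ball x0 r. (\<lambda>n. g n x) \<longlonglongrightarrow> G x \<and> (G has_derivative (\<lambda>h. \<Sum>i\<in>Basis. (h \<bullet> i) * w i x)) (at x within ball x0 r)"
    proof (rule has_derivative_sequence[where f=g and f'="\<lambda>n x h. \<Sum>i\<in>Basis. (h \<bullet> i) * pd i (g n) x" and l="v x" and ?x0.0=x])
      show "convex (ball x0 r)" "x \<in> ball x0 r" "(\<lambda>n. g n x) \<longlonglongrightarrow> v x" using x lim by auto
      show "(g n has_derivative (\<lambda>h. \<Sum>i\<in>Basis. (h \<bullet> i) * pd i (g n) x)) (at x within ball x0 r)" for n x
        using has_derivative_pd[OF df] by (rule has_derivative_at_withinI)
      fix e :: real assume e: "e > 0"
      define e' where "e' = e / DIM('a)"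
      have e': "e' > 0" using e by (simp add: e'_def)
      have "\<forall>\<^sub>F n in sequentially. \<forall>i\<in>Basis. \<forall>x\<in>ball x0 r. dist (pd i (g n) x) (w i x) < e'"
        using w(1) e' unfolding uniform_limit_iff by (intro eventually_ball_finite) auto
      then show "\<forall>\<^sub>F n in sequentially. \<forall>x\<in>ball x0 r. \<forall>h. norm ((\<Sum>i\<in>Basis. (h \<bullet> i) * pd i (g n) x) - (\<Sum>i\<in>Basis. (h \<bullet> i) * w i x)) \<le> e * norm h"
      proof eventually_elim
        case (elim n)
        show ?case
        proof (intro ballI allI)
          fix x h assume x: "x \<in> ball x0 r"
          have "(\<Sum>i\<in>Basis. (h \<bullet> i) * pd i (g n) x) - (\<Sum>i\<in>Basis. (h \<bullet> i) * w i x) = (\<Sum>i\<in>Basis. (h \<bullet> i) * (pd i (g n) x - w i x))"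
            by (simp add: sum_subtractf right_diff_distrib)
          also have "\<bar>\<dots>\<bar> \<le> (\<Sum>i\<in>Basis. \<bar>(h \<bullet> i) * (pd i (g n) x - w i x)\<bar>)" by (rule sum_abs)
          also have "\<dots> \<le> (\<Sum>i\<in>(Basis::'a set). norm h * e')"
            unfolding abs_mult using elim x by (intro sum_mono mult_mono) (auto simp: Basis_le_norm dist_real_def less_imp_le)
          also have "\<dots> = e * norm h" by (simp add: e'_def)
          finally show "norm ((\<Sum>i\<in>Basis. (h \<bullet> i) * pd i (g n) x) - (\<Sum>i\<in>Basis. (h \<bullet> i) * w i x)) \<le> e * norm h" by simp
        qed
      qed
    qed
    then obtain G where G: "\<And>x. x \<in> ball x0 r \<Longrightarrow> (\<lambda>n. g n x) \<longlonglongrightarrow> G x"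
      "\<And>x. x \<in> ball x0 r \<Longrightarrow> (G has_derivative (\<lambda>h. \<Sum>i\<in>Basis. (h \<bullet> i) * w i x)) (at x within ball x0 r)" by blast
    have "G y = v y" if "y \<in> ball x0 r" for y using G(1)[OF that] lim[OF that] LIMSEQ_unique by blast
    moreover have "(G has_derivative (\<lambda>h. \<Sum>i\<in>Basis. (h \<bullet> i) * w i x)) (at x)"
      using G(2)[OF x] unfolding at_within_open[OF x open_ball] .
    ultimately show ?thesis using has_derivative_transform_within_open[OF _ open_ball x] by blast
  qed
  have pdv: "pd i v x = w i x" if "x \<in> ball x0 r" "i \<in> Basis" for i x
    using pd_eqI[OF der[OF that(1)], of i] that(2)
    by (simp add: inner_Basis if_distrib[of "\<lambda>c. c * _"] cong: if_cong)
  have "Ck_holder_loc k \<sigma> (ball x0 r) (pd i v)" if "i \<in> Basis" for i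
    using Ck_holder_loc_cong[OF open_ball _ w(2)[OF that]] pdv that by force
  then have "Ck_holder_loc (Suc k) \<sigma> (ball x0 r) v"
    unfolding Ck_holder_loc_Suc_open[OF open_ball] using der differentiable_def by blast
  then show ?case using v by blast
qed

text \<open>
  Only the values of \<open>F\<close> within distance \<open>2^(-n)\<close> of \<open>x\<close> enter, and a constant may be subtracted from \<open>F\<close> if the kernel
  has integral zero. With \<open>c = 0\<close> this is the bound by the local supremum, with \<open>c\<close> a value of \<open>F\<close> near \<open>x\<close> the one by the local oscillation.
\<close>

lemma conv_dil_bound:
  fixes F \<kappa> :: "'a::euclidean_space \<Rightarrow> real"
  assumes F: "integrable lborel F" and k: "kernel \<kappa>" and c: "c = 0 \<or> integral\<^sup>L lborel \<kappa> = 0"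
    and b: "AE y in lborel. y \<in> cball x (1 / 2 ^ n) \<longrightarrow> \<bar>F y - c\<bar> \<le> M"
  shows "\<bar>conv F (dil n \<kappa>) x\<bar> \<le> M * (LINT z|lborel. \<bar>\<kappa> z\<bar>)"
proof -
  note dI = dil_integrable(1)[OF k, of n x]
  have FI: "integrable lborel (\<lambda>y. F y * dil n \<kappa> (x - y))"
    by (rule conv_integrable[OF F Cinfc_C1c[OF Cinfc_dil[OF k]]])
  have z: "c * (LINT y|lborel. dil n \<kappa> (x - y)) = 0"
    using c integral_dil(1)[OF kernel_continuous[OF k], of n x] by auto
  have DI: "integrable lborel (\<lambda>y. (F y - c) * dil n \<kappa> (x - y))"
    unfolding left_diff_distrib using FI dI by simp
  have "conv F (dil n \<kappa>) x = (LINT y|lborel. F y * dil n \<kappa> (x - y)) - c * (LINT y|lborel. dil n \<kappa> (x - y))"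
    unfolding z by (simp add: conv_def)
  also have "\<dots> = (LINT y|lborel. (F y - c) * dil n \<kappa> (x - y))"
    unfolding left_diff_distrib using FI dI by simp
  also have "\<bar>\<dots>\<bar> \<le> (LINT y|lborel. \<bar>(F y - c) * dil n \<kappa> (x - y)\<bar>)" by (rule integral_abs_bound)
  also have "\<dots> \<le> (LINT y|lborel. M * \<bar>dil n \<kappa> (x - y)\<bar>)"
  proof (rule integral_mono_AE)
    show "integrable lborel (\<lambda>y. \<bar>(F y - c) * dil n \<kappa> (x - y)\<bar>)" using DI by (rule integrable_abs)
    show "integrable lborel (\<lambda>y. M * \<bar>dil n \<kappa> (x - y)\<bar>)" using dI by (intro integrable_mult_right integrable_abs)
    show "AE y in lborel. \<bar>(F y - c) * dil n \<kappa> (x - y)\<bar> \<le> M * \<bar>dil n \<kappa> (x - y)\<bar>"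
      using b
    proof eventually_elim
      case (elim y)
      show ?case
      proof (cases "y \<in> cball x (1 / 2 ^ n)")
        case True
        then show ?thesis using elim by (auto simp: abs_mult intro!: mult_right_mono)
      next
        case False
        then have "dil n \<kappa> (x - y) = 0" by (intro dil_zero[OF k]) (simp add: dist_norm)
        then show ?thesis by simp
      qed
    qed
  qed
  also have "\<dots> = M * (LINT y|lborel. \<bar>dil n \<kappa> (x - y)\<bar>)" by simp
  also have "(LINT y|lborel. \<bar>dil n \<kappa> (x - y)\<bar>) = (LINT z|lborel. \<bar>\<kappa> z\<bar>)"
    using integral_dil(1)[of "\<lambda>z. \<bar>\<kappa> z\<bar>" n x] kernel_continuous[OF k]
    by (simp add: dil_def abs_mult continuous_on_rabs)
  finally show ?thesis .
qed

lemma pd_difference_conv: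
  fixes F \<kappa> :: "'j \<Rightarrow> 'a::euclidean_space \<Rightarrow> real"
  assumes B: "open B" and J: "finite J" and F: "\<And>j. j \<in> J \<Longrightarrow> integrable lborel (F j)" and k: "\<And>j. j \<in> J \<Longrightarrow> kernel (\<kappa> j)"
    and sm: "Ck_on 1 UNIV g" "Ck_on 1 UNIV g'"
    and eq: "\<And>x. x \<in> B \<Longrightarrow> g x - g' x = c * (\<Sum>j\<in>J. conv (F j) (dil n (\<kappa> j)) x)"
    and x: "x \<in> B" and i: "i \<in> Basis"
  shows "pd i g x - pd i g' x = c * 2 ^ n * (\<Sum>j\<in>J. conv (F j) (dil n (pd i (\<kappa> j))) x)"
proof -
  have d: "g differentiable (at x)" "g' differentiable (at x)" using sm by (auto simp: Ck_on_Suc_open)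
  have d': "(\<lambda>x. (-1) * g' x) differentiable (at x)" using d by (intro differentiable_mult) auto
  have dc: "conv (F j) (dil n (\<kappa> j)) differentiable (at x)" if "j \<in> J" for j
    using conv_differentiable[OF F[OF that] Cinfc_C1c[OF Cinfc_dil[OF k[OF that]]]] .
  have ds: "(\<lambda>x. \<Sum>j\<in>J. conv (F j) (dil n (\<kappa> j)) x) differentiable (at x)"
    using dc J by (intro differentiable_sum) auto
  have "pd i g x - pd i g' x = pd i (\<lambda>x. g x + (-1) * g' x) x"
    by (simp only: pd_add[OF d(1) d'] pd_cmult[OF d(2)])
  also have "\<dots> = pd i (\<lambda>x. c * (\<Sum>j\<in>J. conv (F j) (dil n (\<kappa> j)) x)) x"
    using eq by (intro pd_cong_open[OF B _ x]) simp
  also have "\<dots> = c * (\<Sum>j\<in>J. pd i (conv (F j) (dil n (\<kappa> j))) x)"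
    by (simp only: pd_cmult[OF ds] pd_sum[OF J dc])
  also have "(\<Sum>j\<in>J. pd i (conv (F j) (dil n (\<kappa> j))) x) = (\<Sum>j\<in>J. 2 ^ n * conv (F j) (dil n (pd i (\<kappa> j))) x)"
    using pd_conv_dil[OF F k i] by (intro sum.cong) auto
  finally show ?thesis by (simp add: sum_distrib_left mult.assoc)
qed

text \<open>
  If the differences are \<open>2^(-(k+e)n)\<close> times convolutions with dilated kernels, then \<open>k\<close> derivatives leave the factor
  \<open>2^(-en)\<close> and turn the kernels into derivatives, which have integral zero; only then is the gain \<open>2^(-\<beta>n)\<close>
  available. For \<open>k = 0\<close> nothing is differentiated, hence the extra hypothesis on the kernels.
\<close>

lemma dyadic_of_conv:
  fixes F \<kappa> :: "'j \<Rightarrow> 'a::euclidean_space \<Rightarrow> real" and g :: "nat \<Rightarrow> 'a \<Rightarrow> real"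
  assumes B: "open B" and J: "finite J" and F: "\<And>j. j \<in> J \<Longrightarrow> integrable lborel (F j)"
    and bd: "\<And>j \<kappa>. j \<in> J \<Longrightarrow> kernel \<kappa> \<Longrightarrow> \<exists>C. \<forall>n\<ge>N. \<forall>x\<in>B. \<bar>conv (F j) (dil n \<kappa>) x\<bar> \<le> C"
    and hd: "\<And>j \<kappa>. j \<in> J \<Longrightarrow> kernel \<kappa> \<Longrightarrow> integral\<^sup>L lborel \<kappa> = 0 \<Longrightarrow>
        \<exists>C. \<forall>n\<ge>N. \<forall>x\<in>B. \<bar>conv (F j) (dil n \<kappa>) x\<bar> \<le> C * 2 powr (- \<beta> * n)"
    and \<beta>: "0 \<le> \<beta>" "real e + \<beta> \<le> 1"
  shows "(\<And>j. j \<in> J \<Longrightarrow> kernel (\<kappa> j)) \<Longrightarrow> (\<And>n k. Ck_on k UNIV (g n)) \<Longrightarrow>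
     (k = 0 \<longrightarrow> (\<forall>j\<in>J. integral\<^sup>L lborel (\<kappa> j) = 0)) \<Longrightarrow>
     (\<And>n x. n \<ge> N \<Longrightarrow> x \<in> B \<Longrightarrow> g n x - g (Suc n) x = (1 / 2 ^ ((k + e) * n)) * (\<Sum>j\<in>J. conv (F j) (dil n (\<kappa> j)) x)) \<Longrightarrow>
     dyadic k (real e + \<beta>) B N g"
proof (induction k arbitrary: g \<kappa>)
  case 0
  have sum_bd: "\<exists>C. \<forall>n\<ge>N. \<forall>x\<in>B. \<bar>\<Sum>j\<in>J. conv (F j) (dil n (\<theta> j)) x\<bar> \<le> C * 2 powr (- \<beta> * n)"
    if th: "\<And>j. j \<in> J \<Longrightarrow> kernel (\<theta> j)" "\<And>j. j \<in> J \<Longrightarrow> integral\<^sup>L lborel (\<theta> j) = 0" for \<theta> :: "'j \<Rightarrow> 'a \<Rightarrow> real"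
  proof -
    have "\<exists>C. \<forall>j\<in>J. \<forall>n\<ge>N. \<forall>x\<in>B. \<bar>conv (F j) (dil n (\<theta> j)) x\<bar> \<le> C j * 2 powr (- \<beta> * n)"
      using hd th by (intro bchoice) auto
    then obtain C where C: "\<And>j n x. j \<in> J \<Longrightarrow> n \<ge> N \<Longrightarrow> x \<in> B \<Longrightarrow> \<bar>conv (F j) (dil n (\<theta> j)) x\<bar> \<le> C j * 2 powr (- \<beta> * n)"
      by blast
    have "\<bar>\<Sum>j\<in>J. conv (F j) (dil n (\<theta> j)) x\<bar> \<le> (\<Sum>j\<in>J. C j) * 2 powr (- \<beta> * n)" if "n \<ge> N" "x \<in> B" for n x
    proof -
      have "\<bar>\<Sum>j\<in>J. conv (F j) (dil n (\<theta> j)) x\<bar> \<le> (\<Sum>j\<in>J. \<bar>conv (F j) (dil n (\<theta> j)) x\<bar>)" by (rule sum_abs)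
      also have "\<dots> \<le> (\<Sum>j\<in>J. C j * 2 powr (- \<beta> * n))" using C that by (intro sum_mono)
      finally show ?thesis by (simp add: sum_distrib_right)
    qed
    then show ?thesis by blast
  qed
  have pw: "1 / 2 ^ (e * n) * (2 powr (- \<beta> * n)) = (2::real) powr (- (real e + \<beta>) * n)" for n
  proof -
    have "(1::real) / 2 ^ (e * n) = 2 powr (- (real e * real n))"
      by (simp add: powr_minus powr_realpow[symmetric] field_simps)
    then show ?thesis by (simp add: powr_add[symmetric] algebra_simps)
  qed
  have pw2: "2 ^ n * (2::real) powr (- (real e + \<beta>) * n) = 2 powr ((1 - (real e + \<beta>)) * n)" for n
    by (simp add: powr_realpow[symmetric] powr_add[symmetric] algebra_simps)
  have 1: "\<exists>C. \<forall>n\<ge>N. \<forall>x\<in>B. \<bar>g n x - g (Suc n) x\<bar> \<le> C * 2 powr (- (real e + \<beta>) * n)"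
  proof -
    obtain C where C: "\<forall>n\<ge>N. \<forall>x\<in>B. \<bar>\<Sum>j\<in>J. conv (F j) (dil n (\<kappa> j)) x\<bar> \<le> C * 2 powr (- \<beta> * n)"
      using sum_bd[of \<kappa>] 0 by auto
    have "\<bar>g n x - g (Suc n) x\<bar> \<le> C * 2 powr (- (real e + \<beta>) * n)" if "n \<ge> N" "x \<in> B" for n x
    proof -
      have "\<bar>g n x - g (Suc n) x\<bar> = 1 / 2 ^ (e * n) * \<bar>\<Sum>j\<in>J. conv (F j) (dil n (\<kappa> j)) x\<bar>"
        using 0(4)[OF that] by (simp add: abs_mult)
      also have "\<dots> \<le> 1 / 2 ^ (e * n) * (C * 2 powr (- \<beta> * n))" using C that by (intro mult_left_mono) auto
      also have "\<dots> = C * (1 / 2 ^ (e * n) * (2 powr (- \<beta> * n)))" by simp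
      finally show ?thesis unfolding pw .
    qed
    then show ?thesis by blast
  qed
  have 2: "\<exists>C. \<forall>n\<ge>N. \<forall>x\<in>B. \<bar>pd i (g n) x - pd i (g (Suc n)) x\<bar> \<le> C * 2 powr ((1 - (real e + \<beta>)) * n)"
    if i: "i \<in> Basis" for i
  proof -
    have "kernel (pd i (\<kappa> j))" "integral\<^sup>L lborel (pd i (\<kappa> j)) = 0" if "j \<in> J" for j
      using 0(1)[OF that] i kernel_pd integral_pd_C1c Cinfc_C1c kernel_Cinfc by blast+
    then obtain C where C: "\<forall>n\<ge>N. \<forall>x\<in>B. \<bar>\<Sum>j\<in>J. conv (F j) (dil n (pd i (\<kappa> j))) x\<bar> \<le> C * 2 powr (- \<beta> * n)"
      using sum_bd[of "\<lambda>j. pd i (\<kappa> j)"] by blast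
    have "\<bar>pd i (g n) x - pd i (g (Suc n)) x\<bar> \<le> C * 2 powr ((1 - (real e + \<beta>)) * n)" if "n \<ge> N" "x \<in> B" for n x
    proof -
      have "pd i (g n) x - pd i (g (Suc n)) x = 1 / 2 ^ (e * n) * 2 ^ n * (\<Sum>j\<in>J. conv (F j) (dil n (pd i (\<kappa> j))) x)"
        using 0(4)[OF that(1)] by (intro pd_difference_conv[OF B J F 0(1) 0(2) 0(2) _ that(2) i]) auto
      then have "\<bar>pd i (g n) x - pd i (g (Suc n)) x\<bar> = 1 / 2 ^ (e * n) * 2 ^ n * \<bar>\<Sum>j\<in>J. conv (F j) (dil n (pd i (\<kappa> j))) x\<bar>"
        by (simp add: abs_mult)
      also have "\<dots> \<le> 1 / 2 ^ (e * n) * 2 ^ n * (C * 2 powr (- \<beta> * n))" using C that by (intro mult_left_mono) auto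
      also have "\<dots> = C * (2 ^ n * (1 / 2 ^ (e * n) * (2 powr (- \<beta> * n))))" by simp
      finally show ?thesis unfolding pw pw2 .
    qed
    then show ?thesis by blast
  qed
  show ?case using 0(2) 1 2 by simp
next
  case (Suc k)
  have "\<exists>C. \<forall>j\<in>J. \<forall>n\<ge>N. \<forall>x\<in>B. \<bar>conv (F j) (dil n (\<kappa> j)) x\<bar> \<le> C j"
    using bd Suc.prems(1) by (intro bchoice) auto
  then obtain C where C: "\<And>j n x. j \<in> J \<Longrightarrow> n \<ge> N \<Longrightarrow> x \<in> B \<Longrightarrow> \<bar>conv (F j) (dil n (\<kappa> j)) x\<bar> \<le> C j"
    by blast
  have 1: "\<bar>g n x - g (Suc n) x\<bar> \<le> (\<Sum>j\<in>J. \<bar>C j\<bar>) * 2 powr (- (real e + \<beta>) * n)" if "n \<ge> N" "x \<in> B" for n x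
  proof -
    have "\<bar>\<Sum>j\<in>J. conv (F j) (dil n (\<kappa> j)) x\<bar> \<le> (\<Sum>j\<in>J. \<bar>conv (F j) (dil n (\<kappa> j)) x\<bar>)" by (rule sum_abs)
    also have "\<dots> \<le> (\<Sum>j\<in>J. \<bar>C j\<bar>)" using C[OF _ that] by (intro sum_mono) (meson abs_ge_self order_trans)
    finally have b: "\<bar>\<Sum>j\<in>J. conv (F j) (dil n (\<kappa> j)) x\<bar> \<le> (\<Sum>j\<in>J. \<bar>C j\<bar>)" .
    have "\<bar>g n x - g (Suc n) x\<bar> = 1 / 2 ^ ((Suc k + e) * n) * \<bar>\<Sum>j\<in>J. conv (F j) (dil n (\<kappa> j)) x\<bar>"
      using Suc.prems(4)[OF that] by (simp add: abs_mult)
    also have "\<dots> \<le> 2 powr (- (real e + \<beta>) * n) * (\<Sum>j\<in>J. \<bar>C j\<bar>)"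
    proof (rule mult_mono[OF _ b])
      have "(1::real) / 2 ^ ((Suc k + e) * n) = 2 powr (- (real (Suc k + e) * real n))"
        by (simp only: powr_minus powr_realpow[symmetric] of_nat_mult inverse_eq_divide zero_less_numeral)
      also have "\<dots> \<le> 2 powr (- (real e + \<beta>) * n)"
      proof (rule powr_mono)
        have "(real e + \<beta>) * real n \<le> real (Suc k + e) * real n" using \<beta> by (intro mult_right_mono) auto
        then show "- (real (Suc k + e) * real n) \<le> - (real e + \<beta>) * real n"
          by (simp only: mult_minus_left neg_le_iff_le)
      qed simp
      finally show "(1::real) / 2 ^ ((Suc k + e) * n) \<le> 2 powr (- (real e + \<beta>) * n)" .
    qed auto
    finally show ?thesis by (simp add: mult.commute)
  qed
  have 2: "dyadic k (real e + \<beta>) B N (\<lambda>n. pd i (g n))" if i: "i \<in> Basis" for i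
  proof (rule Suc.IH[of "\<lambda>j. pd i (\<kappa> j)"])
    show "kernel (pd i (\<kappa> j))" if "j \<in> J" for j using kernel_pd Suc.prems(1)[OF that] i by blast
    show "Ck_on l UNIV (pd i (g n))" for n l using Suc.prems(2)[of "Suc l" n] i Ck_on_pd by blast
    show "k = 0 \<longrightarrow> (\<forall>j\<in>J. integral\<^sup>L lborel (pd i (\<kappa> j)) = 0)"
      using Suc.prems(1) i integral_pd_C1c Cinfc_C1c kernel_Cinfc by blast
    fix n x assume n: "n \<ge> N" and x: "x \<in> B"
    have "pd i (g n) x - pd i (g (Suc n)) x = 1 / 2 ^ ((Suc k + e) * n) * 2 ^ n * (\<Sum>j\<in>J. conv (F j) (dil n (pd i (\<kappa> j))) x)"
      using Suc.prems(4)[OF n] by (intro pd_difference_conv[OF B J F Suc.prems(1) Suc.prems(2) Suc.prems(2) _ x i]) auto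
    also have "1 / 2 ^ ((Suc k + e) * n) * 2 ^ n = (1::real) / 2 ^ ((k + e) * n)"
      by (simp add: power_add)
    finally show "pd i (g n) x - pd i (g (Suc n)) x = 1 / 2 ^ ((k + e) * n) * (\<Sum>j\<in>J. conv (F j) (dil n (pd i (\<kappa> j))) x)" .
  qed
  show ?case unfolding dyadic.simps using Suc.prems(2) 1 2 by blast
qed

section \<open>Singular integrals of order below the dimension\<close>

lemma ball_sets_borel [measurable]: "ball x r \<in> sets borel" "cball x r \<in> sets borel"
  for x :: "'a::euclidean_space" by simp_all

lemma powr_neg_bound_dyadic:
  fixes t b :: real
  assumes "0 < t" "t \<le> 1" "0 \<le> b"
  obtains n where "t \<le> 1 / 2 ^ n" "t powr (- b) \<le> 2 powr b * (2 powr b) ^ n"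
proof -
  define P where "P n \<longleftrightarrow> 1 / 2 ^ Suc n < t" for n :: nat
  have "\<exists>n. P n"
  proof -
    obtain n where "(1/2::real) ^ n < t" using real_arch_pow_inv[of t "1/2"] assms by auto
    moreover have "(1/2::real) ^ Suc n \<le> (1/2) ^ n" by simp
    ultimately show ?thesis unfolding P_def by (intro exI[of _ n]) (simp add: power_one_over)
  qed
  define n where "n = (LEAST n. P n)"
  have Pn: "P n" unfolding n_def using \<open>\<exists>n. P n\<close> by (rule LeastI_ex)
  have le: "t \<le> 1 / 2 ^ n"
  proof (cases n)
    case 0 then show ?thesis using assms by simp
  next
    case (Suc m)
    then have "\<not> P m" unfolding n_def by (metis lessI not_less_Least)
    then show ?thesis unfolding P_def Suc by simp
  qed
  have "t powr (- b) \<le> (1 / 2 ^ Suc n) powr (- b)"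
    using Pn assms unfolding P_def by (intro powr_mono2') auto
  also have "\<dots> = 2 powr (real (Suc n) * b)"
  proof -
    have h: "(1::real) / 2 ^ Suc n = 2 powr (- real (Suc n))"
      by (simp only: powr_minus powr_realpow zero_less_numeral inverse_eq_divide)
    show ?thesis unfolding h powr_powr by (simp add: algebra_simps)
  qed
  also have "\<dots> = 2 powr b * (2 powr b) ^ n"
    by (simp add: powr_add[symmetric] algebra_simps powr_mult_nat[symmetric])
  finally show ?thesis using that le by blast
qed

lemma le_suminf_ennreal: "f n \<le> (\<Sum>n. f n)" for f :: "nat \<Rightarrow> ennreal"
  using sum_le_suminf[OF summableI, of "{n}" f] by simp

text \<open>
  Where \<open>|x-y| \<le> 1\<close>, the integrand is dominated by the step function with values \<open>2^(b(n+1))\<close> on the balls of radius \<open>2^(-n)\<close>,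
  whose integrals form a geometric series with ratio \<open>2^(b-d)\<close>. This keeps the bound independent of \<open>y\<close> and avoids polar coordinates.
\<close>

lemma nn_integral_singular_bound:
  fixes x0 :: "'a::euclidean_space"
  assumes "0 \<le> b" "b < real DIM('a)"
  shows "\<exists>C. \<forall>y. (\<integral>\<^sup>+x. ennreal (norm (x - y) powr (- b)) * indicator (ball x0 R) x \<partial>lborel) \<le> ennreal C"
proof -
  define V where "V = unit_ball_vol (real DIM('a))"
  have V: "V \<ge> 0" unfolding V_def by simp
  define q where "q = (2::real) powr (b - real DIM('a))"
  have q: "0 < q" "q < 1" using assms by (auto simp: q_def powr_less_one)
  have em: "emeasure lborel (cball y (1 / 2 ^ n)) = ennreal (V * (1 / 2 ^ n) ^ DIM('a))" for y :: 'a and n :: nat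
    unfolding V_def by (rule emeasure_cball) simp
  have pt: "ennreal (norm (x - y) powr (- b)) * indicator (ball x0 R) x
      \<le> indicator (ball x0 R) x + (\<Sum>n. ennreal (2 powr b * (2 powr b) ^ n) * indicator (cball y (1 / 2 ^ n)) x)" for x y
  proof (cases "x = y \<or> 1 < norm (x - y)")
    case True
    have "norm (x - y) powr (- b) \<le> 1"
    proof (cases "x = y")
      case False
      then have "norm (x - y) powr (- b) \<le> norm (x - y) powr 0" using True assms by (intro powr_mono) auto
      then show ?thesis using False by simp
    qed simp
    then have "ennreal (norm (x - y) powr (- b)) * indicator (ball x0 R) x \<le> indicator (ball x0 R) x"
      by (auto simp: indicator_def)
    then show ?thesis by (rule order_trans) simp
  next
    case False
    then have t: "0 < norm (x - y)" "norm (x - y) \<le> 1" by auto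
    obtain n where n: "norm (x - y) \<le> 1 / 2 ^ n" "norm (x - y) powr (- b) \<le> 2 powr b * (2 powr b) ^ n"
      using powr_neg_bound_dyadic[OF t assms(1)] by blast
    have "ennreal (norm (x - y) powr (- b)) * indicator (ball x0 R) x \<le> ennreal (norm (x - y) powr (- b))"
      by (auto simp: indicator_def)
    also have "\<dots> \<le> ennreal (2 powr b * (2 powr b) ^ n) * indicator (cball y (1 / 2 ^ n)) x"
      using n by (auto simp: dist_norm norm_minus_commute intro!: ennreal_leI)
    also have "\<dots> \<le> (\<Sum>n. ennreal (2 powr b * (2 powr b) ^ n) * indicator (cball y (1 / 2 ^ n)) x)"
      by (rule le_suminf_ennreal)
    finally show ?thesis by (rule order_trans) simp
  qed
  define C where "C = measure lborel (ball x0 R) + 2 powr b * V * (1 / (1 - q))"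
  have "(\<integral>\<^sup>+x. ennreal (norm (x - y) powr (- b)) * indicator (ball x0 R) x \<partial>lborel) \<le> ennreal C" for y
  proof -
    have "(\<integral>\<^sup>+x. ennreal (norm (x - y) powr (- b)) * indicator (ball x0 R) x \<partial>lborel)
      \<le> (\<integral>\<^sup>+x. indicator (ball x0 R) x + (\<Sum>n. ennreal (2 powr b * (2 powr b) ^ n) * indicator (cball y (1 / 2 ^ n)) x) \<partial>lborel)"
      by (intro nn_integral_mono pt)
    also have "\<dots> = emeasure lborel (ball x0 R) + (\<Sum>n. ennreal (2 powr b * (2 powr b) ^ n) * emeasure lborel (cball y (1 / 2 ^ n)))"
      by (subst nn_integral_add, simp, simp, subst nn_integral_suminf, simp) (simp add: nn_integral_cmult_indicator)
    also have "(\<lambda>n. ennreal (2 powr b * (2 powr b) ^ n) * emeasure lborel (cball y (1 / 2 ^ n))) = (\<lambda>n. ennreal (2 powr b * V * q ^ n))"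
    proof
      fix n
      have "(2 powr b) ^ n * (1 / 2 ^ n) ^ DIM('a) = q ^ n"
      proof -
        have "q ^ n = (2 powr b * (1 / 2 ^ DIM('a))) ^ n"
          by (simp add: q_def powr_diff powr_realpow)
        then show ?thesis by (simp add: power_mult_distrib power_divide power_mult[symmetric] mult.commute)
      qed
      then have e: "2 powr b * (2 powr b) ^ n * (V * (1 / 2 ^ n) ^ DIM('a)) = 2 powr b * V * q ^ n"
        by (simp add: mult_ac)
      show "ennreal (2 powr b * (2 powr b) ^ n) * emeasure lborel (cball y (1 / 2 ^ n)) = ennreal (2 powr b * V * q ^ n)"
        unfolding em e[symmetric] using V by (intro ennreal_mult[symmetric]) auto
    qed
    also have "(\<Sum>n. ennreal (2 powr b * V * q ^ n)) = ennreal (2 powr b * V * (1 / (1 - q)))"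
      using q V by (subst suminf_ennreal2) (auto intro!: summable_mult summable_geometric simp: suminf_mult summable_geometric suminf_geometric)
    also have "emeasure lborel (ball x0 R) = ennreal (measure lborel (ball x0 R))"
      using emeasure_bounded_finite[OF bounded_ball, of x0 R] by (intro emeasure_eq_ennreal_measure) simp
    finally show ?thesis unfolding C_def using q V by (simp add: ennreal_plus)
  qed
  then show ?thesis by blast
qed

text \<open>
  One of the two distances is at least \<open>|y-z|/2\<close>. There \<open>\<theta>\<close> of the exponent is traded for \<open>|y-z|^(-\<theta>)\<close>, and the rest
  is moved to the smaller distance.
\<close>

lemma singular_product_bound:
  fixes x y z :: "'a::euclidean_space"
  assumes "0 \<le> th" "th \<le> a" "th \<le> th'" "y \<noteq> z"
  shows "norm (x - y) powr (- a) * norm (x - z) powr (- th')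
    \<le> 2 powr th * norm (y - z) powr (- th) * (norm (x - y) powr (- (a + th' - th)) + norm (x - z) powr (- (a + th' - th)))"
proof (cases "x = y \<or> x = z")
  case True then show ?thesis by auto
next
  case False
  have main: "s powr (- a1) * t powr (- a2) \<le> 2 powr th * D powr (- th) * s powr (- (a1 + a2 - th))"
    if "0 < s" "s \<le> t" "0 < D" "D \<le> s + t" "th \<le> a2" for s t D a1 a2 :: real
  proof -
    have "t powr (- a2) = t powr (- th) * t powr (- (a2 - th))" using that by (simp add: powr_add[symmetric])
    also have "\<dots> \<le> (D / 2) powr (- th) * s powr (- (a2 - th))"
      using that assms by (intro mult_mono powr_mono2') auto
    also have "(D / 2) powr (- th) = 2 powr th * D powr (- th)"
      using that by (simp add: powr_divide powr_minus field_simps)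
    finally have "s powr (- a1) * t powr (- a2) \<le> s powr (- a1) * (2 powr th * D powr (- th) * s powr (- (a2 - th)))"
      by (intro mult_left_mono) auto
    also have "\<dots> = 2 powr th * D powr (- th) * (s powr (- a1) * s powr (- (a2 - th)))" by simp
    also have "s powr (- a1) * s powr (- (a2 - th)) = s powr (- (a1 + a2 - th))"
      by (simp add: powr_add[symmetric] algebra_simps)
    finally show ?thesis .
  qed
  have tri: "norm (y - z) \<le> norm (x - y) + norm (x - z)"
    using norm_triangle_ineq4[of "x - z" "x - y"] by simp
  have pos: "0 \<le> 2 powr th * norm (y - z) powr (- th)" by simp
  show ?thesis
  proof (cases "norm (x - y) \<le> norm (x - z)")
    case True
    then have "norm (x - y) powr (- a) * norm (x - z) powr (- th')
      \<le> 2 powr th * norm (y - z) powr (- th) * norm (x - y) powr (- (a + th' - th))"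
      using False assms tri by (intro main) auto
    also have "\<dots> \<le> 2 powr th * norm (y - z) powr (- th) * (norm (x - y) powr (- (a + th' - th)) + norm (x - z) powr (- (a + th' - th)))"
      by (intro mult_left_mono pos) simp
    finally show ?thesis .
  next
    case F: False
    then have "norm (x - z) powr (- th') * norm (x - y) powr (- a)
      \<le> 2 powr th * norm (y - z) powr (- th) * norm (x - z) powr (- (th' + a - th))"
      using False assms tri by (intro main) auto
    also have "\<dots> \<le> 2 powr th * norm (y - z) powr (- th) * (norm (x - y) powr (- (a + th' - th)) + norm (x - z) powr (- (a + th' - th)))"
      by (intro mult_left_mono pos) (simp add: add.commute)
    finally show ?thesis by (simp add: mult.commute)
  qed
qed

lemma singular_composition:
  fixes x0 :: "'a::euclidean_space"
  assumes "0 \<le> th" "th \<le> a" "th \<le> th'" "a + th' - th < real DIM('a)"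
  shows "\<exists>C\<ge>0. \<forall>y z. y \<noteq> z \<longrightarrow> (\<integral>\<^sup>+x. ennreal (norm (x - y) powr (- a) * norm (x - z) powr (- th')) * indicator (ball x0 r) x \<partial>lborel)
       \<le> ennreal (C * norm (y - z) powr (- th))"
proof -
  let ?b = "a + th' - th"
  obtain C where C: "\<And>y. (\<integral>\<^sup>+x. ennreal (norm (x - y) powr (- ?b)) * indicator (ball x0 r) x \<partial>lborel) \<le> ennreal C"
    using nn_integral_singular_bound[of ?b x0 r] assms by auto
  define D where "D = 2 powr th * (\<bar>C\<bar> + \<bar>C\<bar>)"
  have C': "(\<integral>\<^sup>+x. ennreal (norm (x - y) powr (- ?b)) * indicator (ball x0 r) x \<partial>lborel) \<le> ennreal \<bar>C\<bar>" for y
    using C[of y] by (rule order_trans) (simp add: ennreal_leI)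
  have "(\<integral>\<^sup>+x. ennreal (norm (x - y) powr (- a) * norm (x - z) powr (- th')) * indicator (ball x0 r) x \<partial>lborel)
       \<le> ennreal (D * norm (y - z) powr (- th))" if "y \<noteq> z" for y z
  proof -
    let ?k = "ennreal (2 powr th * norm (y - z) powr (- th))"
    have "(\<integral>\<^sup>+x. ennreal (norm (x - y) powr (- a) * norm (x - z) powr (- th')) * indicator (ball x0 r) x \<partial>lborel)
      \<le> (\<integral>\<^sup>+x. ?k * (ennreal (norm (x - y) powr (- ?b)) * indicator (ball x0 r) x + ennreal (norm (x - z) powr (- ?b)) * indicator (ball x0 r) x) \<partial>lborel)"
    proof (rule nn_integral_mono)
      fix x
      have "ennreal (norm (x - y) powr (- a) * norm (x - z) powr (- th'))
        \<le> ennreal (2 powr th * norm (y - z) powr (- th) * (norm (x - y) powr (- ?b) + norm (x - z) powr (- ?b)))"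
        using singular_product_bound[OF assms(1-3) that] by (intro ennreal_leI)
      also have "\<dots> = ?k * (ennreal (norm (x - y) powr (- ?b)) + ennreal (norm (x - z) powr (- ?b)))"
        by (subst ennreal_mult) auto
      finally show "ennreal (norm (x - y) powr (- a) * norm (x - z) powr (- th')) * indicator (ball x0 r) x
        \<le> ?k * (ennreal (norm (x - y) powr (- ?b)) * indicator (ball x0 r) x + ennreal (norm (x - z) powr (- ?b)) * indicator (ball x0 r) x)"
        by (auto simp: indicator_def)
    qed
    also have "\<dots> = ?k * ((\<integral>\<^sup>+x. ennreal (norm (x - y) powr (- ?b)) * indicator (ball x0 r) x \<partial>lborel)
        + (\<integral>\<^sup>+x. ennreal (norm (x - z) powr (- ?b)) * indicator (ball x0 r) x \<partial>lborel))"
      by (simp add: nn_integral_cmult nn_integral_add)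
    also have "\<dots> \<le> ?k * (ennreal \<bar>C\<bar> + ennreal \<bar>C\<bar>)"
      by (intro mult_left_mono add_mono C') auto
    also have "\<dots> = ennreal (D * norm (y - z) powr (- th))"
      unfolding D_def by (subst ennreal_plus[symmetric], simp, simp, subst ennreal_mult[symmetric]) (auto simp: mult_ac)
    finally show ?thesis .
  qed
  then show ?thesis by (intro exI[of _ D]) (auto simp: D_def)
qed

section \<open>Bootstrapping an inequality of Riesz potential type\<close>

text \<open>
  Interpolation of the kernel \<open>t^(-D)\<close> between a weaker and a stronger singularity with a free weight \<open>c\<close>: either the
  first term already dominates, or \<open>t^(\<theta>-D) > c\<close>, and then the factor \<open>c^(1-p)\<close> outweighs \<open>t^((\<theta>-D)(1-p))\<close>.
\<close>

lemma riesz_split: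
  fixes t c th p :: real
  assumes t: "0 \<le> t" and c: "c > 0" and p: "1 < p"
  shows "t powr (- D) \<le> c * t powr (- th) + c powr (- (p - 1)) * t powr (- (p * D - th * (p - 1)))"
proof (cases "t = 0")
  case False
  then have t: "t > 0" using t by simp
  show ?thesis
  proof (cases "t powr (- D) \<le> c * t powr (- th)")
    case True then show ?thesis by (rule order_trans) simp
  next
    case F: False
    have "c = c * t powr (- th) * t powr th" using t by (simp add: powr_minus)
    also have "\<dots> \<le> t powr (- D) * t powr th" using F by (intro mult_right_mono) auto
    also have "\<dots> = t powr (th - D)" by (simp add: powr_add[symmetric])
    finally have "(t powr (th - D)) powr (- (p - 1)) \<le> c powr (- (p - 1))"
      using c p by (intro powr_mono2') auto
    then have "(t powr (th - D)) powr (- (p - 1)) * t powr (- (p * D - th * (p - 1))) \<le> c powr (- (p - 1)) * t powr (- (p * D - th * (p - 1)))"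
      by (rule mult_right_mono) simp
    moreover have "(t powr (th - D)) powr (- (p - 1)) * t powr (- (p * D - th * (p - 1))) = t powr (- D)"
      by (simp add: powr_powr powr_add[symmetric] algebra_simps)
    ultimately have "t powr (- D) \<le> c powr (- (p - 1)) * t powr (- (p * D - th * (p - 1)))" by simp
    then show ?thesis using c by (smt (verit) mult_nonneg_nonneg powr_ge_zero)
  qed
qed simp

text \<open>
  Values in the extended reals, since finiteness of these potentials is what has to be proved.
\<close>

definition riesz_potential :: "real \<Rightarrow> 'a::euclidean_space \<Rightarrow> real \<Rightarrow> ('a \<Rightarrow> real) \<Rightarrow> 'a \<Rightarrow> ennreal" where
  "riesz_potential th x0 r H z = (\<integral>\<^sup>+y. ennreal (H y * norm (y - z) powr (- th)) * indicator (ball x0 r) y \<partial>lborel)"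

lemma riesz_potential_measurable [measurable]:
  fixes x0 :: "'a::euclidean_space"
  assumes [measurable]: "H \<in> borel_measurable borel"
  shows "riesz_potential th x0 r H \<in> borel_measurable borel"
  unfolding riesz_potential_def[abs_def] by measurable

text \<open>
  Let \<open>H = 1 + v^p\<close>, and suppose its potential of order \<open>\<theta>\<close> is bounded. Splitting the kernel of order \<open>D\<close> by
  \<open>riesz_split\<close>, with a weight chosen depending on the point, gives \<open>v \<le> const (1 + Z)^(1/p)\<close> for the potential \<open>Z\<close> of \<open>H\<close> of order
  \<open>a = pD - \<theta>(p-1)\<close>, that is, \<open>H \<le> K (1 + Z)\<close>: the nonlinear inequality has become linear. Composing with the kernel of order
  \<open>\<theta>'\<close> leads back to the potential of order \<open>\<theta>\<close> as long as \<open>a + \<theta>' - \<theta> < d\<close>.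
\<close>

lemma bootstrap_step:
  fixes x0 :: "'a::euclidean_space" and v :: "'a \<Rightarrow> real"
  assumes v[measurable]: "v \<in> borel_measurable borel" and vn: "\<And>x. 0 \<le> v x"
    and p: "1 < p" and th: "0 \<le> th" "th \<le> D" and D: "D = real DIM('a) - 1"
    and th': "th \<le> th'" "th' < real DIM('a)" "p * D - th * (p - 1) + th' - th < real DIM('a)"
    and A: "0 \<le> A" "AE x in lborel. x \<in> ball x0 r \<longrightarrow> ennreal (v x) \<le> ennreal A + ennreal A * riesz_potential D x0 r' (\<lambda>y. 1 + v y powr p) x"
    and C: "0 \<le> C" "\<And>z. riesz_potential th x0 r' (\<lambda>y. 1 + v y powr p) z \<le> ennreal C"
  shows "\<exists>C'\<ge>0. \<forall>z. riesz_potential th' x0 r (\<lambda>y. 1 + v y powr p) z \<le> ennreal C'"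
proof -
  define H where "H y = 1 + v y powr p" for y
  have Hm[measurable]: "H \<in> borel_measurable borel" unfolding H_def by measurable
  have Hn: "0 \<le> H y" for y by (simp add: H_def)
  define a where "a = p * D - th * (p - 1)"
  have ath: "th \<le> a"
  proof -
    have "p * th \<le> p * D" using th p by (intro mult_left_mono) auto
    then show ?thesis by (simp add: a_def algebra_simps)
  qed
  define Z where "Z = riesz_potential a x0 r' H"
  have Zm[measurable]: "Z \<in> borel_measurable borel" unfolding Z_def by measurable
  define K where "K = 1 + (A + A * (C + 1)) powr p"
  have K: "K \<ge> 1" by (simp add: K_def)
  have pt: "ennreal (H x) \<le> ennreal K * (1 + Z x)"
    if x: "ennreal (v x) \<le> ennreal A + ennreal A * riesz_potential D x0 r' H x" for x
  proof (cases "Z x = \<infinity>")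
    case True
    then show ?thesis using K by (simp add: ennreal_mult_top)
  next
    case False
    then obtain \<zeta> where \<zeta>: "Z x = ennreal \<zeta>" "\<zeta> \<ge> 0" by (cases "Z x") auto
    \<comment> \<open>The weight that balances the two terms of the split kernel.\<close>
    define lam where "lam = (1 + \<zeta>) powr (1 / p)"
    have lam: "lam \<ge> 1" using \<zeta>(2) p by (simp add: lam_def ge_one_powr_ge_zero)
    have lamp: "lam powr p = 1 + \<zeta>" using \<zeta>(2) p by (simp add: lam_def powr_powr)
    have lamZ: "lam powr (- (p - 1)) * \<zeta> \<le> lam"
    proof -
      have "lam powr (- (p - 1)) * \<zeta> \<le> lam powr (- (p - 1)) * lam powr p" using lamp by (intro mult_left_mono) auto
      also have "\<dots> = lam" using lam by (simp add: powr_add[symmetric])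
      finally show ?thesis .
    qed
    have "riesz_potential D x0 r' H x \<le> ennreal lam * riesz_potential th x0 r' H x + ennreal (lam powr (- (p - 1))) * Z x"
    proof -
      have "riesz_potential D x0 r' H x \<le> (\<integral>\<^sup>+y. ennreal lam * (ennreal (H y * norm (y - x) powr (- th)) * indicator (ball x0 r') y)
         + ennreal (lam powr (- (p - 1))) * (ennreal (H y * norm (y - x) powr (- a)) * indicator (ball x0 r') y) \<partial>lborel)"
        unfolding riesz_potential_def
      proof (rule nn_integral_mono)
        fix y
        have "H y * norm (y - x) powr (- D) \<le> H y * (lam * norm (y - x) powr (- th) + lam powr (- (p - 1)) * norm (y - x) powr (- a))"
          unfolding a_def using lam p by (intro mult_left_mono riesz_split Hn) auto
        also have "\<dots> = lam * (H y * norm (y - x) powr (- th)) + lam powr (- (p - 1)) * (H y * norm (y - x) powr (- a))"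
          by (simp add: algebra_simps)
        finally have "ennreal (H y * norm (y - x) powr (- D)) \<le> ennreal (lam * (H y * norm (y - x) powr (- th)) + lam powr (- (p - 1)) * (H y * norm (y - x) powr (- a)))"
          by (rule ennreal_leI)
        also have "\<dots> = ennreal lam * ennreal (H y * norm (y - x) powr (- th)) + ennreal (lam powr (- (p - 1))) * ennreal (H y * norm (y - x) powr (- a))"
          using lam Hn by (simp add: ennreal_plus ennreal_mult)
        finally show "ennreal (H y * norm (y - x) powr (- D)) * indicator (ball x0 r') y
          \<le> ennreal lam * (ennreal (H y * norm (y - x) powr (- th)) * indicator (ball x0 r') y)
         + ennreal (lam powr (- (p - 1))) * (ennreal (H y * norm (y - x) powr (- a)) * indicator (ball x0 r') y)"
          by (auto simp: indicator_def)
      qed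
      also have "\<dots> = ennreal lam * riesz_potential th x0 r' H x + ennreal (lam powr (- (p - 1))) * Z x"
        unfolding riesz_potential_def Z_def by (simp add: nn_integral_cmult nn_integral_add)
      finally show ?thesis .
    qed
    also have "\<dots> \<le> ennreal lam * ennreal C + ennreal (lam powr (- (p - 1))) * ennreal \<zeta>"
      unfolding \<zeta>(1) using C(2)[of x] by (intro add_mono mult_left_mono) (auto simp: H_def[abs_def])
    also have "\<dots> = ennreal (lam * C + lam powr (- (p - 1)) * \<zeta>)"
      using lam C(1) \<zeta>(2) by (simp add: ennreal_plus ennreal_mult)
    also have "\<dots> \<le> ennreal (lam * (C + 1))" using lamZ by (intro ennreal_leI) (simp add: algebra_simps)
    finally have S: "riesz_potential D x0 r' H x \<le> ennreal (lam * (C + 1))" .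
    have "ennreal (v x) \<le> ennreal A + ennreal A * ennreal (lam * (C + 1))"
      using x S by (meson add_left_mono mult_left_mono order_trans zero_le)
    also have "\<dots> = ennreal (A + A * (lam * (C + 1)))" using A(1) C(1) lam by (simp add: ennreal_plus ennreal_mult)
    finally have "v x \<le> A + A * (lam * (C + 1))" using A(1) C(1) lam by (subst (asm) ennreal_le_iff) auto
    also have "\<dots> \<le> (A + A * (C + 1)) * lam"
    proof -
      have "A * 1 \<le> A * lam" using A(1) lam by (intro mult_left_mono)
      then show ?thesis by (simp add: algebra_simps)
    qed
    finally have "v x powr p \<le> ((A + A * (C + 1)) * lam) powr p" using vn p by (intro powr_mono2) auto
    also have "\<dots> = (A + A * (C + 1)) powr p * (1 + \<zeta>)" using A(1) C(1) lam lamp by (simp add: powr_mult)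
    finally have "H x \<le> K * (1 + \<zeta>)" unfolding H_def K_def using \<zeta>(2) by (simp add: algebra_simps)
    then have "ennreal (H x) \<le> ennreal (K * (1 + \<zeta>))" by (rule ennreal_leI)
    also have "\<dots> = ennreal K * (1 + Z x)" unfolding \<zeta>(1) using K \<zeta>(2) by (simp add: ennreal_plus ennreal_mult)
    finally show ?thesis .
  qed
  obtain C1 where C1: "\<And>z. (\<integral>\<^sup>+x. ennreal (norm (x - z) powr (- th')) * indicator (ball x0 r) x \<partial>lborel) \<le> ennreal C1"
    using nn_integral_singular_bound[of th' x0 r] th th' by auto
  obtain C2 where C2: "C2 \<ge> 0" "\<And>y z. y \<noteq> z \<Longrightarrow> (\<integral>\<^sup>+x. ennreal (norm (x - y) powr (- a) * norm (x - z) powr (- th')) * indicator (ball x0 r) x \<partial>lborel)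
       \<le> ennreal (C2 * norm (y - z) powr (- th))"
    using singular_composition[OF th(1) ath th'(1), of x0 r] th'(3) unfolding a_def by blast
  have "riesz_potential th' x0 r H z \<le> ennreal (K * (\<bar>C1\<bar> + C2 * C))" for z
  proof -
    have "riesz_potential th' x0 r H z \<le> (\<integral>\<^sup>+x. ennreal K * (ennreal (norm (x - z) powr (- th')) * indicator (ball x0 r) x
        + Z x * (ennreal (norm (x - z) powr (- th')) * indicator (ball x0 r) x)) \<partial>lborel)"
      unfolding riesz_potential_def
    proof (rule nn_integral_mono_AE)
      show "AE x in lborel. ennreal (H x * norm (x - z) powr (- th')) * indicator (ball x0 r) x
        \<le> ennreal K * (ennreal (norm (x - z) powr (- th')) * indicator (ball x0 r) x
        + Z x * (ennreal (norm (x - z) powr (- th')) * indicator (ball x0 r) x))"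
        using A(2)
      proof eventually_elim
        case (elim x)
        show ?case
        proof (cases "x \<in> ball x0 r")
          case True
          then have "ennreal (H x) * ennreal (norm (x - z) powr (- th')) \<le> ennreal K * (1 + Z x) * ennreal (norm (x - z) powr (- th'))"
            using elim by (intro mult_right_mono pt) (auto simp: H_def[abs_def])
          then show ?thesis using True Hn by (simp add: ennreal_mult algebra_simps)
        qed simp
      qed
    qed
    also have "\<dots> = ennreal K * ((\<integral>\<^sup>+x. ennreal (norm (x - z) powr (- th')) * indicator (ball x0 r) x \<partial>lborel)
        + (\<integral>\<^sup>+x. Z x * (ennreal (norm (x - z) powr (- th')) * indicator (ball x0 r) x) \<partial>lborel))"
      by (simp add: nn_integral_cmult nn_integral_add)
    also have "\<dots> \<le> ennreal K * (ennreal \<bar>C1\<bar> + ennreal (C2 * C))"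
    proof (intro mult_left_mono add_mono)
      show "(\<integral>\<^sup>+x. ennreal (norm (x - z) powr (- th')) * indicator (ball x0 r) x \<partial>lborel) \<le> ennreal \<bar>C1\<bar>"
        using C1[of z] by (rule order_trans) (simp add: ennreal_leI)
      have "(\<integral>\<^sup>+x. Z x * (ennreal (norm (x - z) powr (- th')) * indicator (ball x0 r) x) \<partial>lborel)
        = (\<integral>\<^sup>+x. \<integral>\<^sup>+y. ennreal (H y) * indicator (ball x0 r') y * (ennreal (norm (x - y) powr (- a) * norm (x - z) powr (- th')) * indicator (ball x0 r) x) \<partial>lborel \<partial>lborel)"
        unfolding Z_def riesz_potential_def using Hn
        by (subst nn_integral_multc[symmetric], measurable)
           (simp add: ennreal_mult norm_minus_commute mult_ac)
      \<comment> \<open>Tonelli; the inner integral is the composition of the two kernels.\<close>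
      also have "\<dots> = (\<integral>\<^sup>+y. \<integral>\<^sup>+x. ennreal (H y) * indicator (ball x0 r') y * (ennreal (norm (x - y) powr (- a) * norm (x - z) powr (- th')) * indicator (ball x0 r) x) \<partial>lborel \<partial>lborel)"
        by (rule lborel_pair.Fubini') measurable
      also have "\<dots> = (\<integral>\<^sup>+y. ennreal (H y) * indicator (ball x0 r') y * (\<integral>\<^sup>+x. ennreal (norm (x - y) powr (- a) * norm (x - z) powr (- th')) * indicator (ball x0 r) x \<partial>lborel) \<partial>lborel)"
        by (intro nn_integral_cong nn_integral_cmult) measurable
      also have "\<dots> \<le> (\<integral>\<^sup>+y. ennreal C2 * (ennreal (H y * norm (y - z) powr (- th)) * indicator (ball x0 r') y) \<partial>lborel)"
      proof (rule nn_integral_mono_AE)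
        have "AE y in lborel. y \<noteq> z" by (rule AE_lborel_singleton)
        then show "AE y in lborel. ennreal (H y) * indicator (ball x0 r') y * (\<integral>\<^sup>+x. ennreal (norm (x - y) powr (- a) * norm (x - z) powr (- th')) * indicator (ball x0 r) x \<partial>lborel)
          \<le> ennreal C2 * (ennreal (H y * norm (y - z) powr (- th)) * indicator (ball x0 r') y)"
        proof eventually_elim
          case (elim y)
          have "ennreal (H y) * indicator (ball x0 r') y * (\<integral>\<^sup>+x. ennreal (norm (x - y) powr (- a) * norm (x - z) powr (- th')) * indicator (ball x0 r) x \<partial>lborel)
            \<le> ennreal (H y) * indicator (ball x0 r') y * ennreal (C2 * norm (y - z) powr (- th))"
            using C2(2)[OF elim] by (intro mult_left_mono) auto
          also have "\<dots> = ennreal C2 * (ennreal (H y * norm (y - z) powr (- th)) * indicator (ball x0 r') y)"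
            using C2(1) Hn by (simp add: ennreal_mult mult_ac)
          finally show ?case .
        qed
      qed
      also have "\<dots> = ennreal C2 * riesz_potential th x0 r' H z" unfolding riesz_potential_def by (rule nn_integral_cmult) measurable
      also have "\<dots> \<le> ennreal C2 * ennreal C" using C(2)[of z] by (intro mult_left_mono) (auto simp: H_def[abs_def])
      also have "\<dots> = ennreal (C2 * C)" using C2(1) C(1) by (simp add: ennreal_mult)
      finally show "(\<integral>\<^sup>+x. Z x * (ennreal (norm (x - z) powr (- th')) * indicator (ball x0 r) x) \<partial>lborel) \<le> ennreal (C2 * C)" .
    qed auto
    also have "\<dots> = ennreal (K * (\<bar>C1\<bar> + C2 * C))" using K C2(1) C(1) by (simp add: ennreal_mult ennreal_plus)
    finally show ?thesis .
  qed
  then show ?thesis using K C2(1) C(1) unfolding H_def[abs_def]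
    by (intro exI[of _ "K * (\<bar>C1\<bar> + C2 * C)"]) auto
qed

text \<open>
  At every stage \<open>a \<le> pD < d\<close>, so the order can be raised by \<open>\<delta> = (d - pD)/2\<close>. Once it reaches \<open>D\<close>, the hypothesis on
  \<open>v\<close> is itself the bound. The radii shrink a little in each step.
\<close>

lemma riesz_bootstrap:
  fixes x0 :: "'a::euclidean_space" and v :: "'a \<Rightarrow> real"
  assumes v[measurable]: "v \<in> borel_measurable borel" and vn: "\<And>x. 0 \<le> v x"
    and p: "1 < p" "p * (real DIM('a) - 1) < real DIM('a)"
    and int: "(\<integral>\<^sup>+y. ennreal (1 + v y powr p) * indicator (ball x0 R) y \<partial>lborel) < \<infinity>"
    and riesz: "\<And>r r'. 0 < r \<Longrightarrow> r < r' \<Longrightarrow> r' < R \<Longrightarrow> \<exists>A\<ge>0. AE x in lborel. x \<in> ball x0 r \<longrightarrow>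
        ennreal (v x) \<le> ennreal A + ennreal A * riesz_potential (real DIM('a) - 1) x0 r' (\<lambda>y. 1 + v y powr p) x"
    and r: "0 < r" "r < R"
  shows "\<exists>C. AE x in lborel. x \<in> ball x0 r \<longrightarrow> v x \<le> C"
proof -
  define D where "D = real DIM('a) - 1"
  have D0: "0 \<le> D" using DIM_positive[where 'a='a] unfolding D_def by linarith
  define \<delta> where "\<delta> = (real DIM('a) - p * D) / 2"
  have \<delta>: "\<delta> > 0" using p(2) unfolding \<delta>_def D_def by simp
  \<comment> \<open>The orders reached after \<open>k\<close> steps; the last step stops exactly at \<open>D\<close>.\<close>
  define th where "th k = min D (real k * \<delta>)" for k :: nat
  have th: "0 \<le> th k" "th k \<le> D" for k using D0 \<delta> by (auto simp: th_def)
  have thS: "th k \<le> th (Suc k)" "th (Suc k) \<le> th k + \<delta>" for k using \<delta> by (auto simp: th_def algebra_simps min_def)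
  define H where "H y = 1 + v y powr p" for y
  have T: "\<forall>r. 0 < r \<and> r < R \<longrightarrow> (\<exists>C\<ge>0. \<forall>z. riesz_potential (th k) x0 r H z \<le> ennreal C)" for k
  proof (induction k)
    case 0
    obtain C0 where C0: "(\<integral>\<^sup>+y. ennreal (H y) * indicator (ball x0 R) y \<partial>lborel) = ennreal C0" "C0 \<ge> 0"
      using int unfolding H_def by (cases "\<integral>\<^sup>+y. ennreal (1 + v y powr p) * indicator (ball x0 R) y \<partial>lborel") auto
    have "riesz_potential (th 0) x0 r H z \<le> ennreal C0" if "0 < r" "r < R" for r z
    proof -
      have "riesz_potential (th 0) x0 r H z \<le> (\<integral>\<^sup>+y. ennreal (H y) * indicator (ball x0 R) y \<partial>lborel)"
        unfolding riesz_potential_def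
      proof (rule nn_integral_mono)
        fix y
        have "H y * norm (y - z) powr (- th 0) \<le> H y"
          using D0 by (auto simp: th_def H_def intro!: mult_right_le_one_le)
        then show "ennreal (H y * norm (y - z) powr (- th 0)) * indicator (ball x0 r) y \<le> ennreal (H y) * indicator (ball x0 R) y"
          using that by (auto simp: indicator_def intro!: ennreal_leI)
      qed
      then show ?thesis using C0 by simp
    qed
    then show ?case using C0(2) by blast
  next
    case (Suc k)
    show ?case
    proof (intro allI impI)
      fix r assume r: "0 < r \<and> r < R"
      define r' where "r' = (r + R) / 2"
      have r': "r < r'" "r' < R" "0 < r'" using r by (auto simp: r'_def)
      obtain A where A: "A \<ge> 0" "AE x in lborel. x \<in> ball x0 r \<longrightarrow> ennreal (v x) \<le> ennreal A + ennreal A * riesz_potential D x0 r' (\<lambda>y. 1 + v y powr p) x"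
        using riesz[of r r'] r r' unfolding D_def by blast
      obtain C where C: "C \<ge> 0" "\<And>z. riesz_potential (th k) x0 r' (\<lambda>y. 1 + v y powr p) z \<le> ennreal C"
        using Suc r' unfolding H_def by blast
      have "p * D - th k * (p - 1) + th (Suc k) - th k < real DIM('a)"
      proof -
        have "0 \<le> th k * (p - 1)" using th(1) p by simp
        then have "p * D - th k * (p - 1) + th (Suc k) - th k \<le> p * D + \<delta>" using thS(2)[of k] by linarith
        also have "\<dots> < real DIM('a)" using \<delta> unfolding \<delta>_def by (simp add: field_simps)
        finally show ?thesis .
      qed
      moreover have "th (Suc k) < real DIM('a)" using th(2)[of "Suc k"] unfolding D_def by linarith
      ultimately show "\<exists>C\<ge>0. \<forall>z. riesz_potential (th (Suc k)) x0 r H z \<le> ennreal C"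
        using bootstrap_step[OF v vn p(1) th[of k] D_def thS(1) _ _ A C] unfolding H_def by blast
    qed
  qed
  obtain k where k: "D < real k * \<delta>" using reals_Archimedean3[OF \<delta>] by blast
  then have thk: "th k = D" unfolding th_def by simp
  define r' where "r' = (r + R) / 2"
  have r': "r < r'" "r' < R" "0 < r'" using r by (auto simp: r'_def)
  obtain A where A: "A \<ge> 0" "AE x in lborel. x \<in> ball x0 r \<longrightarrow> ennreal (v x) \<le> ennreal A + ennreal A * riesz_potential D x0 r' H x"
    using riesz[of r r'] r r' unfolding D_def H_def by blast
  obtain C where C: "C \<ge> 0" "\<And>z. riesz_potential D x0 r' H z \<le> ennreal C"
    using T[of k] r' unfolding thk by blast
  have "AE x in lborel. x \<in> ball x0 r \<longrightarrow> v x \<le> A + A * C"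
    using A(2)
  proof eventually_elim
    case (elim x)
    show ?case
    proof
      assume "x \<in> ball x0 r"
      then have "ennreal (v x) \<le> ennreal A + ennreal A * riesz_potential D x0 r' H x" using elim by blast
      also have "\<dots> \<le> ennreal A + ennreal A * ennreal C" using C(2) by (intro add_left_mono mult_left_mono) auto
      also have "\<dots> = ennreal (A + A * C)" using A(1) C(1) by (simp add: ennreal_plus ennreal_mult)
      finally show "v x \<le> A + A * C" using A(1) C(1) by (subst (asm) ennreal_le_iff) auto
    qed
  qed
  then show ?thesis by blast
qed

section \<open>Interior regularity of Poisson's equation\<close>

text \<open>
  \<open>\<Delta>w = h\<close> on \<open>U\<close> in the sense of distributions.
\<close>

definition weak_laplacian :: "'a::euclidean_space set \<Rightarrow> ('a \<Rightarrow> real) \<Rightarrow> ('a \<Rightarrow> real) \<Rightarrow> bool" where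
  "weak_laplacian U w h \<longleftrightarrow> (\<forall>\<phi>. test_function U \<phi> \<longrightarrow> (LINT x|lborel. w x * lap \<phi> x) = (LINT x|lborel. h x * \<phi> x))"

text \<open>
  \<open>\<Delta>w = div F\<close> on \<open>U\<close> in the sense of distributions.
\<close>

definition weak_divergence :: "'a::euclidean_space set \<Rightarrow> ('a \<Rightarrow> real) \<Rightarrow> ('a \<Rightarrow> 'a \<Rightarrow> real) \<Rightarrow> bool" where
  "weak_divergence U w F \<longleftrightarrow> (\<forall>\<phi>. test_function U \<phi> \<longrightarrow>
     (LINT x|lborel. w x * lap \<phi> x) = - (\<Sum>i\<in>Basis. (LINT x|lborel. F i x * pd i \<phi> x)))"

text \<open>
  Testing with the reflected dilation of \<open>\<Psi>\<close> evaluates the equation at scale \<open>2^(-n)\<close> around \<open>x\<close>.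
\<close>

lemma test_lap_dil:
  fixes w :: "'a::euclidean_space \<Rightarrow> real"
  assumes w: "integrable lborel w" and k: "kernel \<eta>" "kernel \<Psi>"
    and L: "\<And>z. lap \<Psi> z = \<eta> z - 2 ^ DIM('a) * \<eta> (2 *\<^sub>R z)"
  shows "(LINT y|lborel. w y * lap (\<lambda>y. dil n \<Psi> (x - y)) y)
    = 4 ^ n * (conv w (dil n \<eta>) x - conv w (dil (Suc n) \<eta>) x)"
proof -
  have I: "integrable lborel (\<lambda>y. w y * dil n \<eta> (x - y))" for n
    by (rule conv_integrable[OF w Cinfc_C1c[OF Cinfc_dil[OF k(1)]]])
  have "(\<lambda>y. w y * lap (\<lambda>y. dil n \<Psi> (x - y)) y) = (\<lambda>y. 4 ^ n * (w y * dil n \<eta> (x - y) - w y * dil (Suc n) \<eta> (x - y)))"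
    unfolding lap_reflect[OF Cinfc_dil[OF k(2)]] lap_dil[OF k(2)] dil_telescope[OF L]
    by (auto simp: algebra_simps)
  then show ?thesis using I[of n] I[of "Suc n"] by (simp add: conv_def)
qed

lemma pd_reflect_dil:
  assumes "kernel \<Psi>"
  shows "pd i (\<lambda>y. dil n \<Psi> (x - y)) y = - (2 ^ n * dil n (pd i \<Psi>) (x - y))"
  by (simp only: pd_reflect[OF Cinfc_differentiable[OF Cinfc_dil[OF assms]]] pd_dil[OF assms])

lemma telescope_weak_laplacian:
  fixes w :: "'a::euclidean_space \<Rightarrow> real"
  assumes w: "integrable lborel w" and k: "kernel \<eta>" "kernel \<Psi>"
    and L: "\<And>z. lap \<Psi> z = \<eta> z - 2 ^ DIM('a) * \<eta> (2 *\<^sub>R z)"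
    and weak: "weak_laplacian U w h" and x: "cball x (1 / 2 ^ n) \<subseteq> U"
  shows "conv w (dil n \<eta>) x - conv w (dil (Suc n) \<eta>) x = 1 / 4 ^ n * conv h (dil n \<Psi>) x"
  using test_lap_dil[OF w k L, of n x] weak test_function_dil[OF k(2) x]
  unfolding weak_laplacian_def conv_def by (simp add: field_simps)

lemma telescope_weak_divergence:
  fixes w :: "'a::euclidean_space \<Rightarrow> real"
  assumes w: "integrable lborel w" and k: "kernel \<eta>" "kernel \<Psi>"
    and L: "\<And>z. lap \<Psi> z = \<eta> z - 2 ^ DIM('a) * \<eta> (2 *\<^sub>R z)"
    and weak: "weak_divergence U w F" and x: "cball x (1 / 2 ^ n) \<subseteq> U"
  shows "conv w (dil n \<eta>) x - conv w (dil (Suc n) \<eta>) x = 1 / 2 ^ n * (\<Sum>i\<in>Basis. conv (F i) (dil n (pd i \<Psi>)) x)"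
proof -
  have "(LINT y|lborel. F i y * pd i (\<lambda>y. dil n \<Psi> (x - y)) y) = - (2 ^ n * conv (F i) (dil n (pd i \<Psi>)) x)" for i
  proof -
    have "(\<lambda>y. F i y * pd i (\<lambda>y. dil n \<Psi> (x - y)) y) = (\<lambda>y. - (2 ^ n) * (F i y * dil n (pd i \<Psi>) (x - y)))"
      unfolding pd_reflect_dil[OF k(2)] by auto
    then show ?thesis by (simp add: conv_def)
  qed
  then have A: "4 ^ n * (conv w (dil n \<eta>) x - conv w (dil (Suc n) \<eta>) x) = 2 ^ n * (\<Sum>i\<in>Basis. conv (F i) (dil n (pd i \<Psi>)) x)"
    using test_lap_dil[OF w k L, of n x] weak test_function_dil[OF k(2) x]
    unfolding weak_divergence_def by (simp add: sum_negf sum_distrib_left)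
  have "(4::real) ^ n = 2 ^ n * 2 ^ n" by (simp add: power_mult_distrib[symmetric])
  with A have "2 ^ n * (2 ^ n * (conv w (dil n \<eta>) x - conv w (dil (Suc n) \<eta>) x)) = 2 ^ n * (\<Sum>i\<in>Basis. conv (F i) (dil n (pd i \<Psi>)) x)"
    by (simp only: mult.assoc)
  then have "2 ^ n * (conv w (dil n \<eta>) x - conv w (dil (Suc n) \<eta>) x) = (\<Sum>i\<in>Basis. conv (F i) (dil n (pd i \<Psi>)) x)"
    by (subst (asm) mult_left_cancel) auto
  then show ?thesis by (simp add: field_simps)
qed

lemma AE_open_local:
  fixes U :: "'a::euclidean_space set"
  assumes "\<And>x. x \<in> U \<Longrightarrow> \<exists>r>0. AE y in lborel. y \<in> ball x r \<longrightarrow> P y"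
  shows "AE y in lborel. y \<in> U \<longrightarrow> P y"
proof -
  obtain r where r: "\<And>x. x \<in> U \<Longrightarrow> r x > 0" "\<And>x. x \<in> U \<Longrightarrow> AE y in lborel. y \<in> ball x (r x) \<longrightarrow> P y"
    using assms by metis
  obtain \<F> where F: "\<F> \<subseteq> (\<lambda>x. ball x (r x)) ` U" "countable \<F>" "\<Union>\<F> = (\<Union>x\<in>U. ball x (r x))"
    using Lindelof[of "(\<lambda>x. ball x (r x)) ` U"] by auto
  have "AE y in lborel. \<forall>S\<in>\<F>. y \<in> S \<longrightarrow> P y"
    using F(1,2) r(2) by (subst AE_ball_countable) auto
  then show ?thesis
  proof eventually_elim
    case (elim y)
    show ?case
    proof
      assume "y \<in> U"
      then have "y \<in> \<Union>\<F>" unfolding F(3) using r(1) by force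
      then show "P y" using elim by blast
    qed
  qed
qed

lemma AE_lebesgue_lborel:
  "(AE x in lebesgue. P x) \<longleftrightarrow> (AE x in lborel. P x)"
  by (simp add: AE_completion_iff)

text \<open>
  The mollifications converge to \<open>v\<close> uniformly and to \<open>w\<close> weakly.
\<close>

lemma mollified_limit_AE:
  fixes w v :: "'a::euclidean_space \<Rightarrow> real"
  assumes \<eta>: "kernel \<eta>" "\<And>z. 0 \<le> \<eta> z" "integral\<^sup>L lborel \<eta> = 1"
    and w: "integrable lborel w" and lim: "uniform_limit (ball x0 r) (\<lambda>n. conv w (dil n \<eta>)) v sequentially"
    and v: "continuous_on (ball x0 r) v"
  shows "AE x in lborel. x \<in> ball x0 r \<longrightarrow> w x = v x"
proof -
  let ?B = "ball x0 r"
  have "AE x in lebesgue. x \<in> ?B \<longrightarrow> w x - v x = 0"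
  proof (rule fundamental_zero)
    fix K :: "'a set" assume K: "compact K" "K \<subseteq> ?B"
    have "set_integrable lborel K v"
      unfolding set_integrable_def using K v by (intro borel_integrable_compact) (auto intro: continuous_on_subset)
    moreover have "set_integrable lborel K w"
      unfolding set_integrable_def using w borel_compact[OF K(1)] by (intro integrable_mult_indicator) auto
    ultimately have "set_integrable lborel K (\<lambda>x. w x - v x)" by (intro set_integral_diff)
    then show "set_integrable lebesgue K (\<lambda>x. w x - v x)"
      unfolding set_integrable_def by (simp add: integrable_completion borel_measurable_integrable)
  next
    fix \<phi> assume t: "test_function ?B \<phi>"
    have cv: "Ck_on 0 ?B v" using v by simp
    have vint: "integrable lborel (\<lambda>x. v x * \<phi> x)"
    proof -
      obtain R where R: "\<forall>z. R < norm z \<longrightarrow> v z * \<phi> z = 0" using Ck_on_mult_test(2)[OF open_ball cv t] by blast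
      show ?thesis using Ck_on_mult_test(1)[OF open_ball cv t] R
        by (intro integrable_compact_support[OF _ compact_cball[of 0 R]]) auto
    qed
    have C1: "C1c \<phi>" using Cinfc_C1c test_function_Cinfc t by blast
    obtain M where M: "\<And>x. \<bar>\<phi> x\<bar> \<le> M" using C1c_bounded[OF C1] by blast
    have \<phi>m: "\<phi> \<in> borel_measurable borel" using C1c_continuous[OF C1] by (rule borel_measurable_continuous_onI)
    have wint: "integrable lborel (\<lambda>x. w x * \<phi> x)" by (rule integrable_mult_bounded[OF w \<phi>m M])
    have \<phi>i: "integrable lborel \<phi>" by (rule C1c_integrable[OF C1])
    have gint: "integrable lborel (\<lambda>x. conv w (dil n \<eta>) x * \<phi> x)" for n
    proof -
      have "Ck_on 0 UNIV (conv w (dil n \<eta>))" by (rule Ck_on_conv[OF w Cinfc_dil[OF \<eta>(1)]])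
      then have c: "Ck_on 0 UNIV (conv w (dil n \<eta>))" .
      have t': "test_function UNIV \<phi>" using t unfolding test_function_def by blast
      obtain R where R: "\<forall>z. R < norm z \<longrightarrow> conv w (dil n \<eta>) z * \<phi> z = 0" using Ck_on_mult_test(2)[OF open_UNIV c t'] by blast
      show ?thesis using Ck_on_mult_test(1)[OF open_UNIV c t'] R
        by (intro integrable_compact_support[OF _ compact_cball[of 0 R]]) auto
    qed
    have "(\<lambda>n. LINT x|lborel. conv w (dil n \<eta>) x * \<phi> x) \<longlonglongrightarrow> (LINT x|lborel. v x * \<phi> x)"
    proof (rule LIMSEQ_I)
      fix e :: real assume e: "e > 0"
      define I where "I = (LINT x|lborel. \<bar>\<phi> x\<bar>)"
      have I: "I \<ge> 0" unfolding I_def by (intro integral_nonneg_AE) auto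
      define e' where "e' = e / (I + 1)"
      have e': "e' > 0" "e' * I < e" using e I by (auto simp: e'_def field_simps)
      have "\<forall>\<^sub>F n in sequentially. \<forall>x\<in>?B. dist (conv w (dil n \<eta>) x) (v x) < e'"
        using lim e'(1) unfolding uniform_limit_iff by blast
      then obtain N where N: "\<And>n x. n \<ge> N \<Longrightarrow> x \<in> ?B \<Longrightarrow> \<bar>conv w (dil n \<eta>) x - v x\<bar> < e'"
        unfolding eventually_sequentially dist_real_def by blast
      show "\<exists>N. \<forall>n\<ge>N. norm ((LINT x|lborel. conv w (dil n \<eta>) x * \<phi> x) - (LINT x|lborel. v x * \<phi> x)) < e"
      proof (intro exI[of _ N] allI impI)
        fix n assume n: "n \<ge> N"
        have "(LINT x|lborel. conv w (dil n \<eta>) x * \<phi> x) - (LINT x|lborel. v x * \<phi> x) = (LINT x|lborel. conv w (dil n \<eta>) x * \<phi> x - v x * \<phi> x)"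
          using gint vint by simp
        also have "\<bar>\<dots>\<bar> \<le> (LINT x|lborel. \<bar>conv w (dil n \<eta>) x * \<phi> x - v x * \<phi> x\<bar>)" by (rule integral_abs_bound)
        also have "\<dots> \<le> (LINT x|lborel. e' * \<bar>\<phi> x\<bar>)"
        proof (rule integral_mono)
          show "integrable lborel (\<lambda>x. \<bar>conv w (dil n \<eta>) x * \<phi> x - v x * \<phi> x\<bar>)" using gint vint by (intro integrable_abs Bochner_Integration.integrable_diff)
          show "integrable lborel (\<lambda>x. e' * \<bar>\<phi> x\<bar>)" using \<phi>i by (intro integrable_mult_right integrable_abs)
          fix x
          show "\<bar>conv w (dil n \<eta>) x * \<phi> x - v x * \<phi> x\<bar> \<le> e' * \<bar>\<phi> x\<bar>"
          proof (cases "x \<in> ?B")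
            case True
            have "\<bar>conv w (dil n \<eta>) x * \<phi> x - v x * \<phi> x\<bar> = \<bar>conv w (dil n \<eta>) x - v x\<bar> * \<bar>\<phi> x\<bar>"
              by (simp add: abs_mult[symmetric] left_diff_distrib)
            also have "\<dots> \<le> e' * \<bar>\<phi> x\<bar>" using N[OF n True] by (intro mult_right_mono) auto
            finally show ?thesis .
          next
            case False then show ?thesis using test_function_zero_outside[OF t] by simp
          qed
        qed
        also have "\<dots> < e" using e'(2) by (simp add: I_def)
        finally show "norm ((LINT x|lborel. conv w (dil n \<eta>) x * \<phi> x) - (LINT x|lborel. v x * \<phi> x)) < e" by simp
      qed
    qed
    moreover have "(\<lambda>n. LINT x|lborel. conv w (dil n \<eta>) x * \<phi> x) \<longlonglongrightarrow> (LINT x|lborel. w x * \<phi> x)"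
      by (rule mollify_limit[OF \<eta> w C1])
    ultimately have eq: "(LINT x|lborel. v x * \<phi> x) = (LINT x|lborel. w x * \<phi> x)" by (rule LIMSEQ_unique)
    have fe: "(\<lambda>x. indicator ?B x *\<^sub>R ((w x - v x) * \<phi> x)) = (\<lambda>x. w x * \<phi> x - v x * \<phi> x)"
      using test_function_zero_outside[OF t] by (auto simp: fun_eq_iff indicator_def left_diff_distrib)
    have "(\<lambda>x. w x * \<phi> x - v x * \<phi> x) \<in> borel_measurable lborel" using wint vint by simp
    then have "(LINT x:?B|lebesgue. (w x - v x) * \<phi> x) = (LINT x|lborel. w x * \<phi> x - v x * \<phi> x)"
      unfolding set_lebesgue_integral_def fe by (rule integral_completion)
    then show "(LINT x:?B|lebesgue. (w x - v x) * \<phi> x) = 0" using eq wint vint by simp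
  qed simp
  then show ?thesis unfolding AE_lebesgue_lborel by simp
qed

text \<open>
  A single global function, so that the local limits on different balls need not be glued.
\<close>

definition mollifier_limit :: "('a::euclidean_space \<Rightarrow> real) \<Rightarrow> ('a \<Rightarrow> real) \<Rightarrow> 'a \<Rightarrow> real" where
  "mollifier_limit \<eta> w x = lim (\<lambda>n. conv w (dil n \<eta>) x)"

lemma regularity_of_dyadic:
  fixes w :: "'a::euclidean_space \<Rightarrow> real"
  assumes \<eta>: "kernel \<eta>" "\<And>z. 0 \<le> \<eta> z" "integral\<^sup>L lborel \<eta> = 1"
    and U: "open U" and w: "integrable lborel w" and \<sigma>: "0 < \<sigma>" "\<sigma> < \<gamma>" "\<gamma> \<le> 1"
    and dy: "\<And>x. x \<in> U \<Longrightarrow> \<exists>r>0. \<exists>N. dyadic k \<gamma> (ball x r) N (\<lambda>n. conv w (dil n \<eta>))"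
  shows "Ck_holder_loc k \<sigma> U (mollifier_limit \<eta> w)" "AE x in lborel. x \<in> U \<longrightarrow> w x = mollifier_limit \<eta> w x"
proof -
  have loc: "\<exists>r>0. Ck_holder_loc k \<sigma> (ball x r) (mollifier_limit \<eta> w) \<and> (AE y in lborel. y \<in> ball x r \<longrightarrow> w y = mollifier_limit \<eta> w y)"
    if x: "x \<in> U" for x
  proof -
    obtain r N where r: "r > 0" and "dyadic k \<gamma> (ball x r) N (\<lambda>n. conv w (dil n \<eta>))" using dy[OF x] by blast
    then obtain v where v: "uniform_limit (ball x r) (\<lambda>n. conv w (dil n \<eta>)) v sequentially" "Ck_holder_loc k \<sigma> (ball x r) v"
      using dyadic_limit[OF \<sigma>] by blast
    have eq: "v y = mollifier_limit \<eta> w y" if "y \<in> ball x r" for y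
      unfolding mollifier_limit_def using limI[OF tendsto_uniform_limitI[OF v(1) that]] by simp
    have cv: "continuous_on (ball x r) v"
      using v(2) by (cases k) (auto simp: Ck_holder_loc.simps)
    have "AE y in lborel. y \<in> ball x r \<longrightarrow> w y = v y" by (rule mollified_limit_AE[OF \<eta> w v(1) cv])
    then have "AE y in lborel. y \<in> ball x r \<longrightarrow> w y = mollifier_limit \<eta> w y" by eventually_elim (use eq in auto)
    moreover have "Ck_holder_loc k \<sigma> (ball x r) (mollifier_limit \<eta> w)" using Ck_holder_loc_cong[OF open_ball eq v(2)] .
    ultimately show ?thesis using r by blast
  qed
  show "Ck_holder_loc k \<sigma> U (mollifier_limit \<eta> w)" using loc by (intro Ck_holder_loc_local[OF U \<sigma>(1)]) blast
  show "AE x in lborel. x \<in> U \<longrightarrow> w x = mollifier_limit \<eta> w x" using loc by (intro AE_open_local) blast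
qed

lemma small_dyadic: "0 < r \<Longrightarrow> \<exists>N. \<forall>n\<ge>N. 1 / 2 ^ n \<le> (r::real)"
proof -
  assume r: "0 < r"
  obtain N where N: "(1/2::real) ^ N < r" using real_arch_pow_inv[OF r, of "1/2"] by auto
  show "\<exists>N. \<forall>n\<ge>N. 1 / 2 ^ n \<le> r"
  proof (intro exI[of _ N] allI impI)
    fix n assume "n \<ge> N"
    then have "(1/2::real) ^ n \<le> (1/2) ^ N" by (intro power_decreasing) auto
    then show "1 / 2 ^ n \<le> r" using N by (simp add: power_one_over)
  qed
qed

lemma cball_dyadic_subset:
  assumes "x \<in> ball x0 r" "1 / 2 ^ n \<le> r"
  shows "cball x (1 / 2 ^ n) \<subseteq> cball x0 (2 * r)"
proof
  fix y assume "y \<in> cball x (1 / 2 ^ n)"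
  then show "y \<in> cball x0 (2 * r)" using assms dist_triangle[of x0 y x] by simp
qed

lemma conv_local_bounded:
  fixes F :: "'a::euclidean_space \<Rightarrow> real"
  assumes F: "integrable lborel F" and k: "kernel \<kappa>"
    and b: "AE y in lborel. y \<in> cball x0 (2 * r) \<longrightarrow> \<bar>F y\<bar> \<le> M" and N: "\<forall>n\<ge>N. 1 / 2 ^ n \<le> r"
  shows "\<exists>C. \<forall>n\<ge>N. \<forall>x\<in>ball x0 r. \<bar>conv F (dil n \<kappa>) x\<bar> \<le> C"
proof (intro exI allI impI ballI)
  fix n x assume "n \<ge> N" and x: "x \<in> ball x0 r"
  then have "1 / 2 ^ n \<le> r" using N by blast
  note sub = cball_dyadic_subset[OF x this]
  show "\<bar>conv F (dil n \<kappa>) x\<bar> \<le> M * (LINT z|lborel. \<bar>\<kappa> z\<bar>)"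
  proof (rule conv_dil_bound[OF F k, of 0])
    show "AE y in lborel. y \<in> cball x (1 / 2 ^ n) \<longrightarrow> \<bar>F y - 0\<bar> \<le> M"
      using b by eventually_elim (use sub in auto)
  qed simp
qed

text \<open>
  \<open>F\<close> is compared with the value of its continuous representative at the centre of the ball.
\<close>

lemma conv_local_holder:
  fixes F G :: "'a::euclidean_space \<Rightarrow> real"
  assumes F: "integrable lborel F" and k: "kernel \<kappa>" "integral\<^sup>L lborel \<kappa> = 0"
    and b: "AE y in lborel. y \<in> cball x0 (2 * r) \<longrightarrow> F y = G y" and G: "holder_on \<beta> (cball x0 (2 * r)) G" and \<beta>: "0 < \<beta>"
    and N: "\<forall>n\<ge>N. 1 / 2 ^ n \<le> r"
  shows "\<exists>C. \<forall>n\<ge>N. \<forall>x\<in>ball x0 r. \<bar>conv F (dil n \<kappa>) x\<bar> \<le> C * 2 powr (- \<beta> * n)"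
proof -
  obtain C where C: "C \<ge> 0" "\<And>x y. x \<in> cball x0 (2 * r) \<Longrightarrow> y \<in> cball x0 (2 * r) \<Longrightarrow> \<bar>G x - G y\<bar> \<le> C * dist x y powr \<beta>"
    using holder_onD[OF G] by blast
  have "\<bar>conv F (dil n \<kappa>) x\<bar> \<le> C * (LINT z|lborel. \<bar>\<kappa> z\<bar>) * 2 powr (- \<beta> * n)" if "n \<ge> N" and x: "x \<in> ball x0 r" for n x
  proof -
    have "1 / 2 ^ n \<le> r" using N that by blast
    note sub = cball_dyadic_subset[OF x this]
    have h: "1 / 2 ^ n = (2::real) powr (- real n)" by (simp add: powr_minus powr_realpow divide_inverse)
    have "\<bar>conv F (dil n \<kappa>) x\<bar> \<le> (C * 2 powr (- \<beta> * n)) * (LINT z|lborel. \<bar>\<kappa> z\<bar>)"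
    proof (rule conv_dil_bound[OF F k(1), of "G x"])
      show "AE y in lborel. y \<in> cball x (1 / 2 ^ n) \<longrightarrow> \<bar>F y - G x\<bar> \<le> C * 2 powr (- \<beta> * n)"
        using b
      proof eventually_elim
        case (elim y)
        show ?case
        proof
          assume y: "y \<in> cball x (1 / 2 ^ n)"
          then have "\<bar>F y - G x\<bar> = \<bar>G y - G x\<bar>" using elim sub by auto
          also have "\<dots> \<le> C * dist y x powr \<beta>"
          proof (rule C(2))
            show "y \<in> cball x0 (2 * r)" using sub y by blast
            have "x \<in> cball x (1 / 2 ^ n)" by simp
            then show "x \<in> cball x0 (2 * r)" using sub by blast
          qed
          also have "\<dots> \<le> C * (1 / 2 ^ n) powr \<beta>"
            using y C(1) \<beta> by (intro mult_left_mono powr_mono2) (auto simp: dist_commute)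
          also have "(1 / 2 ^ n) powr \<beta> = (2::real) powr (- \<beta> * n)"
            unfolding h powr_powr by (simp add: mult.commute)
          finally show "\<bar>F y - G x\<bar> \<le> C * 2 powr (- \<beta> * n)" .
        qed
      qed
    qed (use k in simp)
    then show ?thesis by (simp add: mult_ac)
  qed
  then show ?thesis by blast
qed

lemma open_cball_dyadic:
  fixes U :: "'a::euclidean_space set"
  assumes "open U" "x \<in> U" "e > 0"
  obtains r N where "r > 0" "2 * r \<le> e" "cball x (2 * r) \<subseteq> U" "\<forall>n\<ge>N. 1 / 2 ^ n \<le> r"
    "\<And>n y. n \<ge> N \<Longrightarrow> y \<in> ball x r \<Longrightarrow> cball y (1 / 2 ^ n) \<subseteq> U"
proof -
  obtain d where d: "d > 0" "cball x d \<subseteq> U" using open_contains_cball assms by blast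
  define r where "r = min d e / 2"
  have r: "r > 0" "2 * r \<le> e" "cball x (2 * r) \<subseteq> U" using d assms(3) by (auto simp: r_def)
  obtain N where N: "\<forall>n\<ge>N. 1 / 2 ^ n \<le> r" using small_dyadic[OF r(1)] by blast
  show ?thesis using that[OF r N] cball_dyadic_subset N r(3) by blast
qed

lemma kernel_pd_integral: "kernel \<kappa> \<Longrightarrow> i \<in> Basis \<Longrightarrow> integral\<^sup>L lborel (pd i \<kappa>) = 0"
  using integral_pd_C1c Cinfc_C1c kernel_Cinfc by blast

lemma four_pow: "(4::real) ^ n = 2 ^ (2 * n)" by (simp add: power_mult)

lemma smooth_conv: "kernel \<eta> \<Longrightarrow> integrable lborel w \<Longrightarrow> Ck_on k UNIV (conv w (dil n \<eta>))"
  by (rule Ck_on_conv[OF _ Cinfc_dil])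

context
  fixes \<eta> \<Psi> :: "'a::euclidean_space \<Rightarrow> real" and U :: "'a set"
  assumes \<eta>: "kernel \<eta>" "\<And>z. 0 \<le> \<eta> z" "integral\<^sup>L lborel \<eta> = 1" and \<Psi>: "kernel \<Psi>"
    and L: "\<And>z. lap \<Psi> z = \<eta> z - 2 ^ DIM('a) * \<eta> (2 *\<^sub>R z)"
    and U: "open U"
begin

text \<open>
  A bounded right-hand side: the difference is \<open>4^(-n) h * \<Psi>_n\<close>, two derivatives use up this factor, and the first
  derivatives retain \<open>2^(-n)\<close>. The limit is in \<open>C^(1,\<sigma>)\<close> for every \<open>\<sigma> < 1\<close>.
\<close>

lemma dyadic_weak_laplacian_bounded:
  assumes w: "integrable lborel w" and h: "integrable lborel h" and weak: "weak_laplacian U w h"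
    and x: "x \<in> U" and e: "e > 0" and b: "AE y in lborel. y \<in> ball x e \<longrightarrow> \<bar>h y\<bar> \<le> M"
  shows "\<exists>r>0. \<exists>N. dyadic 1 1 (ball x r) N (\<lambda>n. conv w (dil n \<eta>))"
proof -
  obtain r N where r: "r > 0" "2 * r \<le> e/2" "cball x (2 * r) \<subseteq> U" "\<forall>n\<ge>N. 1 / 2 ^ n \<le> r"
    "\<And>n y. n \<ge> N \<Longrightarrow> y \<in> ball x r \<Longrightarrow> cball y (1 / 2 ^ n) \<subseteq> U"
    using open_cball_dyadic[OF U x half_gt_zero[OF e]] by metis
  have b': "AE y in lborel. y \<in> cball x (2 * r) \<longrightarrow> \<bar>h y\<bar> \<le> M"
    using b by eventually_elim (use r e in auto)
  have "dyadic 1 (real 1 + 0) (ball x r) N (\<lambda>n. conv w (dil n \<eta>))"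
  proof (rule dyadic_of_conv[where J="{0::nat}" and F="\<lambda>_. h" and \<kappa>="\<lambda>_. \<Psi>"])
    show "\<exists>C. \<forall>n\<ge>N. \<forall>y\<in>ball x r. \<bar>conv h (dil n \<kappa>) y\<bar> \<le> C" if "kernel \<kappa>" for \<kappa>
      by (rule conv_local_bounded[OF h that b' r(4)])
    then show "\<exists>C. \<forall>n\<ge>N. \<forall>y\<in>ball x r. \<bar>conv h (dil n \<kappa>) y\<bar> \<le> C * 2 powr (- 0 * real n)" if "kernel \<kappa>" for \<kappa>
      using that by simp
    fix n y assume "n \<ge> N" "y \<in> ball x r"
    then show "conv w (dil n \<eta>) y - conv w (dil (Suc n) \<eta>) y = 1 / 2 ^ ((1 + 1) * n) * (\<Sum>j\<in>{0::nat}. conv h (dil n \<Psi>) y)"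
      using telescope_weak_laplacian[OF w \<eta>(1) \<Psi> L weak r(5)] by (simp add: four_pow)
  qed (use \<Psi> h smooth_conv[OF \<eta>(1) w] in auto)
  then show ?thesis using r(1) unfolding of_nat_1 of_nat_0 add_0_right add_0_left by blast
qed

text \<open>
  In divergence form one derivative falls on \<open>\<Psi>\<close>, so that one order less is gained.
\<close>

lemma dyadic_weak_divergence_bounded:
  assumes w: "integrable lborel w" and F: "\<And>i. i \<in> Basis \<Longrightarrow> integrable lborel (F i)" and weak: "weak_divergence U w F"
    and x: "x \<in> U" and e: "e > 0" and b: "\<And>i. i \<in> Basis \<Longrightarrow> AE y in lborel. y \<in> ball x e \<longrightarrow> \<bar>F i y\<bar> \<le> M"
  shows "\<exists>r>0. \<exists>N. dyadic 0 1 (ball x r) N (\<lambda>n. conv w (dil n \<eta>))"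
proof -
  obtain r N where r: "r > 0" "2 * r \<le> e/2" "cball x (2 * r) \<subseteq> U" "\<forall>n\<ge>N. 1 / 2 ^ n \<le> r"
    "\<And>n y. n \<ge> N \<Longrightarrow> y \<in> ball x r \<Longrightarrow> cball y (1 / 2 ^ n) \<subseteq> U"
    using open_cball_dyadic[OF U x half_gt_zero[OF e]] by metis
  have b': "AE y in lborel. y \<in> cball x (2 * r) \<longrightarrow> \<bar>F i y\<bar> \<le> M" if "i \<in> Basis" for i
    using b[OF that] by eventually_elim (use r e in auto)
  have "dyadic 0 (real 1 + 0) (ball x r) N (\<lambda>n. conv w (dil n \<eta>))"
  proof (rule dyadic_of_conv[where J=Basis and F=F and \<kappa>="\<lambda>i. pd i \<Psi>"])
    show "\<exists>C. \<forall>n\<ge>N. \<forall>y\<in>ball x r. \<bar>conv (F i) (dil n \<kappa>) y\<bar> \<le> C" if "i \<in> Basis" "kernel \<kappa>" for \<kappa> i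
      by (rule conv_local_bounded[OF F[OF that(1)] that(2) b'[OF that(1)] r(4)])
    then show "\<exists>C. \<forall>n\<ge>N. \<forall>y\<in>ball x r. \<bar>conv (F i) (dil n \<kappa>) y\<bar> \<le> C * 2 powr (- 0 * real n)" if "i \<in> Basis" "kernel \<kappa>" for \<kappa> i
      using that by simp
    fix n y assume "n \<ge> N" "y \<in> ball x r"
    then show "conv w (dil n \<eta>) y - conv w (dil (Suc n) \<eta>) y = 1 / 2 ^ ((0 + 1) * n) * (\<Sum>i\<in>Basis. conv (F i) (dil n (pd i \<Psi>)) y)"
      using telescope_weak_divergence[OF w \<eta>(1) \<Psi> L weak r(5)] by simp
  qed (use \<Psi> F smooth_conv[OF \<eta>(1) w] kernel_pd kernel_pd_integral in auto)
  then show ?thesis using r(1) unfolding of_nat_1 of_nat_0 add_0_right add_0_left by blast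
qed

lemma AE_bounded_on_compact:
  assumes "compact K" "continuous_on K G" "AE y in lborel. y \<in> K \<longrightarrow> F y = G y"
  shows "\<exists>M. AE y in lborel. y \<in> K \<longrightarrow> \<bar>F y\<bar> \<le> (M::real)"
proof -
  have "bounded (G ` K)" using assms(1,2) compact_continuous_image compact_imp_bounded by blast
  then obtain M where M: "\<forall>y\<in>K. \<bar>G y\<bar> \<le> M" unfolding bounded_iff by auto
  have "AE y in lborel. y \<in> K \<longrightarrow> \<bar>F y\<bar> \<le> M" using assms(3) by eventually_elim (use M in auto)
  then show ?thesis by blast
qed

text \<open>
  After two derivatives the kernels have integral zero, and the Hoelder continuity of the right-hand side supplies the decay.
\<close>

lemma dyadic_weak_laplacian_holder:
  assumes w: "integrable lborel w" and h: "integrable lborel h" and weak: "weak_laplacian U w h"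
    and G: "Ck_holder_loc 0 \<beta> U G" "0 < \<beta>" "\<beta> \<le> 1" and hG: "AE y in lborel. y \<in> U \<longrightarrow> h y = G y"
    and x: "x \<in> U"
  shows "\<exists>r>0. \<exists>N. dyadic 2 \<beta> (ball x r) N (\<lambda>n. conv w (dil n \<eta>))"
proof -
  obtain r N where r: "r > 0" "2 * r \<le> 1" "cball x (2 * r) \<subseteq> U" "\<forall>n\<ge>N. 1 / 2 ^ n \<le> r"
    "\<And>n y. n \<ge> N \<Longrightarrow> y \<in> ball x r \<Longrightarrow> cball y (1 / 2 ^ n) \<subseteq> U"
    using open_cball_dyadic[OF U x zero_less_one] by metis
  have c: "continuous_on (cball x (2 * r)) G" and hl: "holder_on \<beta> (cball x (2 * r)) G"
    using G(1) r(3) compact_cball by (auto simp: holder_on_compacts_iff intro: continuous_on_subset)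
  have hG': "AE y in lborel. y \<in> cball x (2 * r) \<longrightarrow> h y = G y" using hG by eventually_elim (use r(3) in auto)
  obtain M where b: "AE y in lborel. y \<in> cball x (2 * r) \<longrightarrow> \<bar>h y\<bar> \<le> M"
    using AE_bounded_on_compact[OF compact_cball c hG'] by blast
  have "dyadic 2 (real 0 + \<beta>) (ball x r) N (\<lambda>n. conv w (dil n \<eta>))"
  proof (rule dyadic_of_conv[where J="{0::nat}" and F="\<lambda>_. h" and \<kappa>="\<lambda>_. \<Psi>"])
    show "\<exists>C. \<forall>n\<ge>N. \<forall>y\<in>ball x r. \<bar>conv h (dil n \<kappa>) y\<bar> \<le> C" if "kernel \<kappa>" for \<kappa>
      by (rule conv_local_bounded[OF h that b r(4)])
    show "\<exists>C. \<forall>n\<ge>N. \<forall>y\<in>ball x r. \<bar>conv h (dil n \<kappa>) y\<bar> \<le> C * 2 powr (- \<beta> * real n)" if "kernel \<kappa>" "integral\<^sup>L lborel \<kappa> = 0" for \<kappa>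
      by (rule conv_local_holder[OF h that hG' hl G(2) r(4)])
    fix n y assume "n \<ge> N" "y \<in> ball x r"
    then show "conv w (dil n \<eta>) y - conv w (dil (Suc n) \<eta>) y = 1 / 2 ^ ((2 + 0) * n) * (\<Sum>j\<in>{0::nat}. conv h (dil n \<Psi>) y)"
      using telescope_weak_laplacian[OF w \<eta>(1) \<Psi> L weak r(5)] by (simp add: four_pow)
  qed (use \<Psi> h smooth_conv[OF \<eta>(1) w] G in auto)
  then show ?thesis using r(1) unfolding of_nat_1 of_nat_0 add_0_right add_0_left by blast
qed

text \<open>
  As for a Hoelder continuous right-hand side in the form \<open>\<Delta>w = h\<close>, with one derivative less.
\<close>

lemma dyadic_weak_divergence_holder:
  assumes w: "integrable lborel w" and F: "\<And>i. i \<in> Basis \<Longrightarrow> integrable lborel (F i)" and weak: "weak_divergence U w F"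
    and G: "\<And>i. i \<in> Basis \<Longrightarrow> Ck_holder_loc 0 \<beta> U (G i)" "0 < \<beta>" "\<beta> \<le> 1"
    and FG: "\<And>i. i \<in> Basis \<Longrightarrow> AE y in lborel. y \<in> U \<longrightarrow> F i y = G i y"
    and x: "x \<in> U"
  shows "\<exists>r>0. \<exists>N. dyadic 1 \<beta> (ball x r) N (\<lambda>n. conv w (dil n \<eta>))"
proof -
  obtain r N where r: "r > 0" "2 * r \<le> 1" "cball x (2 * r) \<subseteq> U" "\<forall>n\<ge>N. 1 / 2 ^ n \<le> r"
    "\<And>n y. n \<ge> N \<Longrightarrow> y \<in> ball x r \<Longrightarrow> cball y (1 / 2 ^ n) \<subseteq> U"
    using open_cball_dyadic[OF U x zero_less_one] by metis
  have c: "continuous_on (cball x (2 * r)) (G i)" and hl: "holder_on \<beta> (cball x (2 * r)) (G i)" if "i \<in> Basis" for i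
    using G(1)[OF that] r(3) compact_cball by (auto simp: holder_on_compacts_iff intro: continuous_on_subset)
  have FG': "AE y in lborel. y \<in> cball x (2 * r) \<longrightarrow> F i y = G i y" if "i \<in> Basis" for i
    using FG[OF that] by eventually_elim (use r(3) in auto)
  have b: "\<exists>M. AE y in lborel. y \<in> cball x (2 * r) \<longrightarrow> \<bar>F i y\<bar> \<le> M" if "i \<in> Basis" for i
    by (rule AE_bounded_on_compact[OF compact_cball c[OF that] FG'[OF that]])
  have "dyadic 1 (real 0 + \<beta>) (ball x r) N (\<lambda>n. conv w (dil n \<eta>))"
  proof (rule dyadic_of_conv[where J=Basis and F=F and \<kappa>="\<lambda>i. pd i \<Psi>"])
    show "\<exists>C. \<forall>n\<ge>N. \<forall>y\<in>ball x r. \<bar>conv (F i) (dil n \<kappa>) y\<bar> \<le> C" if "i \<in> Basis" "kernel \<kappa>" for \<kappa> i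
      using b[OF that(1)] conv_local_bounded[OF F[OF that(1)] that(2) _ r(4)] by blast
    show "\<exists>C. \<forall>n\<ge>N. \<forall>y\<in>ball x r. \<bar>conv (F i) (dil n \<kappa>) y\<bar> \<le> C * 2 powr (- \<beta> * real n)"
      if "i \<in> Basis" "kernel \<kappa>" "integral\<^sup>L lborel \<kappa> = 0" for \<kappa> i
      by (rule conv_local_holder[OF F[OF that(1)] that(2,3) FG'[OF that(1)] hl[OF that(1)] G(2) r(4)])
    fix n y assume "n \<ge> N" "y \<in> ball x r"
    then show "conv w (dil n \<eta>) y - conv w (dil (Suc n) \<eta>) y = 1 / 2 ^ ((1 + 0) * n) * (\<Sum>i\<in>Basis. conv (F i) (dil n (pd i \<Psi>)) y)"
      using telescope_weak_divergence[OF w \<eta>(1) \<Psi> L weak r(5)] by simp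
  qed (use \<Psi> F G smooth_conv[OF \<eta>(1) w] kernel_pd kernel_pd_integral in auto)
  then show ?thesis using r(1) unfolding of_nat_1 of_nat_0 add_0_right add_0_left by blast
qed

text \<open>
  One derivative is moved from the kernel to the right-hand side by parts. The derivatives of the mollifications
  then satisfy the identity with the Hoelder continuous source \<open>pd i G\<close>, and they gain two orders.
\<close>

lemma dyadic_weak_laplacian_C1:
  assumes w: "integrable lborel w" and h: "integrable lborel h" and weak: "weak_laplacian U w h"
    and G: "Ck_holder_loc 1 \<beta> U G" "0 < \<beta>" "\<beta> \<le> 1" and hG: "AE y in lborel. y \<in> U \<longrightarrow> h y = G y"
    and x: "x \<in> U"
  shows "\<exists>r>0. \<exists>N. dyadic 3 \<beta> (ball x r) N (\<lambda>n. conv w (dil n \<eta>))"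
proof -
  obtain r N where r: "r > 0" "2 * r \<le> 1" "cball x (2 * r) \<subseteq> U" "\<forall>n\<ge>N. 1 / 2 ^ n \<le> r"
    "\<And>n y. n \<ge> N \<Longrightarrow> y \<in> ball x r \<Longrightarrow> cball y (1 / 2 ^ n) \<subseteq> U"
    using open_cball_dyadic[OF U x zero_less_one] by metis
  let ?K = "cball x (2 * r)"
  have Gd: "G differentiable (at y)" if "y \<in> U" for y using G(1) that by (simp add: Ck_holder_loc_Suc_open[OF U])
  have Gc: "continuous_on U G"
    using Gd by (intro continuous_at_imp_continuous_on ballI differentiable_imp_continuous_within)
  have pG: "Ck_holder_loc 0 \<beta> U (pd i G)" if "i \<in> Basis" for i using G(1) that by (simp add: Ck_holder_loc_Suc_open[OF U])
  have G1: "Ck_on 1 U G" using Gd pG by (simp add: Ck_on_Suc_open[OF U])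
  have c: "continuous_on ?K G" using Gc r(3) continuous_on_subset by blast
  have hG': "AE y in lborel. y \<in> ?K \<longrightarrow> h y = G y" using hG by eventually_elim (use r(3) in auto)
  obtain M where b: "AE y in lborel. y \<in> ?K \<longrightarrow> \<bar>h y\<bar> \<le> M"
    using AE_bounded_on_compact[OF compact_cball c hG'] by blast
  define H where "H i y = indicator ?K y * pd i G y" for i y
  have pc: "continuous_on ?K (pd i G)" and phl: "holder_on \<beta> ?K (pd i G)" if "i \<in> Basis" for i
    using pG[OF that] r(3) compact_cball by (auto simp: holder_on_compacts_iff intro: continuous_on_subset)
  have HI: "integrable lborel (H i)" if "i \<in> Basis" for i
    using borel_integrable_compact[OF compact_cball pc[OF that]] by (simp add: H_def[abs_def])
  have HG: "AE y in lborel. y \<in> ?K \<longrightarrow> H i y = pd i G y" for i by (intro AE_I2) (simp add: H_def)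
  \<comment> \<open>Integration by parts; the kernel vanishes off the ball on which \<open>h\<close> and \<open>G\<close> agree.\<close>
  have move: "2 ^ n * conv h (dil n (pd i \<Psi>)) y = conv (H i) (dil n \<Psi>) y"
    if "n \<ge> N" "y \<in> ball x r" and i: "i \<in> Basis" for n y i
  proof -
    have sub: "cball y (1 / 2 ^ n) \<subseteq> ?K" using cball_dyadic_subset[OF that(2)] r(4) that(1) by blast
    have t: "test_function U (\<lambda>z. dil n \<Psi> (y - z))" by (rule test_function_dil[OF \<Psi> r(5)[OF that(1,2)]])
    have z: "dil n \<kappa> (y - z) = 0" if "z \<notin> ?K" "kernel \<kappa>" for z and \<kappa> :: "'a \<Rightarrow> real"
    proof (rule dil_zero[OF that(2)])
      have "z \<notin> cball y (1 / 2 ^ n)" using sub that(1) by blast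
      then show "1 / 2 ^ n < norm (y - z)" by (simp add: dist_norm)
    qed
    have "2 ^ n * conv h (dil n (pd i \<Psi>)) y = (LINT z|lborel. h z * (2 ^ n * dil n (pd i \<Psi>) (y - z)))"
      unfolding conv_def by (subst integral_mult_right_zero[symmetric]) (simp add: mult_ac)
    also have "\<dots> = (LINT z|lborel. G z * (2 ^ n * dil n (pd i \<Psi>) (y - z)))"
    proof (rule Bochner_Integration.integral_cong_AE)
      have e: "(\<lambda>z. 2 ^ n * dil n (pd i \<Psi>) (y - z)) = (\<lambda>z. - pd i (\<lambda>z. dil n \<Psi> (y - z)) z)"
        unfolding pd_reflect_dil[OF \<Psi>] by simp
      show "(\<lambda>z. G z * (2 ^ n * dil n (pd i \<Psi>) (y - z))) \<in> borel_measurable lborel"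
        unfolding fun_cong[OF e] using borel_measurable_integrable[OF integral_by_parts(1)[OF U G1 t i]] by simp
      have "(\<lambda>z. dil n (pd i \<Psi>) (y - z)) \<in> borel_measurable borel"
        using C1c_continuous Cinfc_C1c Cinfc_dil kernel_pd[OF \<Psi> i] by (intro cont_diff_measurable) blast
      then show "(\<lambda>z. h z * (2 ^ n * dil n (pd i \<Psi>) (y - z))) \<in> borel_measurable lborel"
        using borel_measurable_integrable[OF h] by measurable
      show "AE z in lborel. h z * (2 ^ n * dil n (pd i \<Psi>) (y - z)) = G z * (2 ^ n * dil n (pd i \<Psi>) (y - z))"
        using hG' by eventually_elim (use z[OF _ kernel_pd[OF \<Psi> i]] in auto)
    qed
    also have "\<dots> = (LINT z|lborel. - (G z * pd i (\<lambda>z. dil n \<Psi> (y - z)) z))"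
      unfolding pd_reflect_dil[OF \<Psi>] by simp
    also have "\<dots> = - (LINT z|lborel. G z * pd i (\<lambda>z. dil n \<Psi> (y - z)) z)"
      by (rule integral_minus)
    also have "\<dots> = (LINT z|lborel. pd i G z * dil n \<Psi> (y - z))"
      using integral_by_parts(3)[OF U G1 t i] by simp
    also have "(\<lambda>z. pd i G z * dil n \<Psi> (y - z)) = (\<lambda>z. H i z * dil n \<Psi> (y - z))"
      using z[OF _ \<Psi>] by (auto simp: H_def indicator_def fun_eq_iff)
    finally show ?thesis by (simp add: conv_def)
  qed
  have d2: "dyadic 2 (real 0 + \<beta>) (ball x r) N (\<lambda>n. pd i (conv w (dil n \<eta>)))" if i: "i \<in> Basis" for i
  proof (rule dyadic_of_conv[where J="{0::nat}" and F="\<lambda>_. H i" and \<kappa>="\<lambda>_. \<Psi>"])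
    obtain M where b: "AE y in lborel. y \<in> cball x (2 * r) \<longrightarrow> \<bar>H i y\<bar> \<le> M"
      using AE_bounded_on_compact[OF compact_cball pc[OF i] HG] by blast
    show "\<exists>C. \<forall>n\<ge>N. \<forall>y\<in>ball x r. \<bar>conv (H i) (dil n \<kappa>) y\<bar> \<le> C" if "kernel \<kappa>" for \<kappa>
      by (rule conv_local_bounded[OF HI[OF i] that b r(4)])
    show "\<exists>C. \<forall>n\<ge>N. \<forall>y\<in>ball x r. \<bar>conv (H i) (dil n \<kappa>) y\<bar> \<le> C * 2 powr (- \<beta> * real n)" if "kernel \<kappa>" "integral\<^sup>L lborel \<kappa> = 0" for \<kappa>
      by (rule conv_local_holder[OF HI[OF i] that HG phl[OF i] G(2) r(4)])
    show "Ck_on k UNIV (pd i (conv w (dil n \<eta>)))" for n k using Ck_on_pd[OF smooth_conv[OF \<eta>(1) w] i] .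
    fix n y assume n: "n \<ge> N" and y: "y \<in> ball x r"
    have "pd i (conv w (dil n \<eta>)) y - pd i (conv w (dil (Suc n) \<eta>)) y = 1 / 4 ^ n * 2 ^ n * (\<Sum>j\<in>{0::nat}. conv h (dil n (pd i \<Psi>)) y)"
      using telescope_weak_laplacian[OF w \<eta>(1) \<Psi> L weak r(5)[OF n]] h \<Psi>
      by (intro pd_difference_conv[OF open_ball _ _ _ smooth_conv[OF \<eta>(1) w] smooth_conv[OF \<eta>(1) w] _ y i]) auto
    then show "pd i (conv w (dil n \<eta>)) y - pd i (conv w (dil (Suc n) \<eta>)) y = 1 / 2 ^ ((2 + 0) * n) * (\<Sum>j\<in>{0::nat}. conv (H i) (dil n \<Psi>) y)"
      using move[OF n y i] by (simp add: four_pow)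
  qed (use \<Psi> HI[OF i] G in auto)
  obtain C where C: "\<And>n y. n \<ge> N \<Longrightarrow> y \<in> ball x r \<Longrightarrow> \<bar>conv h (dil n \<Psi>) y\<bar> \<le> C"
    using conv_local_bounded[OF h \<Psi> b r(4)] by blast
  have bd: "\<bar>conv w (dil n \<eta>) y - conv w (dil (Suc n) \<eta>) y\<bar> \<le> \<bar>C\<bar> * 2 powr (- \<beta> * n)" if "n \<ge> N" "y \<in> ball x r" for n y
  proof -
    have "\<bar>conv w (dil n \<eta>) y - conv w (dil (Suc n) \<eta>) y\<bar> = 1 / 4 ^ n * \<bar>conv h (dil n \<Psi>) y\<bar>"
      using telescope_weak_laplacian[OF w \<eta>(1) \<Psi> L weak r(5)[OF that]] by (simp add: abs_mult)
    also have "\<dots> \<le> 2 powr (- \<beta> * n) * \<bar>C\<bar>"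
    proof (intro mult_mono)
      have "(1::real) / 4 ^ n = 2 powr (- (2 * real n))"
        by (simp add: four_pow powr_minus powr_realpow[symmetric] divide_inverse)
      also have "\<dots> \<le> 2 powr (- \<beta> * n)"
      proof (rule powr_mono)
        have "\<beta> * real n \<le> 2 * real n" using G by (intro mult_right_mono) auto
        then show "- (2 * real n) \<le> - \<beta> * n" by (simp only: mult_minus_left neg_le_iff_le)
      qed simp
      finally show "(1::real) / 4 ^ n \<le> 2 powr (- \<beta> * n)" .
      show "\<bar>conv h (dil n \<Psi>) y\<bar> \<le> \<bar>C\<bar>" using C[OF that] by linarith
    qed auto
    finally show ?thesis by (simp add: mult.commute)
  qed
  have "dyadic (Suc 2) \<beta> (ball x r) N (\<lambda>n. conv w (dil n \<eta>))"
    unfolding dyadic.simps(2) using d2[unfolded of_nat_0 add_0_left] smooth_conv[OF \<eta>(1) w] bd by blast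
  moreover have "Suc 2 = 3" by simp
  ultimately show ?thesis using r(1) by metis
qed

end

section \<open>A Riesz potential bound for weak gradients\<close>

text \<open>
  Dilating a kernel with the factor \<open>2^(Dn)\<close> and summing over the scales produces a Riesz kernel: the geometric sum
  is dominated by its last term, the scale of size \<open>t\<close>.
\<close>

lemma dyadic_kernel_sum:
  fixes t D :: real
  assumes t: "0 < t" and D: "1 \<le> D"
  shows "(\<Sum>k<n. if t \<le> 1 / 2 ^ k then (2 powr D) ^ k else 0) \<le> 2 * t powr (- D)"
proof (induction n)
  case (Suc n)
  show ?case
  proof (cases "t \<le> 1 / 2 ^ n")
    case True
    have a: "(2::real) powr D \<ge> 2" using powr_mono[OF D, of 2] by simp
    have geo: "(\<Sum>k<Suc n. a ^ k) \<le> 2 * a ^ n" if "a \<ge> 2" for a :: real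
      using that
    proof (induction n)
      case (Suc n)
      have "2 * a ^ n \<le> a * a ^ n" using Suc.prems by (intro mult_right_mono) auto
      then show ?case using Suc.IH[OF Suc.prems]
        by (simp only: sum.lessThan_Suc[of _ "Suc n"] power_Suc[of a n])
    qed simp
    have "(\<Sum>k<Suc n. if t \<le> 1 / 2 ^ k then (2 powr D) ^ k else 0) \<le> (\<Sum>k<Suc n. (2 powr D) ^ k)"
      by (intro sum_mono) auto
    also have "\<dots> \<le> 2 * (2 powr D) ^ n" using geo a by blast
    also have "(2 powr D) ^ n = (1 / 2 ^ n) powr (- D)"
    proof -
      have h: "1 / 2 ^ n = (2::real) powr (- real n)" by (simp add: powr_minus powr_realpow divide_inverse)
      show ?thesis unfolding h powr_powr by (simp add: powr_mult_nat[symmetric] mult.commute)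
    qed
    also have "\<dots> \<le> t powr (- D)" using t True D by (intro powr_mono2') auto
    finally show ?thesis by simp
  next
    case False then show ?thesis using Suc by simp
  qed
qed (simp add: D)

lemma conv_dil_nn_bound:
  fixes h \<kappa> :: "'a::euclidean_space \<Rightarrow> real"
  assumes h: "integrable lborel h" and k: "kernel \<kappa>" and M: "\<And>z. \<bar>\<kappa> z\<bar> \<le> M"
  shows "ennreal \<bar>conv h (dil n \<kappa>) x\<bar>
     \<le> (\<integral>\<^sup>+y. ennreal (2 ^ (n * DIM('a)) * M * \<bar>h y\<bar>) * indicator (cball x (1 / 2 ^ n)) y \<partial>lborel)"
proof -
  have I: "integrable lborel (\<lambda>y. h y * dil n \<kappa> (x - y))"
    by (rule conv_integrable[OF h Cinfc_C1c[OF Cinfc_dil[OF k]]])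
  have "ennreal \<bar>conv h (dil n \<kappa>) x\<bar> \<le> (\<integral>\<^sup>+y. ennreal (norm (h y * dil n \<kappa> (x - y))) \<partial>lborel)"
    unfolding conv_def using integral_norm_bound_ennreal[OF I] by simp
  also have "\<dots> \<le> (\<integral>\<^sup>+y. ennreal (2 ^ (n * DIM('a)) * M * \<bar>h y\<bar>) * indicator (cball x (1 / 2 ^ n)) y \<partial>lborel)"
  proof (rule nn_integral_mono)
    fix y
    show "ennreal (norm (h y * dil n \<kappa> (x - y))) \<le> ennreal (2 ^ (n * DIM('a)) * M * \<bar>h y\<bar>) * indicator (cball x (1 / 2 ^ n)) y"
    proof (cases "y \<in> cball x (1 / 2 ^ n)")
      case True
      have "\<bar>h y\<bar> * (2 ^ (n * DIM('a)) * \<bar>\<kappa> (2 ^ n *\<^sub>R (x - y))\<bar>) \<le> \<bar>h y\<bar> * (2 ^ (n * DIM('a)) * M)"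
        using M by (intro mult_left_mono) auto
      then show ?thesis using True by (auto simp: dil_def abs_mult mult_ac intro!: ennreal_leI)
    next
      case False
      then have "dil n \<kappa> (x - y) = 0" by (intro dil_zero[OF k]) (simp add: dist_norm)
      then show ?thesis by simp
    qed
  qed
  finally show ?thesis .
qed

lemma riesz_potential_integrable:
  fixes x0 :: "'a::euclidean_space" and h :: "'a \<Rightarrow> real"
  assumes h: "integrable lborel h" and b: "0 \<le> b" "b < real DIM('a)"
  shows "(\<integral>\<^sup>+x. riesz_potential b x0 r' (\<lambda>y. \<bar>h y\<bar>) x * indicator (ball x0 r) x \<partial>lborel) < \<infinity>"
proof -
  have hm[measurable]: "h \<in> borel_measurable borel" using borel_measurable_integrable[OF h] by simp
  obtain C where C: "\<And>y. (\<integral>\<^sup>+x. ennreal (norm (x - y) powr (- b)) * indicator (ball x0 r) x \<partial>lborel) \<le> ennreal C"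
    using nn_integral_singular_bound[OF b, of x0 r] by blast
  have "(\<integral>\<^sup>+x. riesz_potential b x0 r' (\<lambda>y. \<bar>h y\<bar>) x * indicator (ball x0 r) x \<partial>lborel)
    = (\<integral>\<^sup>+x. \<integral>\<^sup>+y. ennreal \<bar>h y\<bar> * indicator (ball x0 r') y * (ennreal (norm (x - y) powr (- b)) * indicator (ball x0 r) x) \<partial>lborel \<partial>lborel)"
    unfolding riesz_potential_def by (subst nn_integral_multc[symmetric], measurable) (simp add: ennreal_mult norm_minus_commute mult_ac)
  also have "\<dots> = (\<integral>\<^sup>+y. \<integral>\<^sup>+x. ennreal \<bar>h y\<bar> * indicator (ball x0 r') y * (ennreal (norm (x - y) powr (- b)) * indicator (ball x0 r) x) \<partial>lborel \<partial>lborel)"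
    by (rule lborel_pair.Fubini') measurable
  also have "\<dots> = (\<integral>\<^sup>+y. ennreal \<bar>h y\<bar> * indicator (ball x0 r') y * (\<integral>\<^sup>+x. ennreal (norm (x - y) powr (- b)) * indicator (ball x0 r) x \<partial>lborel) \<partial>lborel)"
    by (intro nn_integral_cong nn_integral_cmult) measurable
  also have "\<dots> \<le> (\<integral>\<^sup>+y. ennreal \<bar>h y\<bar> * ennreal C \<partial>lborel)"
    using C by (intro nn_integral_mono mult_mono) (auto simp: indicator_def)
  also have "\<dots> = (\<integral>\<^sup>+y. ennreal \<bar>h y\<bar> \<partial>lborel) * ennreal C" by (rule nn_integral_multc) measurable
  also have "\<dots> < \<infinity>"
    using h unfolding integrable_iff_bounded by (auto simp: ennreal_mult_less_top)
  finally show ?thesis .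
qed

lemma set_integrable_lebesgue_of_lborel:
  fixes f :: "'a::euclidean_space \<Rightarrow> real"
  assumes "integrable lborel f" "compact K"
  shows "set_integrable lebesgue K f"
proof -
  have "integrable lborel (\<lambda>x. indicator K x *\<^sub>R f x)"
    using assms borel_compact by (intro integrable_mult_indicator) auto
  then show ?thesis unfolding set_integrable_def
    by (simp add: integrable_completion borel_measurable_integrable)
qed

lemma set_integral_lebesgue_test:
  fixes f \<phi> :: "'a::euclidean_space \<Rightarrow> real"
  assumes f: "f \<in> borel_measurable borel" and t: "test_function U \<phi>"
  shows "(LINT x:U|lebesgue. f x * \<phi> x) = (LINT x|lborel. f x * \<phi> x)"
proof -
  have "\<phi> \<in> borel_measurable borel"
    using C1c_continuous[OF Cinfc_C1c[OF test_function_Cinfc[OF t]]] by (rule borel_measurable_continuous_onI)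
  then have "(\<lambda>x. f x * \<phi> x) \<in> borel_measurable lborel" using f by simp
  moreover have "(\<lambda>x. indicator U x *\<^sub>R (f x * \<phi> x)) = (\<lambda>x. f x * \<phi> x)"
    using test_function_zero_outside[OF t] by (auto simp: fun_eq_iff indicator_def)
  ultimately show ?thesis unfolding set_lebesgue_integral_def by (simp add: integral_completion)
qed

context
  fixes \<eta> \<Psi> :: "'a::euclidean_space \<Rightarrow> real" and U :: "'a set"
  assumes \<eta>: "kernel \<eta>" "\<And>z. 0 \<le> \<eta> z" "integral\<^sup>L lborel \<eta> = 1" and \<Psi>: "kernel \<Psi>"
    and L: "\<And>z. lap \<Psi> z = \<eta> z - 2 ^ DIM('a) * \<eta> (2 *\<^sub>R z)"
    and U: "open U"
begin

text \<open>
  Mollification commutes with weak derivatives, at points at distance more than \<open>2^(-n)\<close> from the complement of \<open>U\<close>.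
\<close>

lemma pd_mollified:
  assumes w: "integrable lborel w" and i: "i \<in> Basis"
    and weak: "\<And>\<phi>. test_function U \<phi> \<Longrightarrow> (LINT x|lborel. w x * pd i \<phi> x) = - (LINT x|lborel. gi x * \<phi> x)"
    and x: "cball x (1 / 2 ^ n) \<subseteq> U"
  shows "pd i (conv w (dil n \<eta>)) x = conv gi (dil n \<eta>) x"
proof -
  have "(\<lambda>y. w y * pd i (\<lambda>y. dil n \<eta> (x - y)) y) = (\<lambda>y. - (2 ^ n) * (w y * dil n (pd i \<eta>) (x - y)))"
    unfolding pd_reflect_dil[OF \<eta>(1)] by auto
  then have "- (2 ^ n) * conv w (dil n (pd i \<eta>)) x = - conv gi (dil n \<eta>) x"
    using weak[OF test_function_dil[OF \<eta>(1) x]] by (simp add: conv_def)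
  then show ?thesis unfolding pd_conv_dil[OF w \<eta>(1) i] by simp
qed

text \<open>
  The differences of the gradients are \<open>2^(-n) h * (pd i \<Psi>)_n\<close>, with kernels of size \<open>2^((d-1)n)\<close> on balls of radius
  \<open>2^(-n)\<close>. Summed over the scales they are bounded by the kernel \<open>|x-y|^(1-d)\<close>; the first mollification only
  contributes a constant.
\<close>

lemma riesz_mollified:
  assumes dim: "DIM('a) \<ge> 2" and w: "integrable lborel w" and h: "integrable lborel h" and weak: "weak_laplacian U w h"
    and i: "i \<in> Basis" and sub: "ball x0 r' \<subseteq> U" and r: "0 < r" "r < r'"
  shows "\<exists>N. \<exists>A\<ge>0. \<forall>n\<ge>N. \<forall>x\<in>ball x0 r. cball x (1 / 2 ^ n) \<subseteq> U \<and>
     ennreal \<bar>pd i (conv w (dil n \<eta>)) x\<bar> \<le> ennreal A + ennreal A * riesz_potential (real DIM('a) - 1) x0 r' (\<lambda>y. \<bar>h y\<bar>) x"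
proof -
  let ?D = "real DIM('a) - 1"
  let ?S = "riesz_potential ?D x0 r' (\<lambda>y. \<bar>h y\<bar>)"
  have D: "1 \<le> ?D" using dim by simp
  have hm[measurable]: "h \<in> borel_measurable borel" using borel_measurable_integrable[OF h] by simp
  obtain N where N: "\<forall>n\<ge>N. 1 / 2 ^ n \<le> (r' - r) / 2" using small_dyadic[of "(r' - r) / 2"] r by auto
  have cb: "cball x (1 / 2 ^ n) \<subseteq> ball x0 r'" if "n \<ge> N" "x \<in> ball x0 r" for n x
  proof
    fix y assume "y \<in> cball x (1 / 2 ^ n)"
    then have "dist x y \<le> (r' - r) / 2" using N that(1) by (meson mem_cball order_trans)
    then show "y \<in> ball x0 r'" using that(2) r dist_triangle[of x0 y x] by simp
  qed
  obtain M where M: "M \<ge> 0" "\<And>z. \<bar>pd i \<Psi> z\<bar> \<le> M"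
    using C1c_bounded[OF Cinfc_C1c[OF kernel_Cinfc[OF kernel_pd[OF \<Psi> i]]]] by blast
  define g where "g n = pd i (conv w (dil n \<eta>))" for n
  define c where "c n t = (if t \<le> 1 / 2 ^ n then (2 powr ?D) ^ n else 0)" for n :: nat and t :: real
  have c0: "c n t \<ge> 0" for n t by (simp add: c_def)
  have cm[measurable]: "c n \<in> borel_measurable borel" for n unfolding c_def[abs_def] by measurable
  have diff: "ennreal \<bar>g n x - g (Suc n) x\<bar> \<le> (\<integral>\<^sup>+y. ennreal (M * \<bar>h y\<bar> * c n (norm (y - x))) * indicator (ball x0 r') y \<partial>lborel)"
    if n: "n \<ge> N" and x: "x \<in> ball x0 r" for n x
  proof -
    have cU: "cball z (1 / 2 ^ n) \<subseteq> U" if "z \<in> ball x0 r" for z using cb[OF n that] sub by blast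
    have "g n x - g (Suc n) x = 1 / 4 ^ n * 2 ^ n * (\<Sum>j\<in>{0::nat}. conv h (dil n (pd i \<Psi>)) x)"
      unfolding g_def using telescope_weak_laplacian[OF w \<eta>(1) \<Psi> L weak cU] h \<Psi>
      by (intro pd_difference_conv[OF open_ball _ _ _ smooth_conv[OF \<eta>(1) w] smooth_conv[OF \<eta>(1) w] _ x i]) auto
    then have "\<bar>g n x - g (Suc n) x\<bar> = 1 / 2 ^ n * \<bar>conv h (dil n (pd i \<Psi>)) x\<bar>"
      by (simp add: abs_mult four_pow mult_2 power_add)
    then have "ennreal \<bar>g n x - g (Suc n) x\<bar> = ennreal (1 / 2 ^ n) * ennreal \<bar>conv h (dil n (pd i \<Psi>)) x\<bar>"
      by (simp add: ennreal_mult[symmetric])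
    also have "\<dots> \<le> ennreal (1 / 2 ^ n) * (\<integral>\<^sup>+y. ennreal (2 ^ (n * DIM('a)) * M * \<bar>h y\<bar>) * indicator (cball x (1 / 2 ^ n)) y \<partial>lborel)"
      by (intro mult_left_mono conv_dil_nn_bound[OF h kernel_pd[OF \<Psi> i] M(2)]) simp
    also have "\<dots> = (\<integral>\<^sup>+y. ennreal (1 / 2 ^ n) * (ennreal (2 ^ (n * DIM('a)) * M * \<bar>h y\<bar>) * indicator (cball x (1 / 2 ^ n)) y) \<partial>lborel)"
      by (rule nn_integral_cmult[symmetric]) measurable
    also have "\<dots> \<le> (\<integral>\<^sup>+y. ennreal (M * \<bar>h y\<bar> * c n (norm (y - x))) * indicator (ball x0 r') y \<partial>lborel)"
    proof (rule nn_integral_mono)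
      fix y
      have p: "(2 powr ?D) ^ n = 1 / 2 ^ n * 2 ^ (n * DIM('a))"
        by (simp add: powr_diff powr_realpow power_divide power_mult mult.commute[of n])
      show "ennreal (1 / 2 ^ n) * (ennreal (2 ^ (n * DIM('a)) * M * \<bar>h y\<bar>) * indicator (cball x (1 / 2 ^ n)) y)
        \<le> ennreal (M * \<bar>h y\<bar> * c n (norm (y - x))) * indicator (ball x0 r') y"
      proof (cases "y \<in> cball x (1 / 2 ^ n)")
        case True
        then have "c n (norm (y - x)) = 1 / 2 ^ n * 2 ^ (n * DIM('a))"
          unfolding c_def p by (simp add: dist_norm norm_minus_commute)
        then show ?thesis using True cb[OF n x] M(1) by (auto simp: ennreal_mult[symmetric] mult_ac)
      qed simp
    qed
    finally show ?thesis .
  qed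
  have acc: "ennreal \<bar>g (N + m) x\<bar> \<le> ennreal \<bar>g N x\<bar> + (\<Sum>k<m. ennreal \<bar>g (N + k) x - g (Suc (N + k)) x\<bar>)" for m x
  proof (induction m)
    case (Suc m)
    have "\<bar>g (N + Suc m) x\<bar> \<le> \<bar>g (N + m) x\<bar> + \<bar>g (N + m) x - g (Suc (N + m)) x\<bar>" by simp
    then have "ennreal \<bar>g (N + Suc m) x\<bar> \<le> ennreal \<bar>g (N + m) x\<bar> + ennreal \<bar>g (N + m) x - g (Suc (N + m)) x\<bar>"
      by (metis abs_ge_zero ennreal_leI ennreal_plus)
    also have "\<dots> \<le> (ennreal \<bar>g N x\<bar> + (\<Sum>k<m. ennreal \<bar>g (N + k) x - g (Suc (N + k)) x\<bar>)) + ennreal \<bar>g (N + m) x - g (Suc (N + m)) x\<bar>"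
      by (intro add_right_mono Suc)
    finally show ?case by (simp add: add.assoc)
  qed simp
  have sumb: "(\<Sum>k<m. ennreal \<bar>g (N + k) x - g (Suc (N + k)) x\<bar>) \<le> ennreal (2 * M) * ?S x" if x: "x \<in> ball x0 r" for m x
  proof -
    have "(\<Sum>k<m. ennreal \<bar>g (N + k) x - g (Suc (N + k)) x\<bar>)
      \<le> (\<Sum>k<m. \<integral>\<^sup>+y. ennreal (M * \<bar>h y\<bar> * c (N + k) (norm (y - x))) * indicator (ball x0 r') y \<partial>lborel)"
      by (intro sum_mono diff x) simp
    also have "\<dots> = (\<integral>\<^sup>+y. (\<Sum>k<m. ennreal (M * \<bar>h y\<bar> * c (N + k) (norm (y - x))) * indicator (ball x0 r') y) \<partial>lborel)"
      by (rule nn_integral_sum[symmetric]) measurable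
    also have "\<dots> \<le> (\<integral>\<^sup>+y. ennreal (2 * M) * (ennreal (\<bar>h y\<bar> * norm (y - x) powr (- ?D)) * indicator (ball x0 r') y) \<partial>lborel)"
    proof (rule nn_integral_mono_AE)
      have "AE y in lborel. y \<noteq> x" by (rule AE_lborel_singleton)
      then show "AE y in lborel. (\<Sum>k<m. ennreal (M * \<bar>h y\<bar> * c (N + k) (norm (y - x))) * indicator (ball x0 r') y)
        \<le> ennreal (2 * M) * (ennreal (\<bar>h y\<bar> * norm (y - x) powr (- ?D)) * indicator (ball x0 r') y)"
      proof eventually_elim
        case (elim y)
        have "(\<Sum>k<m. c (N + k) (norm (y - x))) = (\<Sum>k\<in>{N..<N + m}. c k (norm (y - x)))"
          using sum.shift_bounds_nat_ivl[of "\<lambda>k. c k (norm (y - x))" 0 N m] by (simp add: lessThan_atLeast0 add.commute)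
        also have "\<dots> \<le> (\<Sum>k<N + m. c k (norm (y - x)))" by (intro sum_mono2) (auto simp: c0)
        also have "\<dots> \<le> 2 * norm (y - x) powr (- ?D)"
          unfolding c_def using elim D by (intro dyadic_kernel_sum) auto
        finally have le: "(\<Sum>k<m. c (N + k) (norm (y - x))) \<le> 2 * norm (y - x) powr (- ?D)" .
        have "(\<Sum>k<m. ennreal (M * \<bar>h y\<bar> * c (N + k) (norm (y - x)))) = ennreal (M * \<bar>h y\<bar> * (\<Sum>k<m. c (N + k) (norm (y - x))))"
          using M(1) c0 by (simp add: sum_ennreal sum_distrib_left)
        also have "\<dots> \<le> ennreal (M * \<bar>h y\<bar> * (2 * norm (y - x) powr (- ?D)))"
          using le M(1) by (intro ennreal_leI mult_left_mono) auto
        also have "\<dots> = ennreal (2 * M) * ennreal (\<bar>h y\<bar> * norm (y - x) powr (- ?D))"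
          using M(1) by (simp add: ennreal_mult[symmetric] mult_ac)
        finally show ?case by (auto simp: indicator_def)
      qed
    qed
    also have "\<dots> = ennreal (2 * M) * ?S x" unfolding riesz_potential_def by (rule nn_integral_cmult) measurable
    finally show ?thesis .
  qed
  have "continuous_on (cball x0 r) (g N)"
    unfolding g_def using Ck_on_imp_continuous[OF Ck_on_pd[OF smooth_conv[OF \<eta>(1) w] i]] continuous_on_subset by blast
  then have "bounded (g N ` cball x0 r)" by (intro compact_imp_bounded compact_continuous_image) auto
  then obtain A0 where A0: "\<forall>x\<in>cball x0 r. \<bar>g N x\<bar> \<le> A0" unfolding bounded_iff by auto
  define A where "A = max \<bar>A0\<bar> (2 * M)"
  have "ennreal \<bar>g n x\<bar> \<le> ennreal A + ennreal A * ?S x" if n: "n \<ge> N" and x: "x \<in> ball x0 r" for n x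
  proof -
    obtain m where m: "n = N + m" using n le_Suc_ex by blast
    have "ennreal \<bar>g n x\<bar> \<le> ennreal \<bar>g N x\<bar> + ennreal (2 * M) * ?S x"
      unfolding m using acc[of m x] add_left_mono[OF sumb[OF x]] by (rule order_trans)
    also have "\<dots> \<le> ennreal A + ennreal A * ?S x"
    proof (intro add_mono mult_right_mono ennreal_leI)
      have "\<bar>g N x\<bar> \<le> A0" using A0 x by auto
      then show "\<bar>g N x\<bar> \<le> A" unfolding A_def by linarith
    qed (auto simp: A_def)
    finally show ?thesis .
  qed
  moreover have "A \<ge> 0" by (simp add: A_def)
  ultimately show ?thesis using cb sub unfolding g_def by (intro exI[of _ N] exI[of _ A]) blast
qed

text \<open>
  The bound for the mollified gradients passes to the weak limit. As it depends on the point and may be infinite, the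
  limit is taken against nonnegative test functions, for \<open>gi\<close> and \<open>- gi\<close> separately.
\<close>

lemma riesz_gradient:
  assumes dim: "DIM('a) \<ge> 2" and w: "integrable lborel w" and h: "integrable lborel h" and weak: "weak_laplacian U w h"
    and i: "i \<in> Basis" and gi: "integrable lborel gi"
    and grad: "\<And>\<phi>. test_function U \<phi> \<Longrightarrow> (LINT x|lborel. w x * pd i \<phi> x) = - (LINT x|lborel. gi x * \<phi> x)"
    and sub: "ball x0 r' \<subseteq> U" and r: "0 < r" "r < r'"
  shows "\<exists>A\<ge>0. AE x in lborel. x \<in> ball x0 r \<longrightarrow>
     ennreal \<bar>gi x\<bar> \<le> ennreal A + ennreal A * riesz_potential (real DIM('a) - 1) x0 r' (\<lambda>y. \<bar>h y\<bar>) x"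
proof -
  let ?D = "real DIM('a) - 1" and ?B = "ball x0 r"
  define S where "S = riesz_potential ?D x0 r' (\<lambda>y. \<bar>h y\<bar>)"
  obtain N A where A: "A \<ge> 0" and NA: "\<And>n x. n \<ge> N \<Longrightarrow> x \<in> ?B \<Longrightarrow> cball x (1 / 2 ^ n) \<subseteq> U"
    "\<And>n x. n \<ge> N \<Longrightarrow> x \<in> ?B \<Longrightarrow> ennreal \<bar>pd i (conv w (dil n \<eta>)) x\<bar> \<le> ennreal A + ennreal A * S x"
    using riesz_mollified[OF dim w h weak i sub r] unfolding S_def by blast
  have hm[measurable]: "h \<in> borel_measurable borel" using borel_measurable_integrable[OF h] by simp
  have gm[measurable]: "gi \<in> borel_measurable borel" using borel_measurable_integrable[OF gi] by simp
  have Sm[measurable]: "S \<in> borel_measurable borel" unfolding S_def by measurable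
  have fin: "(\<integral>\<^sup>+x. S x * indicator ?B x \<partial>lborel) < \<infinity>"
    unfolding S_def using dim by (intro riesz_potential_integrable[OF h]) auto
  have Sfin: "AE x in lborel. x \<in> ?B \<longrightarrow> S x < \<infinity>"
  proof -
    have "AE x in lborel. S x * indicator ?B x \<noteq> \<infinity>" using fin by (intro nn_integral_PInf_AE) auto
    then show ?thesis by eventually_elim (auto simp: less_top)
  qed
  \<comment> \<open>The bound as a real-valued integrable function; it equals the potential wherever that is finite.\<close>
  define G where "G x = indicator ?B x * (A + A * enn2real (S x))" for x
  have GI: "integrable lborel G"
  proof -
    have "integrable lborel (\<lambda>x. indicator ?B x * enn2real (S x))"
    proof (rule integrableI_bounded)
      have "(\<integral>\<^sup>+x. ennreal (norm (indicator ?B x * enn2real (S x))) \<partial>lborel) \<le> (\<integral>\<^sup>+x. S x * indicator ?B x \<partial>lborel)"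
        by (intro nn_integral_mono) (auto simp: indicator_def ennreal_enn2real_if)
      then show "(\<integral>\<^sup>+x. ennreal (norm (indicator ?B x * enn2real (S x))) \<partial>lborel) < \<infinity>" using fin by simp
    qed measurable
    moreover have "integrable lborel (\<lambda>x. indicator ?B x * A)"
      using emeasure_bounded_finite[OF bounded_ball, of x0 r] by (intro integrable_mult_left) simp
    ultimately have "integrable lborel (\<lambda>x. indicator ?B x * A + A * (indicator ?B x * enn2real (S x)))" by simp
    then show ?thesis by (simp add: G_def[abs_def] algebra_simps)
  qed
  have le: "\<bar>conv gi (dil n \<eta>) x\<bar> \<le> G x" if "n \<ge> N" "x \<in> ?B" "S x < \<infinity>" for n x
  proof -
    have "ennreal \<bar>conv gi (dil n \<eta>) x\<bar> \<le> ennreal A + ennreal A * S x"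
      using NA[OF that(1,2)] pd_mollified[OF w i grad] by simp
    also have "\<dots> = ennreal (A + A * enn2real (S x))"
      using that(3) A by (cases "S x") (auto simp: ennreal_mult ennreal_plus)
    finally have "\<bar>conv gi (dil n \<eta>) x\<bar> \<le> A + A * enn2real (S x)"
      using A by (subst (asm) ennreal_le_iff) auto
    then show ?thesis using that(2) by (simp add: G_def)
  qed
  \<comment> \<open>Uniform in \<open>n\<close>, the bound survives integration against a nonnegative test function and the weak limit.\<close>
  have one_sided: "AE x in lborel. x \<in> ?B \<longrightarrow> s * gi x - G x \<le> 0" if s: "\<bar>s\<bar> = 1" for s :: real
  proof -
    have fI: "integrable lborel (\<lambda>x. s * gi x - G x)" using gi GI by simp
    have "AE x in lebesgue. x \<in> ?B \<longrightarrow> s * gi x - G x \<le> 0"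
    proof (rule fundamental_nonpos)
      show "set_integrable lebesgue K (\<lambda>x. s * gi x - G x)" if "compact K" for K
        by (rule set_integrable_lebesgue_of_lborel[OF fI that])
      fix \<phi> assume t: "test_function ?B \<phi>" and pos: "\<And>x. 0 \<le> \<phi> x"
      have C1: "C1c \<phi>" using Cinfc_C1c test_function_Cinfc t by blast
      obtain M where M: "\<And>x. \<bar>\<phi> x\<bar> \<le> M" using C1c_bounded[OF C1] by blast
      have \<phi>m[measurable]: "\<phi> \<in> borel_measurable borel" using C1c_continuous[OF C1] by (rule borel_measurable_continuous_onI)
      have I: "integrable lborel (\<lambda>x. G x * \<phi> x)" "integrable lborel (\<lambda>x. gi x * \<phi> x)"
        by (rule integrable_mult_bounded[OF _ \<phi>m M], fact)+
      have lim: "(\<lambda>n. s * (LINT x|lborel. conv gi (dil n \<eta>) x * \<phi> x) - (LINT x|lborel. G x * \<phi> x)) \<longlonglongrightarrow>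
         s * (LINT x|lborel. gi x * \<phi> x) - (LINT x|lborel. G x * \<phi> x)"
        by (intro tendsto_intros mollify_limit[OF \<eta> gi C1])
      have npos: "s * (LINT x|lborel. conv gi (dil n \<eta>) x * \<phi> x) - (LINT x|lborel. G x * \<phi> x) \<le> 0" if n: "n \<ge> N" for n
      proof -
        have c: "Ck_on 0 UNIV (conv gi (dil n \<eta>))" by (rule smooth_conv[OF \<eta>(1) gi])
        have t': "test_function UNIV \<phi>" using t unfolding test_function_def by blast
        obtain R where R: "\<forall>z. R < norm z \<longrightarrow> conv gi (dil n \<eta>) z * \<phi> z = 0" using Ck_on_mult_test(2)[OF open_UNIV c t'] by blast
        have cI: "integrable lborel (\<lambda>x. conv gi (dil n \<eta>) x * \<phi> x)" using Ck_on_mult_test(1)[OF open_UNIV c t'] R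
          by (intro integrable_compact_support[OF _ compact_cball[of 0 R]]) auto
        have "s * (LINT x|lborel. conv gi (dil n \<eta>) x * \<phi> x) = (LINT x|lborel. s * (conv gi (dil n \<eta>) x * \<phi> x))" by simp
        also have "\<dots> \<le> (LINT x|lborel. G x * \<phi> x)"
        proof (rule integral_mono_AE)
          show "integrable lborel (\<lambda>x. s * (conv gi (dil n \<eta>) x * \<phi> x))" using cI by simp
          show "AE x in lborel. s * (conv gi (dil n \<eta>) x * \<phi> x) \<le> G x * \<phi> x"
            using Sfin
          proof eventually_elim
            case (elim x)
            show ?case
            proof (cases "x \<in> ?B")
              case True
              have "s * conv gi (dil n \<eta>) x \<le> \<bar>s * conv gi (dil n \<eta>) x\<bar>" by simp
              also have "\<dots> \<le> G x" using le[OF n True] elim True s by (simp add: abs_mult)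
              finally have "s * conv gi (dil n \<eta>) x * \<phi> x \<le> G x * \<phi> x" using pos by (intro mult_right_mono)
              then show ?thesis by (simp add: mult.assoc)
            next
              case False then show ?thesis using test_function_zero_outside[OF t] by simp
            qed
          qed
        qed (rule I)
        finally show ?thesis by simp
      qed
      have "s * (LINT x|lborel. gi x * \<phi> x) - (LINT x|lborel. G x * \<phi> x) \<le> 0"
        by (rule LIMSEQ_le_const2[OF lim]) (use npos in blast)
      moreover have "(LINT x|lborel. (s * gi x - G x) * \<phi> x) = s * (LINT x|lborel. gi x * \<phi> x) - (LINT x|lborel. G x * \<phi> x)"
        using I by (simp add: left_diff_distrib mult.assoc)
      ultimately show "(LINT x:?B|lebesgue. (s * gi x - G x) * \<phi> x) \<le> 0"
        using borel_measurable_integrable[OF fI] by (subst set_integral_lebesgue_test[OF _ t]) auto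
    qed simp
    then show ?thesis unfolding AE_lebesgue_lborel .
  qed
  have o1: "AE x in lborel. x \<in> ?B \<longrightarrow> gi x - G x \<le> 0" using one_sided[of 1] by simp
  have o2: "AE x in lborel. x \<in> ?B \<longrightarrow> - gi x - G x \<le> 0" using one_sided[of "-1"] by simp
  have "AE x in lborel. x \<in> ?B \<longrightarrow> ennreal \<bar>gi x\<bar> \<le> ennreal A + ennreal A * S x"
    using o1 o2 Sfin
  proof eventually_elim
    case (elim x)
    show ?case
    proof
      assume x: "x \<in> ball x0 r"
      then have "\<bar>gi x\<bar> \<le> A + A * enn2real (S x)" using elim by (auto simp: G_def)
      then have "ennreal \<bar>gi x\<bar> \<le> ennreal (A + A * enn2real (S x))" by (rule ennreal_leI)
      also have "\<dots> = ennreal A + ennreal A * S x"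
        using elim x A by (cases "S x") (auto simp: ennreal_mult ennreal_plus)
      finally show "ennreal \<bar>gi x\<bar> \<le> ennreal A + ennreal A * S x" .
    qed
  qed
  then show ?thesis using A unfolding S_def by blast
qed

end

section \<open>Algebra and composition of Hoelder functions\<close>

lemma holder_0_iff: "Ck_holder_loc 0 \<beta> U f \<longleftrightarrow> continuous_on U f \<and> (\<forall>K. compact K \<and> K \<subseteq> U \<longrightarrow> holder_on \<beta> K f)"
  by (simp add: holder_on_compacts_iff)

lemma dist_powr_mono:
  assumes "bounded K" "\<beta>' \<le> \<beta>"
  shows "\<exists>C\<ge>0. \<forall>x\<in>K. \<forall>y\<in>K. dist x y powr \<beta> \<le> C * dist x y powr \<beta>'"
proof -
  obtain D where D: "\<forall>x\<in>K. \<forall>y\<in>K. dist x y \<le> D" using assms(1) bounded_two_points by blast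
  have "dist x y powr \<beta> \<le> \<bar>D\<bar> powr (\<beta> - \<beta>') * dist x y powr \<beta>'" if "x \<in> K" "y \<in> K" for x y
  proof -
    have "dist x y powr \<beta> = dist x y powr (\<beta> - \<beta>') * dist x y powr \<beta>'" by (simp add: powr_add[symmetric])
    also have "\<dots> \<le> \<bar>D\<bar> powr (\<beta> - \<beta>') * dist x y powr \<beta>'"
    proof (intro mult_right_mono powr_mono2)
      show "dist x y \<le> \<bar>D\<bar>" using D that by (meson abs_ge_self order_trans)
    qed (use assms in auto)
    finally show ?thesis .
  qed
  then show ?thesis by (intro exI[of _ "\<bar>D\<bar> powr (\<beta> - \<beta>')"]) auto
qed

text \<open>
  On a bounded set a smaller exponent is the weaker condition.
\<close>

lemma holder_on_mono_exponent:
  assumes "compact K" "\<beta>' \<le> \<beta>" "holder_on \<beta> K f"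
  shows "holder_on \<beta>' K f"
proof -
  obtain C where C: "C \<ge> 0" "\<And>x y. x \<in> K \<Longrightarrow> y \<in> K \<Longrightarrow> \<bar>f x - f y\<bar> \<le> C * dist x y powr \<beta>"
    using holder_onD[OF assms(3)] by blast
  obtain B where B: "\<And>x y. x \<in> K \<Longrightarrow> y \<in> K \<Longrightarrow> dist x y powr \<beta> \<le> B * dist x y powr \<beta>'"
    using dist_powr_mono[OF compact_imp_bounded[OF assms(1)] assms(2)] by blast
  have "\<bar>f x - f y\<bar> \<le> C * B * dist x y powr \<beta>'" if "x \<in> K" "y \<in> K" for x y
    using C(2)[OF that] mult_left_mono[OF B[OF that] C(1)] by (simp add: mult.assoc)
  then show ?thesis unfolding holder_on_def by blast
qed

lemma holder_0_mono: "Ck_holder_loc 0 \<beta> U f \<Longrightarrow> \<beta>' \<le> \<beta> \<Longrightarrow> Ck_holder_loc 0 \<beta>' U f"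
  unfolding holder_0_iff using holder_on_mono_exponent by blast

lemma holder_0_add:
  assumes "Ck_holder_loc 0 \<beta> U f" "Ck_holder_loc 0 \<beta> U g"
  shows "Ck_holder_loc 0 \<beta> U (\<lambda>x. f x + g x)"
  unfolding holder_0_iff
proof (intro conjI allI impI)
  show "continuous_on U (\<lambda>x. f x + g x)" using assms by (auto intro: continuous_on_add)
  fix K assume "compact K \<and> K \<subseteq> U"
  then have "holder_on \<beta> K f" "holder_on \<beta> K g" using assms unfolding holder_0_iff by auto
  then obtain C D where C: "\<And>x y. x \<in> K \<Longrightarrow> y \<in> K \<Longrightarrow> \<bar>f x - f y\<bar> \<le> C * dist x y powr \<beta>"
     "\<And>x y. x \<in> K \<Longrightarrow> y \<in> K \<Longrightarrow> \<bar>g x - g y\<bar> \<le> D * dist x y powr \<beta>" unfolding holder_on_def by blast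
  have "\<bar>(f x + g x) - (f y + g y)\<bar> \<le> (C + D) * dist x y powr \<beta>" if "x \<in> K" "y \<in> K" for x y
    using C[OF that] by (simp add: algebra_simps)
  then show "holder_on \<beta> K (\<lambda>x. f x + g x)" unfolding holder_on_def by blast
qed

lemma holder_0_mult:
  assumes "Ck_holder_loc 0 \<beta> U f" "Ck_holder_loc 0 \<beta> U g"
  shows "Ck_holder_loc 0 \<beta> U (\<lambda>x. f x * g x)"
  unfolding holder_0_iff
proof (intro conjI allI impI)
  have cont: "continuous_on U f" "continuous_on U g" using assms by auto
  then show "continuous_on U (\<lambda>x. f x * g x)" by (rule continuous_on_mult)
  fix K assume K: "compact K \<and> K \<subseteq> U"
  have "holder_on \<beta> K f" "holder_on \<beta> K g" using assms K unfolding holder_0_iff by auto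
  then obtain C D where C: "C \<ge> 0" "\<And>x y. x \<in> K \<Longrightarrow> y \<in> K \<Longrightarrow> \<bar>f x - f y\<bar> \<le> C * dist x y powr \<beta>"
     and D: "D \<ge> 0" "\<And>x y. x \<in> K \<Longrightarrow> y \<in> K \<Longrightarrow> \<bar>g x - g y\<bar> \<le> D * dist x y powr \<beta>" by (meson holder_onD)
  have "bounded (f ` K)" "bounded (g ` K)"
    using K cont by (auto intro!: compact_imp_bounded compact_continuous_image intro: continuous_on_subset)
  then obtain A B where A: "\<forall>x\<in>K. \<bar>f x\<bar> \<le> A" and B: "\<forall>x\<in>K. \<bar>g x\<bar> \<le> B" unfolding bounded_iff by auto
  have "\<bar>f x * g x - f y * g y\<bar> \<le> (\<bar>A\<bar> * D + \<bar>B\<bar> * C) * dist x y powr \<beta>" if xy: "x \<in> K" "y \<in> K" for x y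
  proof -
    have "f x * g x - f y * g y = f x * (g x - g y) + g y * (f x - f y)" by (simp add: algebra_simps)
    then have "\<bar>f x * g x - f y * g y\<bar> \<le> \<bar>f x\<bar> * \<bar>g x - g y\<bar> + \<bar>g y\<bar> * \<bar>f x - f y\<bar>"
      by (metis abs_mult abs_triangle_ineq)
    also have "\<dots> \<le> \<bar>A\<bar> * (D * dist x y powr \<beta>) + \<bar>B\<bar> * (C * dist x y powr \<beta>)"
    proof (intro add_mono mult_mono C(2) D(2) xy)
      show "\<bar>f x\<bar> \<le> \<bar>A\<bar>" using A xy(1) abs_ge_self[of A] order_trans by blast
      show "\<bar>g y\<bar> \<le> \<bar>B\<bar>" using B xy(2) abs_ge_self[of B] order_trans by blast
    qed auto
    finally show ?thesis by (simp add: algebra_simps)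
  qed
  then show "holder_on \<beta> K (\<lambda>x. f x * g x)" unfolding holder_on_def by blast
qed

lemma holder_0_const: "Ck_holder_loc 0 \<beta> U (\<lambda>x. c)"
  unfolding holder_0_iff holder_on_def by (auto intro!: exI[of _ 0])

lemma holder_0_cmult: "Ck_holder_loc 0 \<beta> U f \<Longrightarrow> Ck_holder_loc 0 \<beta> U (\<lambda>x. c * f x)"
  by (rule holder_0_mult[OF holder_0_const])

lemma holder_0_sum:
  "finite J \<Longrightarrow> (\<And>j. j \<in> J \<Longrightarrow> Ck_holder_loc 0 \<beta> U (f j)) \<Longrightarrow> Ck_holder_loc 0 \<beta> U (\<lambda>x. \<Sum>j\<in>J. f j x)"
proof (induction J rule: finite_induct)
  case empty then show ?case using holder_0_const[of \<beta> U 0] by simp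
next
  case (insert j J) then show ?case using holder_0_add[of \<beta> U "f j" "\<lambda>x. \<Sum>j\<in>J. f j x"] by simp
qed

text \<open>
  On small balls the function is Lipschitz, since the derivatives are bounded there.
\<close>

lemma holder_0_of_C1:
  fixes g :: "'a::euclidean_space \<Rightarrow> real"
  assumes U: "open U" and g: "Ck_on 1 U g" and \<beta>: "0 < \<beta>" "\<beta> \<le> 1"
  shows "Ck_holder_loc 0 \<beta> U g"
proof -
  have "Ck_holder_loc 0 1 U g"
  proof (rule Ck_holder_loc_local[OF U])
    fix x assume x: "x \<in> U"
    obtain r where r: "r > 0" "cball x r \<subseteq> U" using open_contains_cball U x by blast
    have d: "g differentiable (at y)" if "y \<in> U" for y using g that by (simp add: Ck_on_Suc_open[OF U])
    have "\<exists>M. \<forall>i\<in>Basis. 0 \<le> M i \<and> (\<forall>y\<in>cball x r. \<bar>pd i g y\<bar> \<le> M i)"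
    proof (rule bchoice, rule ballI)
      fix i :: 'a assume i: "i \<in> Basis"
      have "continuous_on (cball x r) (pd i g)"
        using g i r(2) by (auto simp: Ck_on_Suc_open[OF U] intro: continuous_on_subset)
      then have "bounded (pd i g ` cball x r)" by (intro compact_imp_bounded compact_continuous_image) auto
      then obtain b where "\<forall>y\<in>cball x r. \<bar>pd i g y\<bar> \<le> b" unfolding bounded_iff by auto
      then show "\<exists>M\<ge>0. \<forall>y\<in>cball x r. \<bar>pd i g y\<bar> \<le> M" by (intro exI[of _ "\<bar>b\<bar>"]) force
    qed
    then obtain M where M: "\<And>i. i \<in> Basis \<Longrightarrow> 0 \<le> M i" "\<And>i y. i \<in> Basis \<Longrightarrow> y \<in> cball x r \<Longrightarrow> \<bar>pd i g y\<bar> \<le> M i"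
      by blast
    have "\<bar>g y - g z\<bar> \<le> (\<Sum>i\<in>Basis. M i) * dist y z powr 1" if "y \<in> ball x r" "z \<in> ball x r" for y z
    proof -
      have "\<bar>g y - g z\<bar> \<le> (\<Sum>i\<in>Basis. M i) * norm (y - z)"
      proof (rule lipschitz_of_pd_bound[OF convex_ball _ _ _ that])
        fix y assume "y \<in> ball x r"
        then have "y \<in> cball x r" by simp
        then show "g differentiable (at y)" "\<And>i. i \<in> Basis \<Longrightarrow> \<bar>pd i g y\<bar> \<le> M i" using d r(2) M(2) by blast+
      qed (rule M(1))
      then show ?thesis by (simp add: dist_norm)
    qed
    then have h: "holder_on 1 (ball x r) g" unfolding holder_on_def by blast
    have "continuous_on (ball x r) g"
      using order_trans[OF ball_subset_cball r(2)]
      by (intro continuous_at_imp_continuous_on ballI differentiable_imp_continuous_within d) blast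
    then have "Ck_holder_loc 0 1 (ball x r) g" using holder_on_subset[OF h] unfolding holder_0_iff by blast
    then show "\<exists>r>0. Ck_holder_loc 0 1 (ball x r) g" using r(1) by blast
  qed simp
  then show ?thesis using holder_0_mono \<beta> by blast
qed

text \<open>
  The inner map is described by its modulus of continuity rather than by components, so that gradients and graphs
  are both covered.
\<close>

lemma holder_0_compose:
  fixes V :: "'a::euclidean_space \<Rightarrow> 'b::euclidean_space" and \<psi> :: "'b \<Rightarrow> real"
  assumes V: "continuous_on U V" "\<And>K. compact K \<Longrightarrow> K \<subseteq> U \<Longrightarrow> \<exists>C\<ge>0. \<forall>x\<in>K. \<forall>y\<in>K. dist (V x) (V y) \<le> C * dist x y powr \<beta>"
    and \<psi>: "Ck_holder_loc 0 s T \<psi>" and T: "V ` U \<subseteq> T" and s: "s > 0"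
  shows "Ck_holder_loc 0 (s * \<beta>) U (\<lambda>x. \<psi> (V x))"
  unfolding holder_0_iff
proof (intro conjI allI impI)
  show "continuous_on U (\<lambda>x. \<psi> (V x))" using \<psi> T V(1) by (auto intro: continuous_on_compose2)
  fix K assume K: "compact K \<and> K \<subseteq> U"
  have "compact (V ` K)" "V ` K \<subseteq> T"
    using K V(1) T by (auto intro!: compact_continuous_image intro: continuous_on_subset)
  then have "holder_on s (V ` K) \<psi>" using \<psi> unfolding holder_0_iff by blast
  from holder_onD[OF this] obtain B where B: "B \<ge> 0" "\<forall>z\<in>V ` K. \<forall>w\<in>V ` K. \<bar>\<psi> z - \<psi> w\<bar> \<le> B * dist z w powr s"
    by blast
  from K have "compact K" "K \<subseteq> U" by auto
  from V(2)[OF this] obtain C where C: "C \<ge> 0" "\<And>x y. x \<in> K \<Longrightarrow> y \<in> K \<Longrightarrow> dist (V x) (V y) \<le> C * dist x y powr \<beta>"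
    by blast
  have "\<bar>\<psi> (V x) - \<psi> (V y)\<bar> \<le> B * C powr s * dist x y powr (s * \<beta>)" if "x \<in> K" "y \<in> K" for x y
  proof -
    have "dist (V x) (V y) powr s \<le> (C * dist x y powr \<beta>) powr s"
      using C(2)[OF that] s by (intro powr_mono2) auto
    also have "\<dots> = C powr s * dist x y powr (s * \<beta>)" using C(1) by (simp add: powr_mult powr_powr mult.commute)
    finally have "B * dist (V x) (V y) powr s \<le> B * (C powr s * dist x y powr (s * \<beta>))" by (rule mult_left_mono[OF _ B(1)])
    then show ?thesis using B(2) that by (fastforce simp: mult.assoc)
  qed
  then show "holder_on (s * \<beta>) K (\<lambda>x. \<psi> (V x))" unfolding holder_on_def by blast
qed

lemma dist_of_components:
  fixes V :: "'a::euclidean_space \<Rightarrow> 'b::euclidean_space"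
  assumes "\<And>i. i \<in> Basis \<Longrightarrow> Ck_holder_loc 0 \<beta> U (\<lambda>x. V x \<bullet> i)"
  shows "continuous_on U V" "compact K \<Longrightarrow> K \<subseteq> U \<Longrightarrow> \<exists>C\<ge>0. \<forall>x\<in>K. \<forall>y\<in>K. dist (V x) (V y) \<le> C * dist x y powr \<beta>"
proof -
  show "continuous_on U V" using assms by (subst continuous_on_componentwise) auto
  assume K: "compact K" "K \<subseteq> U"
  have "\<exists>C. \<forall>i\<in>Basis. 0 \<le> C i \<and> (\<forall>x\<in>K. \<forall>y\<in>K. \<bar>V x \<bullet> i - V y \<bullet> i\<bar> \<le> C i * dist x y powr \<beta>)"
  proof (rule bchoice, rule ballI)
    fix i :: 'b assume i: "i \<in> Basis"
    have "holder_on \<beta> K (\<lambda>x. V x \<bullet> i)" using assms[OF i] K unfolding holder_0_iff by blast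
    then show "\<exists>C\<ge>0. \<forall>x\<in>K. \<forall>y\<in>K. \<bar>V x \<bullet> i - V y \<bullet> i\<bar> \<le> C * dist x y powr \<beta>" by (rule holder_onD)
  qed
  then obtain C where C: "\<And>i. i \<in> Basis \<Longrightarrow> 0 \<le> C i"
    "\<And>i x y. i \<in> Basis \<Longrightarrow> x \<in> K \<Longrightarrow> y \<in> K \<Longrightarrow> \<bar>V x \<bullet> i - V y \<bullet> i\<bar> \<le> C i * dist x y powr \<beta>" by blast
  have "dist (V x) (V y) \<le> (\<Sum>i\<in>Basis. C i) * dist x y powr \<beta>" if "x \<in> K" "y \<in> K" for x y
  proof -
    have "dist (V x) (V y) \<le> (\<Sum>i\<in>Basis. \<bar>(V x - V y) \<bullet> i\<bar>)" unfolding dist_norm by (rule norm_le_l1)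
    also have "\<dots> \<le> (\<Sum>i\<in>Basis. C i * dist x y powr \<beta>)"
      using C(2) that by (intro sum_mono) (simp add: inner_diff_left)
    finally show ?thesis by (simp add: sum_distrib_right)
  qed
  then show "\<exists>C\<ge>0. \<forall>x\<in>K. \<forall>y\<in>K. dist (V x) (V y) \<le> C * dist x y powr \<beta>"
    using C(1) by (intro exI[of _ "\<Sum>i\<in>Basis. C i"]) (auto intro: sum_nonneg)
qed

section \<open>The maps z -> |z|^p and z -> |z|^(p-2) z\<close>

text \<open>
  Here \<open>b\<close> is the shorter vector. If \<open>a\<close> is not much longer than \<open>a - b\<close>, the triangle inequality suffices. Otherwise both
  vectors are far from the origin on the scale of \<open>a - b\<close>, and both the change of the vector and the change of its
  factor contribute at most \<open>|a|^(s-1) |a - b|\<close>.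
\<close>

lemma power_map_holder_aux:
  fixes a b :: "'a::real_normed_vector"
  assumes s: "0 < s" "s < 1" and ab: "norm b \<le> norm a"
  shows "norm (norm a powr (s - 1) *\<^sub>R a - norm b powr (s - 1) *\<^sub>R b) \<le> 4 * norm (a - b) powr s"
proof (cases "a = b")
  case False
  then have d: "0 < norm (a - b)" by simp
  have nn: "norm (norm c powr (s - 1) *\<^sub>R c) = norm c powr s" for c :: 'a
    by (cases "c = 0") (auto simp: powr_diff)
  show ?thesis
  proof (cases "norm a \<le> 2 * norm (a - b)")
    case True
    have "norm (norm a powr (s - 1) *\<^sub>R a - norm b powr (s - 1) *\<^sub>R b) \<le> norm a powr s + norm b powr s"
      using norm_triangle_ineq4[of "norm a powr (s - 1) *\<^sub>R a" "norm b powr (s - 1) *\<^sub>R b"] unfolding nn .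
    also have "\<dots> \<le> 2 * norm a powr s" using ab s powr_mono2[of s "norm b" "norm a"] by simp
    also have "\<dots> \<le> 2 * (2 * norm (a - b)) powr s" using True s by (intro mult_left_mono powr_mono2) auto
    also have "\<dots> \<le> 2 * (2 * norm (a - b) powr s)"
      using s powr_mono[of s 1 2] by (intro mult_left_mono) (auto simp: powr_mult intro!: mult_right_mono)
    finally show ?thesis by simp
  next
    case F: False
    let ?A = "norm a powr (s - 1)" and ?B = "norm b powr (s - 1)"
    have an: "0 < norm a" "norm (a - b) \<le> norm a" using F d by linarith+
    have small: "?A * norm (a - b) \<le> norm (a - b) powr s"
    proof -
      have "?A \<le> norm (a - b) powr (s - 1)" using an d s by (intro powr_mono2') auto
      then have "?A * norm (a - b) \<le> norm (a - b) powr (s - 1) * norm (a - b)" by (rule mult_right_mono) simp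
      also have "\<dots> = norm (a - b) powr s" using d by (simp add: powr_diff)
      finally show ?thesis .
    qed
    have bpos: "0 < norm b" using F d norm_triangle_ineq2[of a b] by linarith
    have AB: "?A \<le> ?B" using ab bpos s by (intro powr_mono2') auto
    have "?A *\<^sub>R a - ?B *\<^sub>R b = ?A *\<^sub>R (a - b) + (?A - ?B) *\<^sub>R b" by (simp add: algebra_simps)
    then have "norm (?A *\<^sub>R a - ?B *\<^sub>R b) \<le> ?A * norm (a - b) + (?B - ?A) * norm b"
      using norm_triangle_ineq[of "?A *\<^sub>R (a - b)" "(?A - ?B) *\<^sub>R b"] AB by simp
    also have "(?B - ?A) * norm b \<le> ?A * norm (a - b)"
    proof -
      have "?B * norm b = norm b powr s" "?A * norm a = norm a powr s" using bpos an by (auto simp: powr_diff)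
      moreover have "norm b powr s \<le> norm a powr s" using ab s by (intro powr_mono2) auto
      ultimately have "(?B - ?A) * norm b \<le> ?A * (norm a - norm b)" by (simp add: algebra_simps)
      also have "\<dots> \<le> ?A * norm (a - b)" by (intro mult_left_mono norm_triangle_ineq2) simp
      finally show ?thesis .
    qed
    finally show ?thesis using small powr_ge_zero[of "norm (a - b)" s] by linarith
  qed
qed simp

lemma power_map_holder:
  fixes a b :: "'a::real_normed_vector"
  assumes s: "0 < s" "s < 1"
  shows "norm (norm a powr (s - 1) *\<^sub>R a - norm b powr (s - 1) *\<^sub>R b) \<le> 4 * norm (a - b) powr s"
  using power_map_holder_aux[OF s, of b a] power_map_holder_aux[OF s, of a b]
  by (cases "norm b \<le> norm a") (auto simp: norm_minus_commute)

lemma power_map_component: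
  fixes i :: "'b::euclidean_space"
  assumes s: "0 < s" "s < 1" and i: "i \<in> Basis"
  shows "Ck_holder_loc 0 s UNIV (\<lambda>z. norm z powr (s - 1) * (z \<bullet> i))"
proof -
  have h: "\<bar>norm a powr (s - 1) * (a \<bullet> i) - norm b powr (s - 1) * (b \<bullet> i)\<bar> \<le> 4 * dist a b powr s" for a b :: 'b
    using Basis_le_norm[OF i, of "norm a powr (s - 1) *\<^sub>R a - norm b powr (s - 1) *\<^sub>R b"] power_map_holder[OF s, of a b]
    by (simp add: inner_diff_left dist_norm)
  have "continuous_on UNIV (\<lambda>z. norm z powr (s - 1) * (z \<bullet> i))"
    unfolding continuous_on_def
  proof
    fix b :: 'b
    have "((\<lambda>a. norm a powr (s - 1) * (a \<bullet> i) - norm b powr (s - 1) * (b \<bullet> i)) \<longlongrightarrow> 0) (at b)"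
    proof (rule Lim_null_comparison)
      show "\<forall>\<^sub>F a in at b. norm (norm a powr (s - 1) * (a \<bullet> i) - norm b powr (s - 1) * (b \<bullet> i)) \<le> 4 * dist a b powr s"
        using h by (intro always_eventually) auto
      have "((\<lambda>a. 4 * dist a b powr s) \<longlongrightarrow> 4 * dist b b powr s) (at b)"
        using s by (intro tendsto_mult tendsto_const tendsto_powr' tendsto_dist tendsto_ident_at) auto
      then show "((\<lambda>a. 4 * dist a b powr s) \<longlongrightarrow> 0) (at b)" by simp
    qed
    then show "((\<lambda>z. norm z powr (s - 1) * (z \<bullet> i)) \<longlongrightarrow> norm b powr (s - 1) * (b \<bullet> i)) (at b within UNIV)"
      by (simp add: LIM_zero_iff)
  qed
  then show ?thesis unfolding holder_0_iff holder_on_def using h by blast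
qed

lemma norm_powr_has_derivative:
  fixes z :: "'b::euclidean_space"
  assumes p: "1 < p"
  shows "((\<lambda>z. norm z powr p) has_derivative (\<lambda>h. p * (norm z powr (p - 2) * (z \<bullet> h)))) (at z)"
proof (cases "z = 0")
  case False
  have 1: "((\<lambda>t. t powr p) has_derivative (*) (p * norm z powr (p - 1))) (at (norm z))"
    using has_real_derivative_powr[of "norm z" p] False by (simp add: has_field_derivative_def)
  have 2: "(norm has_derivative (\<lambda>h. sgn z \<bullet> h)) (at z)"
    using has_derivative_norm[OF False] by (simp add: inner_commute)
  have e: "(\<lambda>h. p * norm z powr (p - 1) * (sgn z \<bullet> h)) = (\<lambda>h. p * (norm z powr (p - 2) * (z \<bullet> h)))"
  proof
    fix h
    have "norm z powr (p - 1) = norm z powr (p - 2) * norm z"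
      using False powr_add[of "norm z" "p - 2" 1] by simp
    then show "p * norm z powr (p - 1) * (sgn z \<bullet> h) = p * (norm z powr (p - 2) * (z \<bullet> h))"
      using False by (simp add: sgn_div_norm)
  qed
  show ?thesis using has_derivative_compose[OF 2 1] unfolding e .
next
  case True
  have "((\<lambda>h::'b. norm h powr (p - 1)) \<longlongrightarrow> 0 powr (p - 1)) (at 0)"
    using p by (intro tendsto_powr' tendsto_norm_zero tendsto_ident_at tendsto_const) auto
  then have "((\<lambda>h::'b. norm h powr (p - 1)) \<longlongrightarrow> 0) (at 0)" by simp
  moreover have "norm (norm (0 + h) powr p - norm (0::'b) powr p - 0) / norm h = norm h powr (p - 1)" for h :: 'b
    by (cases "h = 0") (auto simp: powr_diff)
  ultimately have "((\<lambda>z::'b. norm z powr p) has_derivative (\<lambda>h. 0)) (at 0)"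
    unfolding has_derivative_at by simp
  then show ?thesis using True by simp
qed

lemma norm_powr_pd:
  fixes z :: "'b::euclidean_space"
  assumes "1 < p"
  shows "pd i (\<lambda>z. norm z powr p) z = p * (norm z powr ((p - 1) - 1) * (z \<bullet> i))"
  using pd_eqI[OF norm_powr_has_derivative[OF assms], of i z] by (simp add: diff_diff_add)

lemma norm_powr_C1:
  assumes p: "1 < p" "p < 2"
  shows "Ck_on 1 UNIV (\<lambda>z::'b::euclidean_space. norm z powr p)"
    "i \<in> Basis \<Longrightarrow> Ck_holder_loc 0 (p - 1) UNIV (pd i (\<lambda>z::'b. norm z powr p))"
proof -
  show h: "Ck_holder_loc 0 (p - 1) UNIV (pd i (\<lambda>z::'b. norm z powr p))" if "i \<in> Basis" for i
    unfolding norm_powr_pd[OF p(1), abs_def]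
    using p by (intro holder_0_cmult power_map_component that) auto
  show "Ck_on 1 UNIV (\<lambda>z::'b. norm z powr p)"
    unfolding One_nat_def Ck_on_Suc_open[OF open_UNIV]
    using norm_powr_has_derivative[OF p(1)] h by (auto simp: differentiable_def)
qed

lemma pd_chain:
  fixes V :: "'a::euclidean_space \<Rightarrow> 'b::euclidean_space" and \<psi> :: "'b \<Rightarrow> real"
  assumes "(V has_derivative V') (at x)" "\<psi> differentiable (at (V x))"
  shows "(\<lambda>x. \<psi> (V x)) differentiable (at x)"
    "pd i (\<lambda>x. \<psi> (V x)) x = (\<Sum>j\<in>Basis. (V' i \<bullet> j) * pd j \<psi> (V x))"
proof -
  have *: "((\<lambda>x. \<psi> (V x)) has_derivative (\<lambda>h. \<Sum>j\<in>Basis. (V' h \<bullet> j) * pd j \<psi> (V x))) (at x)"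
    using has_derivative_compose[OF assms(1) has_derivative_pd[OF assms(2)]] .
  show "(\<lambda>x. \<psi> (V x)) differentiable (at x)" using * unfolding differentiable_def by blast
  show "pd i (\<lambda>x. \<psi> (V x)) x = (\<Sum>j\<in>Basis. (V' i \<bullet> j) * pd j \<psi> (V x))" using pd_eqI[OF *] .
qed

section \<open>Borel representatives of Sobolev functions\<close>

lemma lebesgue_real_representative:
  fixes f :: "'a::euclidean_space \<Rightarrow> real"
  assumes "integrable lebesgue f"
  obtains g where "integrable lborel g" "AE x in lborel. f x = g x"
proof -
  obtain g where g: "g \<in> borel_measurable lborel" "AE x in lborel. f x = g x"
    using completion_ex_borel_measurable_real borel_measurable_integrable[OF assms] by blast
  have "AE x in lebesgue. f x = g x" using g(2) by (simp add: AE_lebesgue_lborel)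
  then have "integrable lebesgue g"
    using assms g(1) measurable_completion[OF g(1)] integrable_cong_AE[of f lebesgue g] by auto
  then show ?thesis using that g integrable_completion[OF g(1)] by blast
qed

lemma set_integral_transfer:
  fixes f f0 :: "'a::euclidean_space \<Rightarrow> real"
  assumes U: "U \<subseteq> \<Omega>" and t: "test_function U \<phi>" and f0: "f0 \<in> borel_measurable borel"
    and eq: "AE x in lborel. x \<in> U \<longrightarrow> f x = f0 x"
  shows "(LINT x:\<Omega>|lebesgue. f x * \<phi> x) = (LINT x|lborel. f0 x * \<phi> x)"
proof -
  have "\<phi> \<in> borel_measurable borel"
    using C1c_continuous[OF Cinfc_C1c[OF test_function_Cinfc[OF t]]] by (rule borel_measurable_continuous_onI)
  then have m: "(\<lambda>x. f0 x * \<phi> x) \<in> borel_measurable lborel" using f0 by simp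
  have ae: "AE x in lebesgue. f0 x * \<phi> x = indicator \<Omega> x *\<^sub>R (f x * \<phi> x)"
    using eq unfolding AE_lebesgue_lborel
    by eventually_elim (use test_function_zero_outside[OF t] U in \<open>auto simp: indicator_def\<close>)
  have m2: "(\<lambda>x. f0 x * \<phi> x) \<in> borel_measurable lebesgue" using m by (rule measurable_completion)
  have "(LINT x:\<Omega>|lebesgue. f x * \<phi> x) = (LINT x|lebesgue. f0 x * \<phi> x)"
    unfolding set_lebesgue_integral_def
    using ae borel_measurable_AE[OF m2 ae] m2 by (intro integral_cong_AE) auto
  then show ?thesis using integral_completion[OF m] by simp
qed

lemma test_function_subset: "test_function U \<phi> \<Longrightarrow> U \<subseteq> \<Omega> \<Longrightarrow> test_function \<Omega> \<phi>"
  unfolding test_function_def by blast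

lemma loc_test_integrable:
  fixes f \<phi> :: "'a::euclidean_space \<Rightarrow> real"
  assumes f: "\<And>K. compact K \<Longrightarrow> K \<subseteq> \<Omega> \<Longrightarrow> set_integrable lebesgue K f" and t: "test_function \<Omega> \<phi>"
  shows "set_integrable lebesgue \<Omega> (\<lambda>x. f x * \<phi> x)"
proof -
  obtain K where K: "compact K" "K \<subseteq> \<Omega>" "\<And>x. x \<notin> K \<Longrightarrow> \<phi> x = 0" using test_function_support[OF t] by blast
  have C1: "C1c \<phi>" using Cinfc_C1c test_function_Cinfc t by blast
  obtain M where M: "\<And>x. \<bar>\<phi> x\<bar> \<le> M" using C1c_bounded[OF C1] by blast
  have \<phi>m: "\<phi> \<in> borel_measurable lebesgue" by (rule borel_measurable_lebesgue_of_continuous[OF C1c_continuous[OF C1]])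
  have fK: "integrable lebesgue (\<lambda>x. indicator K x * f x)" using f[OF K(1,2)] by (simp add: set_integrable_def)
  have "integrable lebesgue (\<lambda>x. (indicator K x * f x) * \<phi> x)"
  proof (rule Bochner_Integration.integrable_bound)
    show "integrable lebesgue (\<lambda>x. (indicator K x * f x) * M)" using fK by simp
    show "(\<lambda>x. (indicator K x * f x) * \<phi> x) \<in> borel_measurable lebesgue"
      using borel_measurable_integrable[OF fK] \<phi>m by (rule borel_measurable_times)
    have "\<bar>\<phi> x\<bar> \<le> \<bar>M\<bar>" for x using M[of x] by linarith
    then show "AE x in lebesgue. norm ((indicator K x * f x) * \<phi> x) \<le> norm ((indicator K x * f x) * M)"
      by (intro AE_I2) (auto simp: abs_mult intro!: mult_left_mono)
  qed
  moreover have "(\<lambda>x. (indicator K x * f x) * \<phi> x) = (\<lambda>x. indicator \<Omega> x *\<^sub>R (f x * \<phi> x))"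
    using K by (auto simp: fun_eq_iff indicator_def)
  ultimately show ?thesis by (simp add: set_integrable_def)
qed

lemma loc_component:
  fixes g :: "'a::euclidean_space \<Rightarrow> 'a"
  assumes "locally_integrable \<Omega> g" "compact K" "K \<subseteq> \<Omega>"
  shows "set_integrable lebesgue K (\<lambda>x. g x \<bullet> i)"
proof -
  have "integrable lebesgue (\<lambda>x. (indicator K x *\<^sub>R g x) \<bullet> i)"
    using assms unfolding locally_integrable_def set_integrable_def by (intro integrable_inner_left) auto
  then show ?thesis by (simp add: set_integrable_def)
qed

text \<open>
  Makes the choice hidden in \<open>weak_grad\<close> harmless.
\<close>

lemma weak_gradient_unique:
  fixes g g' :: "'a::euclidean_space \<Rightarrow> 'a"
  assumes \<Omega>: "open \<Omega>" and g: "has_weak_gradient \<Omega> w g" "has_weak_gradient \<Omega> w g'"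
  shows "AE x in lborel. x \<in> \<Omega> \<longrightarrow> g x = g' x"
proof -
  have l: "locally_integrable \<Omega> g" "locally_integrable \<Omega> g'" using g unfolding has_weak_gradient_def by auto
  have ae: "AE x in lebesgue. x \<in> \<Omega> \<longrightarrow> g x \<bullet> i - g' x \<bullet> i = 0" if i: "i \<in> Basis" for i
  proof (rule fundamental_zero[OF \<Omega>])
    show "set_integrable lebesgue K (\<lambda>x. g x \<bullet> i - g' x \<bullet> i)" if "compact K" "K \<subseteq> \<Omega>" for K
      using loc_component[OF l(1) that] loc_component[OF l(2) that] by (rule set_integral_diff)
    fix \<phi> assume t: "test_function \<Omega> \<phi>"
    have I: "set_integrable lebesgue \<Omega> (\<lambda>x. (g x \<bullet> i) * \<phi> x)" "set_integrable lebesgue \<Omega> (\<lambda>x. (g' x \<bullet> i) * \<phi> x)"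
      by (auto intro!: loc_test_integrable[OF _ t] loc_component[OF l(1)] loc_component[OF l(2)])
    have "(LINT x:\<Omega>|lebesgue. (g x \<bullet> i) * \<phi> x) = (LINT x:\<Omega>|lebesgue. (g' x \<bullet> i) * \<phi> x)"
    proof -
      have "(LINT x:\<Omega>|lebesgue. w x * frechet_derivative \<phi> (at x) i) = - (LINT x:\<Omega>|lebesgue. (h x \<bullet> i) * \<phi> x)"
        if "has_weak_gradient \<Omega> w h" for h
        using that t i unfolding has_weak_gradient_def by blast
      from this[OF g(1)] this[OF g(2)] show ?thesis by linarith
    qed
    then show "(LINT x:\<Omega>|lebesgue. (g x \<bullet> i - g' x \<bullet> i) * \<phi> x) = 0"
      using set_integral_diff(2)[OF I] by (simp add: left_diff_distrib)
  qed
  have "AE x in lborel. \<forall>i\<in>Basis. x \<in> \<Omega> \<longrightarrow> g x \<bullet> i - g' x \<bullet> i = 0"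
    by (rule AE_finite_allI[OF finite_Basis ae[unfolded AE_lebesgue_lborel]])
  then show ?thesis by eventually_elim (rule impI, rule euclidean_eqI, simp)
qed

lemma in_Lp_integrable:
  fixes w :: "'a::euclidean_space \<Rightarrow> 'b::euclidean_space"
  assumes \<Omega>: "open \<Omega>" "bounded \<Omega>" and s: "1 \<le> s" and w: "in_Lp s \<Omega> w" and U: "open U" "U \<subseteq> \<Omega>"
  shows "integrable lebesgue (\<lambda>x. indicator U x *\<^sub>R w x)"
    "integrable lebesgue (\<lambda>x. indicator U x * norm (w x) powr s)"
proof -
  have m: "\<Omega> \<in> sets lebesgue" "U \<in> sets lebesgue" using \<Omega>(1) U by auto
  have fin: "emeasure lebesgue \<Omega> < \<infinity>" using emeasure_bounded_finite[OF \<Omega>(2)] \<Omega>(1) by simp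
  have wm: "(\<lambda>x. indicator \<Omega> x *\<^sub>R w x) \<in> borel_measurable lebesgue"
    using w m unfolding in_Lp_def by (simp add: borel_measurable_restrict_space_iff)
  have ws: "integrable lebesgue (\<lambda>x. indicator \<Omega> x *\<^sub>R norm (w x) powr s)"
    using w m unfolding in_Lp_def by (simp add: integrable_restrict_space)
  have "integrable lebesgue (\<lambda>x. indicator \<Omega> x *\<^sub>R w x)"
  proof (rule Bochner_Integration.integrable_bound[OF _ wm])
    show "integrable lebesgue (\<lambda>x. indicator \<Omega> x + indicator \<Omega> x *\<^sub>R norm (w x) powr s)"
      using ws m fin by simp
    have "t \<le> 1 + t powr s" if "0 \<le> t" for t :: real
    proof (cases "t \<le> 1")
      case False
      then have "t powr 1 \<le> t powr s" using s by (intro powr_mono) auto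
      then show ?thesis using False by simp
    qed (simp add: add_increasing2)
    then show "AE x in lebesgue. norm (indicator \<Omega> x *\<^sub>R w x) \<le> norm (indicator \<Omega> x + indicator \<Omega> x *\<^sub>R norm (w x) powr s)"
      by (intro AE_I2) (auto simp: indicator_def)
  qed
  then have "integrable lebesgue (\<lambda>x. indicator U x *\<^sub>R (indicator \<Omega> x *\<^sub>R w x))"
    by (rule integrable_mult_indicator[OF m(2)])
  moreover have "(\<lambda>x. indicator U x *\<^sub>R (indicator \<Omega> x *\<^sub>R w x)) = (\<lambda>x. indicator U x *\<^sub>R w x)"
    using U(2) by (auto simp: fun_eq_iff indicator_def)
  ultimately show "integrable lebesgue (\<lambda>x. indicator U x *\<^sub>R w x)" by simp
  have "integrable lebesgue (\<lambda>x. indicator U x *\<^sub>R (indicator \<Omega> x *\<^sub>R norm (w x) powr s))"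
    by (rule integrable_mult_indicator[OF m(2) ws])
  moreover have "(\<lambda>x. indicator U x *\<^sub>R (indicator \<Omega> x *\<^sub>R norm (w x) powr s)) = (\<lambda>x. indicator U x * norm (w x) powr s)"
    using U(2) by (auto simp: fun_eq_iff indicator_def)
  ultimately show "integrable lebesgue (\<lambda>x. indicator U x * norm (w x) powr s)" by simp
qed

text \<open>
  Replaces a Lebesgue measurable Sobolev function and its chosen weak gradient, restricted to \<open>U\<close>, by Borel functions that are
  integrable on the whole space, as the convolutions require.
\<close>

lemma W1_representative:
  fixes w :: "'a::euclidean_space \<Rightarrow> real"
  assumes \<Omega>: "open \<Omega>" "bounded \<Omega>" and s: "1 \<le> s" and w: "in_W1 s \<Omega> w" and U: "open U" "U \<subseteq> \<Omega>"
  obtains w0 :: "'a \<Rightarrow> real" and V :: "'a \<Rightarrow> 'a" where "integrable lborel w0" "AE x in lborel. x \<in> U \<longrightarrow> w x = w0 x"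
    "V \<in> borel_measurable borel" "\<And>i. i \<in> Basis \<Longrightarrow> integrable lborel (\<lambda>x. V x \<bullet> i)"
    "integrable lborel (\<lambda>x. norm (V x) powr s)"
    "AE x in lborel. x \<in> U \<longrightarrow> weak_grad \<Omega> w x = V x"
    "\<And>\<phi> i. test_function U \<phi> \<Longrightarrow> i \<in> Basis \<Longrightarrow> (LINT x|lborel. w0 x * pd i \<phi> x) = - (LINT x|lborel. (V x \<bullet> i) * \<phi> x)"
proof -
  obtain g where g: "has_weak_gradient \<Omega> w g" "in_Lp s \<Omega> g" and wL: "in_Lp s \<Omega> w"
    using w unfolding in_W1_def by blast
  have wg: "has_weak_gradient \<Omega> w (weak_grad \<Omega> w)" using someI[of "has_weak_gradient \<Omega> w", OF g(1)] by (simp add: weak_grad_def)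
  have eqg: "AE x in lborel. x \<in> \<Omega> \<longrightarrow> weak_grad \<Omega> w x = g x" by (rule weak_gradient_unique[OF \<Omega>(1) wg g(1)])
  obtain w0 where w0: "integrable lborel w0" "AE x in lborel. indicator U x *\<^sub>R w x = w0 x"
    using lebesgue_real_representative[OF in_Lp_integrable(1)[OF \<Omega> s wL U]] by blast
  have gI: "integrable lebesgue (\<lambda>x. (indicator U x *\<^sub>R g x) \<bullet> i)" for i
    by (rule integrable_inner_left) (rule in_Lp_integrable(1)[OF \<Omega> s g(2) U])
  have "\<exists>h. integrable lborel h \<and> (AE x in lborel. (indicator U x *\<^sub>R g x) \<bullet> i = h x)" for i
    using lebesgue_real_representative[OF gI[of i]] by metis
  then obtain h where h: "\<And>i. integrable lborel (h i)" "\<And>i. AE x in lborel. (indicator U x *\<^sub>R g x) \<bullet> i = h i x"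
    by metis
  define V where "V x = (\<Sum>i\<in>Basis. h i x *\<^sub>R i)" for x
  have hm[measurable]: "h i \<in> borel_measurable borel" for i using borel_measurable_integrable[OF h(1)] by simp
  have Vm[measurable]: "V \<in> borel_measurable borel" unfolding V_def by measurable
  have Vi: "V x \<bullet> i = h i x" if "i \<in> Basis" for i x using that by (simp add: V_def)
  have Vg: "AE x in lborel. indicator U x *\<^sub>R g x = V x"
  proof -
    have "AE x in lborel. \<forall>i\<in>Basis. (indicator U x *\<^sub>R g x) \<bullet> i = h i x"
      by (rule AE_finite_allI[OF finite_Basis h(2)])
    then show ?thesis by eventually_elim (rule euclidean_eqI, simp add: Vi)
  qed
  show ?thesis
  proof (rule that[of w0 V])
    show "AE x in lborel. x \<in> U \<longrightarrow> w x = w0 x" using w0(2) by eventually_elim auto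
    show VI: "integrable lborel (\<lambda>x. V x \<bullet> i)" if "i \<in> Basis" for i using h(1) Vi[OF that] by simp
    have m: "(\<lambda>x. norm (V x) powr s) \<in> borel_measurable lborel" by measurable
    have "AE x in lebesgue. indicator U x * norm (g x) powr s = norm (V x) powr s"
      using Vg unfolding AE_lebesgue_lborel by eventually_elim (auto simp: indicator_def split: if_splits)
    then have "integrable lebesgue (\<lambda>x. norm (V x) powr s)"
      using in_Lp_integrable(2)[OF \<Omega> s g(2) U] measurable_completion[OF m] integrable_cong_AE by blast
    then show "integrable lborel (\<lambda>x. norm (V x) powr s)" using integrable_completion[OF m] by simp
    show eV: "AE x in lborel. x \<in> U \<longrightarrow> weak_grad \<Omega> w x = V x"
      using eqg Vg by eventually_elim (use U(2) in \<open>auto simp: indicator_def split: if_splits\<close>)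
    fix \<phi> :: "'a \<Rightarrow> real" and i :: 'a assume t: "test_function U \<phi>" and i: "i \<in> Basis"
    have t': "test_function \<Omega> \<phi>" using test_function_subset[OF t U(2)] .
    have "(LINT x:\<Omega>|lebesgue. w x * pd i \<phi> x) = (LINT x|lborel. w0 x * pd i \<phi> x)"
    proof (rule set_integral_transfer[OF U(2) test_function_pd[OF t i]])
      show "w0 \<in> borel_measurable borel" using borel_measurable_integrable[OF w0(1)] by simp
      show "AE x in lborel. x \<in> U \<longrightarrow> w x = w0 x" using w0(2) by eventually_elim auto
    qed
    moreover have "(LINT x:\<Omega>|lebesgue. (weak_grad \<Omega> w x \<bullet> i) * \<phi> x) = (LINT x|lborel. (V x \<bullet> i) * \<phi> x)"
    proof (rule set_integral_transfer[OF U(2) t])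
      show "(\<lambda>x. V x \<bullet> i) \<in> borel_measurable borel" by measurable
      show "AE x in lborel. x \<in> U \<longrightarrow> weak_grad \<Omega> w x \<bullet> i = V x \<bullet> i" using eV by eventually_elim auto
    qed
    ultimately show "(LINT x|lborel. w0 x * pd i \<phi> x) = - (LINT x|lborel. (V x \<bullet> i) * \<phi> x)"
      using wg t' i unfolding has_weak_gradient_def pd_def by simp
  qed (use w0(1) in auto)
qed

section \<open>Vanishing of integrals off the support of a measure\<close>

text \<open>
  By Lindelof's theorem the complement of the support is a null set.
\<close>

lemma radon_integral_zero:
  fixes \<phi> :: "'a::euclidean_space \<Rightarrow> real"
  assumes \<mu>: "nonneg_radon S \<mu>" and sp: "U \<inter> spt \<mu> = {}" and z: "\<And>x. x \<notin> U \<Longrightarrow> \<phi> x = 0"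
  shows "(LINT x|\<mu>. \<phi> x) = 0"
proof -
  have sets: "sets \<mu> = sets (restrict_space borel S)" using \<mu> unfolding nonneg_radon_def by blast
  have sp\<mu>: "space \<mu> = S" using sets_eq_imp_space_eq[OF sets] by (simp add: space_restrict_space)
  define \<F> where "\<F> = {W. open W \<and> emeasure \<mu> (W \<inter> S) = 0}"
  obtain \<G> where G: "\<G> \<subseteq> \<F>" "countable \<G>" "\<Union>\<G> = \<Union>\<F>" using Lindelof[of \<F>] unfolding \<F>_def by blast
  have null: "W \<inter> S \<in> null_sets \<mu>" if "W \<in> \<F>" for W
    using that unfolding \<F>_def null_sets_def sets sets_restrict_space by (auto simp: Int_commute)
  have "(\<Union>W\<in>\<G>. W \<inter> S) \<in> null_sets \<mu>" using G null by (intro null_sets_UN') auto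
  then have "AE x in \<mu>. x \<notin> (\<Union>W\<in>\<G>. W \<inter> S)" by (rule AE_not_in)
  moreover have "AE x in \<mu>. x \<in> S" using sp\<mu> by (intro AE_I2) simp
  ultimately have "AE x in \<mu>. \<phi> x = 0"
  proof eventually_elim
    case (elim x)
    show ?case
    proof (rule ccontr)
      assume "\<phi> x \<noteq> 0"
      then have "x \<in> U" using z by blast
      then have "x \<notin> spt \<mu>" using sp by blast
      then obtain W where "open W" "x \<in> W" "\<not> emeasure \<mu> (W \<inter> S) > 0" using elim unfolding spt_def sp\<mu> by blast
      then have "x \<in> \<Union>\<F>" unfolding \<F>_def by (auto simp: not_less)
      then show False using G(3) elim by blast
    qed
  qed
  then show ?thesis by (rule integral_eq_zero_AE)
qed

section \<open>Local boundedness of the gradient\<close>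

text \<open>
  Identifies the weak gradient with the classical one as soon as a \<open>C^1\<close> representative is known, which lets the
  nonlinear terms be rewritten with continuous functions.
\<close>

lemma weak_gradient_classical:
  fixes v :: "'a::euclidean_space \<Rightarrow> real"
  assumes U: "open U" and v: "Ck_on 1 U v" and w: "integrable lborel w" and eq: "AE x in lborel. x \<in> U \<longrightarrow> w x = v x"
    and i: "i \<in> Basis" and g: "integrable lborel g"
    and grad: "\<And>\<phi>. test_function U \<phi> \<Longrightarrow> (LINT x|lborel. w x * pd i \<phi> x) = - (LINT x|lborel. g x * \<phi> x)"
  shows "AE x in lborel. x \<in> U \<longrightarrow> g x = pd i v x"
proof -
  have pc: "continuous_on U (pd i v)" using v i by (simp add: Ck_on_Suc_open[OF U])
  have "AE x in lebesgue. x \<in> U \<longrightarrow> g x - pd i v x = 0"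
  proof (rule fundamental_zero[OF U])
    show "set_integrable lebesgue K (\<lambda>x. g x - pd i v x)" if K: "compact K" "K \<subseteq> U" for K
    proof (rule set_integral_diff(1)[OF set_integrable_lebesgue_of_lborel[OF g K(1)]])
      have "integrable lborel (\<lambda>x. indicator K x *\<^sub>R pd i v x)"
        using K pc by (intro borel_integrable_compact) (auto intro: continuous_on_subset)
      then show "set_integrable lebesgue K (pd i v)"
        unfolding set_integrable_def by (simp add: integrable_completion borel_measurable_integrable)
    qed
    fix \<phi> assume t: "test_function U \<phi>"
    note ibp = integral_by_parts[OF U v t i]
    have C1: "C1c \<phi>" using Cinfc_C1c test_function_Cinfc t by blast
    obtain M where M: "\<And>x. \<bar>\<phi> x\<bar> \<le> M" using C1c_bounded[OF C1] by blast
    have \<phi>m: "\<phi> \<in> borel_measurable borel" using C1c_continuous[OF C1] by (rule borel_measurable_continuous_onI)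
    have gI: "integrable lborel (\<lambda>x. g x * \<phi> x)" by (rule integrable_mult_bounded[OF g \<phi>m M])
    have pm: "pd i \<phi> \<in> borel_measurable borel" using C1c_pd_continuous[OF C1 i] by (rule borel_measurable_continuous_onI)
    have "(LINT x|lborel. w x * pd i \<phi> x) = (LINT x|lborel. v x * pd i \<phi> x)"
    proof (rule integral_cong_AE)
      show "(\<lambda>x. w x * pd i \<phi> x) \<in> borel_measurable lborel" using borel_measurable_integrable[OF w] pm by simp
      show "AE x in lborel. w x * pd i \<phi> x = v x * pd i \<phi> x"
        using eq by eventually_elim (use test_function_zero_outside[OF test_function_pd[OF t i]] in auto)
    qed (use ibp(1) in auto)
    then have e: "(LINT x|lborel. g x * \<phi> x - pd i v x * \<phi> x) = 0" using grad[OF t] ibp gI by simp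
    have fe: "(\<lambda>x. indicator U x *\<^sub>R ((g x - pd i v x) * \<phi> x)) = (\<lambda>x. g x * \<phi> x - pd i v x * \<phi> x)"
      using test_function_zero_outside[OF t] by (auto simp: fun_eq_iff indicator_def left_diff_distrib)
    have "(\<lambda>x. g x * \<phi> x - pd i v x * \<phi> x) \<in> borel_measurable lborel" using gI ibp(2) by simp
    from integral_completion[OF this] show "(LINT x:U|lebesgue. (g x - pd i v x) * \<phi> x) = 0"
      unfolding set_lebesgue_integral_def fe using e by simp
  qed
  then show ?thesis unfolding AE_lebesgue_lborel by simp
qed

text \<open>
  The Riesz potential bound is applied to all components of \<open>V\<close>, and \<open>h0\<close> is estimated by \<open>V\<close> again; this closes the
  inequality to which the bootstrap applies.
\<close>

lemma gradient_locally_bounded: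
  fixes u0 h0 :: "'a::euclidean_space \<Rightarrow> real" and V :: "'a \<Rightarrow> 'a"
  assumes dim: "DIM('a) \<ge> 2" and U: "open U" and u0: "integrable lborel u0" and h0: "integrable lborel h0" and weak: "weak_laplacian U u0 h0"
    and V: "V \<in> borel_measurable borel" "\<And>i. i \<in> Basis \<Longrightarrow> integrable lborel (\<lambda>x. V x \<bullet> i)"
    and grad: "\<And>\<phi> i. test_function U \<phi> \<Longrightarrow> i \<in> Basis \<Longrightarrow> (LINT x|lborel. u0 x * pd i \<phi> x) = - (LINT x|lborel. (V x \<bullet> i) * \<phi> x)"
    and p: "1 < p" "p * (real DIM('a) - 1) < real DIM('a)" and Vp: "integrable lborel (\<lambda>x. norm (V x) powr p)"
    and hV: "0 \<le> A" "\<And>x. x \<in> U \<Longrightarrow> \<bar>h0 x\<bar> \<le> A * (1 + norm (V x) powr p)" and x0: "x0 \<in> U"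
  shows "\<exists>e>0. \<exists>C. AE x in lborel. x \<in> ball x0 e \<longrightarrow> norm (V x) \<le> C"
proof -
  obtain \<eta> \<Psi> :: "'a \<Rightarrow> real" where \<eta>: "kernel \<eta>" "\<And>z. 0 \<le> \<eta> z" "integral\<^sup>L lborel \<eta> = 1" and \<Psi>: "kernel \<Psi>"
    and L: "\<And>z. lap \<Psi> z = \<eta> z - 2 ^ DIM('a) * \<eta> (2 *\<^sub>R z)"
    using mollifier_exists by metis
  obtain R where R: "R > 0" "ball x0 R \<subseteq> U" using U x0 open_contains_ball by blast
  let ?D = "real DIM('a) - 1"
  have [measurable]: "V \<in> borel_measurable borel" "h0 \<in> borel_measurable borel"
    using V(1) borel_measurable_integrable[OF h0] by auto
  have "\<exists>C. AE x in lborel. x \<in> ball x0 (R / 2) \<longrightarrow> norm (V x) \<le> C"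
  proof (rule riesz_bootstrap[where R=R and p=p])
    have "(\<integral>\<^sup>+y. ennreal (1 + norm (V y) powr p) * indicator (ball x0 R) y \<partial>lborel)
      \<le> (\<integral>\<^sup>+y. indicator (ball x0 R) y + ennreal (norm (V y) powr p) \<partial>lborel)"
      by (intro nn_integral_mono) (auto simp: indicator_def ennreal_plus)
    also have "\<dots> = emeasure lborel (ball x0 R) + (\<integral>\<^sup>+y. ennreal (norm (V y) powr p) \<partial>lborel)"
      by (subst nn_integral_add) auto
    also have "\<dots> < \<infinity>"
      using Vp emeasure_bounded_finite[OF bounded_ball, of x0 R] unfolding integrable_iff_bounded by simp
    finally show "(\<integral>\<^sup>+y. ennreal (1 + norm (V y) powr p) * indicator (ball x0 R) y \<partial>lborel) < \<infinity>" .
    fix r r' assume r: "0 < r" "r < r'" "r' < R"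
    define H where "H = (\<lambda>y. 1 + norm (V y) powr p)"
    have sub: "ball x0 r' \<subseteq> U" using R r by (meson order_trans less_imp_le subset_ball)
    have "\<forall>i\<in>Basis. \<exists>B\<ge>0. AE x in lborel. x \<in> ball x0 r \<longrightarrow>
      ennreal \<bar>V x \<bullet> i\<bar> \<le> ennreal B + ennreal B * riesz_potential ?D x0 r' (\<lambda>y. \<bar>h0 y\<bar>) x"
      by (rule ballI, rule riesz_gradient[OF \<eta> \<Psi> L U dim u0 h0 weak _ V(2) grad sub r(1,2)])
    from bchoice[OF this] obtain B where B: "\<And>i. i \<in> Basis \<Longrightarrow> B i \<ge> 0" "\<And>i. i \<in> Basis \<Longrightarrow> AE x in lborel. x \<in> ball x0 r \<longrightarrow>
      ennreal \<bar>V x \<bullet> i\<bar> \<le> ennreal (B i) + ennreal (B i) * riesz_potential ?D x0 r' (\<lambda>y. \<bar>h0 y\<bar>) x" by blast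
    define S where "S = (\<Sum>i\<in>(Basis::'a set). B i)"
    have S: "S \<ge> 0" unfolding S_def using B(1) by (rule sum_nonneg)
    have sl: "riesz_potential ?D x0 r' (\<lambda>y. \<bar>h0 y\<bar>) x \<le> ennreal A * riesz_potential ?D x0 r' H x" for x
    proof -
      have "riesz_potential ?D x0 r' (\<lambda>y. \<bar>h0 y\<bar>) x \<le> (\<integral>\<^sup>+y. ennreal A * (ennreal (H y * norm (y - x) powr (- ?D)) * indicator (ball x0 r') y) \<partial>lborel)"
        unfolding riesz_potential_def
      proof (rule nn_integral_mono)
        fix y
        show "ennreal (\<bar>h0 y\<bar> * norm (y - x) powr (- ?D)) * indicator (ball x0 r') y
          \<le> ennreal A * (ennreal (H y * norm (y - x) powr (- ?D)) * indicator (ball x0 r') y)"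
        proof (cases "y \<in> ball x0 r'")
          case True
          then have "\<bar>h0 y\<bar> * norm (y - x) powr (- ?D) \<le> A * H y * norm (y - x) powr (- ?D)"
            using hV(2) sub unfolding H_def by (intro mult_right_mono) auto
          then have "ennreal (\<bar>h0 y\<bar> * norm (y - x) powr (- ?D)) \<le> ennreal (A * (H y * norm (y - x) powr (- ?D)))"
            by (intro ennreal_leI) (simp add: mult.assoc)
          then show ?thesis using True hV(1) by (simp add: ennreal_mult H_def)
        qed simp
      qed
      also have "\<dots> = ennreal A * riesz_potential ?D x0 r' H x" unfolding riesz_potential_def H_def by (rule nn_integral_cmult) measurable
      finally show ?thesis .
    qed
    have "AE x in lborel. \<forall>i\<in>Basis. x \<in> ball x0 r \<longrightarrow>
      ennreal \<bar>V x \<bullet> i\<bar> \<le> ennreal (B i) + ennreal (B i) * riesz_potential ?D x0 r' (\<lambda>y. \<bar>h0 y\<bar>) x"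
      by (rule AE_finite_allI[OF finite_Basis B(2)])
    then have "AE x in lborel. x \<in> ball x0 r \<longrightarrow>
       ennreal (norm (V x)) \<le> ennreal (S + S * A) + ennreal (S + S * A) * riesz_potential ?D x0 r' H x"
    proof eventually_elim
      case (elim x)
      show ?case
      proof
        assume x: "x \<in> ball x0 r"
        let ?s = "riesz_potential ?D x0 r' (\<lambda>y. \<bar>h0 y\<bar>) x"
        have "ennreal (norm (V x)) \<le> ennreal (\<Sum>i\<in>Basis. \<bar>V x \<bullet> i\<bar>)" by (intro ennreal_leI norm_le_l1)
        also have "\<dots> = (\<Sum>i\<in>Basis. ennreal \<bar>V x \<bullet> i\<bar>)" by (simp add: sum_ennreal)
        also have "\<dots> \<le> (\<Sum>i\<in>Basis. ennreal (B i) + ennreal (B i) * ?s)" using elim x by (intro sum_mono) auto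
        also have "\<dots> = ennreal S + ennreal S * ?s"
          unfolding S_def using B(1) by (simp add: sum.distrib sum_ennreal sum_distrib_right[symmetric])
        also have "\<dots> \<le> ennreal S + ennreal S * (ennreal A * riesz_potential ?D x0 r' H x)"
          by (intro add_left_mono mult_left_mono sl) auto
        also have "\<dots> \<le> ennreal (S + S * A) + ennreal (S + S * A) * riesz_potential ?D x0 r' H x"
        proof (intro add_mono)
          show "ennreal S \<le> ennreal (S + S * A)" using S hV(1) by (intro ennreal_leI) simp
          have "ennreal S * (ennreal A * riesz_potential ?D x0 r' H x) = ennreal (S * A) * riesz_potential ?D x0 r' H x"
            using S hV(1) by (simp add: ennreal_mult mult.assoc)
          also have "\<dots> \<le> ennreal (S + S * A) * riesz_potential ?D x0 r' H x"
            using S by (intro mult_right_mono ennreal_leI) auto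
          finally show "ennreal S * (ennreal A * riesz_potential ?D x0 r' H x) \<le> ennreal (S + S * A) * riesz_potential ?D x0 r' H x" .
        qed
        finally show "ennreal (norm (V x)) \<le> ennreal (S + S * A) + ennreal (S + S * A) * riesz_potential ?D x0 r' H x" .
      qed
    qed
    then show "\<exists>A\<ge>0. AE x in lborel. x \<in> ball x0 r \<longrightarrow>
        ennreal (norm (V x)) \<le> ennreal A + ennreal A * riesz_potential ?D x0 r' (\<lambda>y. 1 + norm (V y) powr p) x"
      unfolding H_def using S hV(1) by (intro exI[of _ "S + S * A"]) auto
  qed (use p R in auto)
  then show ?thesis using R(1) by (intro exI[of _ "R / 2"]) auto
qed

section \<open>Regularity of the coupled system\<close>

lemma Ck_holder_loc_Ck_on: "open U \<Longrightarrow> Ck_holder_loc k \<sigma> U v \<Longrightarrow> Ck_on k U v"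
proof (induction k arbitrary: v)
  case (Suc k) then show ?case by (auto simp: Ck_holder_loc_Suc_open Ck_on_Suc_open)
qed simp

lemma continuous_AE_eq:
  fixes f g :: "'a::euclidean_space \<Rightarrow> real"
  assumes U: "open U" and c: "continuous_on U f" "continuous_on U g" and ae: "AE x in lborel. x \<in> U \<longrightarrow> f x = g x" and x: "x \<in> U"
  shows "f x = g x"
proof -
  let ?N = "U \<inter> (\<lambda>x. f x - g x) -` (- {0})"
  have op: "open ?N" by (rule continuous_open_preimage[OF continuous_on_diff[OF c] U]) auto
  have "AE x in lborel. x \<notin> ?N" using ae by eventually_elim auto
  then have "?N \<in> null_sets lborel" using op by (subst AE_iff_null_sets) auto
  then have "negligible ?N" using null_sets_completionI negligible_iff_null_sets by blast
  then have "?N = {}" using open_not_negligible op by blast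
  then show ?thesis using x by auto
qed

lemma indicator_continuous_integrable:
  fixes F :: "'a::euclidean_space \<Rightarrow> real"
  assumes U: "open U" "bounded U" and F: "continuous_on U F" "\<And>x. x \<in> U \<Longrightarrow> \<bar>F x\<bar> \<le> B"
  shows "integrable lborel (\<lambda>x. indicator U x * F x)"
proof (rule Bochner_Integration.integrable_bound)
  show "integrable lborel (\<lambda>x. B * indicator U x)" using emeasure_bounded_finite[OF U(2)] U(1) by simp
  show "(\<lambda>x. indicator U x * F x) \<in> borel_measurable lborel"
    using borel_measurable_continuous_on_indicator[of U F] U F by simp
  show "AE x in lborel. norm (indicator U x * F x) \<le> norm (B * indicator U x)"
    using F(2) by (intro AE_I2) (force simp: indicator_def)
qed

lemma powr_le_one_plus: "0 \<le> t \<Longrightarrow> 0 < a \<Longrightarrow> a \<le> b \<Longrightarrow> t powr a \<le> 1 + t powr b" for t :: real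
proof (cases "t \<le> 1")
  case True
  assume "0 \<le> t" "0 < a"
  then have "t powr a \<le> 1" using True by (intro powr_le1) auto
  then show ?thesis by (simp add: add_increasing2)
next
  case False
  assume "a \<le> b"
  then have "t powr a \<le> t powr b" using False by (intro powr_mono) auto
  then show ?thesis by simp
qed

lemma norm_powr_component:
  fixes z :: "'a::euclidean_space"
  assumes "i \<in> Basis"
  shows "\<bar>norm z powr (p - 2) * (z \<bullet> i)\<bar> \<le> norm z powr (p - 1)"
proof -
  have "\<bar>norm z powr (p - 2) * (z \<bullet> i)\<bar> \<le> norm z powr (p - 2) * norm z"
    using Basis_le_norm[OF assms, of z] by (auto simp: abs_mult intro!: mult_left_mono)
  also have "\<dots> = norm z powr (p - 1)" using powr_add[of "norm z" "p - 2" 1] by (cases "z = 0") auto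
  finally show ?thesis .
qed

text \<open>
  \<open>|V|^(p-1) \<le> 1 + |V|^p\<close> makes the flux as integrable as \<open>|V|^p\<close>.
\<close>

lemma flux_bound:
  fixes V :: "'a::euclidean_space \<Rightarrow> 'a" and m :: "'a \<Rightarrow> real"
  assumes p: "1 < p" and m: "\<And>x. x \<in> U \<Longrightarrow> 0 \<le> m x \<and> m x \<le> 1" and i: "i \<in> Basis"
  shows "\<bar>indicator U x * m x * (norm (V x) powr (p - 2) * (V x \<bullet> i))\<bar> \<le> indicator U x * (1 + norm (V x) powr p)"
proof (cases "x \<in> U")
  case True
  have "\<bar>indicator U x * m x * (norm (V x) powr (p - 2) * (V x \<bullet> i))\<bar> \<le> 1 * norm (V x) powr (p - 1)"
    unfolding abs_mult[of _ "norm _ powr _ * _"] using True m[OF True] i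
    by (intro mult_mono norm_powr_component) auto
  also have "\<dots> \<le> 1 + norm (V x) powr p" using powr_le_one_plus[of "norm (V x)" "p - 1" p] p by simp
  finally show ?thesis using True by simp
qed simp

lemma flux_integrable:
  fixes V :: "'a::euclidean_space \<Rightarrow> 'a" and m :: "'a \<Rightarrow> real"
  assumes U: "open U" "bounded U" and p: "1 < p" and m: "continuous_on U m" "\<And>x. x \<in> U \<Longrightarrow> 0 \<le> m x \<and> m x \<le> 1" and i: "i \<in> Basis"
    and V: "V \<in> borel_measurable borel" "integrable lborel (\<lambda>x. norm (V x) powr p)"
  shows "integrable lborel (\<lambda>x. indicator U x * m x * (norm (V x) powr (p - 2) * (V x \<bullet> i)))"
proof (rule Bochner_Integration.integrable_bound)
  show "integrable lborel (\<lambda>x. indicator U x + norm (V x) powr p)"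
    using V(2) emeasure_bounded_finite[OF U(2)] U(1) by simp
  have m1: "\<bar>m x\<bar> \<le> 1" if "x \<in> U" for x using m(2)[OF that] by simp
  have [measurable]: "V \<in> borel_measurable borel" by (rule V(1))
  have [measurable]: "(\<lambda>x. indicator U x * m x) \<in> borel_measurable borel"
    using borel_measurable_integrable[OF indicator_continuous_integrable[OF U m(1) m1]] by simp
  show "(\<lambda>x. indicator U x * m x * (norm (V x) powr (p - 2) * (V x \<bullet> i))) \<in> borel_measurable lborel" by measurable
  show "AE x in lborel. norm (indicator U x * m x * (norm (V x) powr (p - 2) * (V x \<bullet> i))) \<le> norm (indicator U x + norm (V x) powr p)"
  proof (intro AE_I2)
    fix x
    have "indicator U x * (1 + norm (V x) powr p) \<le> indicator U x + norm (V x) powr p" by (simp add: indicator_def)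
    then show "norm (indicator U x * m x * (norm (V x) powr (p - 2) * (V x \<bullet> i))) \<le> norm (indicator U x + norm (V x) powr p)"
      using flux_bound[where V=V and m=m and U=U and x=x, OF p m(2) i] by simp
  qed
qed

text \<open>
  The chain of gains described at the beginning. The function \<open>v\<close> is the continuously differentiable representative of \<open>u0\<close>; the
  last two conclusions are conditional because they depend on the regularity of the source \<open>F\<close>. Halving the exponents
  absorbs the loss in \<open>dyadic_limit\<close>.
\<close>

lemma system_regularity:
  fixes u0 m F :: "'a::euclidean_space \<Rightarrow> real" and V :: "'a \<Rightarrow> 'a"
  assumes dim: "DIM('a) \<ge> 2" and U: "open U" "bounded U"
    and p: "1 < p" "p < 2" "p * (real DIM('a) - 1) < real DIM('a)"
    and u0: "integrable lborel u0" and V: "V \<in> borel_measurable borel" "\<And>i. i \<in> Basis \<Longrightarrow> integrable lborel (\<lambda>x. V x \<bullet> i)"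
    and Vp: "integrable lborel (\<lambda>x. norm (V x) powr p)"
    and grad: "\<And>\<phi> i. test_function U \<phi> \<Longrightarrow> i \<in> Basis \<Longrightarrow> (LINT x|lborel. u0 x * pd i \<phi> x) = - (LINT x|lborel. (V x \<bullet> i) * \<phi> x)"
    and m: "continuous_on U m" "\<And>x. x \<in> U \<Longrightarrow> 0 \<le> m x \<and> m x \<le> 1"
    and F: "continuous_on U F" "\<And>x. x \<in> U \<Longrightarrow> \<bar>F x\<bar> \<le> B"
    and weak_u: "weak_laplacian U u0 (\<lambda>x. indicator U x * (norm (V x) powr p / p - F x))"
    and weak_m: "weak_divergence U (\<lambda>x. indicator U x * m x) (\<lambda>i x. - (indicator U x * m x * (norm (V x) powr (p - 2) * (V x \<bullet> i))))"
  obtains v where "AE x in lborel. x \<in> U \<longrightarrow> u0 x = v x" "\<And>\<sigma>. 0 < \<sigma> \<Longrightarrow> \<sigma> < 1 \<Longrightarrow> Ck_holder_loc 1 \<sigma> U v"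
    "Ck_holder_loc 1 ((p - 1) / 4) U m"
    "\<And>\<beta>. 0 < \<beta> \<Longrightarrow> \<beta> \<le> 1 / 2 \<Longrightarrow> Ck_holder_loc 0 \<beta> U F \<Longrightarrow> Ck_holder_loc 2 (\<beta> / 2) U v"
    "\<And>\<beta>. 0 < \<beta> \<Longrightarrow> \<beta> \<le> 1 \<Longrightarrow> Ck_holder_loc 1 \<beta> U (\<lambda>x. norm (gradient v x) powr p / p - F x) \<Longrightarrow> Ck_holder_loc 3 (\<beta> / 2) U v"
proof -
  obtain \<eta> \<Psi> :: "'a \<Rightarrow> real" where \<eta>: "kernel \<eta>" "\<And>z. 0 \<le> \<eta> z" "integral\<^sup>L lborel \<eta> = 1" and \<Psi>: "kernel \<Psi>"
    and L: "\<And>z. lap \<Psi> z = \<eta> z - 2 ^ DIM('a) * \<eta> (2 *\<^sub>R z)"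
    using mollifier_exists by metis
  define h0 where "h0 x = indicator U x * (norm (V x) powr p / p - F x)" for x
  define m0 where "m0 x = indicator U x * m x" for x
  define F0 where "F0 i x = - (indicator U x * m x * (norm (V x) powr (p - 2) * (V x \<bullet> i)))" for i x
  have Ub: "U \<in> sets borel" using U(1) by simp
  have h0: "integrable lborel h0"
  proof -
    have "integrable lborel (\<lambda>x. indicator U x *\<^sub>R (norm (V x) powr p / p))"
      using Vp Ub by (intro integrable_mult_indicator) auto
    then have "integrable lborel (\<lambda>x. indicator U x *\<^sub>R (norm (V x) powr p / p) - indicator U x * F x)"
      using indicator_continuous_integrable[OF U F] by simp
    then show ?thesis by (simp add: h0_def[abs_def] right_diff_distrib)
  qed
  have m1: "\<bar>m x\<bar> \<le> 1" if "x \<in> U" for x using m(2)[OF that] by simp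
  have m0: "integrable lborel m0" unfolding m0_def[abs_def] by (rule indicator_continuous_integrable[OF U m(1) m1])
  have Fb: "\<bar>F0 i x\<bar> \<le> indicator U x * (1 + norm (V x) powr p)" if i: "i \<in> Basis" for i x
    unfolding F0_def abs_minus_cancel by (rule flux_bound[OF p(1) m(2) i])
  have F0: "integrable lborel (F0 i)" if i: "i \<in> Basis" for i
    unfolding F0_def[abs_def] by (intro integrable_minus flux_integrable[OF U p(1) m i V(1) Vp])
  have wu: "weak_laplacian U u0 h0" using weak_u by (simp add: h0_def[abs_def])
  have wm: "weak_divergence U m0 F0" using weak_m by (simp add: m0_def[abs_def] F0_def[abs_def])
  have hb: "\<bar>h0 x\<bar> \<le> (1 + \<bar>B\<bar>) * (1 + norm (V x) powr p)" if "x \<in> U" for x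
  proof -
    have "norm (V x) powr p / p \<le> norm (V x) powr p" using p by (simp add: divide_le_eq mult_right_le_one_le mult_le_cancel_left1)
    moreover have "0 \<le> norm (V x) powr p / p" using p by simp
    ultimately have "\<bar>h0 x\<bar> \<le> norm (V x) powr p + \<bar>B\<bar>" using F(2)[OF that] that by (simp add: h0_def)
    also have "\<dots> \<le> (1 + \<bar>B\<bar>) * (1 + norm (V x) powr p)" by (simp add: algebra_simps)
    finally show ?thesis .
  qed
  have Vb: "\<exists>e>0. \<exists>C. AE x in lborel. x \<in> ball x0 e \<longrightarrow> 1 + norm (V x) powr p \<le> C" if x0: "x0 \<in> U" for x0
  proof -
    obtain e C where e: "e > 0" "AE x in lborel. x \<in> ball x0 e \<longrightarrow> norm (V x) \<le> C"
      using gradient_locally_bounded[OF dim U(1) u0 h0 wu V grad p(1,3) Vp _ hb x0] by auto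
    have "AE x in lborel. x \<in> ball x0 e \<longrightarrow> 1 + norm (V x) powr p \<le> 1 + C powr p"
      using e(2) by eventually_elim (use p in \<open>auto intro!: powr_mono2\<close>)
    then show ?thesis using e(1) by blast
  qed
  define v where "v = mollifier_limit \<eta> u0"
  have dyu: "\<exists>r>0. \<exists>N. dyadic 1 1 (ball x r) N (\<lambda>n. conv u0 (dil n \<eta>))" if x: "x \<in> U" for x
  proof -
    obtain e C where e: "e > 0" "AE y in lborel. y \<in> ball x e \<longrightarrow> 1 + norm (V y) powr p \<le> C" using Vb[OF x] by blast
    obtain e' where e': "e' > 0" "ball x e' \<subseteq> U" using U(1) x open_contains_ball by blast
    show ?thesis
    proof (rule dyadic_weak_laplacian_bounded[OF \<eta> \<Psi> L U(1) u0 h0 wu x, of "min e e'" "(1 + \<bar>B\<bar>) * C"])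
      show "AE y in lborel. y \<in> ball x (min e e') \<longrightarrow> \<bar>h0 y\<bar> \<le> (1 + \<bar>B\<bar>) * C"
        using e(2)
      proof eventually_elim
        case (elim y)
        show ?case
        proof
          assume y: "y \<in> ball x (min e e')"
          then have "y \<in> U" "1 + norm (V y) powr p \<le> C" using e' elim by auto
          then show "\<bar>h0 y\<bar> \<le> (1 + \<bar>B\<bar>) * C" using hb[of y] mult_left_mono[of _ C "1 + \<bar>B\<bar>"] by fastforce
        qed
      qed
    qed (use e(1) e'(1) in auto)
  qed
  have v1: "Ck_holder_loc 1 \<sigma> U v" if "0 < \<sigma>" "\<sigma> < 1" for \<sigma>
    unfolding v_def by (rule regularity_of_dyadic(1)[OF \<eta> U(1) u0 that order_refl dyu])
  have vae: "AE x in lborel. x \<in> U \<longrightarrow> u0 x = v x"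
    unfolding v_def by (rule regularity_of_dyadic(2)[OF \<eta> U(1) u0, of "1/2" 1 1]) (use dyu in auto)
  have vC1: "Ck_on 1 U v" using Ck_holder_loc_Ck_on[OF U(1) v1[of "1/2"]] by simp
  have Vv: "AE x in lborel. x \<in> U \<longrightarrow> V x = gradient v x"
  proof -
    have "AE x in lborel. \<forall>i\<in>Basis. x \<in> U \<longrightarrow> V x \<bullet> i = pd i v x"
      by (rule AE_finite_allI[OF finite_Basis weak_gradient_classical[OF U(1) vC1 u0 vae _ V(2) grad]])
    then show ?thesis by eventually_elim (rule impI, rule euclidean_eqI, simp add: gradient_inner)
  qed
  have gradH: "Ck_holder_loc 0 (1/2) U (\<lambda>x. gradient v x \<bullet> i)" if "i \<in> Basis" for i
    using v1[of "1/2"] that by (simp add: Ck_holder_loc_Suc_open[OF U(1)] gradient_inner)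
  note gradC = dist_of_components[of "1/2" U "gradient v", OF gradH]
  \<comment> \<open>The flux is bounded where \<open>V\<close> is, which gives a first Hoelder exponent for \<open>m\<close>.\<close>
  have dym: "\<exists>r>0. \<exists>N. dyadic 0 1 (ball x r) N (\<lambda>n. conv m0 (dil n \<eta>))" if x: "x \<in> U" for x
  proof -
    obtain e C where e: "e > 0" "AE y in lborel. y \<in> ball x e \<longrightarrow> 1 + norm (V y) powr p \<le> C" using Vb[OF x] by blast
    show ?thesis
    proof (rule dyadic_weak_divergence_bounded[OF \<eta> \<Psi> L U(1) m0 F0 wm x e(1)])
      fix i :: 'a assume i: "i \<in> Basis"
      show "AE y in lborel. y \<in> ball x e \<longrightarrow> \<bar>F0 i y\<bar> \<le> C"
        using e(2)
      proof eventually_elim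
        case (elim y)
        have "\<bar>F0 i y\<bar> \<le> 1 + norm (V y) powr p" using Fb[OF i, of y] by (rule order_trans) (simp add: indicator_def)
        then show ?case using elim by auto
      qed
    qed
  qed
  have mm: "m x = mollifier_limit \<eta> m0 x" if x: "x \<in> U" for x
  proof (rule continuous_AE_eq[OF U(1) m(1) _ _ x])
    have "Ck_holder_loc 0 (1/2) U (mollifier_limit \<eta> m0)" by (rule regularity_of_dyadic(1)[OF \<eta> U(1) m0 _ _ order_refl dym]) auto
    then show "continuous_on U (mollifier_limit \<eta> m0)" by simp
    have "AE x in lborel. x \<in> U \<longrightarrow> m0 x = mollifier_limit \<eta> m0 x"
      by (rule regularity_of_dyadic(2)[OF \<eta> U(1) m0, of "1/2" 1 0]) (use dym in auto)
    then show "AE x in lborel. x \<in> U \<longrightarrow> m x = mollifier_limit \<eta> m0 x" by eventually_elim (simp add: m0_def)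
  qed
  have mH: "Ck_holder_loc 0 (1/2) U m"
    by (rule Ck_holder_loc_cong[OF U(1) mm[symmetric] regularity_of_dyadic(1)[OF \<eta> U(1) m0 _ _ order_refl dym]]) auto
  define G where "G i x = - (m x * (norm (gradient v x) powr ((p - 1) - 1) * (gradient v x \<bullet> i)))" for i x
  \<comment> \<open>A product of the \<open>1/2\<close>-Hoelder \<open>m\<close> with the composition of a \<open>(p-1)\<close>-Hoelder map and the \<open>1/2\<close>-Hoelder gradient.\<close>
  have GH: "Ck_holder_loc 0 ((p - 1) / 2) U (G i)" if i: "i \<in> Basis" for i
  proof -
    have c1: "Ck_holder_loc 0 ((p - 1) * (1/2)) U (\<lambda>x. norm (gradient v x) powr ((p - 1) - 1) * (gradient v x \<bullet> i))"
      using p by (intro holder_0_compose[OF gradC power_map_component[OF _ _ i]]) auto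
    have c2: "Ck_holder_loc 0 ((p - 1) * (1/2)) U m" using mH p by (intro holder_0_mono[OF mH]) auto
    have "Ck_holder_loc 0 ((p - 1) * (1/2)) U (\<lambda>x. (-1) * (m x * (norm (gradient v x) powr ((p - 1) - 1) * (gradient v x \<bullet> i))))"
      by (rule holder_0_cmult[OF holder_0_mult[OF c2 c1]])
    then show ?thesis by (simp add: G_def[abs_def])
  qed
  have FG: "AE x in lborel. x \<in> U \<longrightarrow> F0 i x = G i x" for i
    using Vv by eventually_elim (simp add: F0_def G_def diff_diff_add)
  have "Ck_holder_loc 1 ((p - 1) / 4) U (mollifier_limit \<eta> m0)"
    using p by (intro regularity_of_dyadic(1)[OF \<eta> U(1) m0, of _ "(p - 1) / 2"]
      dyadic_weak_divergence_holder[OF \<eta> \<Psi> L U(1) m0 F0 wm GH _ _ FG]) auto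
  then have m1a: "Ck_holder_loc 1 ((p - 1) / 4) U m"
    by (rule Ck_holder_loc_cong[OF U(1) mm[symmetric], rotated]) assumption
  have hG: "AE x in lborel. x \<in> U \<longrightarrow> h0 x = norm (gradient v x) powr p / p - F x"
    using Vv by eventually_elim (simp add: h0_def)
  have C2: "Ck_holder_loc 2 (\<beta> / 2) U v" if \<beta>: "0 < \<beta>" "\<beta> \<le> 1 / 2" and FH: "Ck_holder_loc 0 \<beta> U F" for \<beta>
  proof -
    have "Ck_holder_loc 0 1 UNIV (\<lambda>z::'a. norm z powr p)"
      by (rule holder_0_of_C1[OF open_UNIV norm_powr_C1(1)[OF p(1,2)]]) auto
    then have "Ck_holder_loc 0 (1 * (1/2)) U (\<lambda>x. norm (gradient v x) powr p)"
      by (intro holder_0_compose[OF gradC]) auto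
    then have "Ck_holder_loc 0 \<beta> U (\<lambda>x. norm (gradient v x) powr p)" by (rule holder_0_mono) (use \<beta> in simp)
    then have "Ck_holder_loc 0 \<beta> U (\<lambda>x. (1/p) * norm (gradient v x) powr p + (-1) * F x)"
      by (intro holder_0_add holder_0_cmult FH)
    then have GF: "Ck_holder_loc 0 \<beta> U (\<lambda>x. norm (gradient v x) powr p / p - F x)" by simp
    show ?thesis unfolding v_def
      using \<beta> by (intro regularity_of_dyadic(1)[OF \<eta> U(1) u0, of _ \<beta>] dyadic_weak_laplacian_holder[OF \<eta> \<Psi> L U(1) u0 h0 wu GF _ _ hG]) auto
  qed
  have C3: "Ck_holder_loc 3 (\<beta> / 2) U v" if \<beta>: "0 < \<beta>" "\<beta> \<le> 1" and GF: "Ck_holder_loc 1 \<beta> U (\<lambda>x. norm (gradient v x) powr p / p - F x)" for \<beta>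
    unfolding v_def
    using \<beta> by (intro regularity_of_dyadic(1)[OF \<eta> U(1) u0, of _ \<beta>] dyadic_weak_laplacian_C1[OF \<eta> \<Psi> L U(1) u0 h0 wu GF _ _ hG]) auto
  show ?thesis by (rule that[OF vae v1 m1a C2 C3])
qed

section \<open>Hoelder regularity of the coupling and of the Hamiltonian\<close>

lemma graph_distance:
  fixes m :: "'a::euclidean_space \<Rightarrow> real"
  assumes U: "open U" and m: "Ck_on 1 U m"
  shows "continuous_on U (\<lambda>x. (x, m x))"
    "compact K \<Longrightarrow> K \<subseteq> U \<Longrightarrow> \<exists>C\<ge>0. \<forall>x\<in>K. \<forall>y\<in>K. dist (x, m x) (y, m y) \<le> C * dist x y powr 1"
proof -
  have mH: "Ck_holder_loc 0 1 U m" by (rule holder_0_of_C1[OF U m]) auto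
  show "continuous_on U (\<lambda>x. (x, m x))" using mH by (auto intro!: continuous_intros)
  assume K: "compact K" "K \<subseteq> U"
  have "holder_on 1 K m" using mH K unfolding holder_0_iff by blast
  from holder_onD[OF this] obtain C where C: "C \<ge> 0" "\<forall>x\<in>K. \<forall>y\<in>K. \<bar>m x - m y\<bar> \<le> C * dist x y powr 1" by blast
  have "dist (x, m x) (y, m y) \<le> (1 + C) * dist x y powr 1" if "x \<in> K" "y \<in> K" for x y
  proof -
    have "dist (x, m x) (y, m y) \<le> dist x y + \<bar>m x - m y\<bar>"
      using sqrt_sum_squares_le_sum_abs[of "dist x y" "dist (m x) (m y)"] by (simp add: dist_Pair_Pair dist_real_def)
    also have "\<dots> \<le> (1 + C) * dist x y powr 1" using C(2) that by (auto simp: algebra_simps)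
    finally show ?thesis .
  qed
  then show "\<exists>C\<ge>0. \<forall>x\<in>K. \<forall>y\<in>K. dist (x, m x) (y, m y) \<le> C * dist x y powr 1" using C(1) by (intro exI[of _ "1 + C"]) auto
qed

lemma holder_graph_0:
  fixes m :: "'a::euclidean_space \<Rightarrow> real" and f :: "'a \<times> real \<Rightarrow> real"
  assumes U: "open U" and m: "Ck_on 1 U m" and f: "Ck_holder_loc 0 \<gamma> T f" and T: "\<And>x. x \<in> U \<Longrightarrow> (x, m x) \<in> T" and \<gamma>: "0 < \<gamma>"
  shows "Ck_holder_loc 0 \<gamma> U (\<lambda>x. f (x, m x))"
  using holder_0_compose[OF graph_distance[OF U m] f _ \<gamma>] T by auto

text \<open>
  The chain rule for \<open>x \<mapsto> (x, m x)\<close>. The derivatives of \<open>f\<close> are classical at interior points of \<open>T\<close> only, hence the hypothesis.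
\<close>

lemma holder_graph_1:
  fixes m :: "'a::euclidean_space \<Rightarrow> real" and f :: "'a \<times> real \<Rightarrow> real"
  assumes U: "open U" and m: "Ck_holder_loc 1 \<beta> U m" and f: "Ck_holder_loc 1 \<gamma> T f" and T: "\<And>x. x \<in> U \<Longrightarrow> (x, m x) \<in> interior T"
    and \<gamma>: "0 < \<gamma>" "\<delta> \<le> \<gamma>" "\<delta> \<le> \<beta>"
  shows "Ck_holder_loc 1 \<delta> U (\<lambda>x. f (x, m x))"
proof -
  have mC: "Ck_on 1 U m" using Ck_holder_loc_Ck_on[OF U m] .
  have fd: "f differentiable (at z)" if "z \<in> interior T" for z
    using f that unfolding One_nat_def Ck_holder_loc.simps(2) by blast
  have md: "m differentiable (at x)" if "x \<in> U" for x using mC that by (simp add: Ck_on_Suc_open[OF U])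
  have der: "((\<lambda>x. (x, m x)) has_derivative (\<lambda>h. (h, \<Sum>k\<in>Basis. (h \<bullet> k) * pd k m x))) (at x)" if "x \<in> U" for x
    by (rule has_derivative_Pair[OF has_derivative_ident has_derivative_pd[OF md[OF that]]])
  have pdm: "(\<Sum>k\<in>Basis. (i \<bullet> k) * pd k m x) = pd i m x" if "i \<in> Basis" for i x
    using that by (simp add: inner_Basis if_distrib[of "\<lambda>c. c * _"] cong: if_cong)
  have pdf: "Ck_holder_loc 0 \<delta> U (\<lambda>x. pd j f (x, m x))" if j: "j \<in> Basis" for j
  proof -
    obtain h where h: "\<forall>z\<in>interior T. h z = frechet_derivative f (at z) j" "Ck_holder_loc 0 \<gamma> T h"
      using f j unfolding One_nat_def Ck_holder_loc.simps(2) by blast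
    have T': "(x, m x) \<in> T" if "x \<in> U" for x using T[OF that] interior_subset by blast
    have "Ck_holder_loc 0 \<delta> U (\<lambda>x. h (x, m x))"
      by (rule holder_0_mono[OF holder_graph_0[OF U mC h(2) T' \<gamma>(1)] \<gamma>(2)])
    note hm = this
    have hp: "h (x, m x) = pd j f (x, m x)" if "x \<in> U" for x
      unfolding pd_def by (rule bspec[OF h(1) T[OF that]])
    show ?thesis by (rule Ck_holder_loc_cong[OF U hp hm])
  qed
  have pdmH: "Ck_holder_loc 0 \<delta> U (pd i m)" if "i \<in> Basis" for i
    using m that by (intro holder_0_mono[OF _ \<gamma>(3)]) (simp add: Ck_holder_loc_Suc_open[OF U])
  have "Ck_holder_loc 0 \<delta> U (pd i (\<lambda>x. f (x, m x)))" if i: "i \<in> Basis" for i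
  proof (rule Ck_holder_loc_cong[OF U])
    show "Ck_holder_loc 0 \<delta> U (\<lambda>x. \<Sum>j\<in>Basis. (i \<bullet> fst j + snd j * pd i m x) * pd j f (x, m x))"
      by (intro holder_0_sum holder_0_mult holder_0_add holder_0_const pdf pdmH i) auto
    show "(\<Sum>j\<in>Basis. (i \<bullet> fst j + snd j * pd i m x) * pd j f (x, m x)) = pd i (\<lambda>x. f (x, m x)) x" if x: "x \<in> U" for x
      using pd_chain(2)[OF der[OF x] fd[OF T[OF x]], of i] pdm[OF i, of x]
      by (simp add: inner_prod_def mult.commute)
  qed
  moreover have "(\<lambda>x. f (x, m x)) differentiable (at x)" if "x \<in> U" for x
    by (rule pd_chain(1)[OF der[OF that] fd[OF T[OF that]]])
  ultimately show ?thesis by (simp add: Ck_holder_loc_Suc_open[OF U])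
qed

text \<open>
  The second derivatives of \<open>v\<close> are multiplied by the derivative of \<open>|z|^p\<close> at the gradient, which is only \<open>(p-1)\<close>-Hoelder in \<open>z\<close>.
\<close>

lemma norm_gradient_powr_C1:
  fixes v :: "'a::euclidean_space \<Rightarrow> real"
  assumes U: "open U" and p: "1 < p" "p < 2" and v: "Ck_holder_loc 2 \<beta> U v" "Ck_holder_loc 1 (1/2) U v"
    and \<delta>: "\<delta> \<le> \<beta>" "\<delta> \<le> (p - 1) / 2"
  shows "Ck_holder_loc 1 \<delta> U (\<lambda>x. norm (gradient v x) powr p)"
proof -
  have vj: "Ck_holder_loc 1 \<beta> U (pd j v)" if "j \<in> Basis" for j
    using v(1) that by (simp add: numeral_2_eq_2 Ck_holder_loc_Suc_open[OF U])
  have vij: "Ck_holder_loc 0 \<delta> U (pd i (pd j v))" if "i \<in> Basis" "j \<in> Basis" for i j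
    by (rule holder_0_mono[OF _ \<delta>(1)]) (use vj[OF that(2)] that(1) in \<open>simp add: Ck_holder_loc_Suc_open[OF U]\<close>)
  have d: "pd j v differentiable (at x)" if "x \<in> U" "j \<in> Basis" for j x
    using vj[OF that(2)] that(1) by (simp add: Ck_holder_loc_Suc_open[OF U])
  have grad_eq: "gradient v = (\<lambda>x. \<Sum>j\<in>Basis. pd j v x *\<^sub>R j)" by (simp add: gradient_def[abs_def] pd_def)
  have der: "(gradient v has_derivative (\<lambda>h. \<Sum>j\<in>Basis. (\<Sum>k\<in>Basis. (h \<bullet> k) * pd k (pd j v) x) *\<^sub>R j)) (at x)" if "x \<in> U" for x
    unfolding grad_eq
    by (intro has_derivative_sum has_derivative_scaleR_left has_derivative_pd d that)
  have comp: "(\<Sum>j\<in>Basis. (\<Sum>k\<in>Basis. (i \<bullet> k) * pd k (pd j v) x) *\<^sub>R j) \<bullet> b = pd i (pd b v) x" if "i \<in> Basis" "b \<in> Basis" for i b x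
    using that by (simp add: inner_Basis if_distrib[of "\<lambda>c. c * _"] cong: if_cong)
  have gradH: "Ck_holder_loc 0 (1/2) U (\<lambda>x. gradient v x \<bullet> i)" if "i \<in> Basis" for i
    using v(2) that by (simp add: Ck_holder_loc_Suc_open[OF U] gradient_inner)
  note gradC = dist_of_components[of "1/2" U "gradient v", OF gradH]
  let ?\<psi> = "\<lambda>z::'a. norm z powr p"
  have pd\<psi>: "Ck_holder_loc 0 \<delta> U (\<lambda>x. pd b ?\<psi> (gradient v x))" if "b \<in> Basis" for b
  proof -
    have "Ck_holder_loc 0 ((p - 1) * (1/2)) U (\<lambda>x. pd b ?\<psi> (gradient v x))"
      using p by (intro holder_0_compose[OF gradC norm_powr_C1(2)[OF p that]]) auto
    then show ?thesis by (rule holder_0_mono) (use \<delta> in simp)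
  qed
  have \<psi>d: "?\<psi> differentiable (at z)" for z using norm_powr_has_derivative[OF p(1)] differentiable_def by blast
  have "Ck_holder_loc 0 \<delta> U (pd i (\<lambda>x. norm (gradient v x) powr p))" if i: "i \<in> Basis" for i
  proof (rule Ck_holder_loc_cong[OF U])
    show "Ck_holder_loc 0 \<delta> U (\<lambda>x. \<Sum>b\<in>Basis. pd i (pd b v) x * pd b ?\<psi> (gradient v x))"
      by (intro holder_0_sum holder_0_mult vij pd\<psi> i) auto
    show "(\<Sum>b\<in>Basis. pd i (pd b v) x * pd b ?\<psi> (gradient v x)) = pd i (\<lambda>x. norm (gradient v x) powr p) x" if x: "x \<in> U" for x
      unfolding pd_chain(2)[OF der[OF x] \<psi>d, of i] using comp[OF i] by (intro sum.cong) auto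
  qed
  moreover have "(\<lambda>x. norm (gradient v x) powr p) differentiable (at x)" if "x \<in> U" for x
    by (rule pd_chain(1)[OF der[OF that] \<psi>d])
  ultimately show ?thesis by (simp add: Ck_holder_loc_Suc_open[OF U])
qed

lemma holder_1_add:
  assumes U: "open U" and "Ck_holder_loc 1 \<beta> U f" "Ck_holder_loc 1 \<beta> U g"
  shows "Ck_holder_loc 1 \<beta> U (\<lambda>x. f x + g x)"
proof -
  have d: "f differentiable (at x)" "g differentiable (at x)" if "x \<in> U" for x
    using assms that by (auto simp: Ck_holder_loc_Suc_open[OF U])
  have "Ck_holder_loc 0 \<beta> U (pd i (\<lambda>x. f x + g x))" if i: "i \<in> Basis" for i
    by (rule Ck_holder_loc_cong[OF U pd_add[symmetric] holder_0_add])
       (use d assms i in \<open>auto simp: Ck_holder_loc_Suc_open[OF U]\<close>)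
  then show ?thesis using d by (auto simp: Ck_holder_loc_Suc_open[OF U])
qed

lemma holder_1_cmult:
  assumes U: "open U" and "Ck_holder_loc 1 \<beta> U f"
  shows "Ck_holder_loc 1 \<beta> U (\<lambda>x. c * f x)"
proof -
  have d: "f differentiable (at x)" if "x \<in> U" for x
    using assms that by (auto simp: Ck_holder_loc_Suc_open[OF U])
  have "Ck_holder_loc 0 \<beta> U (pd i (\<lambda>x. c * f x))" if i: "i \<in> Basis" for i
    by (rule Ck_holder_loc_cong[OF U pd_cmult[symmetric] holder_0_cmult])
       (use d assms i in \<open>auto simp: Ck_holder_loc_Suc_open[OF U]\<close>)
  then show ?thesis using d by (auto simp: Ck_holder_loc_Suc_open[OF U] intro: differentiable_mult)
qed

section \<open>The weak formulations on the set where the constraints are inactive\<close>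

text \<open>
  Translates the scalar product under a Lebesgue integral over \<open>\<Omega>\<close> into partial derivatives and Borel integrals over
  the whole space.
\<close>

lemma gradient_pairing:
  fixes g V :: "'a::euclidean_space \<Rightarrow> 'a"
  assumes U: "U \<subseteq> \<Omega>" and t: "test_function U \<phi>" and V: "V \<in> borel_measurable borel" "\<And>i. i \<in> Basis \<Longrightarrow> integrable lborel (\<lambda>x. V x \<bullet> i)"
    and eq: "AE x in lborel. x \<in> U \<longrightarrow> g x = V x"
  shows "(LINT x:\<Omega>|lebesgue. g x \<bullet> gradient \<phi> x) = (\<Sum>i\<in>Basis. LINT x|lborel. (V x \<bullet> i) * pd i \<phi> x)"
proof -
  have C1: "C1c \<phi>" using Cinfc_C1c test_function_Cinfc t by blast
  have pm: "pd i \<phi> \<in> borel_measurable borel" if "i \<in> Basis" for i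
    using C1c_pd_continuous[OF C1 that] by (rule borel_measurable_continuous_onI)
  have I: "integrable lborel (\<lambda>x. (V x \<bullet> i) * pd i \<phi> x)" if i: "i \<in> Basis" for i
  proof -
    obtain M where M: "\<And>x. \<bar>pd i \<phi> x\<bar> \<le> M" using C1c_pd_bounded[OF C1 i] by blast
    show ?thesis by (rule integrable_mult_bounded[OF V(2)[OF i] pm[OF i] M])
  qed
  have sI: "integrable lborel (\<lambda>x. \<Sum>i\<in>Basis. (V x \<bullet> i) * pd i \<phi> x)"
    by (rule Bochner_Integration.integrable_sum[OF I])
  then have m: "(\<lambda>x. \<Sum>i\<in>Basis. (V x \<bullet> i) * pd i \<phi> x) \<in> borel_measurable lborel" by simp
  have e: "y \<bullet> gradient \<phi> x = (\<Sum>i\<in>Basis. (y \<bullet> i) * pd i \<phi> x)" for y x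
    by (subst euclidean_inner) (simp add: gradient_inner)
  have z: "pd i \<phi> x = 0" if "x \<notin> U" "i \<in> Basis" for x i
    using test_function_zero_outside[OF test_function_pd[OF t that(2)] that(1)] .
  have ae: "AE x in lebesgue. (\<Sum>i\<in>Basis. (V x \<bullet> i) * pd i \<phi> x) = indicator \<Omega> x *\<^sub>R (g x \<bullet> gradient \<phi> x)"
    using eq unfolding AE_lebesgue_lborel
  proof eventually_elim
    case (elim x)
    show ?case
    proof (cases "x \<in> U")
      case True then show ?thesis using elim U by (auto simp: e)
    next
      case False then show ?thesis by (simp add: e z)
    qed
  qed
  have m2: "(\<lambda>x. \<Sum>i\<in>Basis. (V x \<bullet> i) * pd i \<phi> x) \<in> borel_measurable lebesgue" using m by (rule measurable_completion)
  have "(LINT x:\<Omega>|lebesgue. g x \<bullet> gradient \<phi> x) = (LINT x|lebesgue. (\<Sum>i\<in>Basis. (V x \<bullet> i) * pd i \<phi> x))"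
    unfolding set_lebesgue_integral_def using ae borel_measurable_AE[OF m2 ae] m2 by (intro integral_cong_AE) auto
  also have "\<dots> = (LINT x|lborel. (\<Sum>i\<in>Basis. (V x \<bullet> i) * pd i \<phi> x))" by (rule integral_completion[OF m])
  also have "\<dots> = (\<Sum>i\<in>Basis. LINT x|lborel. (V x \<bullet> i) * pd i \<phi> x)"
    by (rule Bochner_Integration.integral_sum[OF I])
  finally show ?thesis .
qed

lemma weak_laplacian_of_gradient:
  fixes w :: "'a::euclidean_space \<Rightarrow> real" and V :: "'a \<Rightarrow> 'a"
  assumes w: "integrable lborel w" and t: "test_function U \<phi>"
    and grad: "\<And>\<phi> i. test_function U \<phi> \<Longrightarrow> i \<in> Basis \<Longrightarrow> (LINT x|lborel. w x * pd i \<phi> x) = - (LINT x|lborel. (V x \<bullet> i) * \<phi> x)"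
  shows "(LINT x|lborel. w x * lap \<phi> x) = - (\<Sum>i\<in>Basis. LINT x|lborel. (V x \<bullet> i) * pd i \<phi> x)"
proof -
  have I: "integrable lborel (\<lambda>x. w x * pd i (pd i \<phi>) x)" if i: "i \<in> Basis" for i
  proof -
    have C: "C1c (pd i (pd i \<phi>))" using Cinfc_C1c test_function_Cinfc test_function_pd t i by blast
    obtain M where M: "\<And>x. \<bar>pd i (pd i \<phi>) x\<bar> \<le> M" using C1c_bounded[OF C] by blast
    show ?thesis by (rule integrable_mult_bounded[OF w borel_measurable_continuous_onI[OF C1c_continuous[OF C]] M])
  qed
  have "(LINT x|lborel. w x * lap \<phi> x) = (\<Sum>i\<in>Basis. LINT x|lborel. w x * pd i (pd i \<phi>) x)"
    unfolding lap_def sum_distrib_left by (rule Bochner_Integration.integral_sum[OF I])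
  also have "\<dots> = (\<Sum>i\<in>Basis. - (LINT x|lborel. (V x \<bullet> i) * pd i \<phi> x))"
    by (intro sum.cong refl grad test_function_pd t)
  finally show ?thesis by (simp add: sum_negf)
qed

lemma test_function_closure:
  fixes \<phi> :: "'a::euclidean_space \<Rightarrow> real"
  shows "test_function U \<phi> \<Longrightarrow> Ck_on 1 S \<phi>"
  by (rule Ck_on_1_subset) (auto simp: test_function_def)

text \<open>
  The equation for \<open>u\<close>, tested with functions supported in \<open>U\<close>, as a Poisson equation.
\<close>

lemma weak_hjb_localized:
  fixes \<Omega> U :: "'a::euclidean_space set" and u F G :: "'a \<Rightarrow> real" and wg :: "'a \<Rightarrow> 'a" and \<mu> p :: "'a measure" and q' lam :: real
  assumes U: "open U" "bounded U" "U \<subseteq> \<Omega>" and t: "test_function U \<phi>"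
    and eq: "(LINT x:\<Omega>|lebesgue. wg x \<bullet> gradient \<phi> x)
        + (LINT x:\<Omega>|lebesgue. 1 / q' * norm (wg x) powr q' * \<phi> x)
        - lam * (LINT x:\<Omega>|lebesgue. \<phi> x)
        + ((LINT x|\<mu>. \<phi> x) - (LINT x|p. \<phi> x))
        = (LINT x:\<Omega>|lebesgue. F x * \<phi> x)"
    and zero: "(LINT x|\<mu>. \<phi> x) = 0" "(LINT x|p. \<phi> x) = 0"
    and u0: "integrable lborel u0" and V: "V \<in> borel_measurable borel" "\<And>i. i \<in> Basis \<Longrightarrow> integrable lborel (\<lambda>x. V x \<bullet> i)"
    and Vp: "integrable lborel (\<lambda>x. norm (V x) powr q')" and wV: "AE x in lborel. x \<in> U \<longrightarrow> wg x = V x"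
    and grad: "\<And>\<phi> i. test_function U \<phi> \<Longrightarrow> i \<in> Basis \<Longrightarrow> (LINT x|lborel. u0 x * pd i \<phi> x) = - (LINT x|lborel. (V x \<bullet> i) * \<phi> x)"
    and F: "continuous_on U F" "\<And>x. x \<in> U \<Longrightarrow> \<bar>F x\<bar> \<le> B"
  shows "(LINT x|lborel. u0 x * lap \<phi> x)
    = (LINT x|lborel. indicator U x * (norm (V x) powr q' / q' - (F x + lam)) * \<phi> x)"
proof -
  have [measurable]: "V \<in> borel_measurable borel" by (rule V(1))
  have C1: "C1c \<phi>" using Cinfc_C1c test_function_Cinfc t by blast
  obtain M where M: "\<And>x. \<bar>\<phi> x\<bar> \<le> M" using C1c_bounded[OF C1] by blast
  have \<phi>m: "\<phi> \<in> borel_measurable borel" using C1c_continuous[OF C1] by (rule borel_measurable_continuous_onI)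
  have FI: "integrable lborel (\<lambda>x. indicator U x * F x)" by (rule indicator_continuous_integrable[OF U(1,2) F])
  have I: "integrable lborel (\<lambda>x. (1 / q' * norm (V x) powr q') * \<phi> x)" "integrable lborel (\<lambda>x. (indicator U x * F x) * \<phi> x)" "integrable lborel \<phi>"
    using integrable_mult_bounded[OF integrable_mult_right[OF Vp, of "1/q'"] \<phi>m M] integrable_mult_bounded[OF FI \<phi>m M] C1c_integrable[OF C1] by simp_all
  have 1: "(LINT x:\<Omega>|lebesgue. wg x \<bullet> gradient \<phi> x) = - (LINT x|lborel. u0 x * lap \<phi> x)"
    using gradient_pairing[OF U(3) t V wV] weak_laplacian_of_gradient[OF u0 t grad] by simp
  have 2: "(LINT x:\<Omega>|lebesgue. 1 / q' * norm (wg x) powr q' * \<phi> x) = (LINT x|lborel. (1 / q' * norm (V x) powr q') * \<phi> x)"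
  proof (rule set_integral_transfer[OF U(3) t])
    show "(\<lambda>x. 1 / q' * norm (V x) powr q') \<in> borel_measurable borel" by measurable
    show "AE x in lborel. x \<in> U \<longrightarrow> 1 / q' * norm (wg x) powr q' = 1 / q' * norm (V x) powr q'"
      using wV by eventually_elim simp
  qed
  have 3: "(LINT x:\<Omega>|lebesgue. \<phi> x) = (LINT x|lborel. \<phi> x)"
    using set_integral_transfer[OF U(3) t, of "\<lambda>_. 1" "\<lambda>_. 1"] by simp
  have 4: "(LINT x:\<Omega>|lebesgue. F x * \<phi> x) = (LINT x|lborel. (indicator U x * F x) * \<phi> x)"
    using borel_measurable_integrable[OF FI] by (intro set_integral_transfer[OF U(3) t]) auto
  have "(LINT x|lborel. u0 x * lap \<phi> x) = (LINT x|lborel. (1 / q' * norm (V x) powr q') * \<phi> x) - lam * (LINT x|lborel. \<phi> x) - (LINT x|lborel. (indicator U x * F x) * \<phi> x)"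
    using eq unfolding 1 2 3 4 zero by linarith
  also have "\<dots> = (LINT x|lborel. (1 / q' * norm (V x) powr q') * \<phi> x - lam * \<phi> x - (indicator U x * F x) * \<phi> x)"
    using I by simp
  also have "(\<lambda>x. (1 / q' * norm (V x) powr q') * \<phi> x - lam * \<phi> x - (indicator U x * F x) * \<phi> x)
    = (\<lambda>x. indicator U x * (norm (V x) powr q' / q' - (F x + lam)) * \<phi> x)"
    using test_function_zero_outside[OF t] by (auto simp: fun_eq_iff indicator_def algebra_simps)
  finally show ?thesis .
qed

text \<open>
  The equation for \<open>m\<close>, tested with functions supported in \<open>U\<close>, as a Poisson equation in divergence form.
\<close>

lemma weak_fokker_planck_localized:
  fixes \<Omega> U :: "'a::euclidean_space set" and m m0 :: "'a \<Rightarrow> real" and wm wg V W :: "'a \<Rightarrow> 'a" and s :: real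
  assumes U: "open U" "bounded U" "U \<subseteq> \<Omega>" and t: "test_function U \<phi>"
    and eq: "(LINT x:\<Omega>|lebesgue. (wm x + (m x * norm (wg x) powr (p - 2)) *\<^sub>R wg x) \<bullet> gradient \<phi> x) = 0"
    and p: "1 < p" and m: "continuous_on U m" "\<And>x. x \<in> U \<Longrightarrow> 0 \<le> m x \<and> m x \<le> 1"
    and m0: "integrable lborel m0" "AE x in lborel. x \<in> U \<longrightarrow> m x = m0 x"
    and W: "W \<in> borel_measurable borel" "\<And>i. i \<in> Basis \<Longrightarrow> integrable lborel (\<lambda>x. W x \<bullet> i)" "AE x in lborel. x \<in> U \<longrightarrow> wm x = W x"
    and grad: "\<And>\<phi> i. test_function U \<phi> \<Longrightarrow> i \<in> Basis \<Longrightarrow> (LINT x|lborel. m0 x * pd i \<phi> x) = - (LINT x|lborel. (W x \<bullet> i) * \<phi> x)"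
    and V: "V \<in> borel_measurable borel" "integrable lborel (\<lambda>x. norm (V x) powr p)" and wV: "AE x in lborel. x \<in> U \<longrightarrow> wg x = V x"
  shows "(LINT x|lborel. (indicator U x * m x) * lap \<phi> x)
    = - (\<Sum>i\<in>Basis. LINT x|lborel. - (indicator U x * m x * (norm (V x) powr (p - 2) * (V x \<bullet> i))) * pd i \<phi> x)"
proof -
  define c where "c x = indicator U x * m x * norm (V x) powr (p - 2)" for x
  define Z where "Z x = W x + c x *\<^sub>R V x" for x
  have fluxI: "integrable lborel (\<lambda>x. indicator U x * m x * (norm (V x) powr (p - 2) * (V x \<bullet> i)))" if "i \<in> Basis" for i
    by (rule flux_integrable[OF U(1,2) p m that V])
  have m1: "\<bar>m x\<bar> \<le> 1" if "x \<in> U" for x using m(2)[OF that] by simp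
  have mm[measurable]: "(\<lambda>x. indicator U x * m x) \<in> borel_measurable borel"
    using borel_measurable_integrable[OF indicator_continuous_integrable[OF U(1,2) m(1) m1]] by simp
  have [measurable]: "V \<in> borel_measurable borel" "W \<in> borel_measurable borel" by (fact V(1) W(1))+
  have Zm: "Z \<in> borel_measurable borel" unfolding Z_def c_def by measurable
  have Zi: "Z x \<bullet> i = W x \<bullet> i + indicator U x * m x * (norm (V x) powr (p - 2) * (V x \<bullet> i))" for x i
    by (simp add: Z_def c_def inner_add_left mult.assoc)
  have ZI: "integrable lborel (\<lambda>x. Z x \<bullet> i)" if "i \<in> Basis" for i
    unfolding Zi using W(2)[OF that] fluxI[OF that] by simp
  have ZV: "AE x in lborel. x \<in> U \<longrightarrow> wm x + (m x * norm (wg x) powr (p - 2)) *\<^sub>R wg x = Z x"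
    using W(3) wV by eventually_elim (simp add: Z_def c_def)
  have C1: "C1c \<phi>" using Cinfc_C1c test_function_Cinfc t by blast
  have pI: "integrable lborel (\<lambda>x. h x * pd i \<phi> x)" if h: "integrable lborel h" and i: "i \<in> Basis" for h i
  proof -
    obtain M where M: "\<And>x. \<bar>pd i \<phi> x\<bar> \<le> M" using C1c_pd_bounded[OF C1 i] by blast
    show ?thesis by (rule integrable_mult_bounded[OF h borel_measurable_continuous_onI[OF C1c_pd_continuous[OF C1 i]] M])
  qed
  have "0 = (\<Sum>i\<in>Basis. LINT x|lborel. (Z x \<bullet> i) * pd i \<phi> x)"
    using gradient_pairing[OF U(3) t Zm ZI ZV] eq by simp
  also have "\<dots> = (\<Sum>i\<in>Basis. (LINT x|lborel. (W x \<bullet> i) * pd i \<phi> x)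
      + (LINT x|lborel. indicator U x * m x * (norm (V x) powr (p - 2) * (V x \<bullet> i)) * pd i \<phi> x))"
  proof (rule sum.cong[OF refl])
    fix i :: 'a assume i: "i \<in> Basis"
    show "(LINT x|lborel. (Z x \<bullet> i) * pd i \<phi> x) = (LINT x|lborel. (W x \<bullet> i) * pd i \<phi> x)
      + (LINT x|lborel. indicator U x * m x * (norm (V x) powr (p - 2) * (V x \<bullet> i)) * pd i \<phi> x)"
      unfolding Zi distrib_right by (rule Bochner_Integration.integral_add[OF pI[OF W(2)[OF i] i] pI[OF fluxI[OF i] i]])
  qed
  also have "\<dots> = - (LINT x|lborel. m0 x * lap \<phi> x)
      + (\<Sum>i\<in>Basis. LINT x|lborel. indicator U x * m x * (norm (V x) powr (p - 2) * (V x \<bullet> i)) * pd i \<phi> x)"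
    using weak_laplacian_of_gradient[OF m0(1) t grad] by (simp add: sum.distrib)
  finally have A: "(LINT x|lborel. m0 x * lap \<phi> x) = (\<Sum>i\<in>Basis. LINT x|lborel. indicator U x * m x * (norm (V x) powr (p - 2) * (V x \<bullet> i)) * pd i \<phi> x)"
    by simp
  have lapm: "lap \<phi> \<in> borel_measurable borel"
  proof -
    have "pd i (pd i \<phi>) \<in> borel_measurable borel" if "i \<in> Basis" for i
      using that t by (intro borel_measurable_continuous_onI C1c_continuous Cinfc_C1c test_function_Cinfc[of U] test_function_pd)
    then show ?thesis unfolding lap_def[abs_def] by (intro borel_measurable_sum)
  qed
  have lapz: "lap \<phi> x = 0" if "x \<notin> U" for x
    unfolding lap_def using that t by (intro sum.neutral ballI test_function_zero_outside[of U] test_function_pd)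
  have B: "(LINT x|lborel. (indicator U x * m x) * lap \<phi> x) = (LINT x|lborel. m0 x * lap \<phi> x)"
  proof (rule integral_cong_AE)
    show "AE x in lborel. (indicator U x * m x) * lap \<phi> x = m0 x * lap \<phi> x"
      using m0(2) by eventually_elim (use lapz in \<open>auto simp: indicator_def\<close>)
  qed (use lapm borel_measurable_integrable[OF m0(1)] mm in auto)
  show ?thesis unfolding B A by (simp add: sum_negf)
qed

section \<open>The regularity theorem\<close>

theorem proposition4p3:
  fixes \<Omega> :: "'a::euclidean_space set"
    and f :: "'a \<times> real \<Rightarrow> real"
    and q q' lam :: real
    and m u :: "'a \<Rightarrow> real"
    and \<mu> p :: "'a measure"
    and E2 :: "'a set"
  assumes dim: "DIM('a) \<ge> 2"
    and dom: "\<Omega> \<noteq> {}" "bounded \<Omega>" "open \<Omega>" "smooth_boundary \<Omega>" "uniform_interior_ball \<Omega>"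
      "measure lebesgue \<Omega> > 1"
    and f_cont: "continuous_on (closure \<Omega> \<times> UNIV) f"
    and f_mono: "\<forall>x\<in>closure \<Omega>. mono (\<lambda>t. f (x, t))"
    and q: "q > real DIM('a)"
    and q': "q' = q / (q - 1)"
    and m_W1: "in_W1 q \<Omega> m"
    and m_cont: "continuous_on (closure \<Omega>) m"
    and u_W1: "\<forall>s. 1 < s \<and> s < real DIM('a) / (real DIM('a) - 1) \<longrightarrow> in_W1_mean_zero s \<Omega> u"
    and radon: "nonneg_radon (closure \<Omega>) \<mu>" "nonneg_radon (closure \<Omega>) p"
    and eq_u: "\<forall>\<phi>. Ck_on 1 (closure \<Omega>) \<phi> \<longrightarrow>
        (LINT x:\<Omega>|lebesgue. weak_grad \<Omega> u x \<bullet> gradient \<phi> x)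
        + (LINT x:\<Omega>|lebesgue. 1 / q' * norm (weak_grad \<Omega> u x) powr q' * \<phi> x)
        - lam * (LINT x:\<Omega>|lebesgue. \<phi> x)
        + ((LINT x|\<mu>. \<phi> x) - (LINT x|p. \<phi> x))
        = (LINT x:\<Omega>|lebesgue. f (x, m x) * \<phi> x)"
    and eq_m: "\<forall>\<phi>. Ck_on 1 (closure \<Omega>) \<phi> \<longrightarrow>
        (LINT x:\<Omega>|lebesgue.
           (weak_grad \<Omega> m x
            + (m x * norm (weak_grad \<Omega> u x) powr ((2 - q) / (q - 1))) *\<^sub>R weak_grad \<Omega> u x)
           \<bullet> gradient \<phi> x) = 0"
    and m_mass: "(LINT x:\<Omega>|lebesgue. m x) = 1"
    and m_bounds: "\<forall>x\<in>\<Omega>. 0 \<le> m x \<and> m x \<le> 1"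
    and spt_\<mu>: "spt \<mu> \<subseteq> {x \<in> closure \<Omega>. m x = 0}"
    and spt_p: "spt p \<subseteq> {x \<in> closure \<Omega>. m x = 1}"
    and E2: "E2 = {x \<in> \<Omega>. 0 < m x \<and> m x < 1}"
  shows "open E2
    \<and> (\<exists>\<gamma>0. 0 < \<gamma>0 \<and> \<gamma>0 < 1 \<and> ae_Ck_holder_loc 1 \<gamma>0 E2 u \<and> Ck_holder_loc 1 \<gamma>0 E2 m)
    \<and> (\<forall>j\<in>{0, 1::nat}. \<forall>\<gamma>1. 0 < \<gamma>1 \<and> \<gamma>1 < 1 \<and> Ck_holder_loc j \<gamma>1 (closure \<Omega> \<times> UNIV) f \<longrightarrow>
         (\<exists>\<gamma>2. 0 < \<gamma>2 \<and> \<gamma>2 < 1 \<and> ae_Ck_holder_loc (2 + j) \<gamma>2 E2 u))"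
proof -
  define d where "d = real DIM('a)"
  have d: "d \<ge> 2" using dim by (simp add: d_def)
  have qd: "q > d" using q by (simp add: d_def)
  have q'1: "1 < q'" "q' < 2" unfolding q' using qd d by (auto simp: divide_simps)
  have q'd: "q' * (d - 1) < d" unfolding q' using qd d by (simp add: divide_simps algebra_simps)
  \<comment> \<open>So \<open>q'\<close> is one of the exponents \<open>s\<close> for which \<open>u\<close> is in \<open>W^(1,s)\<close>.\<close>
  then have q'd2: "q' < d / (d - 1)" using d by (simp add: pos_less_divide_eq)
  have expo: "(2 - q) / (q - 1) = q' - 2" unfolding q' using qd d by (simp add: field_simps)
  have mc: "continuous_on \<Omega> m" using m_cont closure_subset continuous_on_subset by blast
  have sub: "E2 \<subseteq> \<Omega>" using E2 by auto
  have opE: "open E2"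
  proof -
    have "E2 = \<Omega> \<inter> m -` {0<..<1}" unfolding E2 by auto
    then show ?thesis using continuous_open_preimage[OF mc dom(3), of "{0<..<1}"] by simp
  qed
  have bdE: "bounded E2" using dom(2) sub bounded_subset by blast
  have mE: "continuous_on E2 m" using mc sub continuous_on_subset by blast
  have m01: "0 \<le> m x \<and> m x \<le> 1" if "x \<in> E2" for x using that m_bounds sub by blast
  have uW: "in_W1 q' \<Omega> u" using u_W1 q'1(1) q'd2 unfolding d_def in_W1_mean_zero_def by blast
  obtain u0 V where u0: "integrable lborel u0" "AE x in lborel. x \<in> E2 \<longrightarrow> u x = u0 x"
    and V: "V \<in> borel_measurable borel" "\<And>i. i \<in> Basis \<Longrightarrow> integrable lborel (\<lambda>x. V x \<bullet> i)"
    and Vp: "integrable lborel (\<lambda>x. norm (V x) powr q')" and wV: "AE x in lborel. x \<in> E2 \<longrightarrow> weak_grad \<Omega> u x = V x"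
    and gradu: "\<And>\<phi> i. test_function E2 \<phi> \<Longrightarrow> i \<in> Basis \<Longrightarrow> (LINT x|lborel. u0 x * pd i \<phi> x) = - (LINT x|lborel. (V x \<bullet> i) * \<phi> x)"
    by (rule W1_representative[OF dom(3,2) less_imp_le[OF q'1(1)] uW opE sub]) (rule that; (assumption | simp))
  have q1: "1 \<le> q" using qd d by linarith
  obtain m0 W where m0: "integrable lborel m0" "AE x in lborel. x \<in> E2 \<longrightarrow> m x = m0 x"
    and W: "W \<in> borel_measurable borel" "\<And>i. i \<in> Basis \<Longrightarrow> integrable lborel (\<lambda>x. W x \<bullet> i)"
    and wW: "AE x in lborel. x \<in> E2 \<longrightarrow> weak_grad \<Omega> m x = W x"
    and gradm: "\<And>\<phi> i. test_function E2 \<phi> \<Longrightarrow> i \<in> Basis \<Longrightarrow> (LINT x|lborel. m0 x * pd i \<phi> x) = - (LINT x|lborel. (W x \<bullet> i) * \<phi> x)"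
    by (rule W1_representative[OF dom(3,2) q1 m_W1 opE sub]) (rule that; (assumption | simp))
  define F where "F x = f (x, m x) + lam" for x
  have graph: "(x, m x) \<in> closure \<Omega> \<times> UNIV" if "x \<in> E2" for x using that sub closure_subset by blast
  have fmc: "continuous_on E2 (\<lambda>x. f (x, m x))"
    by (rule continuous_on_compose2[OF f_cont]) (use mE graph in \<open>auto intro!: continuous_intros\<close>)
  have "compact (closure \<Omega> \<times> {0..1::real})" using dom(2) by (intro compact_Times) auto
  then have "bounded (f ` (closure \<Omega> \<times> {0..1}))"
    by (intro compact_imp_bounded compact_continuous_image continuous_on_subset[OF f_cont]) auto
  then obtain B where B: "\<And>z. z \<in> closure \<Omega> \<times> {0..1} \<Longrightarrow> \<bar>f z\<bar> \<le> B" unfolding bounded_iff by (metis image_eqI real_norm_def)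
  have fB: "\<bar>f (x, m x)\<bar> \<le> B" if "x \<in> E2" for x using B[of "(x, m x)"] m01[OF that] graph[OF that] by auto
  have Fc: "continuous_on E2 F" unfolding F_def[abs_def] by (intro continuous_intros fmc)
  have FB: "\<bar>F x\<bar> \<le> B + \<bar>lam\<bar>" if "x \<in> E2" for x using fB[OF that] unfolding F_def by linarith
  have mu0: "(LINT x|\<mu>. \<phi> x) = 0" "(LINT x|p. \<phi> x) = 0" if t: "test_function E2 \<phi>" for \<phi>
    using spt_\<mu> spt_p E2 test_function_zero_outside[OF t]
    by (auto intro!: radon_integral_zero[OF radon(1), of E2] radon_integral_zero[OF radon(2), of E2])
  have weak_u: "weak_laplacian E2 u0 (\<lambda>x. indicator E2 x * (norm (V x) powr q' / q' - F x))"
    unfolding weak_laplacian_def F_def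
  proof (intro allI impI)
    fix \<phi> assume t: "test_function E2 \<phi>"
    show "(LINT x|lborel. u0 x * lap \<phi> x) = (LINT x|lborel. indicator E2 x * (norm (V x) powr q' / q' - (f (x, m x) + lam)) * \<phi> x)"
      by (rule weak_hjb_localized[OF opE bdE sub t eq_u[rule_format, OF test_function_closure[OF t]] mu0[OF t] u0(1) V Vp wV gradu fmc fB])
  qed
  have weak_m: "weak_divergence E2 (\<lambda>x. indicator E2 x * m x) (\<lambda>i x. - (indicator E2 x * m x * (norm (V x) powr (q' - 2) * (V x \<bullet> i))))"
    unfolding weak_divergence_def
  proof (intro allI impI)
    fix \<phi> assume t: "test_function E2 \<phi>"
    show "(LINT x|lborel. indicator E2 x * m x * lap \<phi> x)
      = - (\<Sum>i\<in>Basis. LINT x|lborel. - (indicator E2 x * m x * (norm (V x) powr (q' - 2) * (V x \<bullet> i))) * pd i \<phi> x)"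
      by (rule weak_fokker_planck_localized[OF opE bdE sub t eq_m[unfolded expo, rule_format, OF test_function_closure[OF t]]
          q'1(1) mE m01 m0 W wW gradm V(1) Vp wV])
  qed
  obtain v where v: "AE x in lborel. x \<in> E2 \<longrightarrow> u0 x = v x" and v1: "\<And>\<sigma>. 0 < \<sigma> \<Longrightarrow> \<sigma> < 1 \<Longrightarrow> Ck_holder_loc 1 \<sigma> E2 v"
    and mH: "Ck_holder_loc 1 ((q' - 1) / 4) E2 m"
    and v2: "\<And>\<beta>. 0 < \<beta> \<Longrightarrow> \<beta> \<le> 1 / 2 \<Longrightarrow> Ck_holder_loc 0 \<beta> E2 F \<Longrightarrow> Ck_holder_loc 2 (\<beta> / 2) E2 v"
    and v3: "\<And>\<beta>. 0 < \<beta> \<Longrightarrow> \<beta> \<le> 1 \<Longrightarrow> Ck_holder_loc 1 \<beta> E2 (\<lambda>x. norm (gradient v x) powr q' / q' - F x) \<Longrightarrow> Ck_holder_loc 3 (\<beta> / 2) E2 v"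
    by (rule system_regularity[OF dim opE bdE q'1 q'd[unfolded d_def] u0(1) V Vp gradu mE m01 Fc FB weak_u weak_m]; (assumption | (rule that; (assumption | simp)))?)
  have uv: "AE x in lebesgue. x \<in> E2 \<longrightarrow> v x = u x"
    unfolding AE_lebesgue_lborel using u0(2) v by eventually_elim auto
  have mC1: "Ck_on 1 E2 m" by (rule Ck_holder_loc_Ck_on[OF opE mH])
  have part2: "\<exists>\<gamma>0. 0 < \<gamma>0 \<and> \<gamma>0 < 1 \<and> ae_Ck_holder_loc 1 \<gamma>0 E2 u \<and> Ck_holder_loc 1 \<gamma>0 E2 m"
    using q'1 v1[of "(q' - 1) / 4"] mH uv unfolding ae_Ck_holder_loc_def
    by (intro exI[of _ "(q' - 1) / 4"]) auto
  have FH: "Ck_holder_loc 0 \<beta> E2 F" if "Ck_holder_loc 0 \<beta> E2 (\<lambda>x. f (x, m x))" for \<beta>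
    unfolding F_def[abs_def] by (intro holder_0_add holder_0_const that)
  have part3: "\<exists>\<gamma>2. 0 < \<gamma>2 \<and> \<gamma>2 < 1 \<and> ae_Ck_holder_loc (2 + j) \<gamma>2 E2 u"
    if j: "j \<in> {0, 1}" and \<gamma>: "0 < \<gamma>1" "\<gamma>1 < 1" and fH: "Ck_holder_loc j \<gamma>1 (closure \<Omega> \<times> UNIV) f" for j :: nat and \<gamma>1
  proof (cases "j = 0")
    case True
    \<comment> \<open>The exponents of \<open>f\<close> along the graph of \<open>m\<close> and of the gradient of \<open>v\<close>.\<close>
    define \<beta> where "\<beta> = min \<gamma>1 (1 / 2)"
    have \<beta>: "0 < \<beta>" "\<beta> \<le> 1 / 2" "\<beta> \<le> \<gamma>1" using \<gamma> by (auto simp: \<beta>_def)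
    have f0: "Ck_holder_loc 0 \<gamma>1 (closure \<Omega> \<times> UNIV) f" using fH True by (simp only:)
    have "Ck_holder_loc 0 \<beta> E2 (\<lambda>x. f (x, m x))"
      by (rule holder_0_mono[OF holder_graph_0[OF opE mC1 f0 graph \<gamma>(1)] \<beta>(3)])
    then have "Ck_holder_loc 2 (\<beta> / 2) E2 v" by (rule v2[OF \<beta>(1,2) FH])
    then show ?thesis using \<beta> uv True unfolding ae_Ck_holder_loc_def by (intro exI[of _ "\<beta> / 2"]) auto
  next
    case False
    with j have j1: "j = 1" by simp
    define \<beta> where "\<beta> = min \<gamma>1 ((q' - 1) / 4)"
    have \<beta>: "0 < \<beta>" "\<beta> \<le> 1 / 4" "\<beta> \<le> \<gamma>1" "\<beta> \<le> (q' - 1) / 4" "\<beta> \<le> (q' - 1) / 2" using \<gamma> q'1 by (auto simp: \<beta>_def min_def)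
    have f1: "Ck_holder_loc 1 \<gamma>1 (closure \<Omega> \<times> UNIV) f" using fH j1 by (simp only:)
    have int: "(x, m x) \<in> interior (closure \<Omega> \<times> UNIV)" if "x \<in> E2" for x
      using that sub by (auto simp: interior_Times intro: subsetD[OF interior_maximal[OF closure_subset dom(3)]])
    have fm: "Ck_holder_loc 1 \<beta> E2 (\<lambda>x. f (x, m x))"
      by (rule holder_graph_1[OF opE mH f1 int \<gamma>(1) \<beta>(3,4)])
    \<comment> \<open>A first gain of two derivatives is needed to differentiate \<open>|\<nabla>v|^q'\<close>.\<close>
    have "Ck_holder_loc 0 (1/2) E2 (\<lambda>x. f (x, m x))"
      by (rule holder_0_of_C1[OF opE Ck_holder_loc_Ck_on[OF opE fm]]) auto
    then have v2': "Ck_holder_loc 2 (1 / 2 / 2) E2 v" by (intro v2 FH) auto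
    have "Ck_holder_loc 1 \<beta> E2 (\<lambda>x. norm (gradient v x) powr q')"
      using \<beta> by (intro norm_gradient_powr_C1[OF opE q'1 v2' v1]) auto
    moreover have "Ck_holder_loc 1 \<beta> E2 (\<lambda>x. lam)"
      unfolding One_nat_def Ck_holder_loc_Suc_open[OF opE]
    proof (intro conjI ballI)
      fix i :: 'a
      have "pd i (\<lambda>x. lam) = (\<lambda>x. 0)" by (rule ext) (rule pd_eqI[OF has_derivative_const])
      then show "Ck_holder_loc 0 \<beta> E2 (pd i (\<lambda>x. lam))" by (simp only: holder_0_const)
    qed simp
    ultimately have "Ck_holder_loc 1 \<beta> E2 (\<lambda>x. (1 / q') * norm (gradient v x) powr q' + - 1 * (f (x, m x) + lam))"
      by (intro holder_1_add[OF opE] holder_1_cmult[OF opE] fm)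
    then have "Ck_holder_loc 1 \<beta> E2 (\<lambda>x. norm (gradient v x) powr q' / q' - F x)"
      by (rule back_subst[of "Ck_holder_loc 1 \<beta> E2"]) (simp add: F_def fun_eq_iff)
    then have "Ck_holder_loc 3 (\<beta> / 2) E2 v" using \<beta> by (intro v3) auto
    moreover have "2 + j = 3" using j1 by simp
    ultimately show ?thesis using \<beta> uv unfolding ae_Ck_holder_loc_def by (intro exI[of _ "\<beta> / 2"]) auto
  qed
  show ?thesis using opE part2 part3 by blast
qed

end
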